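(* Let $G$ be a reductive group over an algebraically closed field $\mathbb{K}$ of characteristic zero, $V$ a rational finite-dimensional $G$-module, and $H\subseteq G$ an isotropy group of a closed $G$-orbit in $V$. For any positive integer $k$ consider the module $V^{\oplus k}=V\oplus\cdots\oplus V$ ($k$ times) with the diagonal $G$-action. Then $H$ is an isotropy group of a closed $G$-orbit in $V^{\oplus k}$, and for $k\ge 2$ the triple $(G,V^{\oplus k},H)$ is admissible.
   Context: Reductive groups are affine algebraic and not necessarily connected. A subgroup $H$ is an isotropy group of a closed $G$-orbit in a $G$-module $M$ if $H=\mathrm{Stab}(v)$ for some $v\in M$ with $G\cdot v$ closed in $M$. For such $H$, $M^H$ is the subspace of $H$-fixed vectors, on which the reductive group $W=N_G(H)/H$ acts. An action of a reductive group $F$ on an affine variety $Z$ is strongly stable if there is an open dense invariant subset $U\subseteq Z$ such that (1) $Z\setminus U$ has codimension at least two in $Z$; (2) $F$ acts freely on $U$; (3) for every $z\in U$ the orbit $F\cdot z$ is closed in $Z$. A triple $(G,M,H)$ (with $H$ an isotropy group of a closed $G$-orbit in $M$) is admissible if the action of $W$ on $M^H$ is strongly stable. *)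

theory Defs
  imports
    "HOL-Algebra.Zassenhaus"
    "HOL-Analysis.Abstract_Topology"
    "HOL-Analysis.Finite_Cartesian_Product"
    "HOL-Computational_Algebra.Polynomial"
    "HOL-Library.Extended_Nat"
begin

section \<open>Affine varieties\<close>

text \<open>
  A variety is a set X of points together with its ring of regular functions, a subset of
  the extensional functions on X with values in the ground field.
\<close>

inductive_set generated_algebra :: "'x set \<Rightarrow> ('x \<Rightarrow> 'a::field) set \<Rightarrow> ('x \<Rightarrow> 'a) set"
  for X :: "'x set" and S :: "('x \<Rightarrow> 'a::field) set"
  where
    const: "(\<lambda>x\<in>X. c) \<in> generated_algebra X S"
  | generator: "f \<in> S \<Longrightarrow> restrict f X \<in> generated_algebra X S"
  | add: "\<lbrakk>f \<in> generated_algebra X S; g \<in> generated_algebra X S\<rbrakk>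
      \<Longrightarrow> (\<lambda>x\<in>X. f x + g x) \<in> generated_algebra X S"
  | mult: "\<lbrakk>f \<in> generated_algebra X S; g \<in> generated_algebra X S\<rbrakk>
      \<Longrightarrow> (\<lambda>x\<in>X. f x * g x) \<in> generated_algebra X S"

text \<open>
  The predicate passed to \<open>topology\<close> is a topology for every coordinate ring, by
  \<open>openin_zariski\<close> below.
\<close>

definition zariski :: "'x set \<Rightarrow> ('x \<Rightarrow> 'a::field) set \<Rightarrow> 'x topology" where
  "zariski X R = topology (\<lambda>U. \<exists>S\<subseteq>R. U = {x \<in> X. \<exists>f\<in>S. f x \<noteq> 0})"

lemma openin_zariski:
  "openin (zariski X (generated_algebra X S)) U \<longleftrightarrow>
     (\<exists>T\<subseteq>generated_algebra X S. U = {x \<in> X. \<exists>f\<in>T. f x \<noteq> 0})"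
proof -
  let ?R = "generated_algebra X S"
  define D where "D T = {x \<in> X. \<exists>f\<in>T. f x \<noteq> 0}" for T :: "('a \<Rightarrow> 'b) set"
  define P where "P U \<longleftrightarrow> (\<exists>T\<subseteq>?R. U = D T)" for U
  have int: "P (U \<inter> V)" if UV: "P U" "P V" for U V
  proof -
    obtain A where A: "A \<subseteq> ?R" "U = D A" using UV(1) P_def by auto
    obtain B where B: "B \<subseteq> ?R" "V = D B" using UV(2) P_def by auto
    define T where "T = (\<lambda>(f, g). \<lambda>x\<in>X. f x * g x) ` (A \<times> B)"
    have "T \<subseteq> ?R"
      using A(1) B(1) unfolding T_def by (auto intro!: generated_algebra.mult)
    moreover have "D A \<inter> D B = D T"
      unfolding D_def T_def by force
    ultimately show ?thesis
      unfolding P_def A(2) B(2) by auto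
  qed
  have un: "P (\<Union>\<K>)" if K: "\<forall>U\<in>\<K>. P U" for \<K>
  proof -
    have "\<forall>U\<in>\<K>. \<exists>T. T \<subseteq> ?R \<and> U = D T" using K P_def by auto
    then obtain T where T: "\<forall>U\<in>\<K>. T U \<subseteq> ?R \<and> U = D (T U)"
      using bchoice[of \<K> "\<lambda>U T. T \<subseteq> ?R \<and> U = D T"] by auto
    have "(\<Union>U\<in>\<K>. T U) \<subseteq> ?R" using T by auto
    moreover have "D (\<Union>U\<in>\<K>. T U) = (\<Union>U\<in>\<K>. D (T U))" unfolding D_def by auto
    moreover have "(\<Union>U\<in>\<K>. D (T U)) = \<Union>\<K>" using T by simp
    ultimately have "(\<Union>U\<in>\<K>. T U) \<subseteq> ?R" "\<Union>\<K> = D (\<Union>U\<in>\<K>. T U)" by simp_all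
    then show ?thesis unfolding P_def by (intro exI conjI)
  qed
  have "istopology P"
    unfolding istopology_def using int un by simp
  moreover have "zariski X ?R = topology P"
    unfolding zariski_def P_def D_def by simp
  ultimately have "openin (zariski X ?R) U = P U" by simp
  then show ?thesis
    unfolding P_def D_def .
qed

definition affine_space :: "nat \<Rightarrow> (nat \<Rightarrow> 'a::field) set" where
  "affine_space n = ({..<n} \<rightarrow>\<^sub>E UNIV)"

definition affine_space_ring :: "nat \<Rightarrow> ((nat \<Rightarrow> 'a::field) \<Rightarrow> 'a) set" where
  "affine_space_ring n = generated_algebra (affine_space n) ((\<lambda>i p. p i) ` {..<n})"

definition affine_variety :: "'x set \<Rightarrow> ('x \<Rightarrow> 'a::field) set \<Rightarrow> bool" where
  "affine_variety X R \<longleftrightarrow>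
     (\<exists>n (c :: nat \<Rightarrow> 'x \<Rightarrow> 'a).
        R = generated_algebra X (c ` {..<n}) \<and>
        inj_on (\<lambda>x. \<lambda>i\<in>{..<n}. c i x) X \<and>
        closedin (zariski (affine_space n) (affine_space_ring n))
          ((\<lambda>x. \<lambda>i\<in>{..<n}. c i x) ` X))"

definition product_ring ::
    "'x set \<Rightarrow> ('x \<Rightarrow> 'a::field) set \<Rightarrow> 'y set \<Rightarrow> ('y \<Rightarrow> 'a) set \<Rightarrow> ('x \<times> 'y \<Rightarrow> 'a) set" where
  "product_ring X R Y S =
     generated_algebra (X \<times> Y) ((\<lambda>f. f \<circ> fst) ` R \<union> (\<lambda>g. g \<circ> snd) ` S)"

section \<open>Codimension\<close>

definition irreducible_closed :: "'x topology \<Rightarrow> 'x set \<Rightarrow> bool" where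
  "irreducible_closed T Y \<longleftrightarrow>
     closedin T Y \<and> Y \<noteq> {} \<and>
     (\<forall>A B. closedin T A \<and> closedin T B \<and> Y \<subseteq> A \<union> B \<longrightarrow> Y \<subseteq> A \<or> Y \<subseteq> B)"

definition codim_irreducible :: "'x topology \<Rightarrow> 'x set \<Rightarrow> enat" where
  "codim_irreducible T Y =
     (SUP n \<in> {n. \<exists>c :: nat \<Rightarrow> 'x set. c 0 = Y \<and> (\<forall>i\<le>n. irreducible_closed T (c i)) \<and>
                     (\<forall>i<n. c i \<subset> c (Suc i))}. enat n)"

text \<open>The empty set has codimension infinity.\<close>

definition codim :: "'x topology \<Rightarrow> 'x set \<Rightarrow> enat" where
  "codim T C = (INF Y \<in> {Y. irreducible_closed T Y \<and> Y \<subseteq> C}. codim_irreducible T Y)"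

section \<open>Reductive groups\<close>

definition affine_algebraic_group ::
    "('g, 'm) monoid_scheme \<Rightarrow> ('g \<Rightarrow> 'a::field) set \<Rightarrow> bool" where
  "affine_algebraic_group G R \<longleftrightarrow>
     group G \<and> affine_variety (carrier G) R \<and>
     (\<forall>f\<in>R. (\<lambda>(x, y) \<in> carrier G \<times> carrier G. f (x \<otimes>\<^bsub>G\<^esub> y))
              \<in> product_ring (carrier G) R (carrier G) R) \<and>
     (\<forall>f\<in>R. (\<lambda>x \<in> carrier G. f (inv\<^bsub>G\<^esub> x)) \<in> R)"

text \<open>
  An element u is unipotent if right translation by u is a locally unipotent operator on the
  coordinate ring.
\<close>

definition unipotent :: "('g, 'm) monoid_scheme \<Rightarrow> ('g \<Rightarrow> 'a::field) set \<Rightarrow> 'g \<Rightarrow> bool" where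
  "unipotent G R u \<longleftrightarrow>
     (\<forall>f\<in>R. \<exists>n. ((\<lambda>h. \<lambda>x \<in> carrier G. h (x \<otimes>\<^bsub>G\<^esub> u) - h x) ^^ n) f = (\<lambda>x \<in> carrier G. 0))"

text \<open>
  Reductive means that the unipotent radical, i.e. the largest closed connected normal
  unipotent subgroup, is trivial; G itself need not be connected.
\<close>

definition reductive_group :: "('g, 'm) monoid_scheme \<Rightarrow> ('g \<Rightarrow> 'a::field) set \<Rightarrow> bool" where
  "reductive_group G R \<longleftrightarrow>
     affine_algebraic_group G R \<and>
     (\<forall>N. N \<lhd> G \<and> closedin (zariski (carrier G) R) N \<and> connectedin (zariski (carrier G) R) N \<and>
          (\<forall>u\<in>N. unipotent G R u) \<longrightarrow> N = {\<one>\<^bsub>G\<^esub>})"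

section \<open>Rational modules\<close>

definition rational_module ::
    "('g, 'm) monoid_scheme \<Rightarrow> ('g \<Rightarrow> 'a::field) set \<Rightarrow> ('a \<Rightarrow> 'v::ab_group_add \<Rightarrow> 'v)
      \<Rightarrow> ('g \<Rightarrow> 'v \<Rightarrow> 'v) \<Rightarrow> bool" where
  "rational_module G R s \<rho> \<longleftrightarrow>
     (\<exists>B. finite_dimensional_vector_space s B) \<and>
     group_action G UNIV \<rho> \<and>
     (\<forall>g \<in> carrier G. Vector_Spaces.linear s s (\<rho> g)) \<and>
     (\<forall>l v. Vector_Spaces.linear s (*) l \<longrightarrow> (\<lambda>g \<in> carrier G. l (\<rho> g v)) \<in> R)"

text \<open>The coordinate ring of a linear subspace Z; \<open>Z = UNIV\<close> gives the whole module.\<close>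

definition linear_ring :: "('a::field \<Rightarrow> 'v::ab_group_add \<Rightarrow> 'v) \<Rightarrow> 'v set \<Rightarrow> ('v \<Rightarrow> 'a) set" where
  "linear_ring s Z = generated_algebra Z {l. Vector_Spaces.linear s (*) l}"

definition power_scale ::
    "('a \<Rightarrow> 'v \<Rightarrow> 'v) \<Rightarrow> 'a \<Rightarrow> 'v ^ 'n::finite \<Rightarrow> 'v ^ 'n" where
  "power_scale s c x = (\<chi> i. s c (x $ i))"

definition power_action ::
    "('g \<Rightarrow> 'v \<Rightarrow> 'v) \<Rightarrow> 'g \<Rightarrow> 'v ^ 'n::finite \<Rightarrow> 'v ^ 'n" where
  "power_action \<rho> g x = (\<chi> i. \<rho> g (x $ i))"

definition closed_orbit_isotropy_group ::
    "('g, 'm) monoid_scheme \<Rightarrow> ('a::field \<Rightarrow> 'v::ab_group_add \<Rightarrow> 'v) \<Rightarrow> ('g \<Rightarrow> 'v \<Rightarrow> 'v)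
      \<Rightarrow> 'g set \<Rightarrow> bool" where
  "closed_orbit_isotropy_group G s \<rho> H \<longleftrightarrow>
     (\<exists>v. H = stabilizer G \<rho> v \<and> closedin (zariski UNIV (linear_ring s UNIV)) (orbit G \<rho> v))"

definition fixed_vectors :: "('g \<Rightarrow> 'v \<Rightarrow> 'v) \<Rightarrow> 'g set \<Rightarrow> 'v set" where
  "fixed_vectors \<rho> H = {x. \<forall>h\<in>H. \<rho> h x = x}"

section \<open>Strongly stable actions and admissible triples\<close>

text \<open>
  Only the points of the acting group F enter the three conditions; in characteristic zero a
  free action is one with trivial stabilizers.
\<close>

definition strongly_stable ::
    "('f, 'm) monoid_scheme \<Rightarrow> 'z set \<Rightarrow> ('z \<Rightarrow> 'a::field) set \<Rightarrow> ('f \<Rightarrow> 'z \<Rightarrow> 'z) \<Rightarrow> bool" where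
  "strongly_stable F Z R \<phi> \<longleftrightarrow>
     group_action F Z \<phi> \<and> affine_variety Z R \<and>
     (\<exists>U. openin (zariski Z R) U \<and> zariski Z R closure_of U = Z \<and>
        (\<forall>g \<in> carrier F. \<phi> g ` U \<subseteq> U) \<and>
        codim (zariski Z R) (Z - U) \<ge> 2 \<and>
        (\<forall>z\<in>U. stabilizer F \<phi> z = {\<one>\<^bsub>F\<^esub>}) \<and>
        (\<forall>z\<in>U. closedin (zariski Z R) (orbit F \<phi> z)))"

definition normalizer_quotient :: "('g, 'm) monoid_scheme \<Rightarrow> 'g set \<Rightarrow> 'g set monoid" where
  "normalizer_quotient G H = (G\<lparr>carrier := normalizer G H\<rparr>) Mod H"

text \<open>
  A coset of H in its normalizer acts on a fixed vector through any of its elements; all of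
  them give the same value, which is the unique member of the image below.
\<close>

definition normalizer_quotient_action ::
    "('g \<Rightarrow> 'v \<Rightarrow> 'v) \<Rightarrow> 'g set \<Rightarrow> 'g set \<Rightarrow> 'v \<Rightarrow> 'v" where
  "normalizer_quotient_action \<rho> H C =
     (\<lambda>z \<in> fixed_vectors \<rho> H. the_elem ((\<lambda>g. \<rho> g z) ` C))"

definition admissible ::
    "('g, 'm) monoid_scheme \<Rightarrow> ('a::field \<Rightarrow> 'v::ab_group_add \<Rightarrow> 'v) \<Rightarrow> ('g \<Rightarrow> 'v \<Rightarrow> 'v)
      \<Rightarrow> 'g set \<Rightarrow> bool" where
  "admissible G s \<rho> H \<longleftrightarrow>
     closed_orbit_isotropy_group G s \<rho> H \<and>
     strongly_stable (normalizer_quotient G H) (fixed_vectors \<rho> H)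
       (linear_ring s (fixed_vectors \<rho> H)) (normalizer_quotient_action \<rho> H)"

end

theory Submission
imports Defs "HOL-Library.Function_Algebras" "Jordan_Normal_Form.Determinant"
begin

text \<open>
  The fixed space of \<open>H\<close> in \<open>V^k\<close> is \<open>(V^H)^k\<close>. The heart of the matter is that for \<open>H = Stab v\<close>
  with closed orbit every \<open>e\<close> in \<open>V^H\<close> is \<open>\<theta> v\<close> for some equivariant polynomial map \<open>\<theta>\<close> of \<open>V\<close>.
  By Cartier's theorem the functions on \<open>G\<close> that are constant on the fibres of the orbit map are
  the restrictions of polynomials to the orbit (up to a denominator, which the closed orbit under
  the reductive group removes), so the covariant \<open>g v \<mapsto> g e\<close> extends to \<open>V\<close>; averaging makes the
  extension equivariant. The average exists because linear reductivity follows from the Casimir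
  element of a nondegenerate trace form.

  A tuple \<open>z\<close> for which some equivariant \<open>\<psi>\<close> has \<open>\<psi> z = v\<close> has isotropy group \<open>H\<close> and a closed orbit,
  and these tuples contain an open set. If at least two components are available, moving along lines
  shows that the complement of that set cannot contain a hypersurface.
\<close>

text \<open>Reductivity is given only as triviality of the unipotent radical, whereas averaging
  needs extensions by the trivial module to split. The bridge is the group \<open>Nrad\<close> of
  elements acting trivially in every irreducible representation: it is unipotent, and in
  characteristic zero its elements lie on polynomial curves through the identity, so it is connected
  and therefore trivial. A Lie ideal of locally nilpotent elements exponentiates into
  \<open>Nrad\<close> and hence vanishes; this is what lets the Casimir element of \<rho> act on an
  extension as well. Nilpotency is read off from traces by Chevalley's replicas. When the Lie
  algebra acts by zero, the cocycle takes finitely many values and their mean replaces the Casimir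
  element. Equivariant polynomial maps take the place of slices: they carry the stabilizer and the
  closed orbit of v over to a tuple, and a determinant of their values makes the suitable tuples
  open. Two components matter because one can be moved to v along a line while the other keeps its
  failure.\<close>

no_notation Matrix.vec_index (infixl \<open>$\<close> 100)

hide_const (open) module.smult

section \<open>Algebras of functions\<close>

abbreviation "cr == carrier"
abbreviation "vlin == Vector_Spaces.linear"
lemmas sdl = sum_distrib_left and sdr = sum_distrib_right and ifi = infinite_finite_induct and mcm = mult.commute and als = algebra_simps
 and fei = fun_eq_iff and vei = Finite_Cartesian_Product.vec_eq_iff and vli = Vector_Spaces.linear_iff and mCe = mem_Collect_eq and ga_const = generated_algebra.const

lemma sum_fun_at: "(SUM i:I. f i) x = (SUM i:I. f i x)" by (induction I rule: ifi) auto

lemma power_fun_at: "(f ^ n) x = f x ^ n" by (induction n) auto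

lemma diff_fun_at [simp]: "(f - g) x = f x - (g x :: 'a :: ab_group_add)" by (simp add: fun_diff_def)

definition fsc :: "'a::field => ('x => 'a) => 'x => 'a" where
 "fsc c f = (%x. c * f x)"

lemma fscale_at [simp]: "fsc c f x = c * f x" by (simp add: fsc_def)

interpretation fs: vector_space fsc by unfold_locales (auto simp: fei als)

abbreviation "fsub == fs.subspace"
lemmas fs_0 = fs.subspace_0 and fs0 = fs.scale_zero_left and fs_sc = fs.subspace_scale and fs_ad = fs.subspace_add and fs_rd = fs.scale_right_diff_distrib and fs_def = fs.subspace_def

text \<open>Functions on X are encoded as functions on the whole type that vanish off X, so that the
  pointwise ring operations of the function type apply. The unit of the algebra is then
  \<open>cst X 1\<close>, not the function 1.\<close>

definition cst :: "'x set => 'a::zero => 'x => 'a" where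
 "cst X c = (%x. if x : X then c else 0)"

lemma cst_at: "cst X c x = (if x : X then c else 0)" by (simp add: cst_def)

locale fun_alg =
 fixes X :: "'x set" and A :: "('x => 'a::field) set" assumes out: "f : A ==> x ~: X ==> f x = 0" and cst_in: "cst X c : A"
 and add_in: "f : A ==> g : A ==> f + g : A" and mult_in: "f : A ==> g : A ==> f * g : A"
begin

lemma zero_in: "0 : A" proof -
 have "cst X 0 = (0 :: 'x => 'a)" by (auto simp: cst_def)
 thus ?thesis using cst_in[of 0] by simp
qed

lemma cst_mult: "f : A ==> cst X c * f = fsc c f" using out by (auto simp: cst_def fei)

lemma scale_in: "f : A ==> fsc c f : A" using mult_in[OF cst_in, of f c] by (simp add: cst_mult)

lemma uminus_in: "f : A ==> - f : A" using scale_in[of f "-1"] by (simp add: fsc_def fun_Compl_def)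

lemma diff_in: "f : A ==> g : A ==> f - g : A" using add_in[of f "- g"] uminus_in[of g] by simp

lemma sum_in: "(!!i. i : I ==> f i : A) ==> (SUM i:I. f i) : A" by (induction I rule: ifi) (auto intro: zero_in add_in)

text \<open>Exponents start at \<open>Suc n\<close>: the zeroth power is the constant 1 on the whole
  type, which need not vanish off X. Where exponent 0 must be allowed, the form
  \<open>f ^ n * g\<close> is used.\<close>

lemma power_in: "f : A ==> f ^ Suc n : A" by (induction n) (auto intro: mult_in)

lemma power_mult_in: "f : A ==> g : A ==> f ^ n * g : A" by (induction n) (auto intro: mult_in simp: mult.assoc)

lemma one_mult: "f : A ==> cst X 1 * f = f" by (simp add: cst_mult fsc_def)

lemma subspace: "fsub A" by (auto simp: fs_def zero_in add_in scale_in)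

definition fideal :: "('x => 'a) set => bool" where
 "fideal J \<longleftrightarrow> J <= A & 0 : J & (ALL f:J. ALL g:J. f + g : J) & (ALL a:A. ALL f:J. a * f : J)"

lemma idealD: assumes "fideal J" shows "J <= A" "0 : J" "f : J ==> g : J ==> f + g : J" "a : A ==> f : J ==> a * f : J"
 using assms by (auto simp: fideal_def)

lemma ideal_uminus: assumes "fideal J" "f : J" shows "- f : J" proof -
 have "cst X (-1) * f : J" using idealD(4)[OF assms(1) cst_in assms(2)] .
 moreover have "f : A" using assms idealD(1) by blast
 ultimately show ?thesis by (simp add: cst_mult fsc_def fun_Compl_def)
qed

lemma ideal_diff: "fideal J ==> f : J ==> g : J ==> f - g : J" using idealD(3)[of J f "- g"] ideal_uminus[of J g] by simp

lemma ideal_sum: "fideal J ==> (!!i. i : I ==> f i : J) ==> (SUM i:I. f i) : J" by (induction I rule: ifi) (auto simp: idealD)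

lemma ideal_power_mult: assumes "fideal J" "a : A" "f : J" shows "a ^ n * f : J" proof (induction n)
 case (Suc n)
 thus ?case using idealD(4)[OF assms(1,2) Suc.IH] by (simp only: power_Suc mult.assoc)
qed (use assms in simp)

section \<open>Prime ideals and homomorphisms to the ground field\<close>

definition fprime :: "('x => 'a) set => bool" where
 "fprime P \<longleftrightarrow> fideal P & cst X 1 ~: P & (ALL f:A. ALL g:A. f * g : P --> f : P \<or> g : P)"

lemma primeD: assumes "fprime P" shows "fideal P" "cst X 1 ~: P" "f : A ==> g : A ==> f * g : P ==> f : P \<or> g : P"
 using assms by (auto simp: fprime_def)

lemma prime_power_mult: assumes "fprime P" "a : A" "f : A" "a ^ n * f : P" "a ~: P" shows "f : P" using assms(4) proof (induction n)
 case (Suc n)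
 have "a * (a ^ n * f) : P" using Suc.prems by (simp only: power_Suc mult.assoc)
 hence "a ^ n * f : P" using primeD(3)[OF assms(1,2) power_mult_in[OF assms(2,3)]] assms(5) by blast
 thus ?case by (rule Suc.IH)
qed simp

definition fhom :: "(('x => 'a) => 'a) => bool" where
 "fhom phi \<longleftrightarrow> (ALL c. phi (cst X c) = c) & (ALL f:A. ALL g:A. phi (f + g) = phi f + phi g) &
 (ALL f:A. ALL g:A. phi (f * g) = phi f * phi g)"

lemma homD: assumes "fhom phi" shows "phi (cst X c) = c" "f : A ==> g : A ==> phi (f + g) = phi f + phi g"
 "f : A ==> g : A ==> phi (f * g) = phi f * phi g" using assms by (auto simp: fhom_def)

lemma hom_zero: "fhom phi ==> phi 0 = 0" proof -
 assume "fhom phi"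
 from homD(2)[OF this zero_in zero_in] have "phi 0 + 0 = phi 0 + phi 0" by (simp only: add_0_right)
 thus ?thesis by (simp only: add_left_cancel)
qed

lemma hom_scale: "fhom phi ==> f : A ==> phi (fsc c f) = c * phi f" by (metis cst_in cst_mult homD(1,3))

lemma hom_diff: assumes "fhom phi" "f : A" "g : A" shows "phi (f - g) = phi f - phi g" proof -
 have "phi (f - g) + phi g = phi f" using homD(2)[OF assms(1) diff_in[OF assms(2,3)] assms(3)] by simp
 thus ?thesis by (simp add: als)
qed

lemma hom_sum: "fhom phi ==> (!!i. i : I ==> f i : A) ==> phi (SUM i:I. f i) = (SUM i:I. phi (f i))"
 by (induction I rule: ifi) (auto simp: hom_zero homD(2) sum_in)

lemma hom_power_mult:
 "fhom phi ==> a : A ==> f : A ==> phi (a ^ n * f) = phi a ^ n * phi f" by (induction n) (auto simp: mult.assoc homD(3) power_mult_in)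

lemma eval_hom: "x : X ==> fhom (%f. f x)" by (auto simp: fhom_def cst_at)

text \<open>Zorn's lemma among the ideals that contain J and miss all powers of h. A maximal one is
  prime, since two elements outside it each catch a power of h modulo it, and multiplying the two
  expressions would put a power of h inside.\<close>

lemma prime_avoiding: assumes J: "fideal J" and h: "h : A" and pow: "!!n. h ^ Suc n ~: J"
 obtains P where "fprime P" "J <= P" "h ~: P" proof -
 define \<Q> where "\<Q> = {Q. fideal Q & J <= Q & (ALL n. h ^ Suc n ~: Q)}"
 have "J : \<Q>" using J pow by (auto simp: \<Q>_def)
 hence ne: "\<Q> ~= {}" by blast
 have "\<Union>\<C> : \<Q>" if C: "\<C> ~= {}" "subset.chain \<Q> \<C>" for \<C> proof -
 have sub: "!!Q. Q : \<C> ==> Q : \<Q>" using C(2) by (auto simp: subset_chain_def)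
 have lin: "!!Q R. Q : \<C> ==> R : \<C> ==> Q <= R \<or> R <= Q" using C(2) by (auto simp: subset_chain_def)
 obtain Q0 where Q0: "Q0 : \<C>" using C(1) by blast
 have id: "!!Q. Q : \<C> ==> fideal Q" using sub by (auto simp: \<Q>_def)
 have "fideal (\<Union>\<C>)" unfolding fideal_def proof (intro conjI ballI)
 show "\<Union>\<C> <= A" using id idealD(1) by blast
 show "0 : \<Union>\<C>" using id[OF Q0] idealD(2) Q0 by blast
 show "f + g : \<Union>\<C>" if "f : \<Union>\<C>" "g : \<Union>\<C>" for f g proof -
 from that obtain Q R where QR: "Q : \<C>" "R : \<C>" "f : Q" "g : R" by blast
 show ?thesis proof (cases "Q <= R")
 case True
 thus ?thesis using idealD(3)[OF id[OF QR(2)], of f g] QR by blast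
 next
 case False
 hence "R <= Q" using lin QR by blast
 thus ?thesis using idealD(3)[OF id[OF QR(1)], of f g] QR by blast
 qed
 qed
 show "a * f : \<Union>\<C>" if "a : A" "f : \<Union>\<C>" for a f using that(2) idealD(4)[OF id that(1)] by blast
 qed
 moreover have "J <= \<Union>\<C>" using sub[OF Q0] Q0 by (auto simp: \<Q>_def)
 moreover have "ALL n. h ^ Suc n ~: \<Union>\<C>" using sub by (auto simp: \<Q>_def)
 ultimately show ?thesis by (auto simp: \<Q>_def)
 qed
 from subset_Zorn_nonempty[OF ne this] obtain P
 where P: "P : \<Q>" and max: "!!Q. Q : \<Q> ==> P <= Q ==> Q = P" by blast
 have idP: "fideal P" and hP: "!!n. h ^ Suc n ~: P" and JP: "J <= P" using P by (auto simp: \<Q>_def)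
 \<comment> \<open>By maximality, adjoining an element f outside P must catch a power of h.\<close>
 have gen: "EX n q a. q : P & a : A & h ^ Suc n = q + a * f" if f: "f : A" "f ~: P" for f proof (rule ccontr)
 assume neg: "\<not> ?thesis"
 define Q where "Q = {q + a * f |q a. q : P & a : A}"
 have "fideal Q" unfolding fideal_def proof (intro conjI ballI)
 show "Q <= A" using idealD(1)[OF idP] f by (auto simp: Q_def intro!: add_in mult_in)
 show "0 : Q" using idealD(2)[OF idP] zero_in by (auto simp: Q_def intro!: exI[of _ 0])
 show "x + y : Q" if "x : Q" "y : Q" for x y proof -
 from that obtain q a q' a' where "q : P" "a : A" "q' : P" "a' : A"
 "x = q + a * f" "y = q' + a' * f" by (auto simp: Q_def)
 hence "x + y = (q + q') + (a + a') * f" "q + q' : P" "a + a' : A" using idealD(3)[OF idP] add_in by (auto simp: als)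
 thus ?thesis unfolding Q_def by blast
 qed
 show "b * x : Q" if "b : A" "x : Q" for b x proof -
 from that obtain q a where "q : P" "a : A" "x = q + a * f" by (auto simp: Q_def)
 hence "b * x = (b * q) + (b * a) * f" "b * q : P" "b * a : A" using idealD(4)[OF idP] mult_in that by (auto simp: als)
 thus ?thesis unfolding Q_def by blast
 qed
 qed
 moreover have PQ: "P <= Q" proof
 fix q assume "q : P"
 moreover have "q = q + 0 * f" by simp
 ultimately show "q : Q" unfolding Q_def using zero_in by blast
 qed
 moreover have "ALL n. h ^ Suc n ~: Q" using neg by (auto simp: Q_def)
 ultimately have "Q : \<Q>" using JP by (auto simp: \<Q>_def)
 hence "Q = P" using max PQ by blast
 moreover have "f : Q" proof -
 have "f = 0 + cst X 1 * f" using one_mult[OF f(1)] by simp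
 thus ?thesis unfolding Q_def using idealD(2)[OF idP] cst_in[of 1] by blast
 qed
 ultimately show False using f by blast
 qed
 have "fprime P" unfolding fprime_def proof (intro conjI ballI impI)
 show "fideal P" by (rule idP)
 have "cst X 1 * h = h ^ Suc 0" using one_mult[OF h] by simp
 thus "cst X 1 ~: P" using hP[of 0] idealD(4)[OF idP h, of "cst X 1"] by (auto simp: mcm)
 show "f : P \<or> g : P" if fg: "f : A" "g : A" "f * g : P" for f g proof (rule ccontr)
 assume "\<not> ?thesis"
 then obtain m q a n q' a' where *: "q : P" "a : A" "h ^ Suc m = q + a * f"
 "q' : P" "a' : A" "h ^ Suc n = q' + a' * g" using gen fg by metis
 have "h ^ Suc (Suc (m + n)) = h ^ Suc m * h ^ Suc n" by (simp add: power_add als)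
 also have "... = (q' + a' * g) * q + (a * f) * q' + (a * a') * (f * g)" unfolding * by (simp add: als)
 also have "... : P" proof -
 have "q' + a' * g : A" "a * f : A" "a * a' : A" using * fg idealD(1)[OF idP] add_in mult_in by blast+
 thus ?thesis by (intro idealD(3)[OF idP] idealD(4)[OF idP] *(1,4) fg(3))
 qed
 finally show False using hP by blast
 qed
 qed
 with JP hP[of 0] show ?thesis by (intro that[of P]) auto
qed

section \<open>Polynomials with coefficients in a function algebra\<close>

definition polys :: "('x => 'a) poly set" where
 "polys = {p. ALL j. coeff p j : A}"

definition adjoin :: "('x => 'a) => ('x => 'a) set" where
 "adjoin c = (%p. poly p c) ` polys"

lemma polysI: shows "0 : polys" "p : polys ==> q : polys ==> p + q : polys"
 "p : polys ==> q : polys ==> p - q : polys"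
 "p : polys ==> q : polys ==> p * q : polys"
 "a : A ==> p : polys ==> smult a p : polys"
 "a : A ==> p : polys ==> smult (a ^ n) p : polys"
 "a : A ==> monom a n : polys" proof -
 show "0 : polys" by (simp add: polys_def zero_in)
 show "p : polys ==> q : polys ==> p + q : polys" unfolding polys_def mCe coeff_add using add_in by blast
 show "p : polys ==> q : polys ==> p - q : polys" unfolding polys_def mCe coeff_diff by (rule allI, rule diff_in) simp_all
 show "p : polys ==> q : polys ==> p * q : polys" unfolding polys_def mCe coeff_mult by (rule allI, rule sum_in, rule mult_in) simp_all
 show "a : A ==> p : polys ==> smult a p : polys" unfolding polys_def mCe coeff_smult using mult_in by blast
 show "a : A ==> p : polys ==> smult (a ^ n) p : polys" unfolding polys_def mCe coeff_smult using power_mult_in by blast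
 show "a : A ==> monom a n : polys" unfolding polys_def mCe coeff_monom using zero_in by simp
qed

text \<open>Division without inverting the leading coefficient: each reduction step costs one factor
  l. The number d only bounds the degree of g, so l may be zero, and the coefficient ring may have
  zero divisors.\<close>

lemma pseudo_division: assumes g: "g : polys" and l: "l = coeff g d" and gd: "!!j. j > d ==> coeff g j = 0" and f: "f : polys"
 shows "EX k q r. q : polys & r : polys & smult (l ^ k) f = q * g + r & (ALL j>=d. coeff r j = 0)" proof -
 have lA: "l : A" using g l by (auto simp: polys_def)
 have "EX k q r. q : polys & r : polys & smult (l ^ k) f = q * g + r & (ALL j>=d. coeff r j = 0)"
 if "f : polys" "!!j. j >= n ==> coeff f j = 0" for n f using that proof (induction n arbitrary: f)
 case 0
 have "smult (l ^ 0) f = 0 * g + f" by (simp only: power_0 smult_1_left) simp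
 thus ?case using polysI(1) 0 by (metis zero_le)
 next
 case (Suc n)
 show ?case proof (cases "n < d")
 case True
 have "smult (l ^ 0) f = 0 * g + f" by (simp only: power_0 smult_1_left) simp
 moreover have "ALL j>=d. coeff f j = 0" using Suc.prems(2) True by (meson Suc_leI le_trans)
 ultimately show ?thesis using polysI(1) Suc.prems(1) by blast
 next
 case False
 define m where "m = monom (coeff f n) (n - d)"
 have "coeff f n : A" using Suc.prems(1) unfolding polys_def by blast
 hence m: "m : polys" unfolding m_def by (rule polysI(7))
 define f' where "f' = smult l f - m * g"
 have "f' : polys" using m Suc.prems g lA by (auto simp: f'_def intro!: polysI)
 moreover have "coeff f' j = 0" if "j >= n" for j proof (cases "j = n")
 case True
 have "coeff (m * g) n = coeff f n * coeff g d" using False by (simp add: m_def coeff_monom_mult)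
 thus ?thesis unfolding f'_def True coeff_diff coeff_smult l by (simp only: mcm diff_self)
 next
 case ne: False
 hence "j - (n - d) > d" "j >= Suc n" using that False by auto
 hence "coeff f j = 0" "coeff g (j - (n - d)) = 0" using Suc.prems(2) gd by blast+
 thus ?thesis unfolding f'_def m_def coeff_diff coeff_smult coeff_monom_mult by (simp only: mult_zero_right diff_self if_cancel)
 qed
 ultimately obtain k q r where IH: "q : polys" "r : polys" "smult (l ^ k) f' = q * g + r"
 "ALL j>=d. coeff r j = 0" using Suc.IH[of f'] by blast
 have "smult (l ^ Suc k) f = smult (l ^ k) (f' + m * g)" by (simp add: f'_def mcm)
 also have "... = (q + smult (l ^ k) m) * g + r" using IH(3) by (simp add: smult_add_right als)
 finally have "smult (l ^ Suc k) f = (q + smult (l ^ k) m) * g + r" .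
 moreover have "q + smult (l ^ k) m : polys" by (intro polysI(2) polysI(6) IH(1) lA m)
 ultimately show ?thesis using IH(2,4) by blast
 qed
 qed
 from this[of f "Suc (degree f)"] f show ?thesis using coeff_eq_0 Suc_le_lessD by blast
qed

end

section \<open>Adjoining one function and Hilbert's basis theorem\<close>

context fun_alg
begin

lemma in_adjoin: "p : polys ==> poly p c : adjoin c" by (auto simp: adjoin_def)

lemma coeff_in: "p : polys ==> coeff p j : A" by (auto simp: polys_def)

lemma const_poly: "a : A ==> monom a 0 : polys" by (rule polysI(7))

lemma poly_const: "poly (monom a 0) c = (a :: 'x => 'a)" by (simp add: poly_monom)

lemma subset_adjoin: "A <= adjoin c" using in_adjoin[OF const_poly] unfolding poly_const by blast

lemma adjoin_fun_alg: assumes c: "!!x. x ~: X ==> c x = 0" shows "fun_alg X (adjoin c)" proof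
 show "f x = 0" if "f : adjoin c" "x ~: X" for f x proof -
 obtain p where p: "p : polys" "f = poly p c" using \<open>f : adjoin c\<close> by (auto simp: adjoin_def)
 have "f x = (SUM j<=degree p. coeff p j x * c x ^ j)" unfolding p(2) poly_altdef sum_fun_at by (simp add: power_fun_at)
 also have "... = 0" using coeff_in[OF p(1)] out that(2) by (intro sum.neutral) auto
 finally show ?thesis .
 qed
 show "cst X a : adjoin c" for a using subset_adjoin cst_in by blast
 show "f + g : adjoin c" if fg: "f : adjoin c" "g : adjoin c" for f g proof -
 obtain p q where "p : polys" "f = poly p c" "q : polys" "g = poly q c" using fg unfolding adjoin_def by blast
 thus ?thesis using in_adjoin[OF polysI(2), of p q c] by (simp only: poly_add)
 qed
 show "f * g : adjoin c" if fg: "f : adjoin c" "g : adjoin c" for f g proof -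
 obtain p q where "p : polys" "f = poly p c" "q : polys" "g = poly q c" using fg unfolding adjoin_def by blast
 thus ?thesis using in_adjoin[OF polysI(4), of p q c] by (simp only: poly_mult)
 qed
qed

lemma gen_in_adjoin: assumes c: "!!x. x ~: X ==> c x = 0" shows "c : adjoin c" proof -
 have "poly (monom (cst X 1) 1) c = c" using c by (auto simp: poly_monom cst_def fei)
 thus ?thesis using in_adjoin[OF polysI(7)[OF cst_in], of 1 1 c] by simp
qed

lemma adjoin_subset: assumes B: "fun_alg X B" "A <= B" "c : B" shows "adjoin c <= B" proof
 interpret B: fun_alg X B by fact
 fix f assume "f : adjoin c"
 then obtain p where p: "p : polys" "f = poly p c" by (auto simp: adjoin_def)
 have "c ^ j * coeff p j : B" for j using B.power_mult_in[OF B(3)] coeff_in[OF p(1)] B(2) by blast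
 thus "f : B" unfolding p(2) poly_altdef mcm[of "coeff p _"] by (intro B.sum_in)
qed

text \<open>Finite generation is phrased without generated ideals: each ideal that contains the
  finite set S contains J.\<close>

definition noeth :: bool where
 "noeth \<longleftrightarrow> (ALL J. fideal J --> (EX S<=J. finite S & (ALL I. fideal I --> S <= I --> J <= I)))"

text \<open>The number d is a formal degree: the coefficient at d may be zero, which is what makes
  the set closed under addition.\<close>

definition lead_ideal :: "('x => 'a) => ('x => 'a) set => nat => ('x => 'a) set" where
 "lead_ideal c J d = {coeff p d |p. p : polys & (ALL j>d. coeff p j = 0) & poly p c : J}"

lemma fideal_lead_ideal: assumes J: "fun_alg.fideal (adjoin c) J" and c: "!!x. x ~: X ==> c x = 0" shows "fideal (lead_ideal c J d)" proof -
 interpret B: fun_alg X "adjoin c" by (rule adjoin_fun_alg[OF c])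
 show ?thesis unfolding fideal_def proof (intro conjI ballI)
 show "lead_ideal c J d <= A" by (auto simp: lead_ideal_def coeff_in)
 have "0 : polys" "poly 0 c : J" "coeff 0 d = (0 :: 'x => 'a)" using B.idealD(2)[OF J] polysI(1) by simp_all
 thus "0 : lead_ideal c J d" unfolding lead_ideal_def by (force intro: exI[of _ 0])
 show "f + g : lead_ideal c J d" if fg: "f : lead_ideal c J d" "g : lead_ideal c J d" for f g proof -
 obtain p where p: "p : polys" "ALL j>d. coeff p j = 0" "poly p c : J" "f = coeff p d" using fg(1) unfolding lead_ideal_def by blast
 obtain q where q: "q : polys" "ALL j>d. coeff q j = 0" "poly q c : J" "g = coeff q d" using fg(2) unfolding lead_ideal_def by blast
 from p q have "p + q : polys" "ALL j>d. coeff (p + q) j = 0" "poly (p + q) c : J"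
 "f + g = coeff (p + q) d" using polysI(2) B.idealD(3)[OF J] by simp_all
 thus ?thesis unfolding lead_ideal_def by blast
 qed
 show "a * f : lead_ideal c J d" if a: "a : A" and f: "f : lead_ideal c J d" for a f proof -
 obtain p where p: "p : polys" "ALL j>d. coeff p j = 0" "poly p c : J" "f = coeff p d" using f unfolding lead_ideal_def by blast
 hence "smult a p : polys" "ALL j>d. coeff (smult a p) j = 0" "poly (smult a p) c : J"
 "a * f = coeff (smult a p) d" using polysI(5)[OF a] B.idealD(4)[OF J subsetD[OF subset_adjoin a]] by simp_all
 thus ?thesis unfolding lead_ideal_def by blast
 qed
 qed
qed

lemma lead_ideal_mono: assumes J: "fun_alg.fideal (adjoin c) J" and c: "!!x. x ~: X ==> c x = 0" and "d <= e"
 shows "lead_ideal c J d <= lead_ideal c J e" proof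
 interpret B: fun_alg X "adjoin c" by (rule adjoin_fun_alg[OF c])
 fix f assume "f : lead_ideal c J d"
 then obtain p where p: "p : polys" "ALL j>d. coeff p j = 0" "poly p c : J" "f = coeff p d" unfolding lead_ideal_def by blast
 define m where "m = monom (cst X (1::'a)) (e - d)"
 have m: "m : polys" unfolding m_def by (rule polysI(7)[OF cst_in])
 have "m * p : polys" using m p(1) by (rule polysI(4))
 moreover have "ALL j>e. coeff (m * p) j = 0" proof (intro allI impI)
 fix j assume "j > e"
 hence "j - (e - d) > d" using \<open>d <= e\<close> by simp
 hence "coeff p (j - (e - d)) = 0" using p(2) by blast
 thus "coeff (m * p) j = 0" unfolding m_def coeff_monom_mult by simp
 qed
 moreover have "poly (m * p) c : J" unfolding poly_mult using in_adjoin[OF m] p(3) by (rule B.idealD(4)[OF J])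
 moreover have "f = coeff (m * p) e" using \<open>d <= e\<close> p(4) one_mult[OF coeff_in[OF p(1), of d]] unfolding m_def coeff_monom_mult by simp
 ultimately show "f : lead_ideal c J e" unfolding lead_ideal_def by blast
qed

text \<open>The ideals of leading coefficients grow with the degree and stop growing at some N.
  Finitely many elements of J realize generators of the first ones up to N, and subtracting
  multiples of them lowers the degree of any other element.\<close>

theorem hilbert_basis: assumes A: noeth and c: "!!x. x ~: X ==> c x = 0" shows "fun_alg.noeth (adjoin c)" proof -
 interpret B: fun_alg X "adjoin c" by (rule adjoin_fun_alg[OF c])
 show ?thesis unfolding B.noeth_def proof (intro allI impI)
 fix J assume J: "B.fideal J"
 let ?L = "lead_ideal c J"
 note idL = fideal_lead_ideal[OF J c] and mono = lead_ideal_mono[OF J c]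
 define L where "L = (\<Union>d. ?L d)"
 have "fideal L" unfolding fideal_def proof (intro conjI ballI)
 show "L <= A" using idealD(1)[OF idL] by (auto simp: L_def)
 show "0 : L" using idealD(2)[OF idL] by (auto simp: L_def)
 show "f + g : L" if fg: "f : L" "g : L" for f g proof -
 obtain d e where "f : ?L d" "g : ?L e" using fg by (auto simp: L_def)
 hence "f : ?L (max d e)" "g : ?L (max d e)" using mono max.cobounded1 max.cobounded2 by blast+
 thus ?thesis using idealD(3)[OF idL] by (auto simp: L_def)
 qed
 show "a * f : L" if "a : A" "f : L" for a f using that idealD(4)[OF idL] by (auto simp: L_def)
 qed
 from A[unfolded noeth_def, rule_format, OF this]
 obtain T where T: "T <= L" "finite T" "!!I. fideal I ==> T <= I ==> L <= I" by metis
 obtain N where N: "T <= ?L N" proof -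
 have "ALL t:T. EX d. t : ?L d" using T(1) by (auto simp: L_def)
 then obtain dd where dd: "ALL t:T. t : ?L (dd t)" by metis
 have "T <= ?L (Max (dd ` T))" proof
 fix t assume t: "t : T"
 hence "dd t <= Max (dd ` T)" using T(2) by simp
 thus "t : ?L (Max (dd ` T))" using mono dd t by blast
 qed
 thus ?thesis by (rule that)
 qed
 have LN: "L <= ?L N" by (rule T(3)[OF idL N])
 have "EX S<=?L d. finite S & (ALL I. fideal I --> S <= I --> ?L d <= I)" for d by (rule A[unfolded noeth_def, rule_format, OF idL])
 then obtain G where G: "!!d. G d <= ?L d" "!!d. finite (G d)"
 "!!d I. fideal I ==> G d <= I ==> ?L d <= I" by metis
 have "EX p. p : polys & (ALL j>d. coeff p j = 0) & poly p c : J & t = coeff p d"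
 if "t : G d" for t d using that G(1) unfolding lead_ideal_def by blast
 then obtain w where w: "!!t d. t : G d ==> w t d : polys & (ALL j>d. coeff (w t d) j = 0) &
 poly (w t d) c : J & t = coeff (w t d) d" by metis
 define S where "S = (\<Union>d\<le>N. (%t. poly (w t d) c) ` G d)"
 have "J <= I" if I: "B.fideal I" and SI: "S <= I" for I proof -
 \<comment> \<open>Leading coefficients are realized inside \<open>I Int J\<close>: the correcting
   polynomial then lies in I, and subtracting it does not leave J.\<close>
 define IJ where "IJ = I Int J"
 have IJ: "B.fideal IJ" using I J unfolding IJ_def B.fideal_def by blast
 have LI: "?L d <= lead_ideal c IJ d" if "d <= N" for d proof (rule G(3)[OF fideal_lead_ideal[OF IJ c]])
 show "G d <= lead_ideal c IJ d" proof
 fix t assume t: "t : G d"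
 hence "poly (w t d) c : IJ" using w SI that unfolding IJ_def S_def by blast
 thus "t : lead_ideal c IJ d" using w[OF t] unfolding lead_ideal_def by blast
 qed
 qed
 have "poly p c : I" if "p : polys" "ALL j>=n. coeff p j = 0" "poly p c : J" for n p using that proof (induction n arbitrary: p)
 case 0
 hence "p = 0" unfolding poly_eq_iff coeff_0 by blast
 thus ?case using B.idealD(2)[OF I] by (simp only: poly_0)
 next
 case (Suc n)
 \<comment> \<open>Beyond degree N the leading ideals are those of degree N, so a polynomial of
   degree N times a power of c cancels the top term.\<close>
 define d where "d = min n N"
 have "ALL j>n. coeff p j = 0" using Suc.prems(2) Suc_leI by blast
 hence "coeff p n : ?L n" using Suc.prems unfolding lead_ideal_def by blast
 hence "coeff p n : ?L d" proof (cases "n <= N")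
 case False
 hence "d = N" by (simp add: d_def)
 moreover have "coeff p n : L" using \<open>coeff p n : ?L n\<close> by (auto simp: L_def)
 ultimately show ?thesis using LN by blast
 qed (simp add: d_def)
 hence "coeff p n : lead_ideal c IJ d" using LI[of d] by (auto simp: d_def)
 then obtain p' where p': "p' : polys" "ALL j>d. coeff p' j = 0" "poly p' c : IJ"
 "coeff p n = coeff p' d" unfolding lead_ideal_def by blast
 define m where "m = monom (cst X (1::'a)) (n - d)"
 have m: "m : polys" unfolding m_def by (rule polysI(7)[OF cst_in])
 have mp: "poly (m * p') c : IJ" unfolding poly_mult using in_adjoin[OF m] p'(3) by (rule B.idealD(4)[OF IJ])
 have "poly (p - m * p') c : I" proof (rule Suc.IH)
 show "p - m * p' : polys" by (intro polysI(3,4) Suc.prems(1) m p'(1))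
 show "ALL j>=n. coeff (p - m * p') j = 0" proof (intro allI impI)
 fix j assume "j >= n"
 show "coeff (p - m * p') j = 0" proof (cases "j = n")
 case True
 have "coeff (m * p') n = cst X 1 * coeff p' d" unfolding m_def coeff_monom_mult by (simp add: d_def)
 also have "... = coeff p n" using one_mult[OF coeff_in[OF p'(1)]] p'(4) by simp
 finally show ?thesis using True by simp
 next
 case False
 hence "j > n" using \<open>j >= n\<close> by simp
 hence "coeff p' (j - (n - d)) = 0" using p'(2) by (simp add: d_def)
 moreover have "coeff p j = 0" using \<open>j > n\<close> Suc.prems(2) Suc_leI by blast
 ultimately show ?thesis unfolding m_def coeff_diff coeff_monom_mult by simp
 qed
 qed
 show "poly (p - m * p') c : J" unfolding poly_diff using B.ideal_diff[OF J Suc.prems(3)] mp by (auto simp: IJ_def)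
 qed
 hence "poly (p - m * p') c + poly (m * p') c : I" by (rule B.idealD(3)[OF I]) (use mp in \<open>simp add: IJ_def\<close>)
 thus ?case unfolding poly_diff by (simp only: diff_add_cancel)
 qed
 hence "poly p c : I" if "p : polys" "poly p c : J" for p using that coeff_eq_0[of p] Suc_le_lessD by blast
 thus ?thesis using B.idealD(1)[OF J] unfolding adjoin_def by blast
 qed
 moreover have "S <= J" using w unfolding S_def by blast
 moreover have "finite S" using G(2) unfolding S_def by blast
 ultimately show "EX S<=J. finite S & (ALL I. B.fideal I --> S <= I --> J <= I)" by blast
 qed
qed

end

section \<open>Extending homomorphisms to an adjoined function\<close>

context fun_alg
begin

definition evp :: "(('x => 'a) => 'a) => 'a => ('x => 'a) poly => 'a" where
 "evp phi b p = poly (map_poly phi p) b"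

lemma map_poly_hom: assumes phi: "fhom phi" shows "p : polys ==> q : polys ==> map_poly phi (p + q) = map_poly phi p + map_poly phi q"
 and "p : polys ==> q : polys ==> map_poly phi (p - q) = map_poly phi p - map_poly phi q"
 and "p : polys ==> q : polys ==> map_poly phi (p * q) = map_poly phi p * map_poly phi q"
 and "a : A ==> p : polys ==> map_poly phi (smult (a ^ n) p) = smult (phi a ^ n) (map_poly phi p)" proof -
 note c = coeff_map_poly[of phi, OF hom_zero[OF phi]]
 show "map_poly phi (p + q) = map_poly phi p + map_poly phi q" if "p : polys" "q : polys"
 by (rule poly_eqI) (simp only: c coeff_add homD(2)[OF phi coeff_in[OF that(1)] coeff_in[OF that(2)]])
 show "map_poly phi (p - q) = map_poly phi p - map_poly phi q" if "p : polys" "q : polys"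
 by (rule poly_eqI) (simp only: c coeff_diff hom_diff[OF phi coeff_in[OF that(1)] coeff_in[OF that(2)]])
 show "map_poly phi (p * q) = map_poly phi p * map_poly phi q" if pq: "p : polys" "q : polys" proof (rule poly_eqI)
 fix n
 have "phi (SUM i<=n. coeff p i * coeff q (n - i)) = (SUM i<=n. phi (coeff p i * coeff q (n - i)))" by (intro hom_sum[OF phi] mult_in coeff_in pq)
 also have "... = (SUM i<=n. phi (coeff p i) * phi (coeff q (n - i)))" by (simp only: homD(3)[OF phi coeff_in[OF pq(1)] coeff_in[OF pq(2)]])
 finally show "coeff (map_poly phi (p * q)) n = coeff (map_poly phi p * map_poly phi q) n" by (simp only: c coeff_mult)
 qed
 show "map_poly phi (smult (a ^ n) p) = smult (phi a ^ n) (map_poly phi p)" if "a : A" "p : polys"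
 by (rule poly_eqI) (simp only: c coeff_smult hom_power_mult[OF phi that(1) coeff_in[OF that(2)]])
qed

lemma evp_hom: assumes phi: "fhom phi" shows "p : polys ==> q : polys ==> evp phi b (p + q) = evp phi b p + evp phi b q"
 and "p : polys ==> q : polys ==> evp phi b (p - q) = evp phi b p - evp phi b q"
 and "p : polys ==> q : polys ==> evp phi b (p * q) = evp phi b p * evp phi b q"
 and "a : A ==> p : polys ==> evp phi b (smult (a ^ n) p) = phi a ^ n * evp phi b p" and "evp phi b (monom a 0) = phi a"
 by (simp_all add: evp_def map_poly_hom[OF phi] map_poly_monom hom_zero[OF phi] poly_monom)

text \<open>The obstruction to sending c to b is that one function has many polynomial expressions
  in c; respecting the relations makes the value independent of the choice.\<close>

lemma hom_extend: assumes phi: "fhom phi" and c: "!!x. x ~: X ==> c x = 0" and wd: "!!p. p : polys ==> poly p c = 0 ==> evp phi b p = 0"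
 shows "EX psi. fun_alg.fhom X (adjoin c) psi & (ALL p:polys. psi (poly p c) = evp phi b p)" proof -
 interpret B: fun_alg X "adjoin c" by (rule adjoin_fun_alg[OF c])
 define psi where "psi f = evp phi b (SOME p. p : polys & poly p c = f)" for f
 have eq: "psi (poly p c) = evp phi b p" if p: "p : polys" for p proof -
 define q where "q = (SOME q. q : polys & poly q c = poly p c)"
 have q: "q : polys" "poly q c = poly p c" using someI[of "%q. q : polys & poly q c = poly p c" p] p by (auto simp: q_def)
 have "poly (q - p) c = 0" using q(2) by (simp only: poly_diff diff_self)
 hence "evp phi b (q - p) = 0" by (rule wd[OF polysI(3)[OF q(1) p]])
 thus ?thesis unfolding psi_def q_def[symmetric] evp_hom(2)[OF phi q(1) p] by simp
 qed
 have "B.fhom psi" unfolding B.fhom_def proof (intro conjI ballI allI)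
 show "psi (cst X a) = a" for a using eq[OF const_poly[OF cst_in], of a] homD(1)[OF phi] by (simp only: poly_const evp_hom(5)[OF phi])
 fix f g assume "f : adjoin c" "g : adjoin c"
 then obtain p q where p: "p : polys" "f = poly p c" and q: "q : polys" "g = poly q c" unfolding adjoin_def by blast
 show "psi (f + g) = psi f + psi g" unfolding p(2) q(2) poly_add[symmetric] eq[OF p(1)] eq[OF q(1)]
 eq[OF polysI(2)[OF p(1) q(1)]] by (rule evp_hom(1)[OF phi p(1) q(1)])
 show "psi (f * g) = psi f * psi g" unfolding p(2) q(2) poly_mult[symmetric] eq[OF p(1)] eq[OF q(1)]
 eq[OF polysI(4)[OF p(1) q(1)]] by (rule evp_hom(3)[OF phi p(1) q(1)])
 qed
 thus ?thesis using eq by blast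
qed

text \<open>The index i is the last one whose coefficient is outside P. Dropping the terms above it
  changes the value only by an element of P and leaves a leading coefficient outside P.\<close>

lemma truncate_poly: assumes P: "fun_alg.fideal (adjoin c) P" and c: "!!x. x ~: X ==> c x = 0"
 and p: "p : polys" and j: "coeff p j ~: P" and n: "!!j. j > n ==> coeff p j : P"
 obtains q i where "q : polys" "poly p c - poly q c : P" "coeff q i ~: P"
 "!!j. j > i ==> coeff q j = 0" "i <= n" "coeff q i = coeff p i" "!!j. j > i ==> coeff p j : P" proof -
 interpret B: fun_alg X "adjoin c" by (rule adjoin_fun_alg[OF c])
 define i where "i = Max {j. coeff p j ~: P}"
 have fin: "finite {j. coeff p j ~: P}" by (rule finite_subset[of _ "{..n}"]) (use n in \<open>auto simp: not_le[symmetric]\<close>)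
 have i: "coeff p i ~: P" using Max_in[OF fin] j by (auto simp: i_def)
 have above: "coeff p j : P" if "j > i" for j using Max_ge[OF fin, of j] that by (auto simp: i_def)
 define q where "q = (SUM k<=i. monom (coeff p k) k)"
 have cq: "coeff q k = (if k <= i then coeff p k else 0)" for k proof -
 have "coeff q k = (SUM l<=i. if l = k then coeff p l else 0)" unfolding q_def coeff_sum coeff_monom by simp
 also have "... = (if k : {..i} then coeff p k else 0)" by (rule sum.delta) simp
 finally show ?thesis by simp
 qed
 have q: "q : polys" unfolding polys_def mCe cq using coeff_in[OF p] zero_in by simp
 have cj: "poly (monom a k) c * f : P" if "a : A" "f : P" for a k f using in_adjoin[OF polysI(7)[OF that(1)]] that(2) by (rule B.idealD(4)[OF P])
 have "poly (p - q) c : P" unfolding poly_altdef[of "p - q"] proof (rule B.ideal_sum[OF P])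
 fix k
 have "coeff (p - q) k : P" using above[of k] B.idealD(2)[OF P] unfolding coeff_diff cq by simp
 moreover have "coeff (p - q) k : A" by (intro coeff_in polysI(3) p q)
 hence "poly (monom (cst X 1) k) c * coeff (p - q) k = coeff (p - q) k * c ^ k" unfolding poly_monom mult.assoc mult.left_commute[of "cst X 1"]
 using one_mult by (metis mult.assoc mcm)
 ultimately show "coeff (p - q) k * c ^ k : P" using cj[OF cst_in] by metis
 qed
 moreover have "i <= n" using i n not_le by blast
 ultimately show ?thesis using q i above by (intro that[of q i]) (auto simp only: cq poly_diff order_refl if_True if_False not_le[symmetric])
qed

text \<open>
  The homomorphism is extended from \<open>A\<close> to \<open>A[c]\<close> by sending \<open>c\<close>
  to a root \<open>b\<close>: modulo the prime \<open>P \<inter> A\<close>, \<open>P\<close> is generated up to denominators by a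
  polynomial \<open>g\<close> of least degree, and a denominator-free combination \<open>s = u h\<close> (mod \<open>P\<close>)
  keeps the image of \<open>h\<close> nonzero.
\<close>

lemma nullstellensatz_step:
 fixes h :: "'x => 'a" assumes ac: "!!p :: 'a poly. degree p > 0 ==> EX x. poly p x = 0" and inf: "infinite (UNIV :: 'a set)"
 and c: "!!x. x ~: X ==> c x = 0" and IH: "!!P h. fprime P ==> h : A ==> h ~: P ==>
 EX phi. fhom phi & (ALL f:P. phi f = 0) & phi h ~= 0" and P: "fun_alg.fprime X (adjoin c) P" and h: "h : adjoin c" "h ~: P"
 shows "EX phi. fun_alg.fhom X (adjoin c) phi & (ALL f:P. phi f = 0) & phi h ~= 0" proof -
 interpret B: fun_alg X "adjoin c" by (rule adjoin_fun_alg[OF c])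
 note idP = B.primeD(1)[OF P]
 note AB = subsetD[OF subset_adjoin[of c]]
 define P' where "P' = P Int A"
 have P': "fprime P'" unfolding fprime_def fideal_def P'_def using B.idealD[OF idP] B.primeD(2,3)[OF P] AB zero_in add_in mult_in by auto
 obtain ph where ph: "ph : polys" "h = poly ph c" using h(1) unfolding adjoin_def by blast
 have coeff_P: "poly p c : P" if "p : polys" "!!j. coeff p j : P" for p proof (rule ccontr)
 assume neg: "poly p c ~: P"
 have "poly p c : P" unfolding poly_altdef proof (rule B.ideal_sum[OF idP])
 fix k
 have "poly (monom (cst X 1) k) c * coeff p k : P" by (rule B.idealD(4)[OF idP in_adjoin[OF polysI(7)[OF cst_in]] that(2)])
 moreover have "poly (monom (cst X 1) k) c * coeff p k = coeff p k * c ^ k"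
 unfolding poly_monom using one_mult[OF coeff_in[OF that(1)]] by (metis mult.assoc mcm)
 ultimately show "coeff p k * c ^ k : P" by simp
 qed
 with neg show False by blast
 qed
 obtain jh where jh: "coeff ph jh ~: P" using coeff_P[OF ph(1)] ph(2) h(2) by blast
 show ?thesis proof (cases "ALL p:polys. poly p c : P --> (ALL j. coeff p j : P)")
 \<comment> \<open>Here c is transcendental modulo P: any b works that is not a root of the image of
   \<open>ph\<close>.\<close>
 case True
 obtain phi where phi: "fhom phi" "!!f. f : P' ==> phi f = 0" "phi (coeff ph jh) ~= 0"
 using IH[OF P' coeff_in[OF ph(1)], of jh] jh unfolding P'_def by blast
 have "coeff (map_poly phi ph) jh ~= 0" using phi(3) coeff_map_poly[of phi, OF hom_zero[OF phi(1)]] by simp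
 hence "map_poly phi ph ~= 0" by force
 hence "finite {b. poly (map_poly phi ph) b = 0}" by (rule poly_roots_finite)
 hence "{b. poly (map_poly phi ph) b = 0} ~= UNIV" using inf by metis
 then obtain b where b: "evp phi b ph ~= 0" unfolding evp_def by blast
 have van: "evp phi b p = 0" if "p : polys" "poly p c : P" for p proof -
 have "phi (coeff p j) = 0" for j using True that phi(2) coeff_in[OF that(1)] unfolding P'_def by blast
 hence "map_poly phi p = 0" by (intro poly_eqI) (simp add: coeff_map_poly[of phi, OF hom_zero[OF phi(1)]])
 thus ?thesis by (simp add: evp_def)
 qed
 hence wd: "!!p. p : polys ==> poly p c = 0 ==> evp phi b p = 0" using B.idealD(2)[OF idP] by metis
 obtain psi where psi': "B.fhom psi & (ALL p:polys. psi (poly p c) = evp phi b p)"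
 using hom_extend[where c = c and b = b, OF phi(1) c wd] by (rule exE)
 hence psi: "B.fhom psi" "!!p. p : polys ==> psi (poly p c) = evp phi b p" by simp_all
 have z: "psi f = 0" if fP: "f : P" for f proof -
 obtain p where p: "p : polys" "f = poly p c" using fP B.idealD(1)[OF idP] unfolding adjoin_def by blast
 thus ?thesis using psi(2)[OF p(1)] van[OF p(1)] fP by simp
 qed
 have "psi h ~= 0" using psi(2)[OF ph(1)] b ph(2) by simp
 thus ?thesis using psi(1) z by blast
 next
 case False
 define Good where "Good Q d p \<longleftrightarrow> p : polys & poly p c : Q & coeff p d ~: P & (ALL j>d. coeff p j = 0)" for Q d p
 have truncate: "EX i<=n. EX q. Good Q i q"
 if t: "p : polys" "poly p c : Q" "coeff p j ~: P" "!!j. j > n ==> coeff p j : P"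
 "ALL x y. x : Q --> x - y : P --> y : Q" for p Q j n proof -
 obtain q i where "q : polys" "poly p c - poly q c : P" "coeff q i ~: P"
 "!!j. j > i ==> coeff q j = 0" "i <= n" using truncate_poly[OF idP c t(1,3,4)] by metis
 thus ?thesis using t(2,5) unfolding Good_def by blast
 qed
 have Pcl: "y : P" if "x : P" "x - y : P" for x y using B.ideal_diff[OF idP that] by simp
 \<comment> \<open>The functions congruent modulo P to a multiple of h. A constant of Q outside P
   will be the denominator s.\<close>
 define Q where "Q = {f : adjoin c. EX u:adjoin c. f - u * h : P}"
 have Qcl: "y : Q" if "x : Q" "x - y : P" for x y proof -
 obtain u where u: "x : adjoin c" "u : adjoin c" "x - u * h : P" using \<open>x : Q\<close> Q_def by blast
 have "y = x - (x - y)" by simp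
 hence "y : adjoin c" using u(1) B.diff_in B.idealD(1)[OF idP] that(2) by (metis subsetD)
 moreover have "y - u * h = (x - u * h) - (x - y)" by simp
 hence "y - u * h : P" using B.ideal_diff[OF idP u(3) that(2)] by metis
 ultimately show ?thesis using u(2) Q_def by blast
 qed
 have PQ: "P <= Q" proof
 fix f assume f: "f : P"
 hence "f - 0 * h : P" by simp
 thus "f : Q" using f B.idealD(1)[OF idP] B.zero_in unfolding Q_def by blast
 qed
 have hQ: "h : Q" proof -
 have "h - cst X 1 * h : P" using B.one_mult[OF h(1)] B.idealD(2)[OF idP] by (simp only: diff_self)
 thus ?thesis using h(1) B.cst_in unfolding Q_def by blast
 qed
 have Qdiff: "f - b * g : Q" if fg: "f : Q" "g : Q" "b : adjoin c" for f g b proof -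
 obtain u where u: "f : adjoin c" "u : adjoin c" "f - u * h : P" using fg(1) unfolding Q_def by blast
 obtain v where v: "g : adjoin c" "v : adjoin c" "g - v * h : P" using fg(2) unfolding Q_def by blast
 have "(f - b * g) - (u - b * v) * h = (f - u * h) - b * (g - v * h)" by (simp add: als)
 also have "... : P" by (rule B.ideal_diff[OF idP u(3) B.idealD(4)[OF idP fg(3) v(3)]])
 finally have "(f - b * g) - (u - b * v) * h : P" .
 moreover have "f - b * g : adjoin c" "u - b * v : adjoin c" by (intro B.diff_in B.mult_in u v fg)+
 ultimately show ?thesis unfolding Q_def by blast
 qed
 have Pcl': "ALL x y. x : P --> x - y : P --> y : P" using Pcl by blast
 have Qcl': "ALL x y. x : Q --> x - y : P --> y : Q" using Qcl by blast
 have Qmult: "b * f : Q" if "b : adjoin c" "f : Q" for b f using Qdiff[OF subsetD[OF PQ B.idealD(2)[OF idP]] that(2) B.uminus_in[OF that(1)]] by simp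
 define d where "d = (LEAST d. EX g. Good P d g)"
 obtain p0 j0 where p0: "p0 : polys" "poly p0 c : P" "coeff p0 j0 ~: P" using False by blast
 have hi: "coeff p j : P" if "j > degree p" for j p using coeff_eq_0[OF that] B.idealD(2)[OF idP] by simp
 have exP: "EX d g. Good P d g" using truncate[where n = "degree p0", OF p0 hi Pcl'] by blast
 then obtain g where g: "Good P d g" unfolding d_def using LeastI_ex[OF exP] by blast
 have dmin: "d <= i" if "Good P i q" for i q unfolding d_def by (rule Least_le) (use that in blast)
 have smallP: "coeff p j : P" if t: "p : polys" "poly p c : P" "ALL j>=d. coeff p j = 0" for p j proof (rule ccontr)
 assume neg: "coeff p j ~: P"
 have "coeff p j : P" if "j > d - 1" for j proof -
 have "j >= d" using that by simp
 thus ?thesis using t(3) B.idealD(2)[OF idP] by simp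
 qed
 then obtain i q where iq: "i <= d - 1" "Good P i q" using truncate[where n = "d - 1" and Q = P, OF t(1,2) neg _ Pcl'] by blast
 hence "d = 0" using dmin[OF iq(2)] by simp
 thus False using neg t(3) B.idealD(2)[OF idP] by simp
 qed
 define e0 where "e0 = (LEAST d. EX e. Good Q d e)"
 have exQ: "EX d e. Good Q d e" using truncate[where n = "degree ph" and Q = Q, OF ph(1) _ jh hi Qcl'] hQ ph(2) by blast
 then obtain e where e: "Good Q e0 e" unfolding e0_def using LeastI_ex[OF exQ] by blast
 have emin: "e0 <= i" if "Good Q i q" for i q unfolding e0_def by (rule Least_le) (use that in blast)
 have smallQ: "coeff p j : P" if t: "e0 > 0" "p : polys" "poly p c : Q" "ALL j>=e0. coeff p j = 0" for p j proof (rule ccontr)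
 assume neg: "coeff p j ~: P"
 have "coeff p j : P" if "j > e0 - 1" for j proof -
 have "j >= e0" using that by simp
 thus ?thesis using t(4) B.idealD(2)[OF idP] by simp
 qed
 then obtain i q where iq: "i <= e0 - 1" "Good Q i q" using truncate[where n = "e0 - 1" and Q = Q, OF t(2,3) neg _ Qcl'] by blast
 thus False using emin[OF iq(2)] t(1) by simp
 qed
 let ?l = "coeff g d" and ?m = "coeff e e0"
 have gD: "g : polys" "poly g c : P" "?l ~: P" "!!j. j > d ==> coeff g j = 0" using g unfolding Good_def by blast+
 have eD: "e : polys" "poly e c : Q" "?m ~: P" "!!j. j > e0 ==> coeff e j = 0" using e unfolding Good_def by blast+
 \<comment> \<open>Otherwise divide g by e. Primality of P puts q(c) or e(c) into P: the first
   yields a relation of degree below d, the second a power of the leading coefficient of e times h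
   inside P.\<close>
 have e0: "e0 = 0" proof (rule ccontr)
 assume "e0 ~= 0"
 hence pos: "e0 > 0" by simp
 obtain k q r where qr: "q : polys" "r : polys" "smult (?m ^ k) g = q * e + r" "ALL j>=e0. coeff r j = 0"
 using pseudo_division[OF eD(1) refl eD(4) gD(1)] by blast
 have mB: "?m : adjoin c" by (rule AB[OF coeff_in[OF eD(1)]])
 have gB: "poly g c : adjoin c" by (rule in_adjoin[OF gD(1)])
 have mgP: "poly (smult (?m ^ k) g) c : P" unfolding poly_smult by (rule B.ideal_power_mult[OF idP mB gD(2)])
 have "poly r c = poly (smult (?m ^ k) g) c - poly q c * poly e c" unfolding qr(3) by (simp only: poly_add poly_mult add_diff_cancel_left')
 hence "poly r c : Q" using Qdiff[OF subsetD[OF PQ mgP] eD(2) in_adjoin[OF qr(1)]] by simp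
 hence rP: "poly r c : P" using coeff_P[OF qr(2)] smallQ[OF pos qr(2) _ qr(4)] by blast
 have "poly q c * poly e c = poly (smult (?m ^ k) g) c - poly r c" unfolding qr(3) by (simp only: poly_add poly_mult add_diff_cancel_right')
 hence "poly q c * poly e c : P" using B.ideal_diff[OF idP mgP rP] by simp
 then consider "poly q c : P" | "poly e c : P" using B.primeD(3)[OF P in_adjoin[OF qr(1)] in_adjoin[OF eD(1)]] by blast
 thus False proof cases
 case 1
 have "EX j. coeff q j ~: P" proof (rule ccontr)
 assume neg: "\<not> ?thesis"
 have "d >= e0" using emin[of d g] gD PQ unfolding Good_def by blast
 hence "coeff r d = 0" using qr(4) by blast
 hence "coeff (smult (?m ^ k) g) d = coeff (q * e) d" unfolding qr(3) by simp
 moreover have "coeff (q * e) d : P" unfolding coeff_mult proof (rule B.ideal_sum[OF idP])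
 fix i show "coeff q i * coeff e (d - i) : P" unfolding mcm[of "coeff q i"] using neg by (intro B.idealD(4)[OF idP AB[OF coeff_in[OF eD(1)]]]) blast
 qed
 ultimately have "?m ^ k * ?l : P" by simp
 thus False using B.prime_power_mult[OF P mB AB[OF coeff_in[OF gD(1)]]] eD(3) gD(3) by blast
 qed
 then obtain j where j: "coeff q j ~: P" by blast
 obtain q' i where q': "q' : polys" "poly q c - poly q' c : P" "coeff q' i ~: P"
 "!!j. j > i ==> coeff q' j = 0" "coeff q' i = coeff q i" "!!j. j > i ==> coeff q j : P" using truncate_poly[OF idP c qr(1) j hi[of q]] by metis
 have "coeff (q * e) (i + e0) = (SUM k<=i + e0. coeff q k * coeff e (i + e0 - k))" by (rule coeff_mult)
 also have "... = coeff q i * coeff e (i + e0 - i) +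
 (SUM k:{..i + e0} - {i}. coeff q k * coeff e (i + e0 - k))" by (rule sum.remove) auto
 finally have s: "coeff (q * e) (i + e0) - coeff q i * ?m =
 (SUM k:{..i + e0} - {i}. coeff q k * coeff e (i + e0 - k))" by simp
 have "(SUM k:{..i + e0} - {i}. coeff q k * coeff e (i + e0 - k)) : P" proof (rule B.ideal_sum[OF idP])
 fix k assume k: "k : {..i + e0} - {i}"
 show "coeff q k * coeff e (i + e0 - k) : P" proof (cases "k > i")
 case True
 thus ?thesis unfolding mcm[of "coeff q k"] using q'(6) by (intro B.idealD(4)[OF idP AB[OF coeff_in[OF eD(1)]]])
 next
 case False
 hence "i + e0 - k > e0" using k by auto
 hence "coeff e (i + e0 - k) = 0" by (rule eD(4))
 thus ?thesis using B.idealD(2)[OF idP] by simp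
 qed
 qed
 hence s2: "coeff (q * e) (i + e0) - coeff q i * ?m : P" unfolding s .
 have "i + e0 <= d" proof (rule ccontr)
 assume "\<not> i + e0 <= d"
 hence "coeff g (i + e0) = 0" by (intro gD(4)) simp
 moreover have "coeff r (i + e0) = 0" using qr(4) by simp
 ultimately have "coeff (q * e) (i + e0) = 0" using arg_cong[OF qr(3), of "%p. coeff p (i + e0)"] by simp
 hence "- (coeff q i * ?m) : P" using s2 by simp
 hence "coeff q i * ?m : P" using B.ideal_uminus[OF idP] by fastforce
 thus False using B.primeD(3)[OF P AB[OF coeff_in[OF qr(1)]] mB] eD(3) q'(3,5) by metis
 qed
 moreover have "Good P i q'" using q' Pcl[OF 1 q'(2)] unfolding Good_def by blast
 hence "d <= i" by (rule dmin)
 ultimately show False using pos by simp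
 next
 case 2
 obtain k q r where qr: "q : polys" "r : polys" "smult (?m ^ k) ph = q * e + r"
 "ALL j>=e0. coeff r j = 0" using pseudo_division[OF eD(1) refl eD(4) ph(1)] by blast
 have m: "poly (smult (?m ^ k) ph) c = ?m ^ k * h" unfolding ph(2) by simp
 have mQ: "?m ^ k * h : Q" using Qmult[OF mB] hQ by (induction k) (auto simp: mult.assoc)
 have "poly r c = poly (smult (?m ^ k) ph) c - poly q c * poly e c" unfolding qr(3) by (simp only: poly_add poly_mult add_diff_cancel_left')
 hence "poly r c : Q" using Qdiff[OF mQ eD(2) in_adjoin[OF qr(1)]] unfolding m by simp
 hence rP: "poly r c : P" using coeff_P[OF qr(2)] smallQ[OF pos qr(2) _ qr(4)] by blast
 have "?m ^ k * h = poly q c * poly e c + poly r c" unfolding m[symmetric] qr(3) by (simp only: poly_add poly_mult)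
 also have "... : P" by (rule B.idealD(3)[OF idP B.idealD(4)[OF idP in_adjoin[OF qr(1)] 2] rP])
 finally show False using B.prime_power_mult[OF P mB h(1)] eD(3) h(2) by blast
 qed
 qed
 define s where "s = coeff e 0"
 have s: "s : A" "s ~: P" using coeff_in[OF eD(1)] eD(3) e0 by (auto simp: s_def)
 have "e = monom s 0" proof (rule poly_eqI)
 fix n show "coeff e n = coeff (monom s 0) n" using eD(4) e0 unfolding s_def by (cases n) auto
 qed
 hence "s : Q" using eD(2) poly_const by metis
 then obtain u where u: "u : adjoin c" "s - u * h : P" unfolding Q_def by blast
 have lA: "?l : A" by (rule coeff_in[OF gD(1)])
 have "?l * s ~: P" using B.primeD(3)[OF P AB[OF lA] AB[OF s(1)]] gD(3) s(2) by blast
 \<comment> \<open>A nonzero image of \<open>?l\<close> keeps the degree of g positive under phi, so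
   that the root b exists; a nonzero image of s will force the value at h to be nonzero.\<close>
 then obtain phi where phi: "fhom phi" "!!f. f : P' ==> phi f = 0" "phi (?l * s) ~= 0" using IH[OF P' mult_in[OF lA s(1)]] unfolding P'_def by blast
 have phils: "phi ?l ~= 0" "phi s ~= 0" using phi(3) unfolding homD(3)[OF phi(1) lA s(1)] by auto
 have "d ~= 0" proof
 assume d0: "d = 0"
 have "g = monom ?l 0" proof (rule poly_eqI)
 fix n show "coeff g n = coeff (monom ?l 0) n" using gD(4) d0 by (cases n) auto
 qed
 thus False using gD(2,3) poly_const by metis
 qed
 moreover have "coeff (map_poly phi g) d ~= 0" using phils(1) coeff_map_poly[of phi, OF hom_zero[OF phi(1)]] by simp
 hence "d <= degree (map_poly phi g)" by (rule le_degree)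
 ultimately obtain b where b: "evp phi b g = 0" using ac[of "map_poly phi g"] unfolding evp_def by auto
 have van: "evp phi b p = 0" if p: "p : polys" "poly p c : P" for p proof -
 obtain k q r where qr: "q : polys" "r : polys" "smult (?l ^ k) p = q * g + r" "ALL j>=d. coeff r j = 0"
 using pseudo_division[OF gD(1) refl gD(4) p(1)] by blast
 have "poly (smult (?l ^ k) p) c : P" unfolding poly_smult by (rule B.ideal_power_mult[OF idP AB[OF lA] p(2)])
 moreover have "poly q c * poly g c : P" by (rule B.idealD(4)[OF idP in_adjoin[OF qr(1)] gD(2)])
 moreover have "poly r c = poly (smult (?l ^ k) p) c - poly q c * poly g c" unfolding qr(3) by (simp only: poly_add poly_mult add_diff_cancel_left')
 ultimately have "poly r c : P" using B.ideal_diff[OF idP] by simp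
 hence "coeff r j : P" for j by (rule smallP[OF qr(2) _ qr(4)])
 hence "phi (coeff r j) = 0" for j using phi(2) coeff_in[OF qr(2)] unfolding P'_def by blast
 hence "map_poly phi r = 0" by (intro poly_eqI) (simp add: coeff_map_poly[of phi, OF hom_zero[OF phi(1)]])
 hence "evp phi b r = 0" by (simp add: evp_def)
 hence "evp phi b (smult (?l ^ k) p) = 0" unfolding qr(3) evp_hom(1)[OF phi(1) polysI(4)[OF qr(1) gD(1)] qr(2)]
 evp_hom(3)[OF phi(1) qr(1) gD(1)] b by simp
 thus ?thesis using phils(1) unfolding evp_hom(4)[OF phi(1) lA p(1)] by simp
 qed
 hence wd: "!!p. p : polys ==> poly p c = 0 ==> evp phi b p = 0" using B.idealD(2)[OF idP] by metis
 obtain psi where psi': "B.fhom psi & (ALL p:polys. psi (poly p c) = evp phi b p)"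
 using hom_extend[where c = c and b = b, OF phi(1) c wd] by (rule exE)
 hence psi: "B.fhom psi" "!!p. p : polys ==> psi (poly p c) = evp phi b p" by simp_all
 have z: "psi f = 0" if fP: "f : P" for f proof -
 obtain p where p: "p : polys" "f = poly p c" using fP B.idealD(1)[OF idP] unfolding adjoin_def by blast
 thus ?thesis using psi(2)[OF p(1)] van[OF p(1)] fP by simp
 qed
 have "psi s = phi s" using psi(2)[OF const_poly[OF s(1)]] unfolding poly_const evp_hom(5)[OF phi(1)] .
 moreover have "psi (s - u * h) = psi s - psi u * psi h"
 using B.hom_diff[OF psi(1) AB[OF s(1)] B.mult_in[OF u(1) h(1)]] B.homD(3)[OF psi(1) u(1) h(1)] by simp
 ultimately have "psi h ~= 0" using z[OF u(2)] phils(2) by auto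
 thus ?thesis using psi(1) z by blast
 qed
qed

end

section \<open>Finitely generated function algebras and the Nullstellensatz\<close>

inductive_set falg :: "'x set => ('x => 'a::field) set => ('x => 'a) set" for X :: "'x set" and S :: "('x => 'a::field) set"
 where
 const: "cst X c : falg X S"
 | gen: "f : S ==> f : falg X S"
 | add: "f : falg X S ==> g : falg X S ==> f + g : falg X S"
 | mult: "f : falg X S ==> g : falg X S ==> f * g : falg X S"

definition supp_in :: "'x set => ('x => 'a::zero) set => bool" where
 "supp_in X S \<longleftrightarrow> (ALL f:S. ALL x. x ~: X --> f x = 0)"

lemma fun_alg_falg: "supp_in X S ==> fun_alg X (falg X S)" proof
 assume S: "supp_in X S"
 show "f x = 0" if "f : falg X S" "x ~: X" for f x using that by induction (use S in \<open>auto simp: cst_def supp_in_def\<close>)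
qed (rule falg.const falg.add falg.mult; assumption)+

lemma falg_least: "fun_alg X B ==> S <= B ==> falg X S <= B" proof
 assume B: "fun_alg X B" "S <= B"
 interpret B: fun_alg X B by fact
 fix f assume "f : falg X S"
 thus "f : B" proof induction
 case (gen f) thus ?case using B(2) by blast
 qed (rule B.cst_in B.add_in B.mult_in; assumption)+
qed

lemma falg_mono: "S <= T ==> falg X S <= falg X T" proof
 fix f assume "S <= T" "f : falg X S"
 from this(2) show "f : falg X T" proof induction
 case (gen f) thus ?case using \<open>S <= T\<close> by (blast intro: falg.gen)
 qed (rule falg.const falg.add falg.mult; assumption)+
qed

lemma falg_insert: assumes "supp_in X (insert c S)" shows "falg X (insert c S) = fun_alg.adjoin (falg X S) c" proof
 have S: "supp_in X S" and c: "!!x. x ~: X ==> c x = 0" using assms by (auto simp: supp_in_def)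
 interpret fun_alg X "falg X S" by (rule fun_alg_falg[OF S])
 show "falg X (insert c S) <= adjoin c" using subset_adjoin[of c] gen_in_adjoin[OF c] falg.gen[of _ S X] by (intro falg_least adjoin_fun_alg c) auto
 show "adjoin c <= falg X (insert c S)" by (intro adjoin_subset fun_alg_falg assms falg_mono falg.gen) auto
qed

lemma falg_empty: "falg X {} = range (cst X)" proof
 show "falg X {} <= range (cst X)" proof
 fix f assume "f : falg X {}"
 thus "f : range (cst X)" proof induction
 case (add f g)
 then obtain c d where "f = cst X c" "g = cst X d" by blast
 hence "f + g = cst X (c + d)" by (auto simp: cst_def)
 thus ?case by blast
 next
 case (mult f g)
 then obtain c d where "f = cst X c" "g = cst X d" by blast
 hence "f * g = cst X (c * d)" by (auto simp: cst_def)
 thus ?case by blast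
 qed auto
 qed
qed (auto intro: falg.const)

lemma supp_in_empty: "supp_in X {}" by (simp add: supp_in_def)

lemma const_ideal:
 fixes X :: "'x set" assumes "fun_alg.fideal (falg X {}) J" and f: "f : J" "f ~= 0" shows "J = falg X {}" proof -
 interpret fun_alg X "falg X {} :: ('x => 'a::field) set" by (rule fun_alg_falg[OF supp_in_empty])
 obtain c where c: "f = cst X c" using f(1) idealD(1)[OF assms(1)] unfolding falg_empty by blast
 have "c ~= 0" using f(2) c by (auto simp: cst_def fei)
 have "cst X d : J" for d proof -
 have "cst X (d / c) * f : J" by (rule idealD(4)[OF assms(1) cst_in f(1)])
 moreover have "cst X (d / c) * f = cst X d" using \<open>c ~= 0\<close> by (auto simp: c cst_def)
 ultimately show ?thesis by simp
 qed
 thus ?thesis using idealD(1)[OF assms(1)] unfolding falg_empty by blast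
qed

theorem noeth_falg: assumes "finite S" "supp_in X S" shows "fun_alg.noeth (falg X S)" using assms proof (induction S)
 case empty
 interpret fun_alg X "falg X {} :: ('a => 'b) set" by (rule fun_alg_falg[OF supp_in_empty])
 show ?case unfolding noeth_def proof (intro allI impI)
 fix J :: "('a => 'b) set" assume J: "fideal J"
 show "EX S<=J. finite S & (ALL I. fideal I --> S <= I --> J <= I)" proof (cases "J <= {0}")
 case True
 thus ?thesis using idealD(2) by (intro exI[of _ "{}"]) auto
 next
 case False
 then obtain f where f: "f : J" "f ~= 0" by blast
 have "J <= I" if "fideal I" "f : I" for I using const_ideal[OF that f(2)] idealD(1)[OF J] by simp
 thus ?thesis using f(1) by (intro exI[of _ "{f}"]) auto
 qed
 qed
next
 case (insert c S)
 hence S: "supp_in X S" and c: "!!x. x ~: X ==> c x = 0" by (auto simp: supp_in_def)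
 interpret fun_alg X "falg X S" by (rule fun_alg_falg[OF S])
 show ?case unfolding falg_insert[OF insert.prems] by (rule hilbert_basis[OF insert.IH[OF S] c])
qed

lemma alg_closed_infinite: "infinite (UNIV :: 'a::{alg_closed_field, field_char_0} set)" by (rule infinite_UNIV_char_0)

lemma prime_hom_falg:
 fixes S :: "('x => 'a::{alg_closed_field, field_char_0}) set" assumes "finite S" "supp_in X S"
 and "fun_alg.fprime X (falg X S) P" "h : falg X S" "h ~: P" shows "EX phi. fun_alg.fhom X (falg X S) phi & (ALL f:P. phi f = 0) & phi h ~= 0"
 using assms proof (induction S arbitrary: P h)
 case empty
 interpret fun_alg X "falg X {} :: ('x => 'a) set" by (rule fun_alg_falg[OF supp_in_empty])
 note P = empty(2)
 have "X ~= {}" proof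
 assume "X = {}"
 hence "cst X 1 = (0 :: 'x => 'a)" by (auto simp: cst_def)
 thus False using primeD(2)[OF P] idealD(2)[OF primeD(1)[OF P]] by simp
 qed
 then obtain x where x: "x : X" by blast
 have z: "f = 0" if "f : P" for f proof (rule ccontr)
 assume "f ~= 0"
 hence "P = falg X {}" by (rule const_ideal[OF primeD(1)[OF P] that])
 thus False using cst_in primeD(2)[OF P] by blast
 qed
 obtain c where c: "h = cst X c" using empty(3) unfolding falg_empty by blast
 have "h ~= 0" using empty(4) idealD(2)[OF primeD(1)[OF P]] by blast
 hence "h x ~= 0" using x by (auto simp: c cst_def fei)
 thus ?case using eval_hom[OF x] z by (intro exI[of _ "%f. f x"]) (metis zero_fun_apply)
next
 case (insert c S)
 hence S: "supp_in X S" and c: "!!x. x ~: X ==> c x = 0" by (auto simp: supp_in_def)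
 interpret fun_alg X "falg X S" by (rule fun_alg_falg[OF S])
 note eq = falg_insert[OF insert.prems(1)]
 have ac: "EX x. poly p x = 0" if "degree p > 0" for p :: "'a poly" using alg_closed_imp_poly_has_root[OF that] .
 show ?case using insert.prems(2-4) unfolding eq by (intro nullstellensatz_step[OF ac alg_closed_infinite c insert.IH[OF S]])
qed

theorem nullstellensatz:
 fixes S :: "('x => 'a::{alg_closed_field, field_char_0}) set" assumes "finite S" "supp_in X S"
 and J: "fun_alg.fideal (falg X S) J" and h: "h : falg X S" "!!n. h ^ Suc n ~: J"
 obtains phi where "fun_alg.fhom X (falg X S) phi" "!!f. f : J ==> phi f = 0" "phi h ~= 0" proof -
 interpret fun_alg X "falg X S" by (rule fun_alg_falg[OF assms(2)])
 obtain P where P: "fprime P" "J <= P" "h ~: P" using prime_avoiding[OF J h] by metis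
 obtain phi where "fhom phi" "ALL f:P. phi f = 0" "phi h ~= 0" using prime_hom_falg[OF assms(1,2) P(1) h(1) P(3)] by blast
 thus ?thesis using P(2) by (intro that[of phi]) auto
qed

section \<open>Affine varieties\<close>

text \<open>Closedness of the embedded variety is recorded by \<open>points\<close>: each
  homomorphism to the ground field is evaluation at a point.\<close>

locale aff_var = fun_alg X A for X :: "'x set" and A :: "('x => 'a::{alg_closed_field, field_char_0}) set" +
 assumes fin_gen: "EX S. finite S & supp_in X S & A = falg X S" and points: "fhom phi ==> EX x:X. ALL f:A. phi f = f x"
 and separated: "x : X ==> y : X ==> (!!f. f : A ==> f x = f y) ==> x = y"
begin

lemma ideal_point: assumes "fideal J" "h : A" "!!n. h ^ Suc n ~: J"
 obtains x where "x : X" "!!f. f : J ==> f x = 0" "h x ~= 0" proof -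
 obtain S where S: "finite S" "supp_in X S" "A = falg X S" using fin_gen by blast
 obtain phi where phi: "fhom phi" "!!f. f : J ==> phi f = 0" "phi h ~= 0"
 using nullstellensatz[OF S(1,2), of J h] assms unfolding S(3)[symmetric] by metis
 obtain x where x: "x : X" "ALL f:A. phi f = f x" using points[OF phi(1)] by blast
 show ?thesis using x phi idealD(1)[OF assms(1)] assms(2) by (intro that[of x]) (metis subsetD)+
qed

lemma unit_ideal: assumes J: "fideal J" and nz: "!!x. x : X ==> EX f:J. f x ~= 0" shows "cst X 1 : J" proof (rule ccontr)
 assume neg: "cst X 1 ~: J"
 have "cst X 1 ^ Suc n = (cst X 1 :: 'x => 'a)" for n by (auto simp: cst_def fei power_fun_at)
 hence "!!n. cst X 1 ^ Suc n ~: J" using neg by metis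
 from ideal_point[OF J cst_in this] nz show False by metis
qed

end

section \<open>From extensional functions to functions extended by zero\<close>

definition zext :: "'x set => ('x => 'a::zero) set => ('x => 'a) set" where
 "zext X R = {f. (ALL x. x ~: X --> f x = 0) & restrict f X : R}"

definition zcut :: "'x set => ('x => 'a::zero) => 'x => 'a" where
 "zcut X f = (%x. if x : X then f x else 0)"

lemma supp_in_zcut: "supp_in X (zcut X ` S)" by (auto simp: supp_in_def zcut_def)

lemma zext_falg: "zext X (generated_algebra X S) = falg X (zcut X ` S)" proof
 have *: "zcut X r : falg X (zcut X ` S)" if "r : generated_algebra X S" for r using that proof induction
 case (const c)
 have "zcut X (\<lambda>x\<in>X. c) = cst X c" by (auto simp: zcut_def cst_def)
 thus ?case using falg.const by metis
 next
 case (generator f)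
 have "zcut X (restrict f X) = zcut X f" by (auto simp: zcut_def)
 thus ?case using falg.gen[of "zcut X f" "zcut X ` S" X] generator by (metis imageI)
 next
 case (add f g)
 have "zcut X (\<lambda>x\<in>X. f x + g x) = zcut X f + zcut X g" by (auto simp: zcut_def)
 thus ?case using falg.add[OF add.IH] by (simp only:)
 next
 case (mult f g)
 have "zcut X (\<lambda>x\<in>X. f x * g x) = zcut X f * zcut X g" by (auto simp: zcut_def)
 thus ?case using falg.mult[OF mult.IH] by (simp only:)
 qed
 show "zext X (generated_algebra X S) <= falg X (zcut X ` S)" proof
 fix f assume f: "f : zext X (generated_algebra X S)"
 hence "zcut X (restrict f X) = f" by (auto simp: zext_def zcut_def)
 thus "f : falg X (zcut X ` S)" using *[of "restrict f X"] f by (auto simp: zext_def)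
 qed
 show "falg X (zcut X ` S) <= zext X (generated_algebra X S)" proof
 fix f assume "f : falg X (zcut X ` S)"
 thus "f : zext X (generated_algebra X S)" proof induction
 case (const c)
 have "restrict (cst X c) X = (\<lambda>x\<in>X. c)" by (auto simp: cst_def)
 thus ?case using ga_const[of c X S] by (auto simp: zext_def cst_def)
 next
 case (gen f)
 then obtain s where s: "s : S" "f = zcut X s" by blast
 have "restrict f X = restrict s X" by (auto simp: s zcut_def)
 thus ?case using generated_algebra.generator[OF s(1), of X] by (auto simp: zext_def s zcut_def)
 next
 case (add f g)
 have "restrict (f + g) X = (\<lambda>x\<in>X. restrict f X x + restrict g X x)" by auto
 moreover have "(\<lambda>x\<in>X. restrict f X x + restrict g X x) : generated_algebra X S"
 by (rule generated_algebra.add) (use add.IH in \<open>unfold zext_def, blast\<close>)+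
 moreover have "ALL x. x ~: X --> (f + g) x = 0" using add.IH by (simp add: zext_def)
 ultimately show ?case by (simp only: zext_def mCe simp_thms)
 next
 case (mult f g)
 have "restrict (f * g) X = (\<lambda>x\<in>X. restrict f X x * restrict g X x)" by auto
 moreover have "(\<lambda>x\<in>X. restrict f X x * restrict g X x) : generated_algebra X S"
 by (rule generated_algebra.mult) (use mult.IH in \<open>unfold zext_def, blast\<close>)+
 moreover have "ALL x. x ~: X --> (f * g) x = 0" using mult.IH by (simp add: zext_def)
 ultimately show ?case by (simp only: zext_def mCe simp_thms)
 qed
 qed
qed

lemma topspace_zariski: "topspace (zariski X (generated_algebra X S)) = X" proof -
 have "(\<lambda>x\<in>X. 1) : generated_algebra X S" by (rule ga_const)
 hence "openin (zariski X (generated_algebra X S)) X" unfolding openin_zariski by (intro exI[of _ "{\<lambda>x\<in>X. 1}"]) auto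
 moreover have "U <= X" if "openin (zariski X (generated_algebra X S)) U" for U using that unfolding openin_zariski by blast
 ultimately show ?thesis by (metis openin_topspace openin_subset subset_antisym)
qed

lemma closedin_zariski:
 "closedin (zariski X (generated_algebra X S)) C \<longleftrightarrow>
 (EX T<=generated_algebra X S. C = {x : X. ALL f:T. f x = 0})" unfolding closedin_def topspace_zariski openin_zariski proof
 assume "C <= X & (EX T<=generated_algebra X S. X - C = {x : X. EX f:T. f x ~= 0})"
 then obtain T where "C <= X" "T <= generated_algebra X S" "X - C = {x : X. EX f:T. f x ~= 0}" by blast
 moreover from this have "C = {x : X. ALL f:T. f x = 0}" by blast
 ultimately show "EX T<=generated_algebra X S. C = {x : X. ALL f:T. f x = 0}" by blast
next
 assume "EX T<=generated_algebra X S. C = {x : X. ALL f:T. f x = 0}"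
 then obtain T where "T <= generated_algebra X S" "C = {x : X. ALL f:T. f x = 0}" by blast
 moreover from this have "X - C = {x : X. EX f:T. f x ~= 0}" by blast
 ultimately show "C <= X & (EX T<=generated_algebra X S. X - C = {x : X. EX f:T. f x ~= 0})" by blast
qed

text \<open>A homomorphism sends the coordinate functions to a point p of affine space and acts on
  the pullback of a polynomial as evaluation at p. The equations of the closed image pull back to
  zero, so they vanish at p and p lies on the image.\<close>

theorem aff_var_zext:
 fixes R :: "('x => 'a::{alg_closed_field, field_char_0}) set" assumes "affine_variety X R" shows "aff_var X (zext X R)" proof -
 obtain n and c :: "nat => 'x => 'a" where R: "R = generated_algebra X (c ` {..<n})" and inj: "inj_on (%x. \<lambda>i\<in>{..<n}. c i x) X"
 and closed: "closedin (zariski (affine_space n) (affine_space_ring n)) ((%x. \<lambda>i\<in>{..<n}. c i x) ` X)"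
 using assms unfolding affine_variety_def by blast
 define e where "e x = (\<lambda>i\<in>{..<n}. c i x)" for x
 define S where "S = zcut X ` c ` {..<n}"
 have A: "zext X R = falg X S" unfolding R S_def by (rule zext_falg)
 have S: "finite S" "supp_in X S" by (auto simp: S_def supp_in_zcut)
 interpret fun_alg X "zext X R" unfolding A by (rule fun_alg_falg[OF S(2)])
 have cA: "zcut X (c i) : zext X R" if "i < n" for i unfolding A by (rule falg.gen) (use that in \<open>auto simp: S_def\<close>)
 show ?thesis proof
 show "EX S. finite S & supp_in X S & zext X R = falg X S" using A S by blast
 fix phi assume phi: "fhom phi"
 define p where "p = (\<lambda>i\<in>{..<n}. phi (zcut X (c i)))"
 have p: "p : affine_space n" by (auto simp: p_def affine_space_def)
 have ex: "e x : affine_space n" for x by (auto simp: e_def affine_space_def)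
 have F: "zcut X (%x. F (e x)) : zext X R & phi (zcut X (%x. F (e x))) = F p"
 if "F : affine_space_ring n" for F using that unfolding affine_space_ring_def proof induction
 case (const b)
 have "zcut X (%x. (\<lambda>x\<in>affine_space n. b) (e x)) = cst X b" using ex by (auto simp: zcut_def cst_def)
 thus ?case using homD(1)[OF phi] cst_in p by simp
 next
 case (generator f)
 then obtain i where i: "i < n" "f = (%p. p i)" by blast
 have "zcut X (%x. restrict f (affine_space n) (e x)) = zcut X (c i)" using ex i by (auto simp: zcut_def e_def)
 moreover have "restrict f (affine_space n) p = phi (zcut X (c i))" unfolding restrict_apply using p i by (simp add: p_def)
 ultimately show ?case using cA[OF i(1)] by (simp only: simp_thms)
 next
 case (add f g)
 have "zcut X (%x. (\<lambda>x\<in>affine_space n. f x + g x) (e x)) =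
 zcut X (%x. f (e x)) + zcut X (%x. g (e x))" using ex by (auto simp: zcut_def)
 moreover have "(\<lambda>x\<in>affine_space n. f x + g x) p = f p + g p" using p by simp
 ultimately show ?case using add.IH homD(2)[OF phi] add_in by (simp only: simp_thms)
 next
 case (mult f g)
 have "zcut X (%x. (\<lambda>x\<in>affine_space n. f x * g x) (e x)) =
 zcut X (%x. f (e x)) * zcut X (%x. g (e x))" using ex by (auto simp: zcut_def)
 moreover have "(\<lambda>x\<in>affine_space n. f x * g x) p = f p * g p" using p by simp
 ultimately show ?case using mult.IH homD(3)[OF phi] mult_in by (simp only: simp_thms)
 qed
 obtain T where T: "T <= affine_space_ring n" "e ` X = {x : affine_space n. ALL f:T. f x = 0}"
 using closed unfolding affine_space_ring_def closedin_zariski e_def by blast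
 have "f p = 0" if "f : T" for f proof -
 have "zcut X (%x. f (e x)) = 0" proof
 fix x
 have "x : X ==> f (e x) = 0" using T(2) that by blast
 thus "zcut X (%x. f (e x)) x = 0 x" by (simp add: zcut_def)
 qed
 thus ?thesis using F[of f] that T(1) hom_zero[OF phi] by auto
 qed
 hence "p : e ` X" unfolding T(2) using p by blast
 then obtain x where x: "x : X" "p = e x" by blast
 have px: "phi (zcut X (c i)) = c i x" if "i < n" for i using fun_cong[OF x(2), of i] that by (simp add: p_def e_def)
 have "phi f = f x" if "f : zext X R" for f using that unfolding A proof induction
 case (const c) thus ?case using homD(1)[OF phi] x(1) by (simp add: cst_def)
 next
 case (gen f) thus ?case using px x(1) by (auto simp: S_def zcut_def)
 next
 case (add f g)
 have "phi (f + g) = phi f + phi g" by (rule homD(2)[OF phi]) (use add.hyps A in blast)+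
 moreover have "(f + g) x = f x + g x" by (rule plus_fun_apply)
 ultimately show ?case using add.IH by metis
 next
 case (mult f g)
 have "phi (f * g) = phi f * phi g" by (rule homD(3)[OF phi]) (use mult.hyps A in blast)+
 moreover have "(f * g) x = f x * g x" by (rule times_fun_apply)
 ultimately show ?case using mult.IH by metis
 qed
 thus "EX x:X. ALL f:zext X R. phi f = f x" using x(1) by blast
 next
 fix x y assume xy: "x : X" "y : X" "!!f. f : zext X R ==> f x = f y"
 have "c i x = c i y" if "i < n" for i using xy(3)[OF cA[OF that]] xy(1,2) by (simp add: zcut_def)
 hence "(\<lambda>i\<in>{..<n}. c i x) = (\<lambda>i\<in>{..<n}. c i y)" by auto
 thus "x = y" using inj_onD[OF inj] xy(1,2) by blast
 qed
qed

declare plus_fun_apply [simp del] times_fun_apply [simp del] zero_fun_apply [simp del]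
 one_fun_apply [simp del] diff_fun_at [simp del]

lemmas fun_at = plus_fun_apply times_fun_apply zero_fun_apply one_fun_apply diff_fun_at fscale_at minus_apply uminus_apply
 sum_fun_at power_fun_at

section \<open>Linear algebra in function spaces\<close>

definition lc :: "nat => (nat => 'a::field) => (nat => 'x => 'a) => 'x => 'a" where
 "lc n c e = (SUM i<n. fsc (c i) (e i))"

lemma lc_at: "lc n c e x = (SUM i<n. c i * e i x)" by (simp add: lc_def fun_at)

lemma lc_in: "fsub T ==> (!!i. i < n ==> e i : T) ==> lc n c e : T" unfolding lc_def by (intro fs.subspace_sum fs_sc) auto

lemma lc_add: "lc n c e + lc n d e = lc n (%i. c i + d i) e" by (rule ext) (simp add: fun_at lc_at sum.distrib als)

lemma lc_diff: "lc n c e - lc n d e = lc n (%i. c i - d i) e" by (rule ext) (simp add: fun_at lc_at sum_subtractf als)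

lemma lc_scale: "fsc b (lc n c e) = lc n (%i. b * c i) e" by (rule ext) (simp add: lc_at sdl als)

lemma lc_cong: "(!!i. i < n ==> c i = d i) ==> lc n c e = lc n d e" by (simp add: lc_def)

lemma lc_delta: assumes "j < n" shows "lc n (%i. if i = j then 1 else 0) e = e j" proof
 fix x
 have "(SUM i<n. (if i = j then 1 else 0) * e i x) = (SUM i<n. if i = j then e i x else 0)" by (rule sum.cong) auto
 thus "lc n (%i. if i = j then 1 else 0) e x = e j x" using assms by (simp add: lc_at)
qed

definition fd :: "('x => 'a::field) set => bool" where
 "fd T \<longleftrightarrow> (EX F. finite F & T <= fs.span F)"

lemma fd_subset: "fd T ==> S <= T ==> fd S" unfolding fd_def by blast

text \<open>\<open>e 0, \<dots>, e (n - 1)\<close> represent a basis of \<open>T / M\<close>.\<close>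

definition bmod :: "('x => 'a::field) set => ('x => 'a) set => nat => (nat => 'x => 'a) => bool" where
 "bmod M T n e \<longleftrightarrow> (ALL i<n. e i : T) & (ALL c. lc n c e : M --> (ALL i<n. c i = 0)) &
 (ALL t:T. EX c. t - lc n c e : M)"

lemma bmD: assumes "bmod M T n e" shows "i < n ==> e i : T" "lc n c e : M ==> i < n ==> c i = 0" "t : T ==> EX c. t - lc n c e : M"
 using assms by (auto simp: bmod_def)

lemma basis_mod_unique: assumes "bmod M T n e" "fsub M" "t - lc n c e : M" "t - lc n d e : M" "i < n" shows "c i = d i" proof -
 have "(t - lc n d e) - (t - lc n c e) : M" by (rule fs.subspace_diff[OF assms(2,4,3)])
 moreover have "(t - lc n d e) - (t - lc n c e) = lc n c e - lc n d e" by simp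
 ultimately have "lc n (%i. c i - d i) e : M" by (simp only: lc_diff)
 from bmD(2)[OF assms(1) this assms(5)] show ?thesis by simp
qed

lemma li_card_bound: assumes F: "finite F" "!!i. i < n ==> e i : fs.span F" and li: "ALL c. lc n c e = 0 --> (ALL i<n. c i = 0)" shows "n <= card F"
proof -
 have inj: "inj_on e {..<n}" proof (rule inj_onI, rule ccontr)
 fix i j assume ij: "i : {..<n}" "j : {..<n}" "e i = e j" "i ~= j"
 define c where "c k = (if k = i then 1 else 0) - (if k = j then 1 else (0::'b))" for k
 have "lc n c e = lc n (%k. if k = i then 1 else 0) e - lc n (%k. if k = j then 1 else 0) e" unfolding lc_diff c_def ..
 also have "... = 0" using ij by (simp add: lc_delta)
 finally have "c i = 0" using li ij(1) by blast
 thus False using ij(4) by (simp add: c_def)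
 qed
 have "fs.independent (e ` {..<n})" proof (rule fs.independent_if_scalars_zero)
 fix u v assume u: "(SUM v:e ` {..<n}. fsc (u v) v) = 0" and v: "v : e ` {..<n}"
 have "lc n (%i. u (e i)) e = 0" unfolding lc_def using u by (simp add: sum.reindex[OF inj])
 hence "ALL i<n. u (e i) = 0" using li by blast
 thus "u v = 0" using v by auto
 qed simp
 moreover have "e ` {..<n} <= fs.span F" using F(2) by auto
 ultimately have "card (e ` {..<n}) <= card F" using fs.independent_span_bound[OF F(1)] by blast
 thus ?thesis by (simp add: card_image[OF inj])
qed

text \<open>A longest family independent modulo M spans modulo M; the size of a finite spanning set
  bounds its length.\<close>

lemma exists_bmod:
 fixes M T :: "('x => 'a::field) set" assumes M: "fsub M" and T: "fsub T" "fd T" and MT: "M <= T"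
 obtains n e where "bmod M T n e" proof -
 define I where "I n \<longleftrightarrow> (EX e. (ALL i<n. e i : T) & (ALL c. lc n c e : M --> (ALL i<n. c i = 0)))" for n
 obtain F where F: "finite F" "T <= fs.span F" using T(2) unfolding fd_def by blast
 have bound: "n <= card F" if "I n" for n proof -
 from that obtain e where e': "ALL i<n. e i : T" "ALL c. lc n c e : M --> (ALL i<n. c i = 0)" unfolding I_def by blast
 show ?thesis by (rule li_card_bound[OF F(1), of n e]) (use e' F(2) fs_0[OF M] in auto)
 qed
 have "I 0" by (simp add: I_def)
 define n where "n = (GREATEST n. I n)"
 have n: "I n" unfolding n_def by (rule GreatestI_nat[of I 0 "card F"]) (use \<open>I 0\<close> bound in auto)
 have max: "m <= n" if "I m" for m unfolding n_def by (rule Greatest_le_nat[of I m "card F"]) (use that bound in auto)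
 obtain e where e': "ALL i<n. e i : T" "ALL c. lc n c e : M --> (ALL i<n. c i = 0)" using n unfolding I_def by blast
 hence e: "!!i. i < n ==> e i : T" "!!c i. lc n c e : M ==> i < n ==> c i = 0" by blast+
 have "EX c. t - lc n c e : M" if t: "t : T" for t proof (rule ccontr)
 assume neg: "\<not> ?thesis"
 define e' where "e' i = (if i < n then e i else t)" for i
 have e'n: "lc (Suc n) c e' = lc n c e + fsc (c n) t" for c unfolding lc_def by (simp add: e'_def)
 have "I (Suc n)" unfolding I_def proof (intro exI[of _ e'] conjI allI impI)
 show "e' i : T" if "i < Suc n" for i using e(1) t by (simp add: e'_def)
 fix c i assume c: "lc (Suc n) c e' : M" and i: "i < Suc n"
 have "c n = 0" proof (rule ccontr)
 assume nz: "c n ~= 0"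
 have "t - lc n (%i. - (c i / c n)) e = fsc (1 / c n) (lc (Suc n) c e')" unfolding e'n using nz
 by (intro ext) (simp add: fun_at lc_at field_simps sdl sum_negf sum_divide_distrib)
 thus False using neg fs_sc[OF M c] by metis
 qed
 hence "lc n c e : M" using c unfolding e'n by simp
 thus "c i = 0" using e(2) \<open>c n = 0\<close> i less_Suc_eq by metis
 qed
 thus False using max by fastforce
 qed
 hence "bmod M T n e" unfolding bmod_def using e by blast
 thus ?thesis by (rule that)
qed

text \<open>Functionals are kept as finite combinations of point evaluations, because applying such
  a functional to the translates of a regular function gives a combination of translates, hence a
  regular function of the group element. This makes matrix coefficients regular.\<close>

definition evf :: "'x set => (('x => 'a::field) => 'a) set" where
 "evf X = {%f. SUM x:F. c x * f x |F c. finite F & F <= X}"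

lemma evf_zero: "(%f. 0) : evf X" unfolding evf_def by (intro CollectI exI[of _ "{}"]) simp

lemma evf_comb: assumes "l1 : evf X" "l2 : evf X" shows "(%f. a * l1 f + b * l2 f) : evf X" proof -
 obtain F c where F: "finite F" "F <= X" "l1 = (%f. SUM x:F. c x * f x)" using assms(1) unfolding evf_def by blast
 obtain E d where E: "finite E" "E <= X" "l2 = (%f. SUM x:E. d x * f x)" using assms(2) unfolding evf_def by blast
 define u where "u x = a * (if x : F then c x else 0) + b * (if x : E then d x else 0)" for x
 have "a * l1 f + b * l2 f = (SUM x:F Un E. u x * f x)" for f proof -
 have "(SUM x:F. c x * f x) = (SUM x:F Un E. (if x : F then c x else 0) * f x)" by (rule sum.mono_neutral_cong_left) (use F E in auto)
 moreover have "(SUM x:E. d x * f x) = (SUM x:F Un E. (if x : E then d x else 0) * f x)" by (rule sum.mono_neutral_cong_left) (use F E in auto)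
 ultimately show ?thesis by (simp add: F(3) E(3) u_def sdl sum.distrib als)
 qed
 thus ?thesis unfolding evf_def using F E by (intro CollectI exI[of _ "F Un E"] exI[of _ u]) auto
qed

lemma evf_point: "x : X ==> (%f. f x) : evf X" unfolding evf_def by (intro CollectI exI[of _ "{x}"] exI[of _ "%_. 1"]) auto

lemma evf_linear: assumes "l1 : evf X" shows "l1 (f + g) = l1 f + l1 g" "l1 (fsc c f) = c * l1 f" "l1 0 = 0"
 "l1 (SUM i:I. h i) = (SUM i:I. l1 (h i))" "l1 (f - g) = l1 f - l1 g"
 "l1 (lc n d e) = (SUM i<n. d i * l1 (e i))" proof -
 obtain F c' where F: "finite F" "F <= X" "l1 = (%f. SUM x:F. c' x * f x)" using assms(1) unfolding evf_def by blast
 show a: "l1 (f + g) = l1 f + l1 g" for f g by (simp add: F fun_at als sum.distrib)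
 show s: "l1 (fsc c f) = c * l1 f" for c f by (simp add: F als sdl)
 show z: "l1 0 = 0" by (simp add: F fun_at)
 show sm: "l1 (SUM i:I. h i) = (SUM i:I. l1 (h i))" for I and h :: "'i => 'a => 'b" by (induction I rule: ifi) (auto simp: a z)
 show "l1 (f - g) = l1 f - l1 g" by (simp add: F fun_at als sum_subtractf)
 have "l1 (SUM i:I. h i) = (SUM i:I. l1 (h i))" for I and h :: "nat => 'a => 'b" by (induction I rule: ifi) (auto simp: a z)
 thus "l1 (lc n d e) = (SUM i<n. d i * l1 (e i))" by (simp add: lc_def s)
qed

text \<open>The part of \<open>e n\<close> that the earlier functionals do not account for is a
  nonzero function, so it is nonzero at some point; evaluation there, corrected by the earlier
  functionals, is the next member of the dual family.\<close>

lemma dual_evaluations: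
 fixes e :: "nat => 'x => 'a::field" assumes "!!i x. i < n ==> x ~: X ==> e i x = 0" "ALL c. lc n c e = 0 --> (ALL i<n. c i = 0)"
 shows "EX l. ALL i<n. l i : evf X & (ALL j<n. l i (e j) = (if i = j then 1 else 0))" using assms proof (induction n)
 case (Suc n)
 have li: "ALL c. lc n c e = 0 --> (ALL i<n. c i = 0)" proof (intro allI impI)
 fix c i assume c: "lc n c e = 0" "i < n"
 define d where "d i = (if i < n then c i else 0)" for i
 have "lc (Suc n) d e = lc n c e" unfolding lc_def by (simp add: d_def)
 hence "d i = 0" using Suc.prems(2) c by (metis less_SucI)
 thus "c i = 0" using c(2) by (simp add: d_def)
 qed
 have p1: "!!i x. i < n ==> x ~: X ==> e i x = 0" using Suc.prems(1) by simp
 obtain l where l: "ALL i<n. l i : evf X & (ALL j<n. l i (e j) = (if i = j then 1 else 0))" using Suc.IH[OF p1 li] by blast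
 define e' where "e' = e n - lc n (%i. l i (e n)) e"
 have "e' ~= 0" proof
 assume z: "e' = 0"
 define d where "d i = (if i < n then - l i (e n) else 1)" for i
 have "lc (Suc n) d e = e'" by (rule ext) (simp add: lc_at e'_def fun_at d_def sum_negf)
 hence "d n = 0" using Suc.prems(2) z by (metis lessI)
 thus False by (simp add: d_def)
 qed
 then obtain x where x: "e' x ~= 0" by (auto simp: fei fun_at)
 have "x : X" proof (rule ccontr)
 assume "x ~: X"
 hence "e' x = 0" using Suc.prems(1) by (simp add: e'_def fun_at lc_at)
 thus False using x by simp
 qed
 have evsum: "(%f. SUM i<m. l i f * u i) : evf X" if "m <= n" for m u using that proof (induction m)
 case (Suc m)
 hence "l m : evf X" using l by simp
 from evf_comb[OF _ this, of "%f. SUM i<m. l i f * u i" 1 "u m"] Suc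
 show ?case by (simp add: mcm)
 qed (simp add: evf_zero)
 define ln where "ln f = (1 / e' x) * f x + (- 1 / e' x) * (SUM i<n. l i f * e i x)" for f
 have ln: "ln : evf X" unfolding ln_def by (rule evf_comb[OF evf_point[OF \<open>x : X\<close>] evsum]) simp
 have lnj: "ln (e j) = 0" if "j < n" for j proof -
 have "(SUM i<n. l i (e j) * e i x) = (SUM i<n. if i = j then e i x else 0)" using l that by (intro sum.cong) auto
 also have "... = e j x" using that by simp
 finally show ?thesis by (simp add: ln_def)
 qed
 have lnn: "ln (e n) = 1" proof -
 have "e' x = e n x - (SUM i<n. l i (e n) * e i x)" by (simp add: e'_def fun_at lc_at)
 thus ?thesis using x unfolding ln_def by (simp add: field_simps)
 qed
 define l' where "l' i = (if i < n then (%f. 1 * l i f + (- l i (e n)) * ln f) else ln)" for i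
 have "l' i : evf X & (ALL j<Suc n. l' i (e j) = (if i = j then 1 else 0))" if i: "i < Suc n" for i proof (cases "i < n")
 case True
 hence "l' i : evf X" unfolding l'_def using evf_comb[OF _ ln, of "l i" 1 "- l i (e n)"] l by simp
 moreover have "l' i (e j) = (if i = j then 1 else 0)" if "j < Suc n" for j using True l lnj lnn that by (cases "j = n") (auto simp: l'_def)
 ultimately show ?thesis by blast
 next
 case False
 hence "i = n" using i by simp
 thus ?thesis using ln lnj lnn by (auto simp: l'_def less_Suc_eq)
 qed
 thus ?case by blast
qed simp

text \<open>A basis of M is placed in front of the representatives e; the functionals dual to the
  second half of the joint family kill M.\<close>

lemma basis_mod_dual: assumes M: "fsub M" and T: "fsub T" "fd T" and MT: "M <= T" and X: "!!f x. f : T ==> x ~: X ==> f x = 0" and e: "bmod M T n e"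
 obtains l where "!!i. i < n ==> l i : evf X" "!!i m. i < n ==> m : M ==> l i m = 0"
 "!!i j. i < n ==> j < n ==> l i (e j) = (if i = j then 1 else 0)" proof -
 have z: "fsub {0}" by (simp add: fs_def)
 obtain m f where f: "bmod {0} M m f" by (rule exists_bmod[OF z M fd_subset[OF T(2) MT]]) (use fs_0[OF M] in auto)
 define h where "h i = (if i < m then f i else e (i - m))" for i
 have split: "lc (m + n) c h = lc m c f + lc n (%i. c (m + i)) e" for c proof -
 have "lc (m + n) c h = (SUM i<m. fsc (c i) (h i)) + (SUM i<n. fsc (c (m + i)) (h (m + i)))" unfolding lc_def by (induction n) (auto simp: add.assoc)
 thus ?thesis by (simp add: lc_def h_def)
 qed
 have fM: "f i : M" if "i < m" for i using bmD(1)[OF f that] .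
 have "EX l. ALL i<m + n. l i : evf X & (ALL j<m + n. l i (h j) = (if i = j then 1 else 0))" proof (rule dual_evaluations)
 show "h i x = 0" if "i < m + n" "x ~: X" for i x using that X fM MT bmD(1)[OF e, of "i - m"] by (auto simp: h_def)
 show "ALL c. lc (m + n) c h = 0 --> (ALL i<m + n. c i = 0)" proof (intro allI impI)
 fix c i assume c: "lc (m + n) c h = 0" and i: "i < m + n"
 have "lc n (%i. c (m + i)) e = - lc m c f" using c unfolding split by (simp add: eq_neg_iff_add_eq_0 add.commute)
 moreover have "lc m c f : M" by (rule lc_in[OF M fM])
 ultimately have "lc n (%i. c (m + i)) e : M" using fs.subspace_neg[OF M] by simp
 hence ce: "c (m + i) = 0" if "i < n" for i using bmD(2)[OF e] that by blast
 hence "lc n (%i. c (m + i)) e = 0" unfolding lc_def by simp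
 hence "lc m c f : {0}" using c unfolding split by simp
 hence "c i = 0" if "i < m" for i using bmD(2)[OF f] that by blast
 thus "c i = 0" using ce[of "i - m"] i by (cases "i < m") auto
 qed
 qed
 then obtain l where l: "ALL i<m + n. l i : evf X & (ALL j<m + n. l i (h j) = (if i = j then 1 else 0))" by blast
 show ?thesis proof (rule that[of "%i. l (m + i)"])
 show "l (m + i) : evf X" if "i < n" for i using l that by simp
 thus "l (m + i) t = 0" if "i < n" "t : M" for i t proof -
 obtain c where "t - lc m c f : {0}" using bmD(3)[OF f \<open>t : M\<close>] by blast
 hence t: "t = lc m c f" by simp
 have "l (m + i) (f j) = 0" if "j < m" for j
 using l[rule_format, of "m + i"] \<open>i < n\<close> that by (auto simp: h_def split: if_splits dest!: spec[of _ j])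
 thus ?thesis unfolding t using evf_linear(6)[of "l (m + i)" X m c f] l \<open>i < n\<close> by simp
 qed
 show "l (m + i) (e j) = (if i = j then 1 else 0)" if "i < n" "j < n" for i j
 using l[rule_format, of "m + i"] that by (auto simp: h_def dest!: spec[of _ "m + j"])
 qed
qed

declare fscale_at [simp del]
section \<open>Affine algebraic groups and their representations\<close>

text \<open>Membership in the image of the tensor product of A and B. A list of pairs is taken, not
  a set, so that repeated pairs count.\<close>

definition tens :: "'x set => 'y set => ('x => 'a::field) set => ('y => 'a) set => ('x => 'y => 'a) => bool" where
 "tens X Y A B F \<longleftrightarrow> (EX ps. set ps <= A \<times> B &
 (ALL x:X. ALL y:Y. F x y = (SUM p<-ps. fst p x * snd p y)))"

lemma tens_add: assumes "tens X Y A B F" "tens X Y A B F'" shows "tens X Y A B (%x y. F x y + F' x y)" proof -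
 obtain ps where ps: "set ps <= A \<times> B" "ALL x:X. ALL y:Y. F x y = (SUM p<-ps. fst p x * snd p y)" using assms(1) unfolding tens_def by blast
 obtain qs where qs: "set qs <= A \<times> B" "ALL x:X. ALL y:Y. F' x y = (SUM p<-qs. fst p x * snd p y)" using assms(2) unfolding tens_def by blast
 show ?thesis unfolding tens_def by (intro exI[of _ "ps @ qs"]) (use ps qs in simp)
qed

lemma sum_list_product:
 fixes u :: "'p => 'a::comm_semiring_0" shows "(SUM p<-ps. u p) * (SUM q<-qs. v q) = (SUM r<-List.product ps qs. u (fst r) * v (snd r))"
proof (induction ps)
 case (Cons p ps)
 have "u p * (SUM q<-qs. v q) = (SUM q<-qs. u p * v q)" by (simp add: sum_list_const_mult)
 thus ?case using Cons.IH by (simp add: distrib_right comp_def)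
qed simp

lemma tens_mult: assumes F: "tens X Y A B F" "tens X Y A B F'" and A: "!!f g. f : A ==> g : A ==> f * g : A"
 and B: "!!f g. f : B ==> g : B ==> f * g : B" shows "tens X Y A B (%x y. F x y * F' x y)" proof -
 obtain ps where ps: "set ps <= A \<times> B" "ALL x:X. ALL y:Y. F x y = (SUM p<-ps. fst p x * snd p y)" using F(1) unfolding tens_def by blast
 obtain qs where qs: "set qs <= A \<times> B" "ALL x:X. ALL y:Y. F' x y = (SUM p<-qs. fst p x * snd p y)" using F(2) unfolding tens_def by blast
 define rs where "rs = map (%r. (fst (fst r) * fst (snd r), snd (fst r) * snd (snd r))) (List.product ps qs)"
 have "set rs <= A \<times> B" proof
 fix r assume "r : set rs"
 then obtain p q where "p : set ps" "q : set qs" "r = (fst p * fst q, snd p * snd q)" unfolding rs_def by auto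
 moreover from this have "fst p : A" "snd p : B" "fst q : A" "snd q : B" using ps(1) qs(1) by auto
 ultimately show "r : A \<times> B" using A B by blast
 qed
 moreover have "F x y * F' x y = (SUM p<-rs. fst p x * snd p y)" if "x : X" "y : Y" for x y using ps(2) qs(2) that
 by (simp add: rs_def sum_list_product comp_def fun_at als)
 ultimately show ?thesis unfolding tens_def by blast
qed

lemma tens_simple: "a : A ==> b : B ==> (!!x y. x : X ==> y : Y ==> F x y = a x * b y) ==> tens X Y A B F"
 unfolding tens_def by (intro exI[of _ "[(a, b)]"]) simp

lemma tensE: assumes "tens X Y A B F"
 obtains n a b where "!!i. i < (n::nat) ==> a i : A" "!!i. i < n ==> b i : B"
 "!!x y. x : X ==> y : Y ==> F x y = (SUM i<n. a i x * b i y)" proof -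
 obtain ps where ps: "set ps <= A \<times> B" "ALL x:X. ALL y:Y. F x y = (SUM p<-ps. fst p x * snd p y)" using assms unfolding tens_def by blast
 have in_prod: "fst (ps ! i) : A & snd (ps ! i) : B" if "i < length ps" for i using ps(1) nth_mem[OF that] by auto
 show ?thesis by (rule that[of "length ps" "%i. fst (ps ! i)" "%i. snd (ps ! i)"])
 (use in_prod ps(2) in \<open>auto simp: sum_list_sum_nth atLeast0LessThan\<close>)
qed

lemma generated_algebra_restrict: "f : generated_algebra X S ==> restrict f X = f" by (induction rule: generated_algebra.induct) auto

lemma zcut_in_zext: "R = generated_algebra X S ==> f : R ==> zcut X f : zext X R" using generated_algebra_restrict[of f X S]
 by (auto simp: zext_def zcut_def restrict_def fei cong: if_cong)

lemma tens_product_ring: assumes R: "R = generated_algebra X S" and R': "R' = generated_algebra Y S'" and F: "F : product_ring X R Y R'"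
 shows "tens X Y (zext X R) (zext Y R') (%x y. F (x, y))" proof -
 have R1: "(\<lambda>x\<in>X. 1) : R" and R1': "(\<lambda>x\<in>Y. 1) : R'" unfolding R R' by (rule ga_const)+
 show ?thesis using F unfolding product_ring_def proof induction
 case (const c)
 have "zcut X (\<lambda>x\<in>X. c) : zext X R" by (rule zcut_in_zext[OF R]) (unfold R, rule ga_const)
 thus ?case by (rule tens_simple[OF _ zcut_in_zext[OF R' R1']]) (auto simp: zcut_def)
 next
 case (generator f)
 then consider r where "r : R" "f = r \<circ> fst" | r where "r : R'" "f = r \<circ> snd" by blast
 thus ?case proof cases
 case 1
 show ?thesis by (rule tens_simple[OF zcut_in_zext[OF R 1(1)] zcut_in_zext[OF R' R1']]) (auto simp: zcut_def 1)
 next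
 case 2
 show ?thesis by (rule tens_simple[OF zcut_in_zext[OF R R1] zcut_in_zext[OF R' 2(1)]]) (auto simp: zcut_def 2)
 qed
 next
 case (add f g)
 from tens_add[OF add.IH] show ?case unfolding tens_def by simp
 next
 case (mult f g)
 have "tens X Y (zext X R) (zext Y R') (%x y. f (x, y) * g (x, y))" by (rule tens_mult[OF mult.IH])
 (unfold R R' zext_falg, erule (1) falg.mult, erule (1) falg.mult)
 thus ?case unfolding tens_def by simp
 qed
qed

locale aff_group = group G + aff_var "cr G" A
 for G :: "('g, 'm) monoid_scheme" (structure) and A :: "('g => 'a::{alg_closed_field, field_char_0}) set" +
 assumes comult: "f : A ==> tens (cr G) (cr G) A A (%x y. f (x \<otimes> y))" and antipode: "f : A ==> zcut (cr G) (%x. f (inv x)) : A"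

theorem aff_group_zext:
 fixes R :: "('g => 'a::{alg_closed_field, field_char_0}) set" assumes "affine_algebraic_group G R" shows "aff_group G (zext (cr G) R)" proof -
 let ?X = "cr G"
 have G: "group G" and R: "affine_variety ?X R"
 and c: "!!f. f : R ==> (\<lambda>(x, y) \<in> ?X \<times> ?X. f (x \<otimes>\<^bsub>G\<^esub> y)) : product_ring ?X R ?X R"
 and i: "!!f. f : R ==> (\<lambda>x \<in> ?X. f (inv\<^bsub>G\<^esub> x)) : R" using assms unfolding affine_algebraic_group_def by blast+
 interpret group G by fact
 interpret aff_var ?X "zext ?X R" by (rule aff_var_zext[OF R])
 obtain S where S: "R = generated_algebra ?X S" using R unfolding affine_variety_def by blast
 show ?thesis proof
 fix f assume f: "f : zext ?X R"
 hence fR: "restrict f ?X : R" by (simp add: zext_def)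
 have "tens ?X ?X (zext ?X R) (zext ?X R)
 (%x y. (\<lambda>(x, y) \<in> ?X \<times> ?X. restrict f ?X (x \<otimes>\<^bsub>G\<^esub> y)) (x, y))" by (rule tens_product_ring[OF S S c[OF fR]])
 thus "tens ?X ?X (zext ?X R) (zext ?X R) (%x y. f (x \<otimes>\<^bsub>G\<^esub> y))" unfolding tens_def by simp
 have "zcut ?X (\<lambda>x\<in>?X. restrict f ?X (inv\<^bsub>G\<^esub> x)) : zext ?X R" by (rule zcut_in_zext[OF S i[OF fR]])
 moreover have "zcut ?X (\<lambda>x\<in>?X. restrict f ?X (inv\<^bsub>G\<^esub> x)) = zcut ?X (%x. f (inv\<^bsub>G\<^esub> x))" by (auto simp: zcut_def)
 ultimately show "zcut ?X (%x. f (inv\<^bsub>G\<^esub> x)) : zext ?X R" by simp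
 qed
qed

context aff_group
begin

definition rt :: "'g => ('g => 'a) => 'g => 'a" where
 "rt g f = zcut (cr G) (%x. f (x \<otimes> g))"

definition lt :: "'g => ('g => 'a) => 'g => 'a" where
 "lt g f = zcut (cr G) (%x. f (g \<otimes> x))"

lemma rt_at: "x : cr G ==> rt g f x = f (x \<otimes> g)" by (simp add: rt_def zcut_def)

lemma lt_at: "x : cr G ==> lt g f x = f (g \<otimes> x)" by (simp add: lt_def zcut_def)

lemma fun_ext: "f : A ==> f' : A ==> (!!x. x : cr G ==> f x = f' x) ==> f = f'" using out by (metis ext)

lemma rt_linear: "rt g (f + f') = rt g f + rt g f'" "rt g (fsc c f) = fsc c (rt g f)"
 "rt g (f - f') = rt g f - rt g f'" "rt g 0 = 0" "rt g (f * f') = rt g f * rt g f'" by (auto simp: rt_def zcut_def fun_at)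

lemma lt_linear: "lt g (f + f') = lt g f + lt g f'" "lt g (fsc c f) = fsc c (lt g f)"
 "lt g (f - f') = lt g f - lt g f'" "lt g 0 = 0" "lt g (f * f') = lt g f * lt g f'" by (auto simp: lt_def zcut_def fun_at)

lemma rt_lc: "rt g (lc n c e) = lc n c (%i. rt g (e i))" by (auto simp: rt_def zcut_def lc_at)

lemma rt_rt: "g : cr G ==> h : cr G ==> rt g (rt h f) = rt (g \<otimes> h) f" by (auto simp: rt_def zcut_def m_assoc fei)

lemma rt_one: "f : A ==> rt \<one> f = f" using out by (auto simp: rt_def zcut_def fei)

lemma rt_in: assumes "f : A" "g : cr G" shows "rt g f : A" proof -
 obtain n a b where ab: "!!i. i < (n::nat) ==> a i : A"
 "!!x y. x : cr G ==> y : cr G ==> f (x \<otimes> y) = (SUM i<n. a i x * b i y)" using tensE[OF comult[OF assms(1)]] by metis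
 have l: "lc n (%i. b i g) a : A" by (rule lc_in[OF subspace ab(1)])
 have "rt g f = lc n (%i. b i g) a" using ab(2) assms(2) out[OF l] by (auto simp: rt_def zcut_def lc_at fei mcm)
 thus ?thesis using l by simp
qed

lemma lt_in: assumes "f : A" "g : cr G" shows "lt g f : A" proof -
 obtain n a b where ab: "!!i. i < (n::nat) ==> b i : A"
 "!!x y. x : cr G ==> y : cr G ==> f (x \<otimes> y) = (SUM i<n. a i x * b i y)" using tensE[OF comult[OF assms(1)]] by metis
 have l: "lc n (%i. a i g) b : A" by (rule lc_in[OF subspace ab(1)])
 have "lt g f = lc n (%i. a i g) b" using ab(2) assms(2) out[OF l] by (auto simp: lt_def zcut_def lc_at fei)
 thus ?thesis using l by simp
qed

definition rstable :: "('g => 'a) set => bool" where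
 "rstable T \<longleftrightarrow> T <= A & fsub T & (ALL g:cr G. ALL f:T. rt g f : T)"

lemma rsD: assumes "rstable T" shows "T <= A" "fsub T" "g : cr G ==> f : T ==> rt g f : T" using assms by (auto simp: rstable_def)

lemma rt_span: assumes "!!f. f : S ==> rt g f : fs.span T" "f : fs.span S" shows "rt g f : fs.span T" using assms(2)
proof (induction rule: fs.span_induct_alt)
 case base
 thus ?case by (simp add: rt_linear fs.span_zero)
next
 case (step c x y)
 show ?case unfolding rt_linear by (rule fs.span_add[OF fs.span_scale[OF assms(1)[OF step(1)]] step(2)])
qed

text \<open>Comultiplication writes every right translate of f as a combination of the same finitely
  many functions \<open>a i\<close>.\<close>

lemma locally_finite: assumes S: "finite S" "S <= A"
 obtains T where "rstable T" "fd T" "S <= T" proof -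
 define T0 where "T0 = (\<Union>g\<in>cr G. rt g ` S)"
 have T0A: "T0 <= A" using S rt_in by (auto simp: T0_def)
 have "EX F. finite F & (ALL g:cr G. rt g f : fs.span F)" if f: "f : S" for f proof -
 obtain n a b where ab: "!!i. i < (n::nat) ==> a i : A"
 "!!x y. x : cr G ==> y : cr G ==> f (x \<otimes> y) = (SUM i<n. a i x * b i y)" using tensE[OF comult[OF subsetD[OF S(2) f]]] by metis
 have "rt g f : fs.span (a ` {..<n})" if g: "g : cr G" for g proof -
 have l: "lc n (%i. b i g) a : A" by (rule lc_in[OF subspace ab(1)])
 have "rt g f = lc n (%i. b i g) a" using ab(2) g out[OF l] by (auto simp: rt_def zcut_def lc_at fei mcm)
 also have "... : fs.span (a ` {..<n})" by (intro lc_in fs.subspace_span fs.span_base) auto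
 finally show ?thesis .
 qed
 thus ?thesis by (intro exI[of _ "a ` {..<n}"]) auto
 qed
 then obtain F where F: "!!f. f : S ==> finite (F f)"
 "!!f g. f : S ==> g : cr G ==> rt g f : fs.span (F f)" by metis
 have "T0 <= fs.span (\<Union>f\<in>S. F f)" proof
 fix t assume "t : T0"
 then obtain g f where "g : cr G" "f : S" "t = rt g f" by (auto simp: T0_def)
 thus "t : fs.span (\<Union>f\<in>S. F f)" using F(2) fs.span_mono[of "F f" "\<Union>f\<in>S. F f"] by blast
 qed
 hence "fd (fs.span T0)" unfolding fd_def using S(1) F(1) fs.span_minimal[OF _ fs.subspace_span, of T0 "\<Union>f\<in>S. F f"] by blast
 moreover have "rstable (fs.span T0)" unfolding rstable_def proof (intro conjI ballI)
 show "fs.span T0 <= A" by (rule fs.span_minimal[OF T0A subspace])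
 show "fsub (fs.span T0)" by (rule fs.subspace_span)
 fix g f assume g: "g : cr G" and f: "f : fs.span T0"
 show "rt g f : fs.span T0" proof (rule rt_span[OF _ f])
 fix t assume "t : T0"
 then obtain h s where "h : cr G" "s : S" "t = rt h s" by (auto simp: T0_def)
 hence "rt g t : T0" using g by (auto simp: T0_def rt_rt)
 thus "rt g t : fs.span T0" by (rule fs.span_base)
 qed
 qed
 moreover have "S <= fs.span T0" proof
 fix f assume "f : S"
 hence "rt \<one> f : T0" "rt \<one> f = f" using S(2) rt_one by (auto simp: T0_def)
 thus "f : fs.span T0" using fs.span_base by metis
 qed
 ultimately show ?thesis by (intro that)
qed

definition rep :: "nat => (nat => nat => 'g => 'a) => bool" where
 "rep n rho \<longleftrightarrow> (ALL i<n. ALL j<n. rho i j : A & rho i j \<one> = (if i = j then 1 else 0) &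
 (ALL g:cr G. ALL h:cr G. rho i j (g \<otimes> h) = (SUM k<n. rho i k g * rho k j h)))"

lemma repD: assumes "rep n rho" "i < n" "j < n" shows "rho i j : A" "rho i j \<one> = (if i = j then 1 else 0)"
 "g : cr G ==> h : cr G ==> rho i j (g \<otimes> h) = (SUM k<n. rho i k g * rho k j h)" using assms by (auto simp: rep_def)

lemma lc_sum: "(SUM j<n. fsc (d j) (lc m (c j) e)) = lc m (%i. SUM j<n. d j * c j i) e" proof
 fix x
 have "(SUM j<n. d j * (SUM i<m. c j i * e i x)) = (SUM j<n. SUM i<m. d j * c j i * e i x)" by (simp add: sdl mult.assoc)
 also have "... = (SUM i<m. (SUM j<n. d j * c j i) * e i x)" unfolding sdr by (rule sum.swap)
 finally show "(SUM j<n. fsc (d j) (lc m (c j) e)) x = lc m (%i. SUM j<n. d j * c j i) e x" by (simp add: fun_at lc_at)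
qed

text \<open>The functional dual to \<open>e i\<close> reads off the entry \<open>rho i j g\<close>
  from \<open>rt g (e j)\<close>. Being a combination of evaluations at points x, it makes the entry
  a combination of the left translates \<open>lt x (e j)\<close>.\<close>

lemma basis_mod_rep: assumes M: "rstable M" and T: "rstable T" "fd T" and MT: "M <= T" and e: "bmod M T n e"
 obtains rho where "rep n rho"
 "!!g j. g : cr G ==> j < n ==> rt g (e j) - lc n (%i. rho i j g) e : M" proof -
 note sM = rsD(2)[OF M] and sT = rsD(2)[OF T(1)]
 obtain l where l: "!!i. i < n ==> l i : evf (cr G)" "!!i m. i < n ==> m : M ==> l i m = 0"
 "!!i j. i < n ==> j < n ==> l i (e j) = (if i = j then 1 else 0)"
 by (rule basis_mod_dual[OF sM sT T(2) MT _ e, of "cr G"]) (use rsD(1)[OF T(1)] out in auto)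
 have co: "t - lc n (%i. l i t) e : M" if t: "t : T" for t proof -
 obtain c where c: "t - lc n c e : M" using bmD(3)[OF e t] by blast
 have "l i t = c i" if i: "i < n" for i proof -
 have "0 = l i (t - lc n c e)" using l(2)[OF i c] by simp
 also have "... = l i t - (SUM j<n. c j * l i (e j))" by (simp add: evf_linear[OF l(1)[OF i]])
 also have "(SUM j<n. c j * l i (e j)) = (SUM j<n. if i = j then c j else 0)" using l(3)[OF i] by (intro sum.cong) auto
 finally show ?thesis using i by simp
 qed
 hence "lc n (%i. l i t) e = lc n c e" by (rule lc_cong)
 thus ?thesis using c by simp
 qed
 define rho where "rho i j = zcut (cr G) (%g. l i (rt g (e j)))" for i j
 have eT: "e j : T" if "j < n" for j using bmD(1)[OF e that] .
 have rho: "rt g (e j) - lc n (%i. rho i j g) e : M" if "g : cr G" "j < n" for g j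
 using co[OF rsD(3)[OF T(1) that(1) eT[OF that(2)]]] that(1) by (simp add: rho_def zcut_def)
 have uniq: "c i = rho i j g" if "rt g (e j) - lc n c e : M" "g : cr G" "j < n" "i < n" for c g i j
 by (rule basis_mod_unique[OF e sM that(1) rho[OF that(2,3)] that(4)])
 have "rep n rho" unfolding rep_def proof (intro allI impI conjI ballI)
 fix i j assume i: "i < n" and j: "j < n"
 have ejA: "e j : A" using eT[OF j] rsD(1)[OF T(1)] by blast
 show "rho i j : A" proof -
 obtain F c where F: "finite F" "F <= cr G" "l i = (%f. SUM x:F. c x * f x)" using l(1)[OF i] unfolding evf_def by blast
 have "rho i j = (SUM x:F. fsc (c x) (lt x (e j)))" using F(2) by (auto simp: rho_def zcut_def F(3) fun_at rt_at lt_def fei intro!: sum.cong)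
 also have "... : A" by (intro sum_in scale_in lt_in[OF ejA]) (use F(2) in auto)
 finally show ?thesis .
 qed
 have "rt \<one> (e j) - lc n (%i. if i = j then 1 else 0) e : M" unfolding rt_one[OF ejA] lc_delta[OF j] using fs_0[OF sM] by simp
 from uniq[OF this _ j i] show "rho i j \<one> = (if i = j then 1 else 0)" by simp
 fix g h assume gh: "g : cr G" "h : cr G"
 define r where "r = rt h (e j) - lc n (%k. rho k j h) e"
 have r: "rt g r : M" unfolding r_def by (rule rsD(3)[OF M gh(1) rho[OF gh(2) j]])
 define s where "s k = rt g (e k) - lc n (%i. rho i k g) e" for k
 have s: "lc n (%k. rho k j h) s : M" unfolding s_def by (intro lc_in sM rho gh)
 have "rt (g \<otimes> h) (e j) = rt g r + lc n (%k. rho k j h) (%k. rt g (e k))" unfolding r_def rt_linear rt_rt[OF gh] rt_lc by simp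
 also have "lc n (%k. rho k j h) (%k. rt g (e k)) =
 lc n (%k. rho k j h) s + (SUM k<n. fsc (rho k j h) (lc n (%i. rho i k g) e))"
 unfolding s_def by (rule ext) (simp add: lc_at fun_at als sum_subtractf)
 finally have "rt (g \<otimes> h) (e j) - lc n (%i. SUM k<n. rho k j h * rho i k g) e =
 rt g r + lc n (%k. rho k j h) s" unfolding lc_sum by simp
 also have "... : M" by (rule fs_ad[OF sM r s])
 finally have "(SUM k<n. rho k j h * rho i k g) = rho i j (g \<otimes> h)" by (rule uniq) (use gh i j in auto)
 thus "rho i j (g \<otimes> h) = (SUM k<n. rho i k g * rho k j h)" by (simp add: mcm)
 qed
 thus ?thesis using rho by (rule that)
qed

end

section \<open>Generalized eigenspaces of locally finite operators\<close>

lemma fscale_minus: "fsc (a - b) f = fsc a f - fsc b (f :: 'x => 'a::field)" by (rule fs.scale_left_diff_distrib)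

locale lin_op =
 fixes A :: "('x => 'a::field) set" and D :: "('x => 'a) => 'x => 'a" assumes subspace_A: "fsub A" and D_in: "f : A ==> D f : A"
 and D_add: "f : A ==> g : A ==> D (f + g) = D f + D g" and D_scale: "f : A ==> D (fsc c f) = fsc c (D f)"
begin

definition dm :: "'a => ('x => 'a) => 'x => 'a" where
 "dm l f = D f - fsc l f"

definition geig :: "'a => ('x => 'a) set" where
 "geig l = {f : A. EX n. (dm l ^^ n) f = 0}"

lemma zero_A: "0 : A" and add_A: "f : A ==> g : A ==> f + g : A" and scale_A: "f : A ==> fsc c f : A" and diff_A: "f : A ==> g : A ==> f - g : A"
 using subspace_A fs_0 fs_ad fs_sc fs.subspace_diff by blast+

lemma dm_in: "f : A ==> dm l f : A" unfolding dm_def by (intro diff_A D_in scale_A)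

lemma dm_pow_in: "f : A ==> (dm l ^^ n) f : A" by (induction n) (auto intro: dm_in)

lemma D_pow_in: "f : A ==> (D ^^ n) f : A" by (induction n) (auto intro: D_in)

lemma dm_add: "f : A ==> g : A ==> dm l (f + g) = dm l f + dm l g" by (simp add: dm_def D_add fs.scale_right_distrib)

lemma dm_scale: "f : A ==> dm l (fsc c f) = fsc c (dm l f)" by (simp add: dm_def D_scale fs_rd fs.scale_left_commute)

lemma dm_zero: "dm l 0 = 0" using dm_scale[OF zero_A, of l 0] by (simp add: fs0)

lemma dm_diff: "f : A ==> g : A ==> dm l (f - g) = dm l f - dm l g" using dm_add[OF diff_A, of f g g l] by (simp add: als)

lemma dm_pow_add: "f : A ==> g : A ==> (dm l ^^ n) (f + g) = (dm l ^^ n) f + (dm l ^^ n) g" by (induction n) (auto simp: dm_add dm_pow_in)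

lemma dm_pow_scale: "f : A ==> (dm l ^^ n) (fsc c f) = fsc c ((dm l ^^ n) f)" by (induction n) (auto simp: dm_scale dm_pow_in)

lemma dm_pow_zero: "(dm l ^^ n) 0 = 0" by (induction n) (auto simp: dm_zero)

lemma dm_pow_mono: "(dm l ^^ n) f = 0 ==> n <= m ==> (dm l ^^ m) f = 0" proof -
 assume "(dm l ^^ n) f = 0" "n <= m"
 then obtain k where "m = k + n" by (metis le_add_diff_inverse2)
 thus ?thesis using \<open>(dm l ^^ n) f = 0\<close> by (simp add: funpow_add dm_pow_zero)
qed

lemma geigD: "f : geig l ==> f : A" "f : geig l ==> EX n. (dm l ^^ n) f = 0" by (auto simp: geig_def)

lemma ss_geig: "fsub (geig l)" proof (rule fs.subspaceI)
 show "0 : geig l" using zero_A dm_pow_zero by (auto simp: geig_def)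
 show "f + g : geig l" if fg: "f : geig l" "g : geig l" for f g proof -
 obtain n m where nm: "(dm l ^^ n) f = 0" "(dm l ^^ m) g = 0" using fg geigD(2) by blast
 have "(dm l ^^ (max n m)) (f + g) = 0" using dm_pow_mono[OF nm(1), of "max n m"] dm_pow_mono[OF nm(2), of "max n m"]
 dm_pow_add[OF geigD(1)[OF fg(1)] geigD(1)[OF fg(2)]] by simp
 thus ?thesis using add_A geigD(1) fg unfolding geig_def by blast
 qed
 show "fsc c f : geig l" if f: "f : geig l" for c f proof -
 obtain n where n: "(dm l ^^ n) f = 0" using f geigD(2) by blast
 hence "(dm l ^^ n) (fsc c f) = 0" using dm_pow_scale[OF geigD(1)[OF f]] by (simp add: fs.scale_zero_right)
 thus ?thesis using scale_A geigD(1) f unfolding geig_def by blast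
 qed
qed

lemma geig_step: "f : A ==> dm l f : geig l ==> f : geig l" proof -
 assume f: "f : A" "dm l f : geig l"
 then obtain n where "(dm l ^^ n) (dm l f) = 0" using geigD(2) by blast
 hence "(dm l ^^ Suc n) f = 0" by (simp add: funpow_swap1)
 thus ?thesis using f(1) unfolding geig_def by blast
qed

lemma dm_geig: "f : geig l ==> dm l f : geig l" proof -
 assume f: "f : geig l"
 then obtain n where "(dm l ^^ n) f = 0" using geigD(2) by blast
 hence "(dm l ^^ n) (dm l f) = 0" by (metis dm_zero funpow_swap1)
 thus ?thesis using dm_in geigD(1)[OF f] unfolding geig_def by blast
qed

lemma dm_change: "dm l f = dm m f + fsc (m - l) f" unfolding dm_def fscale_minus by simp

text \<open>On the l-eigenspace, D - m is a locally nilpotent operator plus a nonzero scalar; it is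
  inverted by induction on the nilpotency exponent of h.\<close>

lemma geig_solve: assumes "h : geig l" "m ~= l" shows "EX k:geig l. dm m k = h" proof -
 have "EX k:geig l. dm m k = h" if "h : geig l" "(dm l ^^ n) h = 0" for n h using that proof (induction n arbitrary: h)
 case 0
 thus ?case using fs_0[OF ss_geig] dm_zero by auto
 next
 case (Suc n)
 have "(dm l ^^ n) (dm l h) = 0" using Suc.prems(2) by (simp add: funpow_swap1)
 then obtain k where k: "k : geig l" "dm m k = dm l h" using Suc.IH[OF dm_geig[OF Suc.prems(1)]] by blast
 note A = geigD(1)[OF k(1)] geigD(1)[OF Suc.prems(1)]
 have "dm m h - dm m k = fsc (l - m) h" unfolding k(2) dm_change[of m h l] by simp
 hence "dm m (fsc (1 / (l - m)) (h - k)) = h" using assms(2) by (simp add: dm_scale[OF diff_A[OF A(2,1)]] dm_diff[OF A(2,1)] fs.scale_scale)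
 moreover have "fsc (1 / (l - m)) (h - k) : geig l" by (intro fs_sc fs.subspace_diff ss_geig Suc.prems k)
 ultimately show ?case by blast
 qed
 thus ?thesis using assms(1) geigD(2) by blast
qed

definition pop :: "'a poly => ('x => 'a) => 'x => 'a" where
 "pop p f = (SUM i<=degree p. fsc (coeff p i) ((D ^^ i) f))"

lemma pop_alt: "degree p <= N ==> pop p f = (SUM i<=N. fsc (coeff p i) ((D ^^ i) f))" unfolding pop_def
 by (rule sum.mono_neutral_left) (auto simp: coeff_eq_0 fs0)

lemma D_pow_dm: "f : A ==> (D ^^ i) (dm a f) = (D ^^ Suc i) f - fsc a ((D ^^ i) f)" proof (induction i)
 case (Suc i)
 have d: "D (g - h) = D g - D h" if "g : A" "h : A" for g h using D_add[OF diff_A[OF that] that(2)] by (simp add: als)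
 have "(D ^^ Suc i) (dm a f) = D ((D ^^ Suc i) f - fsc a ((D ^^ i) f))" unfolding Suc.IH[OF Suc.prems, symmetric] by simp
 also have "... = D ((D ^^ Suc i) f) - D (fsc a ((D ^^ i) f))" by (intro d D_pow_in scale_A Suc.prems)
 also have "... = (D ^^ Suc (Suc i)) f - fsc a ((D ^^ Suc i) f)" by (simp add: D_scale[OF D_pow_in[OF Suc.prems]])
 finally show ?case .
qed (simp add: dm_def)

lemma pop_linear_factor: "f : A ==> pop ([:- a, 1:] * q) f = pop q (dm a f)" proof -
 assume f: "f : A"
 define N where "N = degree q"
 have deg: "degree ([:- a, 1:] * q) <= Suc N" using degree_mult_le[of "[:- a, 1:]" q] by (simp add: N_def)
 let ?t = "%i. fsc (coeff q i) ((D ^^ Suc i) f)" and ?u = "%i. fsc (a * coeff q i) ((D ^^ i) f)"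
 have c: "coeff ([:- a, 1:] * q) i = (case i of 0 => 0 | Suc j => coeff q j) - a * coeff q i" for i by (simp add: coeff_pCons split: nat.splits)
 have "pop ([:- a, 1:] * q) f = (SUM i<=Suc N. fsc (case i of 0 => 0 | Suc j => coeff q j) ((D ^^ i) f)) -
 (SUM i<=Suc N. ?u i)" unfolding pop_alt[OF deg] c fscale_minus sum_subtractf ..
 also have "(SUM i<=Suc N. fsc (case i of 0 => 0 | Suc j => coeff q j) ((D ^^ i) f)) = (SUM i<=N. ?t i)"
 unfolding sum.atMost_Suc_shift by (simp add: fs0)
 also have "(SUM i<=Suc N. ?u i) = (SUM i<=N. ?u i)" by (simp add: N_def coeff_eq_0 fs0)
 also have "(SUM i<=N. ?t i) - (SUM i<=N. ?u i) = pop q (dm a f)" unfolding pop_def N_def[symmetric] sum_subtractf[symmetric]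
 by (rule sum.cong) (simp_all add: D_pow_dm[OF f] fs_rd fs.scale_scale mcm)
 finally show ?thesis .
qed

definition gspan :: "('x => 'a) set" where
 "gspan = fs.span (\<Union>l. geig l)"

lemma gspan_subset: "gspan <= A" unfolding gspan_def by (rule fs.span_minimal) (use geigD(1) subspace_A in auto)

lemma geig_gspan: "f : geig l ==> f : gspan" unfolding gspan_def by (rule fs.span_base) blast

text \<open>For components with eigenvalue other than a, D - a can be solved inside their
  eigenspaces; for eigenvalue a the component is itself the allowed error. The difference h - f then
  has (D - a)-image in the a-eigenspace and belongs to it.\<close>

lemma gspan_step: assumes f: "f : A" "dm a f : gspan" shows "f : gspan" proof -
 have "EX h:gspan. dm a h - g : geig a" if "g : gspan" for g using that unfolding gspan_def proof (induction rule: fs.span_induct_alt)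
 case base
 thus ?case using fs.span_zero fs_0[OF ss_geig] by (intro bexI[of _ 0]) (auto simp: dm_zero)
 next
 case (step c x y)
 then obtain l where x: "x : geig l" by blast
 obtain h where h: "h : gspan" "dm a h - y : geig a" using step.IH unfolding gspan_def by blast
 obtain k where k: "k : gspan" "dm a k - x : geig a" proof (cases "l = a")
 case True
 have "dm a 0 - x : geig a" using fs.subspace_neg[OF ss_geig x] True by (simp add: dm_zero)
 thus ?thesis using fs.span_zero that unfolding gspan_def by blast
 next
 case False
 then obtain k where "k : geig l" "dm a k = x" using geig_solve[OF x] by metis
 thus ?thesis using that geig_gspan fs_0[OF ss_geig] by fastforce
 qed
 note A = subsetD[OF gspan_subset]
 have "dm a (fsc c k + h) - (fsc c x + y) = fsc c (dm a k - x) + (dm a h - y)"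
 using A[OF h(1)] A[OF k(1)] by (simp add: dm_add scale_A dm_scale fs_rd)
 also have "... : geig a" by (intro fs_ad fs_sc ss_geig h k)
 finally have "dm a (fsc c k + h) - (fsc c x + y) : geig a" .
 moreover have "fsc c k + h : fs.span (\<Union>l. geig l)" using h(1) k(1) unfolding gspan_def by (intro fs.span_add fs.span_scale)
 ultimately show ?case by blast
 qed
 then obtain h where h: "h : gspan" "dm a h - dm a f : geig a" using f(2) by blast
 have hA: "h : A" using h(1) gspan_subset by blast
 have "h - f : geig a" by (rule geig_step) (use h(2) diff_A[OF hA f(1)] dm_diff[OF hA f(1)] in auto)
 from fs.span_diff[OF h(1)[unfolded gspan_def] geig_gspan[OF this, unfolded gspan_def]]
 have "h - (h - f) : gspan" unfolding gspan_def .
 moreover have "h - (h - f) = f" by simp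
 ultimately show ?thesis by metis
qed

lemma exists_annihilating_poly: assumes T: "fd T" "!!g. g : T ==> D g : T" and f: "f : T"
 obtains p where "p ~= 0" "pop p f = 0" proof -
 obtain F where F: "finite F" "T <= fs.span F" using T(1) unfolding fd_def by blast
 define v where "v i = (D ^^ i) f" for i
 have vT: "v i : T" for i unfolding v_def by (induction i) (use f T(2) in auto)
 define N where "N = card F"
 have "EX c. (SUM i<=N. fsc (c i) (v i)) = 0 & (EX i<=N. c i ~= 0)" proof (cases "inj_on v {..N}")
 case True
 have "\<not> fs.independent (v ` {..N})" proof
 assume "fs.independent (v ` {..N})"
 moreover have "v ` {..N} <= fs.span F" using vT F(2) by blast
 ultimately have "card (v ` {..N}) <= N" unfolding N_def using fs.independent_span_bound[OF F(1)] by blast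
 thus False by (simp add: card_image[OF True])
 qed
 then obtain u w where u: "(SUM w:v ` {..N}. fsc (u w) w) = 0" "w : v ` {..N}" "u w ~= 0"
 unfolding fs.dependent_finite[OF finite_imageI[OF finite_atMost]] by blast
 thus ?thesis by (intro exI[of _ "%i. u (v i)"]) (auto simp: sum.reindex[OF True])
 next
 case False
 then obtain i j where ij: "i <= N" "j <= N" "i ~= j" "v i = v j" by (auto simp: inj_on_def)
 define c where "c k = (if k = i then 1 else 0) - (if k = j then 1 else (0::'a))" for k
 have s: "(SUM k<=N. fsc (if k = m then 1 else 0) (v k)) = v m" if "m <= N" for m proof -
 have "(SUM k<=N. fsc (if k = m then 1 else 0) (v k)) = (SUM k<=N. if k = m then v k else 0)" by (rule sum.cong) (auto simp: fs0 fs.scale_one)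
 thus ?thesis using that by simp
 qed
 have "(SUM k<=N. fsc (c k) (v k)) = v i - v j" unfolding c_def fscale_minus sum_subtractf s[OF ij(1)] s[OF ij(2)] ..
 hence "(SUM k<=N. fsc (c k) (v k)) = 0" using ij(4) by simp
 moreover have "c i ~= 0" using ij(3) by (simp add: c_def)
 ultimately show ?thesis using ij(1) by blast
 qed
 then obtain c where c: "(SUM i<=N. fsc (c i) (v i)) = 0" "EX i<=N. c i ~= 0" by blast
 define p where "p = (SUM i<=N. monom (c i) i)"
 have cp: "coeff p i = (if i <= N then c i else 0)" for i unfolding p_def coeff_sum coeff_monom by (simp add: sum.delta' if_distrib cong: if_cong)
 have "degree p <= N" by (rule degree_le) (simp add: cp)
 hence "pop p f = (SUM i<=N. fsc (coeff p i) (v i))" unfolding v_def by (rule pop_alt)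
 also have "... = 0" using c(1) by (simp add: cp)
 finally have "pop p f = 0" .
 moreover have "p ~= 0" using c(2) cp by (metis coeff_0)
 ultimately show ?thesis using that by blast
qed

text \<open>A power of D - m kills the component at m and keeps every other component in its
  eigenspace, where it is injective; so induction on the number of components applies.\<close>

lemma gspan_independent: assumes "finite L" "!!l. l : L ==> F l : geig l" "(SUM l:L. F l) = 0" "l : L" shows "F l = 0" using assms
proof (induction "card L" arbitrary: L F l)
 case (Suc k)
 have inj0: "f = 0" if "f : geig l" "(dm m ^^ n) f = 0" "m ~= l" for f l m n proof (rule ccontr)
 assume nz: "f ~= 0"
 obtain N where N: "(dm l ^^ N) f = 0" using geigD(2) \<open>f : geig l\<close> by blast
 define i where "i = (LEAST i. (dm l ^^ i) f = 0)"
 have i: "(dm l ^^ i) f = 0" unfolding i_def by (rule LeastI[of _ N]) (rule N)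
 have "i ~= 0" using i nz by (metis funpow_0)
 define g where "g = (dm l ^^ (i - 1)) f"
 have g: "g ~= 0" using not_less_Least[of "i - 1" "%i. (dm l ^^ i) f = 0"] \<open>i ~= 0\<close> unfolding g_def i_def[symmetric] by simp
 have gA: "g : A" unfolding g_def by (rule dm_pow_in[OF geigD(1)[OF that(1)]])
 have "dm l g = 0" using i \<open>i ~= 0\<close> unfolding g_def by (cases i) auto
 hence dmg: "dm m g = fsc (l - m) g" unfolding dm_change[of m g l] by simp
 have "(dm m ^^ j) g = fsc ((l - m) ^ j) g" for j by (induction j) (use gA dmg in \<open>auto simp: fs.scale_one dm_scale fs.scale_scale mcm\<close>)
 moreover have "(dm m ^^ n) g = 0" proof -
 have comm: "dm m (dm l h) = dm l (dm m h)" if "h : A" for h unfolding dm_change[of m _ l] using that by (simp add: dm_add dm_in scale_A dm_scale)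
 have "dm m ((dm l ^^ j) h) = (dm l ^^ j) (dm m h)" if "h : A" for j h using that by (induction j) (auto simp: comm dm_pow_in)
 hence "(dm m ^^ j) ((dm l ^^ (i - 1)) h) = (dm l ^^ (i - 1)) ((dm m ^^ j) h)" if "h : A" for j h using that by (induction j) (auto simp: dm_pow_in)
 from this[OF geigD(1)[OF that(1)], of n] show ?thesis using that(2) by (simp add: g_def dm_pow_zero)
 qed
 ultimately have "fsc ((l - m) ^ n) g = 0" by metis
 thus False using g that(3) by (simp add: fs.scale_eq_0_iff)
 qed
 obtain m where m: "m : L" using Suc.prems(4) by blast
 obtain n where n: "(dm m ^^ n) (F m) = 0" using geigD(2) Suc.prems(2)[OF m] by blast
 have FA: "F l : A" if "l : L" for l using geigD(1) Suc.prems(2) that by blast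
 have dsum: "(dm m ^^ n) (SUM l:I. F l) = (SUM l:I. (dm m ^^ n) (F l))" if "I <= L" for I using that proof (induction I rule: ifi)
 case (insert x I)
 hence "(SUM l:I. F l) : A" using FA by (intro fs.subspace_sum subspace_A) auto
 thus ?case using insert FA by (simp add: dm_pow_add)
 qed (simp_all add: dm_pow_zero)
 have "0 = (SUM l:L. (dm m ^^ n) (F l))" using dsum[of L] Suc.prems(3) by (simp add: dm_pow_zero)
 also have "... = (SUM l:L - {m}. (dm m ^^ n) (F l))" using n by (subst sum.remove[OF Suc.prems(1) m]) simp
 finally have s0: "(SUM l:L - {m}. (dm m ^^ n) (F l)) = 0" by simp
 have gg: "(dm m ^^ n) (F l) : geig l" if "l : L" for l proof -
 have "dm m f : geig l" if "f : geig l" for f unfolding dm_change[of m f l] by (intro fs_ad fs_sc ss_geig dm_geig that)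
 thus ?thesis using Suc.prems(2)[OF that] by (induction n) auto
 qed
 have "(dm m ^^ n) (F l) = 0" if "l : L - {m}" for l by (rule Suc.hyps(1)[OF _ _ _ s0 that]) (use Suc.hyps(2) Suc.prems(1) m gg in auto)
 hence z: "F l = 0" if "l : L - {m}" for l using inj0[OF Suc.prems(2)] that by blast
 have "F m = (SUM l:L. F l)" by (subst sum.remove[OF Suc.prems(1) m]) (simp add: z)
 thus ?case using z Suc.prems(3,4) by (cases "l = m") auto
qed auto

lemma gspan_explicit: assumes "f : gspan" shows "EX L F. finite L & (ALL l. F l : geig l) & (ALL l. l ~: L --> F l = 0) & f = (SUM l:L. F l)" proof -
 show "EX L F. finite L & (ALL l. F l : geig l) & (ALL l. l ~: L --> F l = 0) & f = (SUM l:L. F l)" using assms unfolding gspan_def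
 proof (induction rule: fs.span_induct_alt)
 case base
 thus ?case using fs_0[OF ss_geig] by (intro exI[of _ "{}"] exI[of _ "%_. 0"]) auto
 next
 case (step c x y)
 then obtain m where x: "x : geig m" by blast
 obtain L F where LF: "finite L" "ALL l. F l : geig l" "ALL l. l ~: L --> F l = 0" "y = (SUM l:L. F l)" using step.IH by blast
 define F' where "F' l = (if l = m then F l + fsc c x else F l)" for l
 have "(SUM l:insert m L. F' l) = (SUM l:insert m L. F l + (if l = m then fsc c x else 0))" by (rule sum.cong) (auto simp: F'_def)
 also have "... = (SUM l:insert m L. F l) + fsc c x" using LF(1) by (simp add: sum.distrib del: sum.insert)
 also have "(SUM l:insert m L. F l) = y" unfolding LF(4) by (rule sum.mono_neutral_right) (use LF in auto)
 finally have "fsc c x + y = (SUM l:insert m L. F' l)" by (simp add: add.commute)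
 moreover have "F' l : geig l" for l using LF(2) x by (simp add: F'_def fs_ad fs_sc ss_geig)
 ultimately show ?case using LF(1,3) by (intro exI[of _ "insert m L"] exI[of _ F']) (auto simp: F'_def)
 qed
qed

text \<open>The functional is obtained from a relation over all decompositions into generalized
  eigenvectors, and independence of the eigenspaces makes the relation single-valued. The weight psi
  may be any function of the eigenvalue; replicas need psi that are additive but not linear over the
  ground field.\<close>

lemma graded_functional:
 obtains d :: "('x => 'a) => 'a"
 where "!!f g. f : gspan ==> g : gspan ==> d (f + g) = d f + d g"
 "!!c f. f : gspan ==> d (fsc c f) = c * d f" "!!l f. f : geig l ==> d f = psi l * f x0" proof -
 define Rel where "Rel f r \<longleftrightarrow> (EX L F. finite L & (ALL l. F l : geig l) & (ALL l. l ~: L --> F l = 0) &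
 f = (SUM l:L. F l) & r = (SUM l:L. psi l * F l x0))" for f r
 have scale: "Rel (fsc c f) (c * r)" if r: "Rel f r" for c f r proof -
 obtain L F where LF: "finite L" "ALL l. F l : geig l" "ALL l. l ~: L --> F l = 0" "f = (SUM l:L. F l)"
 "r = (SUM l:L. psi l * F l x0)" using r unfolding Rel_def by blast
 show ?thesis unfolding Rel_def proof (intro exI[of _ L] exI[of _ "%l. fsc c (F l)"] conjI allI impI)
 show "finite L" by (rule LF(1))
 show "fsc c (F l) : geig l" for l using LF(2) by (simp add: fs_sc ss_geig)
 show "fsc c (F l) = 0" if "l ~: L" for l using LF(3) that by (simp add: fs.scale_zero_right)
 show "fsc c f = (SUM l:L. fsc c (F l))" unfolding LF(4) by (rule fs.scale_sum_right)
 show "c * r = (SUM l:L. psi l * fsc c (F l) x0)" unfolding LF(5) sdl by (simp add: fun_at als)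
 qed
 qed
 have add: "Rel (f + g) (r + s)" if rs: "Rel f r" "Rel g s" for f g r s proof -
 obtain L F where LF: "finite L" "ALL l. F l : geig l" "ALL l. l ~: L --> F l = 0" "f = (SUM l:L. F l)"
 "r = (SUM l:L. psi l * F l x0)" using rs(1) unfolding Rel_def by blast
 obtain M H where MH: "finite M" "ALL l. H l : geig l" "ALL l. l ~: M --> H l = 0" "g = (SUM l:M. H l)"
 "s = (SUM l:M. psi l * H l x0)" using rs(2) unfolding Rel_def by blast
 have f: "f = (SUM l:L Un M. F l)" and g: "g = (SUM l:L Un M. H l)" unfolding LF(4) MH(4) by (rule sum.mono_neutral_left; use LF MH in auto)+
 have r: "r = (SUM l:L Un M. psi l * F l x0)" and s: "s = (SUM l:L Un M. psi l * H l x0)"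
 unfolding LF(5) MH(5) by (rule sum.mono_neutral_left; use LF MH in \<open>auto simp: fun_at\<close>)+
 show ?thesis unfolding Rel_def proof (intro exI[of _ "L Un M"] exI[of _ "%l. F l + H l"] conjI allI impI)
 show "finite (L Un M)" using LF(1) MH(1) by simp
 show "F l + H l : geig l" for l using LF(2) MH(2) by (simp add: fs_ad ss_geig)
 show "F l + H l = 0" if "l ~: L Un M" for l using LF(3) MH(3) that by simp
 show "f + g = (SUM l:L Un M. F l + H l)" unfolding f g by (rule sum.distrib[symmetric])
 show "r + s = (SUM l:L Un M. psi l * (F l + H l) x0)" unfolding r s by (simp add: fun_at als sum.distrib)
 qed
 qed
 have zero: "r = 0" if z: "Rel 0 r" for r proof -
 obtain L F where LF: "finite L" "ALL l. F l : geig l" "0 = (SUM l:L. F l)"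
 "r = (SUM l:L. psi l * F l x0)" using z unfolding Rel_def by blast
 have "F l = 0" if "l : L" for l using gspan_independent[OF LF(1) _ LF(3)[symmetric] that] LF(2) by blast
 thus ?thesis unfolding LF(4) by (simp add: fun_at)
 qed
 have uniq: "r = s" if rs: "Rel f r" "Rel f s" for f r s
 using zero[of "r - s"] add[OF rs(1) scale[OF rs(2), of "-1"]] by (simp add: fs.scale_minus_left fs.scale_one)
 have ex: "EX r. Rel f r" if f: "f : gspan" for f proof -
 obtain L F where "finite L" "ALL l. F l : geig l" "ALL l. l ~: L --> F l = 0" "f = (SUM l:L. F l)" using gspan_explicit[OF f] by blast
 thus ?thesis unfolding Rel_def by (intro exI[of _ "SUM l:L. psi l * F l x0"] exI[of _ L] exI[of _ F]) auto
 qed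
 define d where "d f = (THE r. Rel f r)" for f
 have d: "d f = r" if "Rel f r" for f r unfolding d_def using that uniq by blast
 show ?thesis proof (rule that[of d])
 show "d (f + g) = d f + d g" if fg: "f : gspan" "g : gspan" for f g proof -
 obtain r s where rs: "Rel f r" "Rel g s" using ex fg by blast
 show ?thesis using d[OF rs(1)] d[OF rs(2)] d[OF add[OF rs]] by simp
 qed
 show "d (fsc c f) = c * d f" if f: "f : gspan" for c f proof -
 obtain r where r: "Rel f r" using ex f by blast
 show ?thesis using d[OF r] d[OF scale[OF r]] by simp
 qed
 show "d f = psi l * f x0" if "f : geig l" for l f proof (rule d, unfold Rel_def, intro exI[of _ "{l}"] exI[of _ "%m. if m = l then f else 0"])
 show "finite {l} & (ALL m. (if m = l then f else 0) : geig m) &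
 (ALL m. m ~: {l} --> (if m = l then f else 0) = 0) & f = (SUM m:{l}. if m = l then f else 0) &
 psi l * f x0 = (SUM m:{l}. psi m * (if m = l then f else 0) x0)" using that fs_0[OF ss_geig] by auto
 qed
 qed
qed

end

text \<open>An annihilating polynomial of D on the iterates of f splits into linear factors, which
  \<open>gspan_step\<close> peels off one at a time.\<close>

lemma (in lin_op) locally_finite_gspan:
 fixes f :: "'x => 'a" assumes ac: "!!p :: 'a poly. EX as. p = Polynomial.smult (lead_coeff p) (PROD a<-as. [:- a, 1:])"
 and T: "fd T" "T <= A" "!!g. g : T ==> D g : T" and f: "f : T" shows "f : gspan" proof -
 obtain p where p: "p ~= 0" "pop p f = 0" using exists_annihilating_poly[OF T(1,3) f] by blast
 obtain as where as: "p = Polynomial.smult (lead_coeff p) (PROD a<-as. [:- a, 1:])" using ac by blast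
 let ?q = "PROD a<-as. [:- a, 1:]"
 define c where "c = lead_coeff p"
 have pc: "p = Polynomial.smult c ?q" unfolding c_def by (rule as)
 have "c ~= 0" using p(1) by (simp add: c_def)
 hence "degree ?q = degree p" by (simp add: pc)
 moreover have "coeff p i = c * coeff ?q i" for i by (simp add: pc)
 ultimately have "pop p f = fsc c (pop ?q f)" unfolding pop_def by (simp add: fs.scale_sum_right fs.scale_scale)
 hence "pop ?q f = 0" using p(2) \<open>c ~= 0\<close> by (simp add: fs.scale_eq_0_iff)
 moreover have "f : gspan" if "f : A" "pop (PROD a<-as. [:- a, 1:]) f = 0" for as f using that proof (induction as arbitrary: f)
 case Nil
 hence "f = 0" by (simp add: pop_def fs.scale_one)
 thus ?case unfolding gspan_def using fs.span_zero by simp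
 next
 case (Cons a as)
 have "pop (PROD a<-as. [:- a, 1:]) (dm a f) = 0" using Cons.prems(2) pop_linear_factor[OF Cons.prems(1)] by simp
 thus ?case using Cons.IH[OF dm_in[OF Cons.prems(1)]] gspan_step[OF Cons.prems(1)] by blast
 qed
 ultimately show ?thesis using f T(2) by blast
qed

lemma alg_closed_splits:
 "EX as. p = Polynomial.smult (lead_coeff p) (PROD a<-as. [:- a, 1:])" for p :: "'a::alg_closed_field poly" proof (cases "p = 0")
 case False
 then obtain A where A: "p = Polynomial.smult (lead_coeff p) (PROD x:#A. [:- x, 1:])" using alg_closed_imp_factorization[of p] by metis
 obtain as where "mset as = A" using ex_mset by blast
 thus ?thesis using A by (intro exI[of _ as]) (simp flip: prod_mset_prod_list)
qed simp

section \<open>Matrices\<close>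

definition Kn :: "nat => (nat => 'a::field) set" where
 "Kn n = {w. ALL i>=n. w i = 0}"

definition mv :: "nat => (nat => nat => 'a::field) => (nat => 'a) => nat => 'a" where
 "mv n M w = (%i. if i < n then SUM j<n. M i j * w j else 0)"

definition mm :: "nat => (nat => nat => 'a::field) => (nat => nat => 'a) => nat => nat => 'a" where
 "mm n M N = (%i j. SUM k<n. M i k * N k j)"

definition tr :: "nat => (nat => nat => 'a::field) => 'a" where
 "tr n M = (SUM i<n. M i i)"

definition unitv :: "nat => nat => 'a::field" where
 "unitv j = (%i. if i = j then 1 else 0)"

lemma subspace_Kn: "fsub (Kn n)" by (auto simp: fs_def Kn_def fun_at)

lemma mv_in: "mv n M w : Kn n" by (simp add: mv_def Kn_def)

lemma mv_linear: "mv n M (v + w) = mv n M v + mv n M w" "mv n M (fsc c v) = fsc c (mv n M v)"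
 "mv n M 0 = 0" "mv n M (v - w) = mv n M v - mv n M w" by (auto simp: mv_def fun_at fei als sum.distrib sdl sum_subtractf)

lemma mv_mm: "mv n (mm n M N) w = mv n M (mv n N w)" proof
 fix i
 have "(SUM j<n. (SUM k<n. M i k * N k j) * w j) = (SUM j<n. SUM k<n. M i k * N k j * w j)" by (simp add: sdr)
 also have "... = (SUM k<n. SUM j<n. M i k * N k j * w j)" by (rule sum.swap)
 also have "... = (SUM k<n. M i k * (SUM j<n. N k j * w j))" by (simp add: sdl mult.assoc)
 finally show "mv n (mm n M N) w i = mv n M (mv n N w) i" by (simp add: mv_def mm_def)
qed

lemma mv_unitv: "j < n ==> i < n ==> mv n M (unitv j) i = M i j" proof -
 assume "j < n" "i < n"
 have "(SUM k<n. M i k * unitv j k) = (SUM k<n. if k = j then M i k else 0)" by (rule sum.cong) (auto simp: unitv_def)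
 thus ?thesis using \<open>j < n\<close> \<open>i < n\<close> by (simp add: mv_def)
qed

lemma unitv_in: "j < n ==> unitv j : Kn n" by (auto simp: unitv_def Kn_def)

lemma lc_unitv: "w : Kn n ==> lc n w unitv = w" proof
 fix i assume w: "w : Kn n"
 have "(SUM k<n. w k * unitv k i) = (SUM k<n. if k = i then w k else 0)" by (rule sum.cong) (auto simp: unitv_def)
 thus "lc n w unitv i = w i" using w by (auto simp: lc_at Kn_def)
qed

lemma fd_Kn: "fd (Kn n :: (nat => 'a::field) set)" unfolding fd_def proof (intro exI[of _ "unitv ` {..<n}"] conjI subsetI)
 fix w :: "nat => 'a" assume "w : Kn n"
 hence "lc n w unitv = w" by (rule lc_unitv)
 moreover have "lc n w unitv : fs.span (unitv ` {..<n})" by (intro lc_in fs.subspace_span fs.span_base) auto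
 ultimately show "w : fs.span (unitv ` {..<n})" by metis
qed simp

lemma lin_op_mv: "lin_op (Kn n) (mv n M)" by unfold_locales (auto simp: subspace_Kn mv_in mv_linear)

lemma tr_mm_commute: "tr n (mm n M N) = tr n (mm n N M)" unfolding tr_def mm_def by (subst sum.swap) (simp add: mcm)

text \<open>A triangular family of maximal length is a basis: if a generalized eigenvector f were
  outside its span, the last iterate of D - m on f that is still outside would prolong the
  family.\<close>

lemma (in lin_op) triangular_basis: assumes "fd A" "A <= gspan"
 obtains n w l where "bmod {0} A n w" "!!j. j < n ==> w j : geig (l j)"
 "!!j. j < n ==> EX c. dm (l j) (w j) = lc j c w" proof -
 define I where "I n \<longleftrightarrow> (EX w l. (ALL c. lc n c w = 0 --> (ALL i<n. c i = 0)) & (ALL j<n. w j : geig (l j)) &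
 (ALL j<n. EX c. dm (l j) (w j) = lc j c w))" for n
 obtain F where F: "finite F" "A <= fs.span F" using assms(1) unfolding fd_def by blast
 have bound: "n <= card F" if In: "I n" for n proof -
 obtain w l where w: "ALL c. lc n c w = 0 --> (ALL i<n. c i = 0)" "ALL j<n. w j : geig (l j)" using In unfolding I_def by metis
 show ?thesis by (rule li_card_bound[OF F(1) _ w(1)]) (use w(2) geigD(1) F(2) in blast)
 qed
 have "I 0" by (simp add: I_def)
 define n where "n = (GREATEST n. I n)"
 have n: "I n" unfolding n_def by (rule GreatestI_nat[of I 0 "card F"]) (use \<open>I 0\<close> bound in auto)
 have max: "m <= n" if "I m" for m unfolding n_def by (rule Greatest_le_nat[of I m "card F"]) (use that bound in auto)
 obtain w l where wl: "(ALL c. lc n c w = 0 --> (ALL i<n. c i = 0)) & (ALL j<n. w j : geig (l j)) &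
 (ALL j<n. EX c. dm (l j) (w j) = lc j c w)" using n unfolding I_def by metis
 define S where "S = {lc n c w |c. True}"
 have sS: "fsub S" proof (rule fs.subspaceI)
 have "lc n (%_. 0) w = 0" by (simp add: lc_def fs0)
 thus "0 : S" unfolding S_def by (metis (mono_tags, lifting) mCe)
 show "x + y : S" if "x : S" "y : S" for x y proof -
 from that obtain c d where "x = lc n c w" "y = lc n d w" unfolding S_def by blast
 thus ?thesis unfolding S_def using lc_add[of n c w d] by blast
 qed
 show "fsc a x : S" if "x : S" for a x proof -
 from that obtain c where "x = lc n c w" unfolding S_def by blast
 thus ?thesis unfolding S_def using lc_scale[of a n c w] by blast
 qed
 qed
 have AS: "A <= S" proof (rule ccontr)
 assume "\<not> A <= S"
 hence "\<not> (\<Union>l. geig l) <= S" using assms(2) fs.span_minimal[OF _ sS, of "\<Union>l. geig l"] unfolding gspan_def by blast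
 then obtain f m where f: "f : geig m" "f ~: S" by blast
 obtain N where N: "(dm m ^^ N) f = 0" using geigD(2)[OF f(1)] by blast
 define i where "i = (LEAST i. (dm m ^^ i) f : S)"
 have "(dm m ^^ N) f : S" using N fs_0[OF sS] by simp
 hence i: "(dm m ^^ i) f : S" unfolding i_def by (rule LeastI)
 have "i ~= 0" using i f(2) by (metis funpow_0)
 define g where "g = (dm m ^^ (i - 1)) f"
 have g: "g ~: S" using not_less_Least[of "i - 1" "%i. (dm m ^^ i) f : S"] \<open>i ~= 0\<close> unfolding g_def i_def[symmetric] by simp
 have "(dm m ^^ k) f : geig m" for k by (induction k) (auto intro: dm_geig f(1))
 hence gm: "g : geig m" unfolding g_def .
 have "dm m g : S" using i \<open>i ~= 0\<close> unfolding g_def by (cases i) auto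
 then obtain c where c: "dm m g = lc n c w" unfolding S_def by blast
 define w' where "w' j = (if j < n then w j else g)" for j
 define l' where "l' j = (if j < n then l j else m)" for j
 have lcw: "lc j c w' = lc j c w" if "j <= n" for j c unfolding lc_def by (rule sum.cong) (use that in \<open>auto simp: w'_def\<close>)
 have Sn: "lc (Suc n) d w' = lc n d w + fsc (d n) g" for d using lcw[of n d] unfolding lc_def by (simp add: w'_def)
 have "I (Suc n)" unfolding I_def proof (rule exI[of _ w'], rule exI[of _ l'], intro conjI allI impI)
 fix d j assume d: "lc (Suc n) d w' = 0" and j: "j < Suc n"
 have "d n = 0" proof (rule ccontr)
 assume nz: "d n ~= 0"
 have "fsc (d n) g = - lc n d w" using d unfolding Sn by (simp add: eq_neg_iff_add_eq_0 add.commute)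
 hence "fsc (1 / d n) (fsc (d n) g) : S" using fs_sc[OF sS fs.subspace_neg[OF sS]] unfolding S_def by auto
 thus False using g nz by (simp add: fs.scale_scale fs.scale_one)
 qed
 hence "lc n d w = 0" using d unfolding Sn by (simp add: fs0)
 thus "d j = 0" using wl \<open>d n = 0\<close> j less_Suc_eq by metis
 next
 fix j assume j: "j < Suc n"
 show "w' j : geig (l' j)" using wl gm j by (auto simp: w'_def l'_def)
 show "EX c. dm (l' j) (w' j) = lc j c w'" proof (cases "j < n")
 case True
 then obtain c' where "dm (l j) (w j) = lc j c' w" using wl by blast
 thus ?thesis using lcw[of j c'] True by (intro exI[of _ c']) (simp add: w'_def l'_def)
 next
 case False
 with j have "j = n" by simp
 thus ?thesis using c lcw[of n c] by (intro exI[of _ c]) (simp add: w'_def l'_def)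
 qed
 qed
 thus False using max by fastforce
 qed
 have "EX c. t - lc n c w : {0}" if t: "t : A" for t proof -
 obtain c where "t = lc n c w" using t AS unfolding S_def by blast
 thus ?thesis by (intro exI[of _ c]) simp
 qed
 hence "bmod {0} A n w" unfolding bmod_def using wl geigD(1) by (metis singletonD)
 thus ?thesis using that wl by blast
qed

text \<open>The functional \<open>gmm k\<close> reads off the coefficient of \<open>w k\<close>, so
  the second clause computes the trace in an arbitrary basis.\<close>

lemma tr_basis:
 fixes w :: "nat => nat => 'a::field" assumes w: "bmod {0} (Kn n) m w"
 obtains gmm where "!!k v c. k < m ==> v = lc m c w ==> gmm k v = c k"
 "!!M. tr n M = (SUM k<m. gmm k (mv n M (w k)))" proof -
 have "EX c. unitv i = lc m c w" if "i < n" for i using bmD(3)[OF w unitv_in[OF that]] by auto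
 then obtain a where a: "!!i. i < n ==> unitv i = lc m (a i) w" by metis
 define gmm where "gmm k v = (SUM i<n. v i * a i k)" for k v
 have exp: "v = lc m (%k. gmm k v) w" if v: "v : Kn n" for v proof -
 have "v = lc n v unitv" using lc_unitv[OF v] by simp
 also have "... = (SUM i<n. fsc (v i) (lc m (a i) w))" unfolding lc_def[of n] using a by simp
 also have "... = lc m (%k. gmm k v) w" proof
 fix x
 have "(SUM i<n. v i * (SUM k<m. a i k * w k x)) = (SUM i<n. SUM k<m. v i * a i k * w k x)" by (simp add: sdl mult.assoc)
 also have "... = (SUM k<m. (SUM i<n. v i * a i k) * w k x)" unfolding sdr by (rule sum.swap)
 finally show "(SUM i<n. fsc (v i) (lc m (a i) w)) x = lc m (%k. gmm k v) w x" by (simp add: fun_at lc_at gmm_def)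
 qed
 finally show ?thesis .
 qed
 show ?thesis proof (rule that[of gmm])
 fix k v c assume k: "k < m" and v: "v = lc m c w"
 have "v : Kn n" unfolding v by (intro lc_in subspace_Kn bmD(1)[OF w])
 hence "v - lc m (%k. gmm k v) w : {0}" "v - lc m c w : {0}" using exp v by auto
 thus "gmm k v = c k" using basis_mod_unique[OF w _ _ _ k, of v "%k. gmm k v" c] by (simp add: fs_def)
 next
 fix M :: "nat => nat => 'a"
 have "tr n M = (SUM i<n. mv n M (unitv i) i)" unfolding tr_def by (simp add: mv_unitv)
 also have "... = (SUM i<n. SUM k<m. a i k * mv n M (w k) i)" proof (rule sum.cong)
 fix i assume i: "i : {..<n}"
 have "mv n M (lc m c w) = lc m c (%k. mv n M (w k))" for c unfolding lc_def by (induction m) (auto simp: mv_linear)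
 thus "mv n M (unitv i) i = (SUM k<m. a i k * mv n M (w k) i)" using a[of i] i by (simp add: lc_at)
 qed simp
 also have "... = (SUM k<m. gmm k (mv n M (w k)))" unfolding gmm_def by (subst sum.swap) (simp add: mcm)
 finally show "tr n M = (SUM k<m. gmm k (mv n M (w k)))" .
 qed
qed

section \<open>A trace test for nilpotency through additive functionals\<close>

lemma exists_rat_functional:
 fixes a :: "'a::field_char_0" assumes "a ~= 0"
 obtains psi :: "'a => rat" where "!!x y. psi (x + y) = psi x + psi y" "!!r x. psi (of_rat r * x) = r * psi x" "psi a ~= 0" proof -
 interpret qv: vector_space "%r x. of_rat r * (x :: 'a)" by unfold_locales (auto simp: als of_rat_add of_rat_mult)
 interpret q: vector_space "(*) :: rat => rat => rat" by unfold_locales (auto simp: als)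
 interpret p: vector_space_pair "%r x. of_rat r * (x :: 'a)" "(*) :: rat => rat => rat" ..
 have "qv.independent {a}" using assms by (simp add: qv.dependent_single)
 then obtain psi where psi: "vlin (%r x. of_rat r * (x :: 'a)) (*) psi" "psi a = (1 :: rat)"
 using p.linear_independent_extend[of "{a}" "%_. 1"] by auto
 interpret l: Vector_Spaces.linear "%r x. of_rat r * (x :: 'a)" "(*)" psi by fact
 show ?thesis by (rule that[of psi]) (use l.add l.scale psi(2) in auto)
qed

text \<open>The positivity that the ground field lacks is borrowed from the rationals: a functional
  psi with rational values, nonzero at \<open>l k\<close>, turns the hypothesis for psi into a
  vanishing sum of rational squares.\<close>

lemma rational_isotropy:
 fixes l :: "nat => 'a::field_char_0" assumes "!!psi. (!!x y. psi (x + y) = psi x + psi y) ==> (SUM k<m. l k * psi (l k)) = 0" and "k < m"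
 shows "l k = 0" proof (rule ccontr)
 assume "l k ~= 0"
 then obtain psi :: "'a => rat" where psi: "!!x y. psi (x + y) = psi x + psi y"
 "!!r x. psi (of_rat r * x) = r * psi x" "psi (l k) ~= 0" by (rule exists_rat_functional) blast
 have psi0: "psi 0 = 0" using psi(2)[of 0 0] by simp
 have psis: "psi (SUM i:I. h i) = (SUM i:I. psi (h i))" for I and h :: "nat => 'a" by (induction I rule: ifi) (auto simp: psi(1) psi0)
 have "(SUM k<m. l k * of_rat (psi (l k))) = 0" using assms(1)[of "%x. of_rat (psi x)"] by (simp add: psi(1) of_rat_add)
 hence "psi (SUM k<m. of_rat (psi (l k)) * l k) = 0" by (simp add: psi0 mcm)
 hence "(SUM k<m. psi (l k) * psi (l k)) = 0" by (simp add: psis psi(2))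
 hence "psi (l k) * psi (l k) = 0" using assms(2) by (subst (asm) sum_nonneg_eq_0_iff) auto
 thus False using psi(3) by simp
qed

definition nilp :: "nat => (nat => nat => 'a::field) => bool" where
 "nilp n M \<longleftrightarrow> (ALL w:Kn n. EX N. (mv n M ^^ N) w = 0)"

lemma mv_dm0: "lin_op.dm (mv n M) 0 = mv n M" by (rule ext) (simp add: lin_op.dm_def[OF lin_op_mv] fs0)

lemma nilp_geig: "nilp n M \<longleftrightarrow> Kn n <= lin_op.geig (Kn n) (mv n M) 0"
 unfolding nilp_def lin_op.geig_def[OF lin_op_mv] mv_dm0 by blast

text \<open>
  \<open>N \<psi>\<close> acts on the generalized eigenspaces of \<open>M\<close> by the scalars \<open>\<psi> \<lambda>\<close>; for rational
  \<open>\<psi>\<close> the trace of \<open>M N\<close> is \<open>\<Sum> \<lambda> \<psi> \<lambda>\<close>, and applying \<open>\<psi>\<close> again gives a sum of squares.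
\<close>

lemma nilp_if_replica_traces_vanish:
 fixes M :: "nat => nat => 'a::{alg_closed_field, field_char_0}"
 assumes N: "!!psi l w. (!!x y. psi (x + y) = psi x + psi y) ==> w : lin_op.geig (Kn n) (mv n M) l ==>
 mv n (N psi) w = fsc (psi l) w" and z: "!!psi. (!!x y. psi (x + y) = psi x + psi y) ==> tr n (mm n M (N psi)) = 0" shows "nilp n M" proof -
 interpret lin_op "Kn n" "mv n M" by (rule lin_op_mv)
 have gs: "Kn n <= gspan" by (rule subsetI, rule locally_finite_gspan[OF alg_closed_splits fd_Kn order_refl D_in])
 obtain m w l where w: "bmod {0} (Kn n) m w" "!!j. j < m ==> w j : geig (l j)"
 "!!j. j < m ==> EX c. dm (l j) (w j) = lc j c w" by (rule triangular_basis[OF fd_Kn gs]) blast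
 obtain gmm where gmm: "!!k v c. k < m ==> v = lc m c w ==> gmm k v = c k"
 "!!M. tr n M = (SUM k<m. gmm k (mv n M (w k)))" by (rule tr_basis[OF w(1)]) blast
 have "(SUM k<m. l k * psi (l k)) = 0" if psi: "!!x y. psi (x + y) = psi x + psi y" for psi proof -
 have "gmm k (mv n (mm n M (N psi)) (w k)) = l k * psi (l k)" if k: "k < m" for k proof -
 obtain c where c: "dm (l k) (w k) = lc k c w" using w(3)[OF k] by blast
 define d where "d j = psi (l k) * ((if j = k then l k else 0) + (if j < k then c j else 0))" for j
 have "lc m (%j. if j < k then c j else 0) w = lc k c w"
 unfolding lc_def by (rule sum.mono_neutral_cong_right) (use k in \<open>auto simp: fs0\<close>)
 moreover have "lc m (%j. if j = k then l k else 0) w = fsc (l k) (w k)"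
 using lc_scale[of "l k" m "%j. if j = k then 1 else 0" w] lc_delta[OF k, of w] by (simp add: if_distrib cong: if_cong)
 ultimately have "lc m d w = fsc (psi (l k)) (fsc (l k) (w k) + lc k c w)" unfolding d_def lc_scale[symmetric] lc_add[symmetric] by simp
 also have "... = fsc (psi (l k)) (mv n M (w k))" unfolding c[symmetric] dm_def by simp
 also have "... = mv n (mm n M (N psi)) (w k)" unfolding mv_mm N[OF psi w(2)[OF k]] mv_linear ..
 finally have "gmm k (mv n (mm n M (N psi)) (w k)) = d k" by (intro gmm(1)[OF k]) simp
 thus ?thesis by (simp add: d_def mcm)
 qed
 thus ?thesis using z[OF psi] unfolding gmm(2) by simp
 qed
 note isot = this
 have l: "l k = 0" if "k < m" for k by (rule rational_isotropy[where l = l and m = m, OF isot that])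
 have "v : geig 0" if v: "v : Kn n" for v proof -
 obtain c where "v = lc m c w" using bmD(3)[OF w(1) v] by auto
 moreover have "lc m c w : geig 0" by (rule lc_in[OF ss_geig]) (use w(2) l in fastforce)
 ultimately show ?thesis by simp
 qed
 thus ?thesis unfolding nilp_geig by blast
qed

section \<open>The Lie algebra of an affine algebraic group\<close>

context aff_group
begin

text \<open>The tangent space at the identity, as point derivations. Only the values on A are
  constrained, so members that agree on A need not be equal; statements below therefore compare
  values on functions of A or on matrix entries.\<close>

definition gl :: "(('g => 'a) => 'a) set" where
 "gl = {dl. (ALL f:A. ALL f':A. dl (f + f') = dl f + dl f') & (ALL c. ALL f:A. dl (fsc c f) = c * dl f) &
 (ALL f:A. ALL f':A. dl (f * f') = f \<one> * dl f' + dl f * f' \<one>)}"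

text \<open>The left-invariant vector field with value dl at the identity. It is an infinitesimal
  right translation and so preserves finite-dimensional right-stable subspaces.\<close>

definition dop :: "(('g => 'a) => 'a) => ('g => 'a) => 'g => 'a" where
 "dop dl f = zcut (cr G) (%x. dl (lt x f))"

definition dmat :: "(('g => 'a) => 'a) => (nat => nat => 'g => 'a) => nat => nat => 'a" where
 "dmat dl rho = (%i j. dl (rho i j))"

lemma glD: assumes "dl : gl" shows "f : A ==> f' : A ==> dl (f + f') = dl f + dl f'" "f : A ==> dl (fsc c f) = c * dl f"
 "f : A ==> f' : A ==> dl (f * f') = f \<one> * dl f' + dl f * f' \<one>" using assms by (auto simp: gl_def)

lemma gl_zero: "dl : gl ==> dl 0 = 0" using glD(2)[OF _ zero_in, of dl 0] by (simp add: fs0)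

lemma gl_sum: "dl : gl ==> (!!i. i : I ==> f i : A) ==> dl (SUM i:I. f i) = (SUM i:I. dl (f i))"
 by (induction I rule: ifi) (auto simp: gl_zero glD(1) sum_in)

lemma gl_lc: "dl : gl ==> (!!i. i < n ==> e i : A) ==> dl (lc n c e) = (SUM i<n. c i * dl (e i))" proof -
 assume d: "dl : gl" and e: "!!i. i < n ==> e i : A"
 have "dl (lc n c e) = (SUM i<n. dl (fsc (c i) (e i)))" unfolding lc_def by (rule gl_sum[OF d]) (use e in \<open>simp add: scale_in\<close>)
 also have "... = (SUM i<n. c i * dl (e i))" by (rule sum.cong) (use e d in \<open>auto simp: glD(2)\<close>)
 finally show ?thesis .
qed

lemma gl_const: "dl : gl ==> dl (cst (cr G) c) = 0" proof -
 assume d: "dl : gl"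
 let ?o = "cst (cr G) (1 :: 'a)"
 have o: "?o : A" by (rule cst_in)
 have "dl (?o * ?o) = ?o \<one> * dl ?o + dl ?o * ?o \<one>" by (rule glD(3)[OF d o o])
 hence "dl ?o = dl ?o + dl ?o" unfolding one_mult[OF o] by (simp add: cst_at)
 hence "dl ?o = 0" by simp
 moreover have "cst (cr G) c = fsc c ?o" by (auto simp: cst_def fun_at)
 ultimately show ?thesis using glD(2)[OF d o] by simp
qed

lemma subspace_gl: "fsub gl" by (rule fs.subspaceI) (auto simp: gl_def fun_at als)

lemma lt_cst: "x : cr G ==> lt x (cst (cr G) c) = cst (cr G) c" by (auto simp: lt_def zcut_def cst_def)

lemma lt_one: "f : A ==> lt \<one> f = f" using out by (auto simp: lt_def zcut_def fei)

lemma dop_at: "x : cr G ==> dop dl f x = dl (lt x f)" by (simp add: dop_def zcut_def)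

lemma dop_one: "f : A ==> dop dl f \<one> = dl f" by (simp add: dop_at lt_one)

lemma dop_in: assumes d: "dl : gl" and f: "f : A" shows "dop dl f : A" proof -
 obtain n a b where ab: "!!i. i < (n::nat) ==> a i : A" "!!i. i < n ==> b i : A"
 "!!x y. x : cr G ==> y : cr G ==> f (x \<otimes> y) = (SUM i<n. a i x * b i y)" by (rule tensE[OF comult[OF f]]) blast
 have "lt x f = lc n (%i. a i x) b" if "x : cr G" for x
 by (rule fun_ext[OF lt_in[OF f that] lc_in[OF subspace ab(2)]]) (simp_all add: lt_at lc_at ab(3) that)
 hence "dop dl f x = lc n (%i. dl (b i)) a x" if "x : cr G" for x using that gl_lc[OF d ab(2)] by (simp add: dop_at lc_at mcm)
 moreover have l: "lc n (%i. dl (b i)) a : A" by (rule lc_in[OF subspace ab(1)])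
 ultimately have "dop dl f = lc n (%i. dl (b i)) a" using out[OF l] by (auto simp: dop_def zcut_def fei)
 thus ?thesis using l by simp
qed

lemma lin_op_dop: "dl : gl ==> lin_op A (dop dl)"
 by (unfold_locales; (rule subspace | rule dop_in | rule ext); (assumption | simp add: dop_def zcut_def fun_at lt_linear glD lt_in))

lemma dop_mult: "dl : gl ==> f : A ==> f' : A ==> dop dl (f * f') = f * dop dl f' + dop dl f * f'"
 by (rule ext) (simp add: dop_def zcut_def fun_at lt_linear glD(3) lt_in lt_at)

lemma rstable_zero: "rstable {0}" using zero_in by (auto simp: rstable_def fs_def rt_linear)

lemma dop_rep: assumes d: "dl : gl" and r: "rep n rho" and i: "i < n" and j: "j < n" shows "dop dl (rho i j) = lc n (%k. dl (rho k j)) (rho i)"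
proof (rule fun_ext[OF dop_in[OF d repD(1)[OF r i j]] lc_in[OF subspace repD(1)[OF r i]]])
 fix x assume x: "x : cr G"
 have "lt x (rho i j) = lc n (%k. rho i k x) (%k. rho k j)" by (rule fun_ext[OF lt_in[OF repD(1)[OF r i j] x] lc_in[OF subspace repD(1)[OF r _ j]]])
 (simp_all add: lt_at lc_at x repD(3)[OF r i j])
 thus "dop dl (rho i j) x = lc n (%k. dl (rho k j)) (rho i) x" using gl_lc[OF d, of n "%k. rho k j" "%k. rho i k x"] repD(1)[OF r _ j] x
 by (simp add: dop_at lc_at mcm)
qed

lemma rstable_coeffs: assumes T: "rstable T" "fd T"
 obtains n e rho where "bmod {0} T n e" "rep n rho"
 "!!g j. g : cr G ==> j < n ==> rt g (e j) = lc n (%i. rho i j g) e" proof -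
 have z: "fsub {0 :: 'g => 'a}" by (simp add: fs_def)
 have zT: "{0} <= T" using fs_0[OF rsD(2)[OF T(1)]] by simp
 obtain n e where e: "bmod {0} T n e" by (rule exists_bmod[OF z rsD(2)[OF T(1)] T(2) zT])
 obtain rho where rho: "rep n rho"
 "!!g j. g : cr G ==> j < n ==> rt g (e j) - lc n (%i. rho i j g) e : {0}" by (rule basis_mod_rep[OF rstable_zero T zT e]) blast
 show ?thesis by (rule that[OF e rho(1)]) (use rho(2) in auto)
qed

lemma dop_coeffs: assumes d: "dl : gl" and r: "rep n rho" and e: "!!j. j < n ==> e j : A"
 and rt: "!!g j. g : cr G ==> j < n ==> rt g (e j) = lc n (%i. rho i j g) e" shows "dop dl (lc n w e) = lc n (mv n (dmat dl rho) w) e"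
proof (rule fun_ext)
 have wA: "lc n w e : A" by (rule lc_in[OF subspace e])
 thus "dop dl (lc n w e) : A" by (rule dop_in[OF d])
 show "lc n (mv n (dmat dl rho) w) e : A" by (rule lc_in[OF subspace e])
 fix x assume x: "x : cr G"
 have lej: "lt x (e j) = lc n (%i. e i x) (%i. rho i j)" if j: "j < n" for j
 proof (rule fun_ext[OF lt_in[OF e[OF j] x] lc_in[OF subspace repD(1)[OF r _ j]]])
 fix g assume g: "g : cr G"
 have "lt x (e j) g = rt g (e j) x" using x g by (simp add: lt_at rt_at)
 thus "lt x (e j) g = lc n (%i. e i x) (%i. rho i j) g" unfolding rt[OF g j] by (simp add: lc_at mcm)
 qed simp_all
 have "lt x (lc n w e) = lc n w (%j. lt x (e j))" by (rule ext) (simp add: lt_def zcut_def lc_at)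
 hence "dop dl (lc n w e) x = (SUM j<n. w j * dl (lt x (e j)))" using gl_lc[OF d, of n "%j. lt x (e j)" w] x e by (simp add: dop_at lt_in)
 also have "... = (SUM j<n. w j * (SUM i<n. e i x * dl (rho i j)))" proof (rule sum.cong)
 fix j assume "j : {..<n}"
 hence j: "j < n" by simp
 show "w j * dl (lt x (e j)) = w j * (SUM i<n. e i x * dl (rho i j))"
 unfolding lej[OF j] using gl_lc[OF d, of n "%i. rho i j"] repD(1)[OF r _ j] by simp
 qed simp
 also have "... = (SUM j<n. SUM i<n. dl (rho i j) * w j * e i x)" by (simp add: sdl als)
 also have "... = (SUM i<n. (SUM j<n. dl (rho i j) * w j) * e i x)" unfolding sdr by (rule sum.swap)
 finally show "dop dl (lc n w e) x = lc n (mv n (dmat dl rho) w) e x" by (simp add: lc_at mv_def dmat_def)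
qed

lemma dop_rstable: assumes d: "dl : gl" and T: "rstable T" "fd T" and f: "f : T" shows "dop dl f : T" proof -
 obtain n e rho where e: "bmod {0} T n e" "rep n rho"
 "!!g j. g : cr G ==> j < n ==> rt g (e j) = lc n (%i. rho i j g) e" by (rule rstable_coeffs[OF T]) blast
 have eT: "!!j. j < n ==> e j : T" using bmD(1)[OF e(1)] .
 obtain w where "f = lc n w e" using bmD(3)[OF e(1) f] by auto
 hence "dop dl f = lc n (mv n (dmat dl rho) w) e" using dop_coeffs[OF d e(2) _ e(3)] eT rsD(1)[OF T(1)] by blast
 also have "... : T" by (rule lc_in[OF rsD(2)[OF T(1)] eT])
 finally show ?thesis .
qed

section \<open>Eigenspaces of invariant vector fields and replicas\<close>

abbreviation geg :: "(('g => 'a) => 'a) => 'a => ('g => 'a) set" where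
 "geg dl \<equiv> lin_op.geig A (dop dl)"

lemma dop_gspan: assumes d: "dl : gl" shows "A <= lin_op.gspan A (dop dl)" proof
 interpret lin_op A "dop dl" by (rule lin_op_dop[OF d])
 fix f assume f: "f : A"
 obtain T where T: "rstable T" "fd T" "{f} <= T" using locally_finite[of "{f}"] f by auto
 show "f : gspan" by (rule locally_finite_gspan[OF alg_closed_splits T(2) rsD(1)[OF T(1)]]) (use dop_rstable[OF d T(1,2)] T(3) in auto)
qed

text \<open>By Leibniz, D - (l + m) on a product is the sum of D - l on the first and D - m on the
  second factor; the induction runs over the sum of the two nilpotency exponents.\<close>

lemma geg_mult: assumes d: "dl : gl" and fg: "f : geg dl l" "g : geg dl m" shows "f * g : geg dl (l + m)" proof -
 interpret lin_op A "dop dl" by (rule lin_op_dop[OF d])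
 have "f * g : geig (l + m)"
 if "f : A" "g : A" "(dm l ^^ i) f = 0" "(dm m ^^ j) g = 0" "i + j <= n" for n i j f g using that proof (induction n arbitrary: i j f g)
 case 0
 hence "f * g = 0" by simp
 thus ?case using fs_0[OF ss_geig] by simp
 next
 case (Suc n)
 show ?case proof (cases "i = 0 \<or> j = 0")
 case True
 hence "f * g = 0" using Suc.prems by auto
 thus ?thesis using fs_0[OF ss_geig] by simp
 next
 case False
 then obtain i' j' where ij: "i = Suc i'" "j = Suc j'" by (meson not0_implies_Suc)
 have "dm l f * g : geig (l + m)" by (rule Suc.IH[of _ _ i' j]) (use Suc.prems ij in \<open>auto simp: dm_in funpow_swap1\<close>)
 moreover have "f * dm m g : geig (l + m)" by (rule Suc.IH[of _ _ i j']) (use Suc.prems ij in \<open>auto simp: dm_in funpow_swap1\<close>)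
 moreover have "dm (l + m) (f * g) = dm l f * g + f * dm m g" unfolding dm_def dop_mult[OF d Suc.prems(1,2)] by (rule ext) (simp add: fun_at als)
 ultimately have "dm (l + m) (f * g) : geig (l + m)" using fs_ad[OF ss_geig] by metis
 thus ?thesis by (rule geig_step[OF mult_in[OF Suc.prems(1,2)]])
 qed
 qed
 moreover obtain i where "(dm l ^^ i) f = 0" using geigD(2)[OF fg(1)] by blast
 moreover obtain j where "(dm m ^^ j) g = 0" using geigD(2)[OF fg(2)] by blast
 ultimately show ?thesis using geigD(1)[OF fg(1)] geigD(1)[OF fg(2)] by blast
qed

text \<open>Chevalley's replica: the semisimple part of dl with each eigenvalue l replaced by
  \<open>psi l\<close>, evaluated at the identity.\<close>

definition replica :: "(('g => 'a) => 'a) => ('a => 'a) => (('g => 'a) => 'a) => bool" where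
 "replica dl psi dl' \<longleftrightarrow> dl' : gl & (ALL l. ALL f:geg dl l. dl' f = psi l * f \<one>)"

text \<open>Eigenvalues add when eigenfunctions are multiplied, so additivity of psi is what the
  product rule of a derivation requires of the graded functional.\<close>

lemma exists_replica: assumes d: "dl : gl" and psi: "!!x y. psi (x + y) = psi x + psi y"
 obtains dl' where "replica dl psi dl'" proof -
 interpret lin_op A "dop dl" by (rule lin_op_dop[OF d])
 have AA: "f : gspan \<longleftrightarrow> f : A" for f using dop_gspan[OF d] gspan_subset by blast
 obtain r where r: "!!f g. f : gspan ==> g : gspan ==> r (f + g) = r f + r g"
 "!!c f. f : gspan ==> r (fsc c f) = c * r f" "!!l f. f : geig l ==> r f = psi l * f \<one>" using graded_functional[of psi \<one>] by blast
 have rs: "r (SUM i:I. f i) = (SUM i:I. r (f i))" if "!!i. i : I ==> f i : A" for I and f :: "'a => 'g => 'a" using that proof (induction I rule: ifi)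
 case (insert x I)
 thus ?case using r(1)[unfolded AA, of "f x" "SUM i:I. f i"] sum_in[of I f] by simp
 qed (use r(2)[unfolded AA, OF zero_in, of 0] in \<open>simp_all add: fs0\<close>)
 have "r (f * g) = f \<one> * r g + r f * g \<one>" if fg: "f : A" "g : A" for f g proof -
 obtain L F where LF: "finite L" "ALL l. F l : geig l" "f = (SUM l:L. F l)" using gspan_explicit fg(1) AA by metis
 obtain M H where MH: "finite M" "ALL l. H l : geig l" "g = (SUM l:M. H l)" using gspan_explicit fg(2) AA by metis
 have FA: "F l : A" "H l : A" for l using LF(2) MH(2) geigD(1) by blast+
 have "f * g = (SUM l:L. SUM m:M. F l * H m)" unfolding LF(3) MH(3) by (rule sum_product)
 hence "r (f * g) = (SUM l:L. SUM m:M. r (F l * H m))" using FA by (simp add: rs sum_in mult_in)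
 also have "... = (SUM l:L. SUM m:M. F l \<one> * r (H m) + r (F l) * H m \<one>)" proof (intro sum.cong refl)
 fix l m
 have F: "F l : geig l" and H: "H m : geig m" using LF(2) MH(2) by blast+
 show "r (F l * H m) = F l \<one> * r (H m) + r (F l) * H m \<one>" unfolding r(3)[OF geg_mult[OF d F H]] r(3)[OF F] r(3)[OF H]
 by (simp add: psi fun_at als)
 qed
 also have "... = f \<one> * r g + r f * g \<one>" unfolding LF(3) MH(3) using FA by (simp add: rs fun_at sum.distrib sum_product)
 finally show ?thesis .
 qed
 hence "r : gl" using r unfolding gl_def AA by blast
 thus ?thesis using r(3) that unfolding replica_def by blast
qed

text \<open>Combining row i of rho with the coefficients w intertwines the matrix of dl with its
  invariant vector field, so generalized eigenvectors become generalized eigenfunctions.\<close>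

lemma matrix_coeff_geg: assumes d: "dl : gl" and r: "rep n rho" and w: "w : lin_op.geig (Kn n) (mv n (dmat dl rho)) l" and i: "i < n"
 shows "lc n w (rho i) : geg dl l" proof -
 interpret M: lin_op "Kn n" "mv n (dmat dl rho)" by (rule lin_op_mv)
 interpret lin_op A "dop dl" by (rule lin_op_dop[OF d])
 have rhoA: "!!j. j < n ==> rho i j : A" using repD(1)[OF r i] .
 have D: "dop dl (lc n v (rho i)) = lc n (mv n (dmat dl rho) v) (rho i)" for v proof -
 have "dop dl (lc n v (rho i)) = (SUM j<n. fsc (v j) (dop dl (rho i j)))" proof -
 have "m <= n ==> dop dl (lc m v (rho i)) = (SUM j<m. fsc (v j) (dop dl (rho i j)))" for m proof (induction m)
 case 0
 thus ?case using D_scale[OF zero_A, of 0] by (simp add: lc_def fs0)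
 next
 case (Suc m)
 have "lc m v (rho i) : A" by (rule lc_in[OF subspace]) (use rhoA Suc in auto)
 thus ?case using Suc rhoA[of m] by (simp add: lc_def D_add D_scale scale_in)
 qed
 thus ?thesis by simp
 qed
 also have "... = (SUM j<n. fsc (v j) (lc n (%k. dl (rho k j)) (rho i)))" using dop_rep[OF d r i] by simp
 also have "... = lc n (mv n (dmat dl rho) v) (rho i)" unfolding lc_sum by (rule lc_cong) (simp add: mv_def dmat_def mcm)
 finally show ?thesis .
 qed
 have dmw: "dm l (lc n v (rho i)) = lc n (M.dm l v) (rho i)" for v unfolding dm_def M.dm_def D lc_scale lc_diff by (rule lc_cong) (simp add: fun_at)
 have "(dm l ^^ N) (lc n v (rho i)) = lc n ((M.dm l ^^ N) v) (rho i)" for N v by (induction N) (auto simp: dmw)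
 moreover obtain N where "(M.dm l ^^ N) w = 0" using M.geigD(2)[OF w] by blast
 ultimately have "(dm l ^^ N) (lc n w (rho i)) = 0" by (simp add: lc_def fun_at fs0)
 moreover have "lc n w (rho i) : A" by (rule lc_in[OF subspace rhoA])
 ultimately show ?thesis unfolding geig_def by blast
qed

lemma replica_matrix: assumes d: "dl : gl" and r: "rep n rho" and d': "replica dl psi dl'" and w: "w : lin_op.geig (Kn n) (mv n (dmat dl rho)) l"
 shows "mv n (dmat dl' rho) w = fsc (psi l) w" proof
 fix i
 have dg: "dl' : gl" using d' by (simp add: replica_def)
 have wK: "w : Kn n" using lin_op.geigD(1)[OF lin_op_mv w] .
 show "mv n (dmat dl' rho) w i = fsc (psi l) w i" proof (cases "i < n")
 case True
 have "lc n w (rho i) \<one> = (SUM j<n. if i = j then w j else 0)" unfolding lc_at by (rule sum.cong) (use repD(2)[OF r True] in auto)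
 also have "... = w i" using True by simp
 finally have "dl' (lc n w (rho i)) = psi l * w i" using d' matrix_coeff_geg[OF d r w True] by (simp add: replica_def)
 moreover have "dl' (lc n w (rho i)) = (SUM j<n. w j * dl' (rho i j))" by (rule gl_lc[OF dg repD(1)[OF r True]])
 ultimately show ?thesis using True by (simp add: mv_def dmat_def fun_at mcm)
 next
 case False
 thus ?thesis using wK by (simp add: mv_def Kn_def fun_at)
 qed
qed

lemma nilp_if_traces_vanish: assumes d: "dl : gl" and r: "rep n rho"
 and z: "!!psi dl'. (!!x y. psi (x + y) = psi x + psi y) ==> replica dl psi dl' ==>
 tr n (mm n (dmat dl rho) (dmat dl' rho)) = 0" shows "nilp n (dmat dl rho)" proof -
 define R where "R psi = (SOME dl'. replica dl psi dl')" for psi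
 have R: "replica dl psi (R psi)" if ad: "!!x y. psi (x + y) = psi x + psi y" for psi proof -
 obtain dl' where "replica dl psi dl'" by (rule exists_replica[OF d ad])
 thus ?thesis unfolding R_def by (rule someI[of "replica dl psi"])
 qed
 show ?thesis proof (rule nilp_if_replica_traces_vanish[where N = "%psi. dmat (R psi) rho"])
 fix psi :: "'a => 'a" assume psi: "!!x y. psi (x + y) = psi x + psi y"
 show "mv n (dmat (R psi) rho) w = fsc (psi l) w" if "w : lin_op.geig (Kn n) (mv n (dmat dl rho)) l" for l w
 by (rule replica_matrix[OF d r R[OF psi] that])
 show "tr n (mm n (dmat dl rho) (dmat (R psi) rho)) = 0" by (rule z[OF psi R[OF psi]])
 qed
qed

lemma replica_of_nilp: assumes d: "dl : gl" and r: "rep n rho" and nil: "nilp n (dmat dl rho)"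
 and psi: "!!x y. psi (x + y) = psi x + psi y" and d': "replica dl psi dl'" and ij: "i < n" "j < n" shows "dl' (rho i j) = 0" proof -
 have "unitv j : lin_op.geig (Kn n) (mv n (dmat dl rho)) 0" using nil unitv_in[OF ij(2)] unfolding nilp_geig by blast
 from replica_matrix[OF d r d' this] have "mv n (dmat dl' rho) (unitv j) i = psi 0 * unitv j i" by (simp add: fun_at)
 moreover have "psi 0 = 0" using psi[of 0 0] by simp
 ultimately show ?thesis using mv_unitv[OF ij(2,1), of "dmat dl' rho"] unfolding dmat_def by simp
qed

end

declare minus_apply [simp del] uminus_apply [simp del]
section \<open>Engel's theorem\<close>

text \<open>The conclusion of Engel's theorem for every quotient of stable subspaces: a vector of W
  / W' killed by C. The relative form is needed because the induction applies it both to the module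
  and to the adjoint action on B / C.\<close>

definition eng :: "(('y => 'a::field) => ('x => 'a) => 'x => 'a) => ('x => 'a) set => ('y => 'a) set => bool" where
 "eng phi W0 C \<longleftrightarrow> (ALL W W'. fsub W --> fsub W' --> W' < W --> W <= W0 -->
 (ALL c:C. ALL w:W. phi c w : W) --> (ALL c:C. ALL w:W'. phi c w : W') -->
 (EX w:W - W'. ALL c:C. phi c w : W'))"

lemma engD: assumes "eng phi W0 C" "fsub W" "fsub W'" "W' < W" "W <= W0"
 "!!c w. c : C ==> w : W ==> phi c w : W" "!!c w. c : C ==> w : W' ==> phi c w : W'" shows "EX w:W - W'. ALL c:C. phi c w : W'"
 using assms(1)[unfolded eng_def, rule_format, OF assms(2-5)] assms(6,7) by blast

lemma eng_zero: assumes "!!w. phi 0 w = 0" shows "eng phi W0 {0}" unfolding eng_def using assms fs_0 by auto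

text \<open>Since brackets with Y stay in C, the vectors that C kills modulo W' are preserved by Y.
  The last iterate of Y on such a vector that is still outside W' is killed modulo W' by Y as
  well.\<close>

lemma eng_step: assumes C: "fsub C" "eng phi W0 C" and Y: "!!c. c : C ==> br c Y : C"
 and add: "!!b c w. phi (b + c) w = phi b w + phi c w" and scale: "!!a b w. phi (fsc a b) w = fsc a (phi b w)"
 and hom: "!!b c w. phi (br b c) w = phi b (phi c w) - phi c (phi b w)" and nil: "!!w. w : W0 ==> EX N. (phi Y ^^ N) w = 0"
 shows "eng phi W0 {c + fsc a Y |c a. c : C}" unfolding eng_def proof (intro allI impI)
 fix W W' assume W: "fsub W" and W': "fsub W'" and sub: "W' < W" "W <= W0" and st: "ALL c:{c + fsc a Y |c a. c : C}. ALL w:W. phi c w : W"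
 and st': "ALL c:{c + fsc a Y |c a. c : C}. ALL w:W'. phi c w : W'"
 have C0: "0 : C" by (rule fs_0[OF C(1)])
 have inC: "c : {c + fsc a Y |c a. c : C}" if "c : C" for c proof -
 have "c = c + fsc 0 Y" by (simp add: fs0)
 thus ?thesis using that by blast
 qed
 have inY: "Y : {c + fsc a Y |c a. c : C}" proof -
 have "Y = 0 + fsc 1 Y" by (simp add: fs.scale_one)
 thus ?thesis using C0 by blast
 qed
 have "EX w:W - W'. ALL c:C. phi c w : W'" by (rule engD[OF C(2) W W' sub]) (erule (1) st[rule_format, OF inC] st'[rule_format, OF inC])+
 then obtain w0 where w0: "w0 : W - W'" "ALL c:C. phi c w0 : W'" by blast
 have pw: "(phi Y ^^ k) w0 : W & (ALL c:C. phi c ((phi Y ^^ k) w0) : W')" for k proof (induction k)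
 case 0
 thus ?case using w0 by simp
 next
 case (Suc k)
 let ?w = "(phi Y ^^ k) w0"
 have "phi c (phi Y ?w) : W'" if c: "c : C" for c proof -
 have "phi c (phi Y ?w) = phi Y (phi c ?w) + phi (br c Y) ?w" unfolding hom by simp
 also have "... : W'" by (rule fs_ad[OF W']) (use Suc c Y st' inY in blast)+
 finally show ?thesis .
 qed
 thus ?case using Suc st inY by simp
 qed
 obtain N where N: "(phi Y ^^ N) w0 = 0" using nil w0(1) sub by blast
 define i where "i = (LEAST i. (phi Y ^^ i) w0 : W')"
 have "(phi Y ^^ N) w0 : W'" using N fs_0[OF W'] by simp
 hence i: "(phi Y ^^ i) w0 : W'" unfolding i_def by (rule LeastI)
 have "i ~= 0" using i w0(1) by (metis DiffD2 funpow_0)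
 then obtain k where k: "i = Suc k" by (meson not0_implies_Suc)
 have "(phi Y ^^ k) w0 ~: W'" using not_less_Least[of k "%i. (phi Y ^^ i) w0 : W'"] k unfolding i_def[symmetric] by simp
 moreover have "phi d ((phi Y ^^ k) w0) : W'" if d: "d : {c + fsc a Y |c a. c : C}" for d proof -
 obtain c a where "c : C" "d = c + fsc a Y" using d by blast
 moreover have "phi Y ((phi Y ^^ k) w0) : W'" using i k by simp
 ultimately show ?thesis using pw[of k] unfolding add scale by (simp add: add scale fs_ad[OF W'] fs_sc[OF W'])
 qed
 ultimately show "EX w:W - W'. ALL c:{c + fsc a Y |c a. c : C}. phi c w : W'" using pw[of k] by blast
qed

text \<open>Subalgebras C with the Engel property are enlarged one dimension at a time. The next
  element Y comes from the Engel property of the adjoint action on B / C, which is why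
  \<open>good\<close> carries that property along. As long as B fails, the growth never stops,
  against finite dimension.\<close>

lemma eng_all:
 fixes B :: "('y => 'a::field) set" assumes B: "fsub B" "fd B" "!!b c. b : B ==> c : B ==> br b c : B"
 and add: "!!b c w. phi (b + c) w = phi b w + phi c w" "!!a b w. phi (fsc a b) w = fsc a (phi b w)"
 "!!b c w. phi (br b c) w = phi b (phi c w) - phi c (phi b w)" and nil: "!!b w. b : B ==> w : W0 ==> EX N. (phi b ^^ N) w = 0"
 and br: "!!b c w. br (b + c) w = br b w + br c w" "!!a b w. br (fsc a b) w = fsc a (br b w)"
 "!!b c w. br w (b + c) = br w b + br w c" "!!a b w. br w (fsc a b) = fsc a (br w b)"
 "!!b c w. br (br b c) w = br b (br c w) - br c (br b w)" "!!b. br b b = 0" and ad: "!!b w. b : B ==> w : B ==> EX N. (br b ^^ N) w = 0"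
 shows "eng phi W0 B" proof (rule ccontr)
 assume neg: "\<not> eng phi W0 B"
 define good where "good C \<longleftrightarrow> fsub C & C <= B & (ALL b:C. ALL c:C. br b c : C) & eng phi W0 C & eng br B C" for C
 have z: "f 0 = 0" if "!!a b. f (fsc a b) = fsc a (f b)" for f :: "('u => 'a) => ('v => 'a)" using that[of 0 0] by (simp add: fs0)
 have g0: "good {0}" proof -
 have "br 0 0 = 0" by (rule br(6))
 moreover have "eng phi W0 {0}" by (rule eng_zero) (use add(2)[of 0 0] in \<open>simp add: fs0\<close>)
 moreover have "eng br B {0}" by (rule eng_zero) (use br(2)[of 0 0] in \<open>simp add: fs0\<close>)
 ultimately show ?thesis using fs_0[OF B(1)] unfolding good_def by (simp add: fs_def)
 qed
 have "EX C e. good C & (ALL i<k. e i : C) & (ALL c. lc k c e = 0 --> (ALL i<k. c i = 0))" for k proof (induction k)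
 case 0
 thus ?case using g0 by auto
 next
 case (Suc k)
 then obtain C e where C: "good C" "ALL i<k. e i : C" "ALL c. lc k c e = 0 --> (ALL i<k. c i = 0)" by blast
 have gC: "fsub C" "C <= B" "!!b c. b : C ==> c : C ==> br b c : C" "eng phi W0 C" "eng br B C" using C(1) unfolding good_def by blast+
 have "C ~= B" using neg gC(4) by blast
 hence "C < B" using gC(2) by blast
 then obtain Y where Y: "Y : B - C" "ALL c:C. br c Y : C" using engD[OF gC(5) B(1) gC(1) _ order_refl] B(3) gC(2,3) by blast
 define C' where "C' = {c + fsc a Y |c a. c : C}"
 have sub: "c : C ==> c : C'" for c proof -
 assume "c : C"
 moreover have "c = c + fsc 0 Y" by (simp add: fs0)
 ultimately show ?thesis unfolding C'_def by blast
 qed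
 have YC: "Y : C'" proof -
 have "Y = 0 + fsc 1 Y" by (simp add: fs.scale_one)
 thus ?thesis unfolding C'_def using fs_0[OF gC(1)] by blast
 qed
 have anti: "br c b = - br b c" for b c proof -
 have "br (b + c) (b + c) = br b c + br c b" unfolding br(1,3) by (simp add: br(6))
 hence "br b c + br c b = 0" by (simp add: br(6))
 thus ?thesis by (simp add: eq_neg_iff_add_eq_0 add.commute)
 qed
 have "good C'" unfolding good_def proof (intro conjI ballI)
 show "fsub C'" proof (rule fs.subspaceI)
 show "0 : C'" using sub fs_0[OF gC(1)] by blast
 show "x + y : C'" if xy: "x : C'" "y : C'" for x y proof -
 obtain c a d b where "c : C" "x = c + fsc a Y" "d : C" "y = d + fsc b Y" using xy unfolding C'_def by blast
 moreover from this have "x + y = (c + d) + fsc (a + b) Y" by (simp add: fs.scale_left_distrib)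
 ultimately show ?thesis unfolding C'_def using fs_ad[OF gC(1)] by blast
 qed
 show "fsc b x : C'" if x: "x : C'" for b x proof -
 obtain c a where "c : C" "x = c + fsc a Y" using x unfolding C'_def by blast
 moreover from this have "fsc b x = fsc b c + fsc (b * a) Y" by (simp add: fs.scale_right_distrib fs.scale_scale)
 ultimately show ?thesis unfolding C'_def using fs_sc[OF gC(1)] by blast
 qed
 qed
 show "C' <= B" proof
 fix x assume "x : C'"
 then obtain c a where "c : C" "x = c + fsc a Y" unfolding C'_def by blast
 thus "x : B" using fs_ad[OF B(1)] fs_sc[OF B(1)] Y(1) gC(2) by blast
 qed
 show "br x y : C'" if xy: "x : C'" "y : C'" for x y proof -
 obtain c a d b where cd: "c : C" "x = c + fsc a Y" "d : C" "y = d + fsc b Y" using xy unfolding C'_def by blast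
 have "br x y = br c d + fsc b (br c Y) + fsc a (- br d Y)"
 unfolding cd br(1-4) br(6) anti[of Y d] by (simp add: br(6) fs.scale_zero_right fs.scale_right_distrib)
 also have "... : C" by (intro fs_ad fs_sc fs.subspace_neg gC(1)) (use cd Y(2) gC(3) in auto)
 finally show ?thesis by (rule sub)
 qed
 show "eng phi W0 C'" unfolding C'_def by (rule eng_step[OF gC(1,4) _ add]) (use Y nil in auto)
 show "eng br B C'" unfolding C'_def by (rule eng_step[OF gC(1,5) _ br(1,2,5)]) (use Y ad in auto)
 qed
 moreover define e' where "e' i = (if i < k then e i else Y)" for i
 have "ALL i<Suc k. e' i : C'" using C(2) sub YC by (auto simp: e'_def)
 moreover have "ALL c. lc (Suc k) c e' = 0 --> (ALL i<Suc k. c i = 0)" proof (rule allI, rule impI, rule allI, rule impI)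
 fix c i assume c: "lc (Suc k) c e' = 0" and i: "i < Suc k"
 have s: "lc (Suc k) c e' = lc k c e + fsc (c k) Y" unfolding lc_def by (simp add: e'_def)
 have lC: "lc k c e : C" by (rule lc_in[OF gC(1)]) (use C(2) in blast)
 have "c k = 0" proof (rule ccontr)
 assume nz: "c k ~= 0"
 have "fsc (c k) Y = - lc k c e" using c unfolding s by (simp add: eq_neg_iff_add_eq_0 add.commute)
 hence "fsc (1 / c k) (fsc (c k) Y) : C" using fs_sc[OF gC(1) fs.subspace_neg[OF gC(1) lC]] by metis
 thus False using Y(1) nz by (simp add: fs.scale_scale fs.scale_one)
 qed
 hence "lc k c e = 0" using c unfolding s by (simp add: fs0)
 thus "c i = 0" using C(3) \<open>c k = 0\<close> i less_Suc_eq by metis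
 qed
 ultimately show ?case by blast
 qed
 note chain = this
 obtain F where F: "finite F" "B <= fs.span F" using B(2) unfolding fd_def by blast
 obtain C e where C: "good C" "ALL i<Suc (card F). e i : C"
 "ALL c. lc (Suc (card F)) c e = 0 --> (ALL i<Suc (card F). c i = 0)" using chain[of "Suc (card F)"] by blast
 have "Suc (card F) <= card F" by (rule li_card_bound[OF F(1) _ C(3)]) (use C(1,2) F(2) in \<open>unfold good_def, blast\<close>)
 thus False by simp
qed

text \<open>Matrices become functions on pairs of indices here, so that the notions of subspace and
  dimension for function spaces apply to them; \<open>cm\<close> and \<open>uc\<close> translate
  from and to curried matrices.\<close>

definition pm :: "nat => (nat \<times> nat => 'a::field) => (nat \<times> nat => 'a) => nat \<times> nat => 'a" where
 "pm n P Q = (%(i, j). if i < n & j < n then SUM k<n. P (i, k) * Q (k, j) else 0)"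

definition pbr :: "nat => (nat \<times> nat => 'a::field) => (nat \<times> nat => 'a) => nat \<times> nat => 'a" where
 "pbr n P Q = pm n P Q - pm n Q P"

definition cm :: "nat => (nat => nat => 'a::field) => nat \<times> nat => 'a" where
 "cm n M = (%(i, j). if i < n & j < n then M i j else 0)"

definition uc :: "(nat \<times> nat => 'a) => nat => nat => 'a" where
 "uc P i j = P (i, j)"

lemma pm_linear: "pm n (P + P') Q = pm n P Q + pm n P' Q" "pm n (fsc a P) Q = fsc a (pm n P Q)"
 "pm n P (Q + Q') = pm n P Q + pm n P Q'" "pm n P (fsc a Q) = fsc a (pm n P Q)"
 "pm n (P - P') Q = pm n P Q - pm n P' Q" "pm n P (Q - Q') = pm n P Q - pm n P Q'"
 "pm n 0 Q = 0" "pm n P 0 = 0" by (auto simp: pm_def fun_at fei als sum.distrib sdl sum_subtractf)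

lemma pm_assoc: "pm n (pm n P Q) R = pm n P (pm n Q R)" proof (rule ext, clarify)
 fix i j
 show "pm n (pm n P Q) R (i, j) = pm n P (pm n Q R) (i, j)" proof (cases "i < n & j < n")
 case True
 have "(SUM k<n. (SUM l<n. P (i, l) * Q (l, k)) * R (k, j)) = (SUM k<n. SUM l<n. P (i, l) * Q (l, k) * R (k, j))" by (simp add: sdr)
 also have "... = (SUM l<n. SUM k<n. P (i, l) * Q (l, k) * R (k, j))" by (rule sum.swap)
 also have "... = (SUM l<n. P (i, l) * (SUM k<n. Q (l, k) * R (k, j)))" by (simp add: sdl mult.assoc)
 finally show ?thesis using True by (simp add: pm_def)
 qed (auto simp: pm_def)
qed

lemma mv_uc: "mv n (uc (P + Q)) w = mv n (uc P) w + mv n (uc Q) w"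
 "mv n (uc (fsc a P)) w = fsc a (mv n (uc P) w)"
 "mv n (uc (P - Q)) w = mv n (uc P) w - mv n (uc Q) w" by (auto simp: mv_def uc_def fun_at fei als sum.distrib sdl sum_subtractf)

lemma mv_uc_pm: "mv n (uc (pm n P Q)) w = mv n (uc P) (mv n (uc Q) w)" proof -
 have "mv n (uc (pm n P Q)) w = mv n (mm n (uc P) (uc Q)) w" by (rule ext) (simp add: mv_def mm_def uc_def pm_def)
 thus ?thesis by (simp add: mv_mm)
qed

lemma mv_cm: "mv n (uc (cm n M)) w = mv n M w" by (rule ext) (simp add: mv_def uc_def cm_def)

lemma fd_matrices: "fd {P :: nat \<times> nat => 'a::field. ALL i j. \<not> (i < n & j < n) --> P (i, j) = 0}" unfolding fd_def
proof (intro exI[of _ "(%p q. if q = p then 1 else 0) ` ({..<n} \<times> {..<n})"] conjI subsetI)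
 let ?u = "%p q. if q = p then (1::'a) else 0"
 fix P :: "nat \<times> nat => 'a" assume "P : {P. ALL i j. \<not> (i < n & j < n) --> P (i, j) = 0}"
 hence P: "P q = 0" if "q ~: {..<n} \<times> {..<n}" for q using that by (cases q) auto
 have "P = (SUM p:{..<n} \<times> {..<n}. fsc (P p) (?u p))" proof
 fix q
 have "(SUM p:{..<n} \<times> {..<n}. P p * ?u p q) = (SUM p:{..<n} \<times> {..<n}. if p = q then P p else 0)" by (rule sum.cong) auto
 thus "P q = (SUM p:{..<n} \<times> {..<n}. fsc (P p) (?u p)) q" using P[of q] by (simp add: fun_at)
 qed
 moreover have "(SUM p:{..<n} \<times> {..<n}. fsc (P p) (?u p)) : fs.span (?u ` ({..<n} \<times> {..<n}))"
 by (intro fs.span_sum fs.span_scale fs.span_base) auto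
 ultimately show "P : fs.span (?u ` ({..<n} \<times> {..<n}))" by metis
qed simp

lemma nilp_power: assumes "nilp n (uc P)" and "!!i j. \<not> (i < n & j < n) ==> Q (i, j) = 0" shows "EX N. (pm n P ^^ N) Q = 0" proof -
 have z: "(mv n (uc P) ^^ M) w = 0" if "(mv n (uc P) ^^ N) w = 0" "N <= M" for N M w proof -
 obtain k where "M = k + N" using \<open>N <= M\<close> by (metis le_add_diff_inverse2)
 moreover have "(mv n (uc P) ^^ k) 0 = 0" by (induction k) (auto simp: mv_linear)
 ultimately show ?thesis using that(1) by (simp add: funpow_add)
 qed
 define col where "col R j = (%i. R (i, j))" for R :: "nat \<times> nat => 'a" and j
 have "col Q j : Kn n" for j using assms(2) by (simp add: col_def Kn_def)
 hence "ALL j. EX N. (mv n (uc P) ^^ N) (col Q j) = 0" using assms(1) unfolding nilp_def by blast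
 then obtain N where N: "!!j. (mv n (uc P) ^^ N j) (col Q j) = 0" by metis
 define M where "M = Max (N ` {..<n})"
 have step: "col (pm n P R) j = mv n (uc P) (col R j)" if "j < n" for R j using that by (auto simp: col_def pm_def mv_def uc_def)
 have pw: "col ((pm n P ^^ k) Q) j = (mv n (uc P) ^^ k) (col Q j)" if "j < n" for k j by (induction k) (auto simp: step that)
 have supp: "(pm n P ^^ k) Q (i, j) = 0" if "\<not> (i < n & j < n)" for i j k using that assms(2) by (cases k) (auto simp: pm_def)
 have "(pm n P ^^ M) Q = 0" proof (rule ext, clarify)
 fix i j
 show "(pm n P ^^ M) Q (i, j) = 0 (i, j)" proof (cases "j < n")
 case True
 have "N j <= M" unfolding M_def using True by simp
 hence "col ((pm n P ^^ M) Q) j = 0" unfolding pw[OF True] using z N by blast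
 thus ?thesis by (simp add: col_def fei fun_at)
 qed (use supp in \<open>simp add: fun_at\<close>)
 qed
 thus ?thesis by blast
qed

text \<open>The binomial argument for commuting operators, carried out as induction on the sum of
  the two exponents at a single vector.\<close>

lemma commuting_difference_nilpotent:
 fixes L R :: "('x => 'a::field) => 'x => 'a" assumes lin: "!!x y. L (x - y) = L x - L y" "!!x y. R (x - y) = R x - R y"
 and comm: "!!x. L (R x) = R (L x)" and "(L ^^ a) x = 0" "(R ^^ b) x = 0" shows "EX N. ((%x. L x - R x) ^^ N) x = 0" proof -
 let ?D = "%x. L x - R x"
 have L0: "L 0 = 0" and R0: "R 0 = 0" using lin(1)[of 0 0] lin(2)[of 0 0] by simp_all
 have Ddiff: "(?D ^^ N) (x - y) = (?D ^^ N) x - (?D ^^ N) y" for N x y by (induction N) (simp_all add: lin)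
 have D0: "(?D ^^ N) 0 = 0" for N using Ddiff[of N 0 0] by simp
 have mono: "(?D ^^ M) y = 0" if "(?D ^^ N) y = 0" "N <= M" for N M y proof -
 obtain k where "M = k + N" using \<open>N <= M\<close> by (metis le_add_diff_inverse2)
 thus ?thesis using that(1) D0 by (simp add: funpow_add)
 qed
 have cL: "(L ^^ k) (R y) = R ((L ^^ k) y)" for k y by (induction k) (simp_all add: comm)
 have cR: "(R ^^ k) (L y) = L ((R ^^ k) y)" for k y by (induction k) (simp_all add: comm[symmetric])
 have "EX N. (?D ^^ N) x = 0" if "(L ^^ a) x = 0" "(R ^^ b) x = 0" "a + b <= n" for a b n x using that proof (induction n arbitrary: a b x)
 case (Suc n)
 show ?case proof (cases "a = 0 \<or> b = 0")
 case False
 then obtain a' b' where ab: "a = Suc a'" "b = Suc b'" by (meson not0_implies_Suc)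
 have "(L ^^ a') (L x) = 0" "(R ^^ b) (L x) = 0" "a' + b <= n" using Suc.prems ab(1) unfolding cR by (simp_all add: funpow_swap1 L0)
 then obtain N where N: "(?D ^^ N) (L x) = 0" using Suc.IH by blast
 have "(L ^^ a) (R x) = 0" "(R ^^ b') (R x) = 0" "a + b' <= n" using Suc.prems ab(2) unfolding cL by (simp_all add: funpow_swap1 R0)
 then obtain M where M: "(?D ^^ M) (R x) = 0" using Suc.IH by blast
 have "(?D ^^ max N M) (?D x) = 0" unfolding Ddiff mono[OF N max.cobounded1] mono[OF M max.cobounded2] by simp
 hence "(?D ^^ Suc (max N M)) x = 0" by (simp only: funpow_Suc_right o_apply)
 thus ?thesis by blast
 qed (use Suc.prems in \<open>auto intro: exI[of _ 0]\<close>)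
 qed (auto intro: exI[of _ 0])
 thus ?thesis using assms(4,5) by blast
qed

theorem engel:
 fixes B :: "(nat \<times> nat => 'a::field) set" assumes B: "fsub B" "!!P Q. P : B ==> Q : B ==> pbr n P Q : B"
 and supp: "!!P i j. P : B ==> \<not> (i < n & j < n) ==> P (i, j) = 0" and nil: "!!P. P : B ==> nilp n (uc P)" and n: "n > 0"
 obtains w where "w : Kn n" "w ~= 0" "!!P. P : B ==> mv n (uc P) w = 0" proof -
 have fdB: "fd B" by (rule fd_subset[OF fd_matrices[of n]]) (use supp in blast)
 \<comment> \<open>The k-th power of P is written as left multiplication by P iterated on the
   identity matrix, so that \<open>nilp_power\<close> also covers right multiplication. Both are
   needed because the adjoint action is their difference.\<close>
 have powR: "((%Q. pm n Q P) ^^ k) Q = pm n Q ((pm n P ^^ k) (cm n (%i j. if i = j then 1 else 0)))"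
 if Q: "!!i j. \<not> (i < n & j < n) ==> Q (i, j) = 0" for P Q k proof (induction k)
 case 0
 show ?case proof (rule ext, clarify)
 fix i j
 have "i < n ==> j < n ==> (SUM k<n. Q (i, k) * (if k < n & j < n then if k = j then 1 else 0 else 0)) =
 (SUM k<n. if k = j then Q (i, k) else 0)" by (rule sum.cong) auto
 thus "((%Q. pm n Q P) ^^ 0) Q (i, j) =
 pm n Q ((pm n P ^^ 0) (cm n (%i j. if i = j then 1 else 0))) (i, j)" using Q[of i j] by (auto simp: pm_def cm_def)
 qed
 next
 case (Suc k)
 have "pm n ((pm n P ^^ k) I) P = pm n P ((pm n P ^^ k) I)"
 if "pm n I P = pm n P I" for I proof (induction k)
 case (Suc k)
 thus ?case by (simp add: pm_assoc)
 qed (simp add: that)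
 moreover have "pm n (cm n (%i j. if i = j then 1 else 0)) P = pm n P (cm n (%i j. if i = j then 1 else 0))" proof (rule ext, clarify)
 fix i j
 have "i < n ==> j < n ==> (SUM k<n. P (i, k) * (if k < n & j < n then if k = j then 1 else 0 else 0)) =
 (SUM k<n. if k = j then P (i, k) else 0)"
 "i < n ==> j < n ==> (SUM k<n. (if i < n & k < n then if i = k then 1 else 0 else 0) * P (k, j)) =
 (SUM k<n. if k = i then P (k, j) else 0)" by (rule sum.cong; auto)+
 thus "pm n (cm n (%i j. if i = j then 1 else 0)) P (i, j) =
 pm n P (cm n (%i j. if i = j then 1 else 0)) (i, j)" by (auto simp: pm_def cm_def)
 qed
 ultimately show ?case using Suc by (simp add: pm_assoc)
 qed
 have adnil: "EX N. (pbr n P ^^ N) Q = 0" if P: "P : B" and Q: "Q : B" for P Q proof -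
 obtain a where a: "(pm n P ^^ a) Q = 0" using nilp_power[OF nil[OF P]] supp[OF Q] by blast
 have "EX b. (pm n P ^^ b) (cm n (%i j. if i = j then 1 else 0)) = 0" by (rule nilp_power[OF nil[OF P]]) (auto simp: cm_def)
 then obtain b where b: "(pm n P ^^ b) (cm n (%i j. if i = j then 1 else 0)) = 0" by blast
 have "((%Q. pm n Q P) ^^ b) Q = pm n Q ((pm n P ^^ b) (cm n (%i j. if i = j then 1 else 0)))" by (rule powR) (rule supp[OF Q])
 hence b': "((%Q. pm n Q P) ^^ b) Q = 0" unfolding b by (simp add: pm_linear)
 have "EX N. ((%x. pm n P x - pm n x P) ^^ N) Q = 0" by (rule commuting_difference_nilpotent[OF _ _ _ a b']) (simp_all add: pm_linear pm_assoc)
 thus ?thesis by (simp add: pbr_def[abs_def])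
 qed
 have "eng (%P. mv n (uc P)) (Kn n) B" proof (rule eng_all[where br = "pbr n", OF B(1) fdB B(2)])
 show "mv n (uc (pbr n P Q)) w = mv n (uc P) (mv n (uc Q) w) - mv n (uc Q) (mv n (uc P) w)" for P Q w by (simp add: pbr_def mv_uc mv_uc_pm)
 show "EX N. (mv n (uc P) ^^ N) w = 0" if "P : B" "w : Kn n" for P w using nil that unfolding nilp_def by blast
 show "EX N. (pbr n P ^^ N) Q = 0" if "P : B" "Q : B" for P Q by (rule adnil[OF that])
 show "pbr n (pbr n b c) w = pbr n b (pbr n c w) - pbr n c (pbr n b w)" for b c w by (simp add: pbr_def pm_linear pm_assoc als)
 qed (simp_all add: mv_uc pbr_def pm_linear fs_rd)
 moreover have "{0} < (Kn n :: (nat => 'a) set)" proof -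
 have "unitv 0 : (Kn n :: (nat => 'a) set)" by (rule unitv_in[OF n])
 moreover have "unitv 0 ~= (0 :: nat => 'a)" by (auto simp: unitv_def fei fun_at)
 moreover have "0 : (Kn n :: (nat => 'a) set)" by (rule fs_0[OF subspace_Kn])
 ultimately show ?thesis by auto
 qed
 moreover have "fsub {0 :: nat => 'a}" by (simp add: fs_def)
 ultimately have "EX w:Kn n - {0}. ALL P:B. mv n (uc P) w : {0}" by (intro engD[OF _ subspace_Kn _ _ order_refl]) (auto simp: mv_in mv_linear)
 thus ?thesis using that by blast
qed

section \<open>Irreducible representations and the unipotent radical\<close>

definition sz :: "('x => 'a::field) set => nat" where
 "sz M = (SOME n. EX e. bmod {0} M n e)"

lemma sz_basis:
 fixes M :: "('x => 'a::field) set" assumes "fsub M" "fd M"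
 obtains e where "bmod {0} M (sz M) e" proof -
 have z: "fsub {0 :: 'x => 'a}" by (simp add: fs_def)
 have zM: "{0} <= M" using fs_0[OF assms(1)] by simp
 obtain n e where "bmod {0} M n e" by (rule exists_bmod[OF z assms zM])
 hence "EX n e. bmod {0} M n e" by blast
 hence "EX e. bmod {0} M (sz M) e" unfolding sz_def by (rule someI_ex)
 thus ?thesis using that by blast
qed

lemma sz_strict_mono: assumes M: "fsub M" and T: "fsub T" "fd T" and MT: "M < T" shows "sz M < sz T" proof -
 have "fd M" using T(2) MT fd_subset by blast
 then obtain e where e: "bmod {0} M (sz M) e" using sz_basis[OF M] by blast
 obtain f where f: "bmod {0} T (sz T) f" using sz_basis[OF T] by blast
 obtain y where y: "y : T" "y ~: M" using MT by blast
 define n where "n = sz M"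
 define h where "h i = (if i < n then e i else y)" for i
 have fT: "t : fs.span (f ` {..<sz T})" if t: "t : T" for t proof -
 obtain c where "t - lc (sz T) c f : {0}" using bmD(3)[OF f t] by blast
 hence "t = lc (sz T) c f" by simp
 moreover have "lc (sz T) c f : fs.span (f ` {..<sz T})" by (intro lc_in fs.subspace_span fs.span_base) auto
 ultimately show ?thesis by simp
 qed
 have eM: "e i : M" if "i < n" for i using bmD(1)[OF e] that by (simp add: n_def)
 have "Suc n <= card (f ` {..<sz T})" proof (rule li_card_bound[where e = h])
 show "h i : fs.span (f ` {..<sz T})" if "i < Suc n" for i using fT eM MT y(1) by (auto simp: h_def)
 show "ALL c. lc (Suc n) c h = 0 --> (ALL i<Suc n. c i = 0)" proof (rule allI, rule impI, rule allI, rule impI)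
 fix c i assume c: "lc (Suc n) c h = 0" and i: "i < Suc n"
 have s: "lc (Suc n) c h = lc n c e + fsc (c n) y" unfolding lc_def by (simp add: h_def)
 have lM: "lc n c e : M" by (rule lc_in[OF M eM])
 have cn: "c n = 0" proof (rule ccontr)
 assume nz: "c n ~= 0"
 have "fsc (c n) y = - lc n c e" using c unfolding s by (simp add: eq_neg_iff_add_eq_0 add.commute)
 hence "fsc (1 / c n) (fsc (c n) y) : M" using fs_sc[OF M fs.subspace_neg[OF M lM]] by metis
 thus False using y(2) nz by (simp add: fs.scale_scale fs.scale_one)
 qed
 hence "lc n c e : {0}" using c unfolding s by (simp add: fs0)
 thus "c i = 0" using bmD(2)[OF e] cn i less_Suc_eq unfolding n_def by metis
 qed
 qed simp
 also have "... <= sz T" using card_image_le[of "{..<sz T}" f] by simp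
 finally show ?thesis by (simp add: n_def)
qed

context aff_group
begin

definition mat :: "(nat => nat => 'g => 'a) => 'g => nat => nat => 'a" where
 "mat rho g = (%i j. rho i j g)"

lemma mv_mat_mult: assumes "rep n rho" "g : cr G" "h : cr G" shows "mv n (mat rho g) (mv n (mat rho h) w) = mv n (mat rho (g \<otimes> h)) w"
 unfolding mv_mm[symmetric] using repD(3)[OF assms(1) _ _ assms(2,3)] by (intro ext) (simp add: mv_def mm_def mat_def)

lemma mv_mat_one: assumes "rep n rho" "w : Kn n" shows "mv n (mat rho \<one>) w = w" proof
 fix i
 have "i < n ==> (SUM j<n. rho i j \<one> * w j) = (SUM j<n. if i = j then w j else 0)" using repD(2)[OF assms(1)] by (intro sum.cong) auto
 thus "mv n (mat rho \<one>) w i = w i" using assms(2) by (simp add: mv_def mat_def Kn_def)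
qed

definition irred :: "nat => (nat => nat => 'g => 'a) => bool" where
 "irred n rho \<longleftrightarrow> rep n rho & n > 0 & (ALL W. fsub W --> W <= Kn n -->
 (ALL g:cr G. ALL w:W. mv n (mat rho g) w : W) --> W = {0} \<or> W = Kn n)"

lemma irredD: assumes "irred n rho" shows "rep n rho" "n > 0" "fsub W ==> W <= Kn n ==>
 (!!g w. g : cr G ==> w : W ==> mv n (mat rho g) w : W) ==> W = {0} \<or> W = Kn n" using assms unfolding irred_def by blast+

text \<open>An invariant subspace W of coordinate vectors lifts to the right-stable space N between
  M and T; simplicity leaves only the two extremes for N, hence for W.\<close>

lemma simple_quotient_irred: assumes M: "rstable M" and T: "rstable T" and MT: "M < T"
 and simple: "!!N. rstable N ==> M <= N ==> N <= T ==> N = M \<or> N = T" and e: "bmod M T n e" and rho: "rep n rho"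
 and rel: "!!g j. g : cr G ==> j < n ==> rt g (e j) - lc n (%i. rho i j g) e : M" shows "irred n rho" unfolding irred_def
proof (intro conjI allI impI)
 note sM = rsD(2)[OF M] and sT = rsD(2)[OF T]
 have eT: "e j : T" if "j < n" for j by (rule bmD(1)[OF e that])
 show "rep n rho" by (rule rho)
 show "n > 0" proof (rule ccontr)
 assume "\<not> n > 0"
 hence "n = 0" by simp
 hence "lc n c e = 0" for c by (simp add: lc_def)
 hence "T <= M" using bmD(3)[OF e] by fastforce
 thus False using MT by blast
 qed
 fix W assume W: "fsub W" "W <= Kn n" "ALL g:cr G. ALL w:W. mv n (mat rho g) w : W"
 define N where "N = {m + lc n w e |m w. m : M & w : W}"
 have lcT: "lc n w e : T" for w by (rule lc_in[OF sT eT])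
 have lcadd: "lc n (v + w) e = lc n v e + lc n w e" for v w unfolding lc_add by (rule lc_cong) (simp add: fun_at)
 have lcsc: "lc n (fsc a w) e = fsc a (lc n w e)" for a w unfolding lc_scale by (rule lc_cong) (simp add: fun_at)
 have lc0: "lc n 0 e = 0" using lcsc[of 0 0] by (simp add: fs0)
 have rtlc: "rt g (lc n w e) - lc n (mv n (mat rho g) w) e : M" if g: "g : cr G" for g w proof -
 have "(SUM j<n. fsc (w j) (rt g (e j) - lc n (%i. rho i j g) e)) : M" by (intro fs.subspace_sum fs_sc sM rel[OF g]) auto
 moreover have "(SUM j<n. fsc (w j) (rt g (e j) - lc n (%i. rho i j g) e)) =
 rt g (lc n w e) - (SUM j<n. fsc (w j) (lc n (%i. rho i j g) e))" unfolding rt_lc by (simp add: lc_def[of n w] fs_rd sum_subtractf)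
 moreover have "(SUM j<n. fsc (w j) (lc n (%i. rho i j g) e)) = lc n (mv n (mat rho g) w) e"
 unfolding lc_sum by (rule lc_cong) (simp add: mv_def mat_def mcm)
 ultimately show ?thesis by simp
 qed
 have "rstable N" unfolding rstable_def proof (intro conjI ballI)
 show "N <= A" proof
 fix x assume "x : N"
 then obtain m w where "m : M" "x = m + lc n w e" unfolding N_def by blast
 thus "x : A" using add_in rsD(1)[OF M] rsD(1)[OF T] lcT by blast
 qed
 show "fsub N" proof (rule fs.subspaceI)
 have "0 = 0 + lc n 0 e" by (simp add: lc0)
 thus "0 : N" unfolding N_def using fs_0[OF sM] fs_0[OF W(1)] by blast
 show "x + y : N" if xy: "x : N" "y : N" for x y proof -
 obtain m w m' w' where "m : M" "w : W" "x = m + lc n w e" "m' : M" "w' : W" "y = m' + lc n w' e" using xy unfolding N_def by blast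
 moreover from this have "x + y = (m + m') + lc n (w + w') e" by (simp add: lcadd)
 ultimately show ?thesis unfolding N_def using fs_ad[OF sM] fs_ad[OF W(1)] by blast
 qed
 show "fsc a x : N" if x: "x : N" for a x proof -
 obtain m w where "m : M" "w : W" "x = m + lc n w e" using x unfolding N_def by blast
 moreover from this have "fsc a x = fsc a m + lc n (fsc a w) e" by (simp add: lcsc fs.scale_right_distrib)
 ultimately show ?thesis unfolding N_def using fs_sc[OF sM] fs_sc[OF W(1)] by blast
 qed
 qed
 fix g x assume g: "g : cr G" and x: "x : N"
 obtain m w where mw: "m : M" "w : W" "x = m + lc n w e" using x unfolding N_def by blast
 have "rt g x = (rt g m + (rt g (lc n w e) - lc n (mv n (mat rho g) w) e)) + lc n (mv n (mat rho g) w) e" unfolding mw(3) rt_linear by simp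
 moreover have "rt g m + (rt g (lc n w e) - lc n (mv n (mat rho g) w) e) : M" by (rule fs_ad[OF sM rsD(3)[OF M g mw(1)] rtlc[OF g]])
 ultimately show "rt g x : N" unfolding N_def using W(3) g mw(2) by blast
 qed
 moreover have "M <= N" proof
 fix m assume "m : M"
 moreover have "m = m + lc n 0 e" by (simp add: lc0)
 ultimately show "m : N" unfolding N_def using fs_0[OF W(1)] by blast
 qed
 moreover have "N <= T" proof
 fix x assume "x : N"
 then obtain m w where "m : M" "x = m + lc n w e" unfolding N_def by blast
 thus "x : T" using fs_ad[OF sT] MT lcT by blast
 qed
 ultimately consider "N = M" | "N = T" using simple by blast
 thus "W = {0} \<or> W = Kn n" proof cases
 case 1
 have "w = 0" if w: "w : W" for w proof
 fix i
 have "0 + lc n w e : N" unfolding N_def using w fs_0[OF sM] by blast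
 hence "lc n w e : M" using 1 by simp
 hence "i < n ==> w i = 0" using bmD(2)[OF e] by blast
 moreover have "i >= n ==> w i = 0" using w W(2) by (auto simp: Kn_def)
 ultimately show "w i = 0 i" by (simp add: fun_at not_less[symmetric]) blast
 qed
 thus ?thesis using fs_0[OF W(1)] by blast
 next
 case 2
 have "v : W" if v: "v : Kn n" for v proof -
 have "lc n v e : N" using 2 lcT by simp
 then obtain m w where mw: "m : M" "w : W" "lc n v e = m + lc n w e" unfolding N_def by blast
 hence "lc n v e - lc n w e : M" by simp
 hence "lc n (%i. v i - w i) e : M" by (simp only: lc_diff)
 hence "i < n ==> v i - w i = 0" for i using bmD(2)[OF e] by blast
 moreover have "i >= n ==> v i = w i" for i using v mw(2) W(2) by (auto simp: Kn_def)
 ultimately have "v = w" by (intro ext) (metis eq_iff_diff_eq_0 not_less)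
 thus ?thesis using mw(2) by simp
 qed
 thus ?thesis using W(2) by blast
 qed
qed

lemma exists_irreducible_quotient: assumes M: "rstable M" and T: "rstable T" "fd T" and MT: "M < T"
 obtains T' n e rho where "rstable T'" "M < T'" "T' <= T" "bmod M T' n e" "irred n rho"
 "!!g j. g : cr G ==> j < n ==> rt g (e j) - lc n (%i. rho i j g) e : M" proof -
 define P where "P N \<longleftrightarrow> rstable N & M < N & N <= T" for N
 have "P T" using T MT by (simp add: P_def)
 then obtain T' where T': "P T'" "!!N. P N ==> sz T' <= sz N" by (metis ex_has_least_nat)
 have T'D: "rstable T'" "M < T'" "T' <= T" using T'(1) by (auto simp: P_def)
 have fdT': "fd T'" by (rule fd_subset[OF T(2) T'D(3)])
 have simple: "N = M \<or> N = T'" if "rstable N" "M <= N" "N <= T'" for N proof (rule ccontr)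
 assume "\<not> ?thesis"
 hence "P N" "N < T'" using that T'D by (auto simp: P_def)
 thus False using T'(2) sz_strict_mono[OF rsD(2)[OF that(1)] rsD(2)[OF T'D(1)] fdT'] by fastforce
 qed
 obtain n e where e: "bmod M T' n e" by (rule exists_bmod[OF rsD(2)[OF M] rsD(2)[OF T'D(1)] fdT']) (use T'D in auto)
 obtain rho where rho: "rep n rho"
 "!!g j. g : cr G ==> j < n ==> rt g (e j) - lc n (%i. rho i j g) e : M" by (rule basis_mod_rep[OF M T'D(1) fdT' _ e]) (use T'D in auto)
 show ?thesis by (rule that[OF T'D e simple_quotient_irred[OF M T'D(1,2) simple e rho] rho(2)])
qed

section \<open>The adjoint action and Lie ideals of nilpotent elements\<close>

definition Ad :: "'g => (('g => 'a) => 'a) => ('g => 'a) => 'a" where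
 "Ad g dl = (%f. dl (lt g (rt (inv g) f)))"

text \<open>The Lie bracket: the commutator of the two invariant vector fields, evaluated at the
  identity.\<close>

definition brf :: "(('g => 'a) => 'a) => (('g => 'a) => 'a) => ('g => 'a) => 'a" where
 "brf dl ep = (%f. dl (dop ep f) - ep (dop dl f))"

lemma Ad_gl: assumes "g : cr G" "dl : gl" shows "Ad g dl : gl" proof -
 have "lt g (rt (inv g) f) \<one> = f \<one>" for f using assms(1) by (simp add: lt_at rt_at)
 thus ?thesis using assms unfolding gl_def Ad_def by (simp add: lt_linear rt_linear lt_in rt_in)
qed

lemma dmat_Ad: assumes r: "rep n rho" and g: "g : cr G" and d: "dl : gl" and ij: "i < n" "j < n"
 shows "dmat (Ad g dl) rho i j = mm n (mat rho g) (mm n (dmat dl rho) (mat rho (inv g))) i j" proof -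
 define F where "F = (SUM k<n. fsc (rho i k g) (SUM l<n. fsc (rho l j (inv g)) (rho k l)))"
 have "lt g (rt (inv g) (rho i j)) = F" proof (rule fun_ext)
 show "lt g (rt (inv g) (rho i j)) : A" by (intro lt_in rt_in repD(1)[OF r ij]) (use g in auto)
 show "F : A" unfolding F_def by (intro sum_in scale_in repD(1)[OF r]) auto
 fix x assume x: "x : cr G"
 have "lt g (rt (inv g) (rho i j)) x = rho i j (g \<otimes> (x \<otimes> inv g))" using g x by (simp add: lt_at rt_at m_assoc)
 also have "... = (SUM k<n. rho i k g * (SUM l<n. rho k l x * rho l j (inv g)))" using g x repD(3)[OF r] ij by simp
 finally show "lt g (rt (inv g) (rho i j)) x = F x" by (simp add: F_def fun_at mcm)
 qed
 hence "dmat (Ad g dl) rho i j = dl F" by (simp add: dmat_def Ad_def)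
 also have "... = (SUM k<n. rho i k g * dl (SUM l<n. fsc (rho l j (inv g)) (rho k l)))"
 unfolding F_def lc_def[symmetric, where n = n and c = "%k. rho i k g" and e = "%k. SUM l<n. fsc (rho l j (inv g)) (rho k l)"]
 by (rule gl_lc[OF d]) (intro sum_in scale_in repD(1)[OF r]; simp)
 also have "... = (SUM k<n. rho i k g * (SUM l<n. rho l j (inv g) * dl (rho k l)))" proof (rule sum.cong)
 fix k assume "k : {..<n}"
 thus "rho i k g * dl (SUM l<n. fsc (rho l j (inv g)) (rho k l)) =
 rho i k g * (SUM l<n. rho l j (inv g) * dl (rho k l))" using gl_lc[OF d, of n "rho k" "%l. rho l j (inv g)"] repD(1)[OF r] by (simp add: lc_def)
 qed simp
 finally show ?thesis by (simp add: mm_def mat_def dmat_def mcm)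
qed

lemma brf_gl: assumes "dl : gl" "ep : gl" shows "brf dl ep : gl" proof -
 interpret D: lin_op A "dop dl" by (rule lin_op_dop[OF assms(1)])
 interpret E: lin_op A "dop ep" by (rule lin_op_dop[OF assms(2)])
 note d = glD[OF assms(1)] and e = glD[OF assms(2)]
 show ?thesis unfolding gl_def brf_def proof (intro CollectI conjI ballI allI)
 fix f h assume f: "f : A" and h: "h : A"
 show "dl (dop ep (f + h)) - ep (dop dl (f + h)) =
 dl (dop ep f) - ep (dop dl f) + (dl (dop ep h) - ep (dop dl h))" using f h by (simp add: D.D_add E.D_add d(1) e(1) D.D_in E.D_in)
 show "dl (dop ep (fsc c f)) - ep (dop dl (fsc c f)) = c * (dl (dop ep f) - ep (dop dl f))" for c
 using f by (simp add: D.D_scale E.D_scale d(2) e(2) D.D_in E.D_in als)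
 have "dl (dop ep (f * h)) = f \<one> * dl (dop ep h) + dl f * ep h + (ep f * dl h + dl (dop ep f) * h \<one>)"
 unfolding dop_mult[OF assms(2) f h] using f h by (simp add: d(1,3) E.D_in mult_in dop_one)
 moreover have "ep (dop dl (f * h)) = f \<one> * ep (dop dl h) + ep f * dl h + (dl f * ep h + ep (dop dl f) * h \<one>)"
 unfolding dop_mult[OF assms(1) f h] using f h by (simp add: e(1,3) D.D_in mult_in dop_one)
 ultimately show "dl (dop ep (f * h)) - ep (dop dl (f * h)) =
 f \<one> * (dl (dop ep h) - ep (dop dl h)) + (dl (dop ep f) - ep (dop dl f)) * h \<one>" by (simp add: als)
 qed
qed

lemma dmat_brf: assumes r: "rep n rho" and d: "dl : gl" "ep : gl" and ij: "i < n" "j < n"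
 shows "dmat (brf dl ep) rho i j = mm n (dmat dl rho) (dmat ep rho) i j - mm n (dmat ep rho) (dmat dl rho) i j"
 unfolding dmat_def brf_def mm_def dop_rep[OF d(1) r ij] dop_rep[OF d(2) r ij]
 by (simp add: gl_lc[OF d(1) repD(1)[OF r ij(1)]] gl_lc[OF d(2) repD(1)[OF r ij(1)]] mcm)

text \<open>Stability under the whole of G by \<open>Ad\<close> is the form in which ideals are
  used: it makes the vectors annihilated by L a G-stable subspace.\<close>

definition lie_sub :: "(('g => 'a) => 'a) set => bool" where
 "lie_sub L \<longleftrightarrow> L <= gl & fsub L & (ALL dl:L. ALL ep:L. brf dl ep : L) &
 (ALL g:cr G. ALL dl:L. Ad g dl : L)"

lemma lie_subD: assumes "lie_sub L" shows "L <= gl" "fsub L" "dl : L ==> ep : L ==> brf dl ep : L" "g : cr G ==> dl : L ==> Ad g dl : L"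
 using assms unfolding lie_sub_def by blast+

text \<open>Engel's theorem gives a nonzero vector annihilated by all of L. The vectors annihilated
  by L form a G-stable subspace, which irreducibility makes the whole space.\<close>

lemma nilpotent_ideal_acts_trivially: assumes L: "lie_sub L" and ir: "irred n rho" and nil: "!!dl. dl : L ==> nilp n (dmat dl rho)"
 and d: "dl : L" and ij: "i < n" "j < n" shows "dl (rho i j) = 0" proof -
 note r = irredD(1)[OF ir]
 have Lg: "!!dl. dl : L ==> dl : gl" using lie_subD(1)[OF L] by blast
 define B where "B = (%dl. cm n (dmat dl rho)) ` L"
 have sB: "fsub B" proof (rule fs.subspaceI)
 have "cm n (dmat 0 rho) = 0" by (auto simp: cm_def dmat_def fun_at)
 thus "0 : B" unfolding B_def using fs_0[OF lie_subD(2)[OF L]] by (metis imageI)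
 show "x + y : B" if "x : B" "y : B" for x y proof -
 from that obtain dl ep where "dl : L" "ep : L" "x = cm n (dmat dl rho)" "y = cm n (dmat ep rho)" unfolding B_def by blast
 moreover from this have "x + y = cm n (dmat (dl + ep) rho)" by (auto simp: cm_def dmat_def fun_at)
 ultimately show ?thesis unfolding B_def using fs_ad[OF lie_subD(2)[OF L]] by blast
 qed
 show "fsc c x : B" if "x : B" for c x proof -
 from that obtain dl where "dl : L" "x = cm n (dmat dl rho)" unfolding B_def by blast
 moreover from this have "fsc c x = cm n (dmat (fsc c dl) rho)" by (auto simp: cm_def dmat_def fun_at)
 ultimately show ?thesis unfolding B_def using fs_sc[OF lie_subD(2)[OF L]] by blast
 qed
 qed
 obtain w where w: "w : Kn n" "w ~= 0" "!!P. P : B ==> mv n (uc P) w = 0" proof (rule engel[OF sB])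
 show "pbr n P Q : B" if "P : B" "Q : B" for P Q proof -
 from that obtain dl ep where de: "dl : L" "ep : L" "P = cm n (dmat dl rho)" "Q = cm n (dmat ep rho)" unfolding B_def by blast
 have "pbr n P Q = cm n (dmat (brf dl ep) rho)" using dmat_brf[OF r Lg[OF de(1)] Lg[OF de(2)]]
 by (auto simp: pbr_def pm_def cm_def fun_at de(3,4) mm_def fei)
 thus ?thesis unfolding B_def using lie_subD(3)[OF L de(1,2)] by blast
 qed
 show "P (i, j) = 0" if "P : B" "\<not> (i < n & j < n)" for P i j using that by (auto simp: B_def cm_def)
 show "nilp n (uc P)" if "P : B" for P using that nil unfolding B_def nilp_def by (auto simp: mv_cm[abs_def])
 show "n > 0" by (rule irredD(2)[OF ir])
 qed blast
 define W where "W = {v : Kn n. ALL dl:L. mv n (dmat dl rho) v = 0}"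
 have "W = {0} \<or> W = Kn n" proof (rule irredD(3)[OF ir])
 show "fsub W" using subspace_Kn by (auto simp: W_def fs_def mv_linear)
 show "W <= Kn n" by (auto simp: W_def)
 fix g v assume g: "g : cr G" and v: "v : W"
 have "mv n (dmat dl rho) (mv n (mat rho g) v) = 0" if dl: "dl : L" for dl proof -
 have gi: "inv g : cr G" using g by simp
 let ?X = "mv n (dmat dl rho) (mv n (mat rho g) v)"
 have "mv n (dmat (Ad (inv g) dl) rho) v =
 mv n (mm n (mat rho (inv g)) (mm n (dmat dl rho) (mat rho (inv (inv g))))) v" using dmat_Ad[OF r gi Lg[OF dl]] by (intro ext) (simp add: mv_def)
 also have "... = mv n (mat rho (inv g)) ?X" using g by (simp add: mv_mm)
 finally have "mv n (mat rho (inv g)) ?X = 0" using v lie_subD(4)[OF L gi dl] by (simp add: W_def)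
 hence "mv n (mat rho g) (mv n (mat rho (inv g)) ?X) = 0" by (simp add: mv_linear)
 thus ?thesis unfolding mv_mat_mult[OF r g gi] using g mv_mat_one[OF r mv_in] by simp
 qed
 thus "mv n (mat rho g) v : W" by (simp add: W_def mv_in)
 qed
 moreover have "w : W" using w(1,3) by (auto simp: W_def B_def mv_cm[symmetric, of n "dmat _ rho"])
 ultimately have "W = Kn n" using w(2) by blast
 hence "mv n (dmat dl rho) (unitv j) = 0" using unitv_in[OF ij(2)] d by (auto simp: W_def)
 hence "mv n (dmat dl rho) (unitv j) i = 0" by (simp add: fun_at)
 thus ?thesis unfolding mv_unitv[OF ij(2,1)] by (simp add: dmat_def)
qed

section \<open>The common kernel of the irreducible representations\<close>

definition Nrad :: "'g set" where
 "Nrad = {g : cr G. ALL n rho. irred n rho --> (ALL i<n. ALL j<n. rho i j g = (if i = j then 1 else 0))}"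

lemma NradD: "g : Nrad ==> g : cr G"
 "g : Nrad ==> irred n rho ==> i < n ==> j < n ==> rho i j g = (if i = j then 1 else 0)" by (auto simp: Nrad_def)

lemma Nrad_normal: "Nrad \<lhd> G" proof -
 have prod: "(SUM k<n. (if i = k then 1 else 0) * (if k = j then 1 else 0)) = (if i = j then 1 else (0::'a))"
 if "i < n" for i j n :: nat proof -
 have eq: "(SUM k<n. (if i = k then 1 else 0) * (if k = j then 1 else 0)) =
 (SUM k<n. if k = i then (if i = j then 1 else (0::'a)) else 0)" by (rule sum.cong) auto
 show ?thesis unfolding eq using that by simp
 qed
 have conj: "g \<otimes> h \<otimes> inv g : Nrad" if g: "g : cr G" and h: "h : Nrad" for g h unfolding Nrad_def
 proof (intro CollectI conjI allI impI)
 show "g \<otimes> h \<otimes> inv g : cr G" using g NradD(1)[OF h] by simp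
 fix n rho i j assume ir: "irred n rho" and ij: "i < n" "j < n"
 note r = irredD(1)[OF ir] and hG = NradD(1)[OF h]
 have gh: "rho i k (g \<otimes> h) = rho i k g" if k: "k < n" for k proof -
 have "rho i k (g \<otimes> h) = (SUM l<n. rho i l g * (if l = k then 1 else 0))" using repD(3)[OF r ij(1) k g hG] NradD(2)[OF h ir _ k] by simp
 also have "... = (SUM l<n. if l = k then rho i l g else 0)" by (rule sum.cong) auto
 finally show ?thesis using k by simp
 qed
 have "rho i j (g \<otimes> h \<otimes> inv g) = (SUM k<n. rho i k g * rho k j (inv g))"
 using repD(3)[OF r ij, of "g \<otimes> h" "inv g"] g hG gh by simp
 also have "... = rho i j (g \<otimes> inv g)" using repD(3)[OF r ij g, of "inv g"] g by simp
 also have "... = (if i = j then 1 else 0)" using g repD(2)[OF r ij] by simp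
 finally show "rho i j (g \<otimes> h \<otimes> inv g) = (if i = j then 1 else 0)" .
 qed
 have "subgroup Nrad G" proof (rule subgroupI)
 show "Nrad <= cr G" using NradD(1) by blast
 show "Nrad ~= {}" using repD(2)[OF irredD(1)] by (auto simp: Nrad_def intro!: exI[of _ \<one>])
 show "inv h : Nrad" if h: "h : Nrad" for h unfolding Nrad_def proof (intro CollectI conjI allI impI)
 show "inv h : cr G" using NradD(1)[OF h] by simp
 fix n rho i j assume ir: "irred n rho" and ij: "i < n" "j < n"
 note r = irredD(1)[OF ir] and hG = NradD(1)[OF h]
 have "rho i j (h \<otimes> inv h) = (SUM l<n. (if i = l then 1 else 0) * rho l j (inv h))"
 using repD(3)[OF r ij hG, of "inv h"] NradD(2)[OF h ir ij(1)] hG by simp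
 also have "... = (SUM l<n. if l = i then rho l j (inv h) else 0)" by (rule sum.cong) auto
 also have "... = rho i j (inv h)" using ij by simp
 finally show "rho i j (inv h) = (if i = j then 1 else 0)" using hG repD(2)[OF r ij] by simp
 qed
 show "g \<otimes> h : Nrad" if g: "g : Nrad" and h: "h : Nrad" for g h unfolding Nrad_def proof (intro CollectI conjI allI impI)
 show "g \<otimes> h : cr G" using NradD(1) g h by simp
 fix n rho i j assume ir: "irred n rho" and ij: "i < n" "j < n"
 have "rho i j (g \<otimes> h) = (SUM k<n. (if i = k then 1 else 0) * (if k = j then 1 else 0))"
 using repD(3)[OF irredD(1)[OF ir] ij NradD(1)[OF g] NradD(1)[OF h]]
 NradD(2)[OF g ir ij(1)] NradD(2)[OF h ir _ ij(2)] by simp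
 thus "rho i j (g \<otimes> h) = (if i = j then 1 else 0)" using prod[OF ij(1)] by simp
 qed
 qed
 thus ?thesis unfolding normal_inv_iff using conj by blast
qed

lemma Nrad_zero_set:
 obtains S where "S <= A" "Nrad = {x : cr G. ALL f:S. f x = 0}" proof
 define S where "S = {rho i j - cst (cr G) (if i = j then 1 else 0) |n rho i j. irred n rho & i < n & j < n}"
 show "S <= A" proof
 fix f assume "f : S"
 then obtain n rho i j where f: "f = rho i j - cst (cr G) (if i = j then 1 else 0)" "irred n rho" "i < n" "j < n" unfolding S_def by blast
 show "f : A" unfolding f(1) by (rule diff_in[OF repD(1)[OF irredD(1)[OF f(2)] f(3,4)] cst_in])
 qed
 have iff: "(rho i j - cst (cr G) (if i = j then 1 else 0)) x = 0 \<longleftrightarrow> rho i j x = (if i = j then 1 else 0)"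
 if "x : cr G" for rho :: "nat => nat => 'g => 'a" and i j x using that by (simp add: fun_at cst_at)
 show "Nrad = {x : cr G. ALL f:S. f x = 0}" proof (intro subset_antisym subsetI)
 fix x assume x: "x : Nrad"
 have "f x = 0" if fS: "f : S" for f proof -
 obtain n rho i j where f: "f = rho i j - cst (cr G) (if i = j then 1 else 0)" "irred n rho" "i < n" "j < n" using fS unfolding S_def by blast
 show ?thesis unfolding f(1) iff[OF NradD(1)[OF x]] by (rule NradD(2)[OF x f(2-4)])
 qed
 thus "x : {x : cr G. ALL f:S. f x = 0}" using NradD(1)[OF x] by blast
 next
 fix x assume "x : {x : cr G. ALL f:S. f x = 0}"
 hence x: "x : cr G" "ALL f:S. f x = 0" by auto
 show "x : Nrad" unfolding Nrad_def proof (intro CollectI conjI allI impI x(1))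
 fix n rho i j assume "irred n rho" "i < n" "j < n"
 hence "rho i j - cst (cr G) (if i = j then 1 else 0) : S" unfolding S_def by blast
 thus "rho i j x = (if i = j then 1 else 0)" using x(2) iff[OF x(1)] by blast
 qed
 qed
qed

text \<open>Inside a finite-dimensional stable T containing f, take a stable M of largest size on
  which \<open>rt u\<close> minus the identity is locally nilpotent. On the next irreducible
  quotient above M the element u acts as the identity, so the nilpotency would extend to it unless M
  is already T.\<close>

lemma Nrad_unipotent: assumes u: "u : Nrad" and f: "f : A" shows "EX k. ((%h. rt u h - h) ^^ k) f = 0" proof -
 let ?d = "%h. rt u h - h"
 have uG: "u : cr G" by (rule NradD(1)[OF u])
 have dadd: "?d (h + h') = ?d h + ?d h'" and dsc: "?d (fsc c h) = fsc c (?d h)" for h h' c by (simp_all add: rt_linear fs_rd)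
 interpret D: lin_op A ?d by unfold_locales (auto simp only: subspace dadd dsc intro!: diff_in rt_in uG)
 have dm0: "D.dm 0 = ?d" by (rule ext) (simp add: D.dm_def fs0)
 define K where "K = D.geig 0"
 have sK: "fsub K" unfolding K_def by (rule D.ss_geig)
 have Kstep: "h : K" if "h : A" "?d h : K" for h using D.geig_step[of h 0] that by (simp add: K_def dm0)
 obtain T where T: "rstable T" "fd T" "{f} <= T" using locally_finite[of "{f}"] f by auto
 have "EX M. (rstable M & M <= T & M <= K) & (ALL M'. rstable M' & M' <= T & M' <= K --> sz M' <= sz M)"
 proof (rule ex_has_greatest_nat[of _ "{0}" _ "Suc (sz T)"])
 show "rstable {0} & {0} <= T & {0} <= K" using rstable_zero fs_0[OF rsD(2)[OF T(1)]] fs_0[OF sK] by simp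
 show "ALL M. rstable M & M <= T & M <= K --> sz M < Suc (sz T)" proof (intro allI impI)
 fix M assume M: "rstable M & M <= T & M <= K"
 show "sz M < Suc (sz T)" proof (cases "M = T")
 case False
 hence "M < T" using M by blast
 thus ?thesis using sz_strict_mono[OF rsD(2) rsD(2)[OF T(1)] T(2), of M] M by simp
 qed simp
 qed
 qed
 then obtain M where M0: "(rstable M & M <= T & M <= K) &
 (ALL M'. rstable M' & M' <= T & M' <= K --> sz M' <= sz M)" by (rule exE)
 hence M: "rstable M" "M <= T" "M <= K"
 "!!M'. rstable M' ==> M' <= T ==> M' <= K ==> sz M' <= sz M" by simp_all
 have "M = T" proof (rule ccontr)
 assume "M ~= T"
 hence "M < T" using M(2) by blast
 then obtain T' n e rho where T': "rstable T'" "M < T'" "T' <= T" "bmod M T' n e" "irred n rho"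
 "!!g j. g : cr G ==> j < n ==> rt g (e j) - lc n (%i. rho i j g) e : M" by (rule exists_irreducible_quotient[OF M(1) T(1,2)]) blast
 have eK: "e j : K" if j: "j < n" for j proof -
 have "lc n (%i. rho i j u) e = lc n (%i. if i = j then 1 else 0) e" using NradD(2)[OF u T'(5) _ j] by (intro lc_cong) auto
 hence "?d (e j) : M" using T'(6)[OF uG j] lc_delta[OF j, of e] by simp
 thus ?thesis using Kstep bmD(1)[OF T'(4) j] rsD(1)[OF T'(1)] M(3) by blast
 qed
 have "T' <= K" proof
 fix t assume "t : T'"
 then obtain c where "t - lc n c e : M" using bmD(3)[OF T'(4)] by blast
 hence "(t - lc n c e) + lc n c e : K" using M(3) lc_in[OF sK eK] by (intro fs_ad[OF sK]) auto
 thus "t : K" by simp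
 qed
 hence "sz T' <= sz M" by (rule M(4)[OF T'(1,3)])
 moreover have "sz M < sz T'" by (rule sz_strict_mono[OF rsD(2)[OF M(1)] rsD(2)[OF T'(1)] fd_subset[OF T(2) T'(3)] T'(2)])
 ultimately show False by simp
 qed
 hence "f : K" using M(3) T(3) by blast
 thus ?thesis using D.geigD(2)[of f 0] unfolding K_def dm0 by blast
qed

end

section \<open>Polynomial curves through the identity\<close>

lemma poly_eq_on_nats:
 fixes p q :: "'a::field_char_0 poly" assumes "!!n::nat. poly p (of_nat n) = poly q (of_nat n)" shows "p = q" proof (rule ccontr)
 assume "p ~= q"
 hence "p - q ~= 0" by simp
 hence "finite {x. poly (p - q) x = 0}" by (rule poly_roots_finite)
 moreover have "range of_nat <= {x. poly (p - q) x = 0}" using assms by auto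
 ultimately have "finite (range (of_nat :: nat => 'a))" by (rule rev_finite_subset)
 hence "finite (UNIV :: nat set)" by (rule finite_imageD) (simp add: inj_on_def)
 thus False by simp
qed

definition binp :: "nat => 'a::field_char_0 poly" where
 "binp i = Polynomial.smult (1 / fact i) (PROD j<i. [:- of_nat j, 1:])"

lemma poly_binp: "poly (binp i) (of_nat n) = of_nat (n choose i)"
 by (simp add: binp_def poly_prod binomial_gbinomial gbinomial_prod_rev atLeast0LessThan)

context aff_group
begin

text \<open>Newton's difference formula: right translation by u is the identity plus a difference
  operator, and the formula expands its n-th power at the identity.\<close>

lemma f_power_binomial: assumes u: "u : cr G" and f: "f : A" shows "f (u [^] n) = (SUM i<=n. of_nat (n choose i) * ((%h. rt u h - h) ^^ i) f \<one>)"
 using f proof (induction n arbitrary: f)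
 case (Suc n)
 let ?d = "%h. rt u h - h"
 let ?s = "%i. (?d ^^ i) f \<one>"
 have dA: "?d f : A" by (intro diff_in rt_in Suc.prems u)
 have "f (u [^] Suc n) = rt u f (u [^] n)" using u by (simp add: rt_at)
 also have "... = f (u [^] n) + ?d f (u [^] n)" by (simp add: fun_at)
 also have "... = (SUM i<=n. of_nat (n choose i) * ?s i) + (SUM i<=n. of_nat (n choose i) * ?s (Suc i))"
 unfolding Suc.IH[OF Suc.prems] Suc.IH[OF dA] by (simp only: funpow_Suc_right o_apply)
 also have "(SUM i<=n. of_nat (n choose i) * ?s i) = ?s 0 + (SUM i<=n. of_nat (n choose Suc i) * ?s (Suc i))" proof -
 have "(SUM i<=n. of_nat (n choose i) * ?s i) = (SUM i<=Suc n. of_nat (n choose i) * ?s i)" by (simp add: binomial_eq_0)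
 also have "... = ?s 0 + (SUM i<=n. of_nat (n choose Suc i) * ?s (Suc i))" unfolding sum.atMost_Suc_shift by simp
 finally show ?thesis .
 qed
 also have "?s 0 + (SUM i<=n. of_nat (n choose Suc i) * ?s (Suc i)) + (SUM i<=n. of_nat (n choose i) * ?s (Suc i)) =
 ?s 0 + (SUM i<=n. of_nat (Suc n choose Suc i) * ?s (Suc i))" by (simp add: als sum.distrib)
 also have "... = (SUM i<=Suc n. of_nat (Suc n choose i) * ?s i)" unfolding sum.atMost_Suc_shift by simp
 finally show ?case .
qed simp

text \<open>A unipotent element lies on a polynomial curve through the identity, hence in the connected component.\<close>

lemma Nrad_curve: assumes u: "u : Nrad"
 obtains P where "!!t. EX v:Nrad. ALL f:A. f v = poly (P f) t"
 "!!f. f : A ==> poly (P f) 0 = f \<one>" "!!f. f : A ==> poly (P f) 1 = f u" proof -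
 have uG: "u : cr G" by (rule NradD(1)[OF u])
 have ex: "EX p. ALL n::nat. poly p (of_nat n) = f (u [^] n)" if f: "f : A" for f proof -
 let ?d = "%h. rt u h - h"
 obtain k where k: "(?d ^^ k) f = 0" using Nrad_unipotent[OF u f] by blast
 have d0: "(?d ^^ m) 0 = 0" for m by (induction m) (simp_all add: rt_linear)
 have z: "(?d ^^ i) f = 0" if ik: "i >= k" for i proof -
 obtain m where "i = m + k" using ik by (metis le_add_diff_inverse2)
 thus ?thesis using k d0 by (simp add: funpow_add)
 qed
 define p where "p = (SUM i<k. Polynomial.smult ((?d ^^ i) f \<one>) (binp i))"
 have "poly p (of_nat n) = f (u [^] n)" for n :: nat proof -
 have "f (u [^] n) = (SUM i<=n. of_nat (n choose i) * (?d ^^ i) f \<one>)" by (rule f_power_binomial[OF uG f])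
 also have "... = (SUM i:{..n} Un {..<k}. of_nat (n choose i) * (?d ^^ i) f \<one>)" by (rule sum.mono_neutral_left) (auto simp: binomial_eq_0)
 also have "... = (SUM i<k. of_nat (n choose i) * (?d ^^ i) f \<one>)" by (rule sum.mono_neutral_right) (auto simp: z fun_at)
 finally show ?thesis by (simp add: p_def poly_sum poly_binp mcm)
 qed
 thus ?thesis by blast
 qed
 \<comment> \<open>The polynomial interpolating the values of f at the powers of u. Agreement on the
   natural numbers makes P additive and multiplicative in f, so its value at any t is given by a
   point of the group.\<close>
 define P where "P f = (SOME p. ALL n::nat. poly p (of_nat n) = f (u [^] n))" for f :: "'g => 'a"
 have P: "poly (P f) (of_nat n) = f (u [^] n)" if "f : A" for f and n :: nat using someI_ex[OF ex[OF that]] unfolding P_def by blast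
 have un: "u [^] n : cr G" for n :: nat using uG by simp
 have Padd: "P (f + h) = P f + P h" if "f : A" "h : A" for f h by (rule poly_eq_on_nats) (simp add: P that add_in fun_at)
 have Pmult: "P (f * h) = P f * P h" if "f : A" "h : A" for f h by (rule poly_eq_on_nats) (simp add: P that mult_in fun_at)
 have Pc: "P (cst (cr G) c) = [:c:]" for c by (rule poly_eq_on_nats) (simp add: P cst_in cst_at un)
 have "EX v:Nrad. ALL f:A. f v = poly (P f) t" for t proof -
 have "fhom (%f. poly (P f) t)" unfolding fhom_def by (simp add: Padd Pmult Pc)
 then obtain v where v: "v : cr G" "ALL f:A. poly (P f) t = f v" using points by blast
 have "v : Nrad" unfolding Nrad_def proof (intro CollectI conjI allI impI v(1))
 fix n rho i j assume ir: "irred n rho" and ij: "i < n" "j < n"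
 note rhoA = repD(1)[OF irredD(1)[OF ir] ij]
 have "P (rho i j) = [:if i = j then 1 else 0:]" proof (rule poly_eq_on_nats)
 fix m :: nat
 have sub: "subgroup Nrad G" using Nrad_normal by (simp add: normal_def)
 have "u [^] m : Nrad" by (induction m) (simp_all add: u subgroup.one_closed[OF sub] subgroup.m_closed[OF sub])
 thus "poly (P (rho i j)) (of_nat m) = poly [:if i = j then 1 else 0:] (of_nat m)" using NradD(2)[OF _ ir ij] by (simp add: P[OF rhoA])
 qed
 thus "rho i j v = (if i = j then 1 else 0)" using v(2) rhoA by force
 qed
 thus ?thesis using v(2) by metis
 qed
 moreover have "poly (P f) 0 = f \<one>" if "f : A" for f using P[OF that, of 0] by simp
 moreover have "poly (P f) 1 = f u" if "f : A" for f using P[OF that, of 1] uG by simp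
 ultimately show ?thesis by (rule that)
qed

text \<open>The curve exp(t dl): the Taylor coefficients of f at the identity break off because dl
  is locally nilpotent, the Leibniz rule makes P multiplicative, and \<open>points\<close> turns
  each value of t into a group element.\<close>

lemma exponential_point: assumes d: "dl : gl" and nil: "A <= geg dl 0"
 obtains P where "!!t. EX v:cr G. ALL f:A. f v = poly (P f) t"
 "!!f. f : A ==> coeff (P f) 1 = dl f" "!!f. f : A ==> dop dl f = 0 ==> P f = [:f \<one>:]" proof -
 interpret lin_op A "dop dl" by (rule lin_op_dop[OF d])
 have dm0: "dm 0 = dop dl" by (rule ext) (simp add: dm_def fs0)
 let ?D = "dop dl"
 define P where "P f = Abs_poly (%k. (?D ^^ k) f \<one> / fact k)" for f
 have cP: "coeff (P f) k = (?D ^^ k) f \<one> / fact k" if f: "f : A" for f k proof -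
 obtain n where n: "(?D ^^ n) f = 0" using nil f geigD(2)[of f 0] unfolding dm0 by blast
 have z: "(?D ^^ i) f = 0" if "i > n" for i using dm_pow_mono[of n 0 f i] n that unfolding dm0 by simp
 show ?thesis unfolding P_def by (subst coeff_Abs_poly[of n]) (simp_all add: z fun_at)
 qed
 have leib: "(?D ^^ k) (f * h) \<one> / fact k = (SUM i<=k. ((?D ^^ i) f \<one> / fact i) * ((?D ^^ (k - i)) h \<one> / fact (k - i)))"
 if f: "f : A" and h: "h : A" for f h k proof -
 have "(?D ^^ k) (f * h) = (SUM i<=k. fsc (of_nat (k choose i)) ((?D ^^ i) f * (?D ^^ (k - i)) h))" proof (induction k)
 case (Suc k)
 let ?t = "%i j. (?D ^^ i) f * (?D ^^ j) h"
 have tA: "?t i j : A" for i j by (intro mult_in D_pow_in f h)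
 have Ds: "?D (SUM i:I. fsc (c i) (F i)) = (SUM i:I. fsc (c i) (?D (F i)))"
 if "!!i. i : I ==> F i : A" for I :: "nat set" and c F using that proof (induction I rule: ifi)
 case (insert x I)
 thus ?case by (simp add: D_add D_scale scale_in sum_in)
 qed (use D_scale[OF zero_in, of 0] in \<open>simp_all add: fs0\<close>)
 have Dt: "?D (?t i j) = ?t i (Suc j) + ?t (Suc i) j" for i j unfolding dop_mult[OF d D_pow_in[OF f] D_pow_in[OF h]] by simp
 have "(?D ^^ Suc k) (f * h) = (SUM i<=k. fsc (of_nat (k choose i)) (?D (?t i (k - i))))"
 using Suc Ds[of "{..k}" "%i. ?t i (k - i)" "%i. of_nat (k choose i)"] tA by simp
 also have "... = (SUM i<=k. fsc (of_nat (k choose i)) (?t i (Suc k - i))) +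
 (SUM i<=k. fsc (of_nat (k choose i)) (?t (Suc i) (k - i)))" unfolding Dt fs.scale_right_distrib sum.distrib by (simp add: Suc_diff_le)
 also have "(SUM i<=k. fsc (of_nat (k choose i)) (?t i (Suc k - i))) =
 (SUM i<=Suc k. fsc (of_nat (k choose i)) (?t i (Suc k - i)))" by (simp add: binomial_eq_0 fs0)
 also have "... = fsc 1 (?t 0 (Suc k)) + (SUM i<=k. fsc (of_nat (k choose Suc i)) (?t (Suc i) (k - i)))" unfolding sum.atMost_Suc_shift by simp
 also have "fsc 1 (?t 0 (Suc k)) + (SUM i<=k. fsc (of_nat (k choose Suc i)) (?t (Suc i) (k - i))) +
 (SUM i<=k. fsc (of_nat (k choose i)) (?t (Suc i) (k - i))) =
 fsc 1 (?t 0 (Suc k)) + (SUM i<=k. fsc (of_nat (Suc k choose Suc i)) (?t (Suc i) (k - i)))"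
 by (simp add: sum.distrib fs.scale_left_distrib add.commute add.left_commute)
 also have "... = (SUM i<=Suc k. fsc (of_nat (Suc k choose i)) (?t i (Suc k - i)))" unfolding sum.atMost_Suc_shift by simp
 finally show ?case .
 qed (simp add: fs.scale_one)
 hence "(?D ^^ k) (f * h) \<one> / fact k =
 (SUM i<=k. of_nat (k choose i) * ((?D ^^ i) f \<one> * (?D ^^ (k - i)) h \<one>)) / fact k" by (simp add: fun_at)
 also have "... = (SUM i<=k. ((?D ^^ i) f \<one> / fact i) * ((?D ^^ (k - i)) h \<one> / fact (k - i)))"
 unfolding sum_divide_distrib by (rule sum.cong) (auto simp: binomial_fact field_simps)
 finally show ?thesis .
 qed
 have Pmult: "P (f * h) = P f * P h" if "f : A" "h : A" for f h by (rule poly_eqI) (simp add: coeff_mult cP that mult_in leib)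
 have Dadd: "(?D ^^ k) (f + h) = (?D ^^ k) f + (?D ^^ k) h" if "f : A" "h : A" for f h k using dm_pow_add[OF that, of k 0] unfolding dm0 .
 have Padd: "P (f + h) = P f + P h" if "f : A" "h : A" for f h by (rule poly_eqI) (simp add: cP that add_in Dadd fun_at add_divide_distrib)
 have Pz: "P f = [:f \<one>:]" if "f : A" "?D f = 0" for f proof (rule poly_eqI)
 have D0: "?D 0 = 0" using D_scale[OF zero_in, of 0] by (simp add: fs0)
 have "(?D ^^ Suc k) f = 0" for k by (induction k) (simp_all add: that D0)
 thus "coeff (P f) k = coeff [:f \<one>:] k" for k using cP[OF that(1), of k] by (cases k) (simp_all add: fun_at del: funpow.simps(2))
 qed
 have Dc: "?D (cst (cr G) c) = 0" for c by (rule ext) (simp add: dop_def zcut_def lt_cst gl_const[OF d] fun_at)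
 show ?thesis proof (rule that[of P])
 fix t
 have "fhom (%f. poly (P f) t)" unfolding fhom_def by (simp add: Padd Pmult Pz[OF cst_in Dc] cst_at)
 thus "EX v:cr G. ALL f:A. f v = poly (P f) t" using points by metis
 next
 show "coeff (P f) 1 = dl f" if "f : A" for f using cP[OF that, of 1] dop_one[OF that] by simp
 qed (rule Pz)
qed

end

text \<open>From here on reductivity enters as triviality of \<open>Nrad\<close>.\<close>

locale red_group = aff_group G A
 for G :: "('g, 'm) monoid_scheme" (structure) and A :: "('g => 'a::{alg_closed_field, field_char_0}) set" + assumes Nrad_trivial: "Nrad = {\<one>}"
begin

text \<open>The exponential curve of dl acts trivially in every irreducible representation, so it
  stays at the identity, and its derivative dl vanishes on A.\<close>

theorem nilpotent_ideal_zero: assumes L: "lie_sub L" and nil: "!!dl. dl : L ==> A <= geg dl 0" and d: "dl : L" and f: "f : A" shows "dl f = 0" proof -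
 have Lg: "!!dl. dl : L ==> dl : gl" using lie_subD(1)[OF L] by blast
 \<comment> \<open>Local nilpotency on A carries over to every representation: all of A belongs to
   the eigenvalue 0, where a replica multiplies by \<open>psi 0 = 0\<close>, so the traces to be
   tested are zero.\<close>
 have nilm: "nilp n (dmat ep rho)" if ep: "ep : L" and r: "rep n rho" for ep n rho proof (rule nilp_if_traces_vanish[OF Lg[OF ep] r])
 fix psi dl' assume psi: "!!x y. psi (x + y) = psi x + psi y" and rp: "replica ep psi dl'"
 have "psi 0 = 0" using psi[of 0 0] by simp
 hence "dl' (rho i j) = 0" if "i < n" "j < n" for i j using rp nil[OF ep] repD(1)[OF r that] unfolding replica_def by auto
 thus "tr n (mm n (dmat ep rho) (dmat dl' rho)) = 0" by (simp add: tr_def mm_def dmat_def)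
 qed
 obtain P where P: "!!t. EX v:cr G. ALL f:A. f v = poly (P f) t"
 "!!f. f : A ==> coeff (P f) 1 = dl f" "!!f. f : A ==> dop dl f = 0 ==> P f = [:f \<one>:]" by (rule exponential_point[OF Lg[OF d] nil[OF d]]) blast
 have val: "poly (P f) t = f \<one>" if f: "f : A" for f t proof -
 obtain v where v: "v : cr G" "!!f. f : A ==> f v = poly (P f) t" using P(1) by blast
 have "v : Nrad" unfolding Nrad_def proof (intro CollectI conjI allI impI v(1))
 fix n rho i j assume ir: "irred n rho" and ij: "i < n" "j < n"
 note r = irredD(1)[OF ir]
 have z: "dl (rho k j) = 0" if "k < n" for k by (rule nilpotent_ideal_acts_trivially[OF L ir nilm[OF _ r] d that ij(2)])
 have "dop dl (rho i j) = 0" unfolding dop_rep[OF Lg[OF d] r ij] by (rule ext) (simp add: lc_at z fun_at)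
 hence "P (rho i j) = [:rho i j \<one>:]" by (rule P(3)[OF repD(1)[OF r ij]])
 thus "rho i j v = (if i = j then 1 else 0)" using v(2)[OF repD(1)[OF r ij]] repD(2)[OF r ij] by simp
 qed
 hence "v = \<one>" using Nrad_trivial by blast
 thus ?thesis using v(2)[OF f] by simp
 qed
 have "P f = [:f \<one>:]" by (rule poly_eq_on_nats) (simp add: val[OF f])
 thus ?thesis using P(2)[OF f] by simp
qed

end

theorem red_group_zext:
 fixes R :: "('g => 'a::{alg_closed_field, field_char_0}) set" assumes "reductive_group G R" shows "red_group G (zext (cr G) R)" proof -
 let ?X = "cr G"
 have alg: "affine_algebraic_group G R" and red: "!!N. N \<lhd> G ==> closedin (zariski ?X R) N ==> connectedin (zariski ?X R) N ==>
 (!!u. u : N ==> unipotent G R u) ==> N = {\<one>\<^bsub>G\<^esub>}" using assms unfolding reductive_group_def by blast+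
 interpret aff_group G "zext ?X R" by (rule aff_group_zext[OF alg])
 obtain S where R: "R = generated_algebra ?X S" using alg unfolding affine_algebraic_group_def affine_variety_def by blast
 have NX: "Nrad <= ?X" using NradD(1) by blast
 have inA: "zcut ?X f : zext ?X R" if "f : R" for f by (rule zcut_in_zext[OF R that])
 have "Nrad = {\<one>\<^bsub>G\<^esub>}" proof (rule red)
 show "Nrad \<lhd> G" by (rule Nrad_normal)
 show "closedin (zariski ?X R) Nrad" proof -
 obtain T where T: "T <= zext ?X R" "Nrad = {x : ?X. ALL f:T. f x = 0}" by (rule Nrad_zero_set)
 have "(%f. restrict f ?X) ` T <= generated_algebra ?X S" using T(1) R by (auto simp: zext_def)
 moreover have "Nrad = {x : ?X. ALL f:(%f. restrict f ?X) ` T. f x = 0}" using T(2) by auto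
 ultimately show ?thesis unfolding R closedin_zariski by blast
 qed
 show "connectedin (zariski ?X R) Nrad" proof -
 \<comment> \<open>Pulled back along the curve from the identity to u, two relatively disjoint open
   pieces give two nonzero polynomials; at a t where neither vanishes, the curve point lies in both
   pieces.\<close>
 have False if E: "openin (zariski ?X R) E1" "openin (zariski ?X R) E2" "E1 Int E2 Int Nrad = {}"
 and one: "\<one>\<^bsub>G\<^esub> : E1" and u: "u : E2 Int Nrad" for E1 E2 u proof -
 obtain T1 where T1: "T1 <= R" "E1 = {x : ?X. EX f:T1. f x ~= 0}" using E(1) unfolding R openin_zariski by blast
 obtain T2 where T2: "T2 <= R" "E2 = {x : ?X. EX f:T2. f x ~= 0}" using E(2) unfolding R openin_zariski by blast
 obtain f1 where f1: "f1 : T1" "f1 \<one>\<^bsub>G\<^esub> ~= 0" using one T1(2) by blast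
 obtain f2 where f2: "f2 : T2" "f2 u ~= 0" using u T2(2) by blast
 obtain P where P: "!!t. EX v:Nrad. ALL f:zext ?X R. f v = poly (P f) t"
 "!!f. f : zext ?X R ==> poly (P f) 0 = f \<one>\<^bsub>G\<^esub>" "!!f. f : zext ?X R ==> poly (P f) 1 = f u"
 by (rule Nrad_curve[of u]) (use u in blast)+
 have z1: "zcut ?X f1 : zext ?X R" and z2: "zcut ?X f2 : zext ?X R" using inA f1(1) f2(1) T1(1) T2(1) by blast+
 have "poly (P (zcut ?X f1)) 0 ~= 0" using P(2)[OF z1] f1(2) by (simp add: zcut_def)
 moreover have "poly (P (zcut ?X f2)) 1 ~= 0" using P(3)[OF z2] f2(2) u NX by (auto simp: zcut_def)
 ultimately have "P (zcut ?X f1) * P (zcut ?X f2) ~= 0" by force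
 then obtain t where t: "poly (P (zcut ?X f1) * P (zcut ?X f2)) t ~= 0" using poly_all_0_iff_0 by blast
 obtain v where v: "v : Nrad" "ALL f:zext ?X R. f v = poly (P f) t" using P(1) by blast
 have "f1 v ~= 0" "f2 v ~= 0" using t v z1 z2 NX by (auto simp: zcut_def dest!: bspec)
 hence "v : E1 Int E2 Int Nrad" using v(1) NX f1(1) f2(1) unfolding T1(2) T2(2) by blast
 thus False using E(3) by blast
 qed
 note no = this
 have o: "\<one>\<^bsub>G\<^esub> : Nrad" using Nrad_normal by (simp add: normal_def subgroup.one_closed)
 have "False" if E: "openin (zariski ?X R) E1" "openin (zariski ?X R) E2" "Nrad <= E1 Un E2"
 "E1 Int E2 Int Nrad = {}" "E1 Int Nrad ~= {}" "E2 Int Nrad ~= {}" for E1 E2 proof (cases "\<one>\<^bsub>G\<^esub> : E1")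
 case True
 thus ?thesis using no[OF E(1,2,4)] E(6) by blast
 next
 case False
 hence "\<one>\<^bsub>G\<^esub> : E2" using o E(3) by blast
 thus ?thesis using no[OF E(2,1)] E(4,5) by blast
 qed
 thus ?thesis unfolding connectedin using NX by (auto simp: R topspace_zariski)
 qed
 fix u assume u: "u : Nrad"
 show "unipotent G R u" unfolding unipotent_def proof
 fix f assume f: "f : R"
 let ?d = "%h. rt u h - h" and ?e = "%h. \<lambda>x\<in>?X. h (x \<otimes>\<^bsub>G\<^esub> u) - h x"
 obtain k where k: "(?d ^^ k) (zcut ?X f) = 0" using Nrad_unipotent[OF u inA[OF f]] by blast
 have uG: "u : ?X" by (rule NradD(1)[OF u])
 have step: "?e (restrict h ?X) = restrict (?d h) ?X" for h using uG by (auto simp: fun_at rt_at)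
 have it: "(?e ^^ n) (restrict h ?X) = restrict ((?d ^^ n) h) ?X" for n h by (induction n) (simp_all add: step del: restrict_apply)
 have rf: "restrict (zcut ?X f) ?X = f" using generated_algebra_restrict[of f ?X S] f by (simp add: R zcut_def restrict_def cong: if_cong)
 have "(?e ^^ k) f = (\<lambda>x\<in>?X. 0)" using it[of k "zcut ?X f"] unfolding rf k by (simp add: restrict_def fun_at cong: if_cong)
 thus "EX n. (?e ^^ n) f = (\<lambda>x\<in>?X. 0)" by blast
 qed
 qed
 thus ?thesis by unfold_locales
qed

section \<open>Splitting of extensions\<close>

lemma square_inverse:
 fixes M :: "nat => nat => 'a::field" assumes inj: "ALL c. (ALL i<n. (SUM j<n. M i j * c j) = 0) --> (ALL j<n. c j = 0)"
 shows "EX N. ALL i<n. ALL k<n. (SUM j<n. M i j * N j k) = (if i = k then 1 else 0)" proof -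
 define A where "A = Matrix.mat n n (%(i, j). M i j)"
 have A: "A : carrier_mat n n" by (simp add: A_def)
 have "det A ~= 0" proof
 assume "det A = 0"
 then obtain v where v: "v : carrier_vec n" "v ~= 0\<^sub>v n" "A *\<^sub>v v = 0\<^sub>v n" using det_0_iff_vec_prod_zero[OF A] by blast
 have "(SUM j<n. M i j * vec_index v j) = vec_index (A *\<^sub>v v) i" if "i < n" for i
 using that v(1) by (simp add: A_def scalar_prod_def atLeast0LessThan)
 hence "ALL j<n. vec_index v j = 0" using inj[rule_format, of "vec_index v"] v(3) by simp
 hence "v = 0\<^sub>v n" using v(1) by (intro eq_vecI) auto
 thus False using v(2) by blast
 qed
 moreover have adj: "adj_mat A : carrier_mat n n" "A * adj_mat A = det A \<cdot>\<^sub>m 1\<^sub>m n"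
 by (rule adj_mat(1)[OF A], rule adj_mat(2)[OF A])
 have "(SUM j<n. M i j * index_mat (adj_mat A) (j, k)) = (if i = k then det A else 0)" if "i < n" "k < n" for i k proof -
 have "(SUM j<n. M i j * index_mat (adj_mat A) (j, k)) = index_mat (A * adj_mat A) (i, k)"
 using that adj(1) by (simp add: A_def scalar_prod_def atLeast0LessThan)
 thus ?thesis unfolding adj(2) using that by simp
 qed
 ultimately have "ALL i<n. ALL k<n. (SUM j<n. M i j * (index_mat (adj_mat A) (j, k) / det A)) = (if i = k then 1 else 0)"
 by (simp add: sum_divide_distrib[symmetric])
 thus ?thesis by (intro exI[of _ "%j k. index_mat (adj_mat A) (j, k) / det A"])
qed

lemma sum_mult_delta: "(a::nat) < n ==> (SUM b<n. c b * (if b = a then 1 else 0)) = (c a :: 'a::comm_semiring_1)" proof -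
 assume a: "a < n"
 have "(SUM b<n. c b * (if b = a then 1 else 0)) = (SUM b<n. if b = a then c b else 0)" by (rule sum.cong) auto
 thus ?thesis using a by simp
qed

lemma tr_mm_diff: assumes "!!i j. i < n ==> j < n ==> C i j = U i j - V i j" shows "tr n (mm n C Y) = tr n (mm n U Y) - tr n (mm n V Y)"
 using assms by (simp add: tr_def mm_def left_diff_distrib sum_subtractf)

lemma mm_assoc: "mm n (mm n A B) C = mm n A (mm n B C)" proof (intro ext)
 fix i j
 have "mm n (mm n A B) C i j = (SUM k<n. SUM l<n. A i l * B l k * C k j)" by (simp add: mm_def sdr)
 also have "... = (SUM l<n. SUM k<n. A i l * B l k * C k j)" by (rule sum.swap)
 finally show "mm n (mm n A B) C i j = mm n A (mm n B C) i j" by (simp add: mm_def sdl mult.assoc)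
qed

lemma mm_sum: "mm n (%i j. SUM a:I. F a i j) M = (%i j. SUM a:I. mm n (F a) M i j)"
 "mm n M (%i j. SUM a:I. F a i j) = (%i j. SUM a:I. mm n M (F a) i j)" by (intro ext; simp add: mm_def sdl sdr; rule sum.swap)+

lemma mm_scale: "mm n (%i j. c * F i j) M = (%i j. c * mm n F M i j)"
 "mm n M (%i j. c * F i j) = (%i j. c * mm n M F i j)" by (intro ext; simp add: mm_def sdl mult.assoc mult.left_commute)+

lemma mm_cong: "(!!k. k < n ==> A i k = A' i k) ==> (!!k. k < n ==> B k j = B' k j) ==> mm n A B i j = mm n A' B' i j" by (simp add: mm_def)

lemma mm_one: "(!!k. k < n ==> I k j = (if k = j then 1 else 0)) ==> j < n ==> mm n M I i j = M i j" by (simp add: mm_def sum_mult_delta)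

section \<open>Trace forms, dual bases and Casimir elements\<close>

context aff_group
begin

definition bf :: "nat => (nat => nat => 'g => 'a) => (('g => 'a) => 'a) => (('g => 'a) => 'a) => 'a" where
 "bf n rho X Y = tr n (mm n (dmat X rho) (dmat Y rho))"

lemma bf_alt: "bf n rho X Y = (SUM i<n. SUM k<n. X (rho i k) * Y (rho k i))" by (simp add: bf_def tr_def mm_def dmat_def)

lemma bf_sym: "bf n rho X Y = bf n rho Y X" unfolding bf_def by (rule tr_mm_commute)

lemma bf_linear: "bf n rho (X + X') Y = bf n rho X Y + bf n rho X' Y" "bf n rho (fsc c X) Y = c * bf n rho X Y"
 "bf n rho (X - X') Y = bf n rho X Y - bf n rho X' Y"
 "bf n rho 0 Y = 0" by (simp_all add: bf_alt fun_at als sum.distrib sum_subtractf sdl)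

lemma bf_lc: "bf n rho (lc d c x) Y = (SUM a<d. c a * bf n rho (x a) Y)" proof (induction d)
 case (Suc d)
 have "lc (Suc d) c x = lc d c x + fsc (c d) (x d)" by (rule ext) (simp add: lc_at fun_at)
 thus ?case using Suc by (simp add: bf_linear)
qed (simp add: lc_def bf_linear)

lemma bf_cong: "(!!i j. i < n ==> j < n ==> X (rho i j) = X' (rho i j)) ==> bf n rho X Y = bf n rho X' Y" by (simp add: bf_alt)

lemma mat_inv: assumes r: "rep n rho" and g: "g : cr G" and ij: "i < n" "j < n"
 shows "mm n (mat rho (inv g)) (mat rho g) i j = (if i = j then 1 else 0)"
 using repD(3)[OF r ij, of "inv g" g] repD(2)[OF r ij] g by (simp add: mm_def mat_def)

lemma dmat_Ad_mm: assumes r: "rep n rho" and g: "g : cr G" and X: "X : gl" "Y : gl" and ij: "i < n" "j < n"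
 shows "mm n (dmat (Ad g X) rho) (dmat (Ad g Y) rho) i j =
 mm n (mat rho g) (mm n (mm n (dmat X rho) (dmat Y rho)) (mat rho (inv g))) i j" proof -
 let ?P = "mat rho g" and ?Q = "mat rho (inv g)" and ?X = "dmat X rho" and ?Y = "dmat Y rho"
 have "mm n (dmat (Ad g X) rho) (dmat (Ad g Y) rho) i j = mm n (mm n ?P (mm n ?X ?Q)) (mm n ?P (mm n ?Y ?Q)) i j"
 by (rule mm_cong) (simp_all add: dmat_Ad[OF r g] X ij)
 also have "... = mm n (mm n (mm n ?P ?X) (mm n ?Q ?P)) (mm n ?Y ?Q) i j" by (simp add: mm_assoc)
 also have "... = mm n (mm n ?P ?X) (mm n ?Y ?Q) i j" by (rule mm_cong) (simp_all add: mm_one mat_inv[OF r g])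
 finally show ?thesis by (simp add: mm_assoc)
qed

lemma bf_Ad: assumes r: "rep n rho" and g: "g : cr G" and X: "X : gl" "Y : gl" shows "bf n rho (Ad g X) (Ad g Y) = bf n rho X Y" proof -
 let ?Z = "mm n (dmat X rho) (dmat Y rho)"
 have "bf n rho (Ad g X) (Ad g Y) = tr n (mm n (mat rho g) (mm n ?Z (mat rho (inv g))))"
 unfolding bf_def tr_def by (rule sum.cong) (simp_all add: dmat_Ad_mm[OF r g X])
 also have "... = tr n (mm n ?Z (mm n (mat rho (inv g)) (mat rho g)))" unfolding tr_mm_commute[of n "mat rho g"] by (simp add: mm_assoc)
 also have "... = tr n ?Z" unfolding tr_def by (rule sum.cong) (simp_all add: mm_one mat_inv[OF r g])
 finally show ?thesis by (simp add: bf_def)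
qed

lemma Ad_inv: assumes g: "g : cr G" and f: "f : A" shows "Ad g (Ad (inv g) X) f = X f" proof -
 have "lt (inv g) (rt (inv (inv g)) (lt g (rt (inv g) f))) = f"
 by (rule fun_ext) (use g f in \<open>simp_all add: lt_in rt_in lt_at rt_at m_assoc\<close>, simp add: m_assoc[symmetric])
 thus ?thesis by (simp add: Ad_def)
qed

lemma bf_Ad_inv: assumes r: "rep n rho" and g: "g : cr G" and X: "X : gl" "Y : gl" shows "bf n rho (Ad g X) Y = bf n rho X (Ad (inv g) Y)" proof -
 have "bf n rho (Ad g X) Y = bf n rho (Ad g X) (Ad g (Ad (inv g) Y))" unfolding bf_alt using r g by (simp add: Ad_inv repD(1))
 thus ?thesis using bf_Ad[OF r g X(1) Ad_gl[OF _ X(2), of "inv g"]] g by simp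
qed

lemma bf_brf: assumes r: "rep n rho" and X: "X : gl" "X' : gl" "Y : gl" shows "bf n rho (brf X X') Y = bf n rho X (brf X' Y)" proof -
 let ?X = "dmat X rho" and ?X' = "dmat X' rho" and ?Y = "dmat Y rho"
 have "bf n rho (brf X X') Y = tr n (mm n (mm n ?X ?X') ?Y) - tr n (mm n (mm n ?X' ?X) ?Y)"
 unfolding bf_def by (rule tr_mm_diff) (rule dmat_brf[OF r X(1,2)])
 also have "tr n (mm n (mm n ?X' ?X) ?Y) = tr n (mm n ?X (mm n ?Y ?X'))" unfolding mm_assoc tr_mm_commute[of n ?X'] by (simp add: mm_assoc)
 also have "tr n (mm n (mm n ?X ?X') ?Y) = tr n (mm n ?X (mm n ?X' ?Y))" by (simp add: mm_assoc)
 also have "... - tr n (mm n ?X (mm n ?Y ?X')) = bf n rho X (brf X' Y)"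
 unfolding bf_def tr_mm_commute[of n ?X] by (rule tr_mm_diff[symmetric]) (rule dmat_brf[OF r X(2,3)])
 finally show ?thesis .
qed

text \<open>The trace form is invariant under brackets and under \<open>Ad\<close>, so both pass
  from one argument to the other, where L absorbs them.\<close>

lemma lie_sub_perp: assumes r: "rep n rho" and I: "lie_sub I" and L: "L <= gl"
 and br: "!!X Y. X : I ==> Y : L ==> brf X Y : L" and Ad: "!!g Y. g : cr G ==> Y : L ==> Ad g Y : L"
 shows "lie_sub {X : I. ALL Y:L. bf n rho X Y = 0}" proof -
 note ID = lie_subD[OF I]
 have gl: "X : I ==> X : gl" "Y : L ==> Y : gl" for X Y using ID(1) L by blast+
 show ?thesis unfolding lie_sub_def proof (intro conjI ballI)
 show "fsub {X : I. ALL Y:L. bf n rho X Y = 0}" using ID(2) by (auto simp: fs_def bf_linear)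
 qed (use ID gl br Ad in \<open>auto simp: bf_brf[OF r] bf_Ad_inv[OF r]\<close>)
qed

lemma lie_sub_gl: "lie_sub gl" unfolding lie_sub_def by (simp add: subspace_gl brf_gl Ad_gl)

lemma lie_sub_ker: assumes r: "rep n rho" shows "lie_sub {X : gl. ALL i<n. ALL j<n. X (rho i j) = 0}"
 and "!!X Y. X : gl ==> Y : {X : gl. ALL i<n. ALL j<n. X (rho i j) = 0} ==> brf X Y : {X : gl. ALL i<n. ALL j<n. X (rho i j) = 0}" proof -
 show br: "brf X Y : {X : gl. ALL i<n. ALL j<n. X (rho i j) = 0}"
 if "X : gl" "Y : {X : gl. ALL i<n. ALL j<n. X (rho i j) = 0}" for X Y using that brf_gl[of X Y] dmat_brf[OF r, of X Y] by (simp add: dmat_def mm_def)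
 show "lie_sub {X : gl. ALL i<n. ALL j<n. X (rho i j) = 0}" unfolding lie_sub_def proof (intro conjI ballI)
 show "fsub {X : gl. ALL i<n. ALL j<n. X (rho i j) = 0}" using subspace_gl by (auto simp: fs_def fun_at)
 next
 fix g X assume g: "g : cr G" and X: "X : {X : gl. ALL i<n. ALL j<n. X (rho i j) = 0}"
 thus "Ad g X : {X : gl. ALL i<n. ALL j<n. X (rho i j) = 0}" using Ad_gl[of g X] dmat_Ad[OF r, of g X] by (simp add: dmat_def mm_def)
 qed (use br in auto)
qed

text \<open>Everything takes place in the space of matrices of L in rho, which is why the expansions
  are equalities on matrix entries. Nondegeneracy makes the Gram matrix of the basis x injective,
  and its inverse gives the dual family y.\<close>

lemma dual_bases: assumes L: "fsub L" "L <= gl" and nd: "ALL X:L. (ALL Y:L. bf n rho X Y = 0) --> (ALL i<n. ALL j<n. X (rho i j) = 0)"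
 shows "EX d x y. (ALL a<d. x a : L & y a : L & bf n rho (x a) (y a) = 1) &
 (ALL X:L. ALL i<n. ALL j<n. X (rho i j) = lc d (%a. bf n rho X (y a)) x (rho i j) &
 X (rho i j) = lc d (%a. bf n rho X (x a)) y (rho i j))" proof -
 define W where "W = (%X. cm n (dmat X rho)) ` L"
 have cm: "cm n (dmat X rho) + cm n (dmat Y rho) = cm n (dmat (X + Y) rho)"
 "fsc c (cm n (dmat X rho)) = cm n (dmat (fsc c X) rho)" "cm n (dmat 0 rho) = 0" for X Y c by (rule ext, auto simp: cm_def dmat_def fun_at)+
 have W: "fsub W" "fd W" proof -
 have "0 : W" using fs_0[OF L(1)] cm(3) unfolding W_def by (metis image_eqI)
 thus "fsub W" using fs_ad[OF L(1)] fs_sc[OF L(1)] by (auto simp: fs_def W_def cm)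
 show "fd W" by (rule fd_subset[OF fd_matrices[of n]]) (auto simp: W_def cm_def)
 qed
 obtain d e where e: "bmod {0} W d e" by (rule exists_bmod[of "{0}" W]) (use W fs_0[OF W(1)] fs.subspace_single_0 in auto)
 have "EX X. X : L & e a = cm n (dmat X rho)" if "a < d" for a using bmD(1)[OF e that] by (auto simp: W_def)
 then obtain x where x: "!!a. a < d ==> x a : L" "!!a. a < d ==> e a = cm n (dmat (x a) rho)" by metis
 have lcL: "lc d c x : L" for c by (rule lc_in[OF L(1) x(1)])
 have lce: "lc d c e = cm n (dmat (lc d c x) rho)" for c by (rule ext) (auto simp: lc_at x(2) cm_def dmat_def)
 have coord: "EX c. ALL i<n. ALL j<n. X (rho i j) = lc d c x (rho i j)" if X: "X : L" for X proof -
 have "cm n (dmat X rho) : W" using X by (simp add: W_def)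
 from bmD(3)[OF e this] obtain c where c: "cm n (dmat X rho) - lc d c e = 0" by blast
 have eq: "cm n (dmat X rho) (i, j) = cm n (dmat (lc d c x) rho) (i, j)" for i j using c unfolding lce by simp
 have "X (rho i j) = lc d c x (rho i j)" if "i < n" "j < n" for i j using eq[of i j] that by (simp add: cm_def dmat_def)
 thus ?thesis by blast
 qed
 have nd': "!!i j. i < n ==> j < n ==> X (rho i j) = 0" if X: "X : L" "!!a. a < d ==> bf n rho X (x a) = 0" for X
 proof (rule nd[rule_format, OF X(1)])
 fix Y assume "Y : L"
 then obtain c where c: "ALL i<n. ALL j<n. Y (rho i j) = lc d c x (rho i j)" using coord by blast
 have "bf n rho X Y = bf n rho (lc d c x) X" unfolding bf_sym[of n rho X] by (rule bf_cong) (use c in blast)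
 also have "... = 0" unfolding bf_lc by (rule sum.neutral) (simp add: bf_sym[of n rho _ X] X(2))
 finally show "bf n rho X Y = 0" .
 qed
 have "ALL c. (ALL a<d. (SUM b<d. bf n rho (x a) (x b) * c b) = 0) --> (ALL b<d. c b = 0)" proof (intro allI impI)
 fix c b assume c: "ALL a<d. (SUM b<d. bf n rho (x a) (x b) * c b) = 0" and b: "b < d"
 have z: "bf n rho (lc d c x) (x a) = 0" if "a < d" for a proof -
 have "bf n rho (lc d c x) (x a) = (SUM b<d. bf n rho (x a) (x b) * c b)"
 unfolding bf_lc by (rule sum.cong) (simp_all add: bf_sym[of n rho _ "x a"] mcm)
 thus ?thesis using c that by simp
 qed
 have "cm n (dmat (lc d c x) rho) = 0" by (rule ext) (auto simp: cm_def dmat_def fun_at nd'[OF lcL z])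
 thus "c b = 0" using bmD(2)[OF e _ b, of c] by (simp add: lce)
 qed
 from square_inverse[where M = "%a b. bf n rho (x a) (x b)", OF this]
 obtain N where N: "ALL a<d. ALL k<d. (SUM b<d. bf n rho (x a) (x b) * N b k) = (if a = k then 1 else 0)" by blast
 define y where "y k = lc d (%b. N b k) x" for k
 have yx: "bf n rho (y k) (x a) = (if a = k then 1 else 0)" if "a < d" "k < d" for a k
 using N that by (simp add: y_def bf_lc bf_sym[of n rho _ "x a"] mcm)
 have yL: "y k : L" for k unfolding y_def by (rule lcL)
 show ?thesis proof (rule exI[of _ d], rule exI[of _ x], rule exI[of _ y], intro conjI allI impI ballI)
 fix X i j assume X: "X : L" and ij: "i < n" "j < n"
 obtain c where c: "ALL i<n. ALL j<n. X (rho i j) = lc d c x (rho i j)" using coord[OF X] by blast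
 have "bf n rho X (y a) = c a" if "a < d" for a proof -
 have "bf n rho X (y a) = bf n rho (lc d c x) (y a)" by (rule bf_cong) (use c in blast)
 also have "... = (SUM b<d. c b * (if b = a then 1 else 0))" unfolding bf_lc by (rule sum.cong) (simp_all add: bf_sym[of n rho _ "y a"] yx that)
 also have "... = c a" by (rule sum_mult_delta[OF that])
 finally show ?thesis .
 qed
 hence "lc d (%a. bf n rho X (y a)) x = lc d c x" by (rule lc_cong)
 thus "X (rho i j) = lc d (%a. bf n rho X (y a)) x (rho i j)" using c ij by simp
 next
 fix X i j assume X: "X : L" and ij: "i < n" "j < n"
 let ?Z = "X - lc d (%a. bf n rho X (x a)) y"
 have "?Z (rho i j) = 0" proof (rule nd'[OF _ _ ij])
 show "?Z : L" by (intro fs.subspace_diff[OF L(1) X] lc_in[OF L(1) yL])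
 fix b assume b: "b < d"
 have "(SUM a<d. bf n rho X (x a) * bf n rho (y a) (x b)) = (SUM a<d. bf n rho X (x a) * (if a = b then 1 else 0))"
 by (rule sum.cong) (auto simp: yx b)
 also have "... = bf n rho X (x b)" by (rule sum_mult_delta[OF b])
 finally show "bf n rho ?Z (x b) = 0" by (simp add: bf_linear bf_lc)
 qed
 thus "X (rho i j) = lc d (%a. bf n rho X (x a)) y (rho i j)" by (simp add: fun_at)
 next
 show "bf n rho (x a) (y a) = 1" if "a < d" for a using yx[OF that that] by (simp add: bf_sym[of n rho "x a"])
 qed (use x yL in auto)
qed

text \<open>A generalized eigenvector of M, pushed to its last nonzero iterate, is an eigenvector;
  the eigenspace is stable under G, hence everything.\<close>

lemma schur: assumes ir: "irred n rho" and c: "!!g i j. g : cr G ==> i < n ==> j < n ==> mm n (mat rho g) M i j = mm n M (mat rho g) i j"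
 shows "EX l. ALL i<n. ALL j<n. M i j = (if i = j then l else 0)" proof -
 interpret lin_op "Kn n" "mv n M" by (rule lin_op_mv)
 note n = irredD(2)[OF ir]
 have "unitv 0 : gspan" by (rule locally_finite_gspan[OF alg_closed_splits fd_Kn order_refl mv_in unitv_in[OF n]])
 moreover have "unitv 0 ~= (0 :: nat => 'a)" by (metis (no_types) unitv_def zero_fun_apply zero_neq_one)
 ultimately obtain l w where w: "w : geig l" "w ~= 0" using gspan_explicit by (metis sum.neutral)
 define k where "k = (LEAST k. (dm l ^^ k) w = 0)"
 have k: "(dm l ^^ k) w = 0" unfolding k_def using geigD(2)[OF w(1)] by (rule LeastI_ex)
 have "k ~= 0" using k w(2) by (metis funpow_0)
 then obtain k' where k': "k = Suc k'" by (metis not0_implies_Suc)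
 define u where "u = (dm l ^^ k') w"
 have u: "u ~= 0" "dm l u = 0" "u : Kn n" using not_less_Least[of k' "%k. (dm l ^^ k) w = 0"] k dm_pow_in[OF geigD(1)[OF w(1)]]
 by (auto simp: u_def k' k_def[symmetric])
 define W where "W = {w : Kn n. mv n M w = fsc l w}"
 have "W = {0} \<or> W = Kn n" proof (rule irredD(3)[OF ir])
 show "fsub W" using subspace_Kn[of n] by (auto simp: fs_def W_def mv_linear fs.scale_right_distrib fs.scale_left_commute)
 fix g w assume g: "g : cr G" and w: "w : W"
 have "mv n M (mv n (mat rho g) w) = mv n (mm n M (mat rho g)) w" by (simp add: mv_mm)
 also have "... = mv n (mm n (mat rho g) M) w" by (rule ext) (simp add: mv_def c[OF g])
 also have "... = fsc l (mv n (mat rho g) w)" using w by (simp add: mv_mm W_def mv_linear)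
 finally show "mv n (mat rho g) w : W" by (simp add: W_def mv_in)
 qed (auto simp: W_def)
 moreover have "u : W" using u(2,3) by (simp add: W_def dm_def)
 ultimately have W: "W = Kn n" using u(1) by blast
 have "M i j = (if i = j then l else 0)" if "i < n" "j < n" for i j proof -
 have "unitv j : W" using W unitv_in that(2) by blast
 hence "M i j = l * unitv j i" unfolding mv_unitv[OF that(2,1), symmetric] by (simp add: W_def fun_at)
 thus ?thesis by (simp add: unitv_def)
 qed
 thus ?thesis by blast
qed

text \<open>A finite-dimensional stable space containing algebra generators. An element acting
  nilpotently on it is locally nilpotent on the generators, and the generalized eigenspace for 0 is
  an algebra.\<close>

lemma faithful_rep:
 obtains m sg where "rep m sg" "!!X. X : gl ==> nilp m (dmat X sg) ==> A <= geg X 0" proof -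
 obtain S where S: "finite S" "supp_in (cr G) S" "A = falg (cr G) S" using fin_gen by blast
 have SA: "S <= A" using S(3) falg.gen by blast
 obtain T where T: "rstable T" "fd T" "S <= T" by (rule locally_finite[OF S(1) SA])
 obtain m e sg where e: "bmod {0} T m e" "rep m sg"
 "!!g j. g : cr G ==> j < m ==> rt g (e j) = lc m (%i. sg i j g) e" using rstable_coeffs[OF T(1,2)] by metis
 have eA: "e j : A" if "j < m" for j using bmD(1)[OF e(1) that] rsD(1)[OF T(1)] by blast
 show ?thesis proof (rule that[OF e(2)])
 fix X assume X: "X : gl" and nil: "nilp m (dmat X sg)"
 interpret D: lin_op A "dop X" by (rule lin_op_dop[OF X])
 have dm0: "D.dm 0 = dop X" by (rule ext) (simp add: D.dm_def fs0)
 have "S <= geg X 0" proof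
 fix f assume f: "f : S"
 then obtain c where "f - lc m c e : {0}" using bmD(3)[OF e(1)] T(3) by blast
 hence fc: "f = lc m (%i. if i < m then c i else 0) e" (is "f = lc m ?w e") using lc_cong[of m c ?w e] by simp
 have w: "?w : Kn m" by (simp add: Kn_def)
 have pow: "(dop X ^^ N) f = lc m ((mv m (dmat X sg) ^^ N) ?w) e" for N by (induction N) (simp_all add: fc dop_coeffs[OF X e(2) eA e(3)])
 obtain N where "(mv m (dmat X sg) ^^ N) ?w = 0" using nil w unfolding nilp_def by blast
 hence "(dop X ^^ N) f = 0" unfolding pow by (simp add: lc_def fs0 fun_at)
 thus "f : geg X 0" using f SA by (auto simp: D.geig_def dm0)
 qed
 moreover have "fun_alg (cr G) (geg X 0)" proof
 show "f x = 0" if "f : geg X 0" "x ~: cr G" for f x using D.geigD(1)[OF that(1)] out that(2) by blast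
 have "dop X (cst (cr G) c) = 0" for c by (rule ext) (simp add: dop_def zcut_def lt_cst gl_const[OF X] fun_at)
 thus "cst (cr G) c : geg X 0" for c by (auto simp: D.geig_def dm0 cst_in intro!: exI[of _ 1])
 show "f + g : geg X 0" if "f : geg X 0" "g : geg X 0" for f g by (rule fs_ad[OF D.ss_geig that])
 show "f * g : geg X 0" if "f : geg X 0" "g : geg X 0" for f g using geg_mult[OF X that] by simp
 qed
 ultimately show "A <= geg X 0" using falg_least S(3) by metis
 qed
qed

text \<open>The block matrix with first row (1, b), zeros below the 1 and rho in the lower right
  corner: an extension with trivial submodule and quotient rho.\<close>

definition ext :: "nat => (nat => nat => 'g => 'a) => (nat => 'g => 'a) => nat => nat => 'g => 'a" where
 "ext n rho b i j = (case i of 0 => (case j of 0 => cst (cr G) 1 | Suc j' => b j')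
 | Suc i' => (case j of 0 => 0 | Suc j' => rho i' j'))"

lemma ext_simps: "ext n rho b 0 0 = cst (cr G) 1" "ext n rho b 0 (Suc j) = b j" "ext n rho b (Suc i) 0 = 0"
 "ext n rho b (Suc i) (Suc j) = rho i j" by (simp_all add: ext_def)

text \<open>The condition on b is multiplicativity of the first row of \<open>ext\<close>;
  \<open>cocycle_splits\<close> writes b as a coboundary.\<close>

definition cocycle :: "nat => (nat => nat => 'g => 'a) => (nat => 'g => 'a) => bool" where
 "cocycle n rho b \<longleftrightarrow> rep n rho & (ALL j<n. b j : A & (ALL g:cr G. ALL h:cr G.
 b j (g \<otimes> h) = b j h + (SUM i<n. b i g * rho i j h)))"

lemma cocycleD: assumes "cocycle n rho b" shows "rep n rho" "j < n ==> b j : A"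
 "j < n ==> g : cr G ==> h : cr G ==> b j (g \<otimes> h) = b j h + (SUM i<n. b i g * rho i j h)"
 "j < n ==> b j \<one> = 0" proof -
 show r: "rep n rho" and "j < n ==> b j : A"
 and c: "j < n ==> g : cr G ==> h : cr G ==> b j (g \<otimes> h) = b j h + (SUM i<n. b i g * rho i j h)" for g h
 using assms unfolding cocycle_def by blast+
 assume j: "j < n"
 have "(SUM i<n. b i \<one> * rho i j \<one>) = (SUM i<n. b i \<one> * (if i = j then 1 else 0))" by (rule sum.cong) (simp_all add: repD(2)[OF r _ j])
 thus "b j \<one> = 0" using c[OF j, of \<one> \<one>] sum_mult_delta[OF j, of "%i. b i \<one>"] by simp
qed

lemma rep_ext: assumes c: "cocycle n rho b" shows "rep (Suc n) (ext n rho b)" unfolding rep_def proof (intro allI impI)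
 fix i j assume ij: "i < Suc n" "j < Suc n"
 note r = cocycleD(1)[OF c]
 have S: "(SUM k<Suc n. ext n rho b i k g * ext n rho b k j h) =
 ext n rho b i 0 g * ext n rho b 0 j h + (SUM k<n. ext n rho b i (Suc k) g * ext n rho b (Suc k) j h)" for g h by (rule sum.lessThan_Suc_shift)
 show "ext n rho b i j : A & ext n rho b i j \<one> = (if i = j then 1 else 0) &
 (ALL g:cr G. ALL h:cr G. ext n rho b i j (g \<otimes> h) = (SUM k<Suc n. ext n rho b i k g * ext n rho b k j h))"
 unfolding S using ij cocycleD(2-4)[OF c] repD[OF r] by (cases i; cases j) (auto simp: ext_simps cst_in zero_in cst_at fun_at)
qed

text \<open>Conjugation by g transforms one pair of dual families into another, and the sum of
  products does not depend on the pair. The trace form is that of rho while the products are formed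
  in sg, so that sg may be an extension of rho.\<close>

lemma casimir_commutes: assumes r: "rep n rho" and s: "rep m sg" and g: "g : cr G" and xy: "!!a. a < d ==> x a : gl" "!!a. a < d ==> y a : gl"
 and X: "!!X i j. X : gl ==> i < m ==> j < m ==> X (sg i j) = (SUM a<d. bf n rho X (y a) * x a (sg i j))"
 and Y: "!!X i j. X : gl ==> i < m ==> j < m ==> X (sg i j) = (SUM a<d. bf n rho X (x a) * y a (sg i j))"
 and Z: "Z = (%i j. SUM a<d. mm m (dmat (x a) sg) (dmat (y a) sg) i j)" and ij: "i < m" "j < m" shows "mm m (mat sg g) Z i j = mm m Z (mat sg g) i j"
proof -
 let ?P = "mat sg g" and ?Q = "mat sg (inv g)"
 have Adg: "!!X. X : gl ==> Ad g X : gl" "!!X. X : gl ==> Ad (inv g) X : gl" using g Ad_gl by simp_all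
 have x: "(SUM a<d. bf n rho (Ad g (y a)) (x c) * Ad g (x a) (sg i k)) = x c (sg i k)" if c: "c < d" and ik: "i < m" "k < m" for c i k proof -
 let ?V = "Ad (inv g) (x c)"
 have "(SUM a<d. bf n rho (Ad g (y a)) (x c) * Ad g (x a) (sg i k)) =
 (SUM a<d. bf n rho ?V (y a) * mm m ?P (mm m (dmat (x a) sg) ?Q) i k)" proof (rule sum.cong[OF refl])
 fix a assume a: "a : {..<d}"
 have "bf n rho (Ad g (y a)) (x c) = bf n rho ?V (y a)" using bf_Ad_inv[OF r g, of "y a" "x c"] xy a c by (simp add: bf_sym[of n rho "y a"])
 moreover have "Ad g (x a) (sg i k) = mm m ?P (mm m (dmat (x a) sg) ?Q) i k" using dmat_Ad[OF s g _ ik, of "x a"] xy a by (simp add: dmat_def)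
 ultimately show "bf n rho (Ad g (y a)) (x c) * Ad g (x a) (sg i k) =
 bf n rho ?V (y a) * mm m ?P (mm m (dmat (x a) sg) ?Q) i k" by simp
 qed
 also have "... = mm m ?P (mm m (%i j. SUM a<d. bf n rho ?V (y a) * dmat (x a) sg i j) ?Q) i k" by (simp only: mm_sum mm_scale)
 also have "... = mm m ?P (mm m (dmat ?V sg) ?Q) i k"
 by (intro mm_cong refl) (use X[OF Adg(2)[OF xy(1)[OF c]]] in \<open>simp_all add: dmat_def\<close>)
 also have "... = dmat (Ad g ?V) sg i k" by (rule dmat_Ad[OF s g Adg(2)[OF xy(1)[OF c]] ik, symmetric])
 finally show ?thesis using Ad_inv[OF g repD(1)[OF s ik]] by (simp add: dmat_def)
 qed
 \<comment> \<open>\<open>Ad g (y a)\<close> is expanded in the family y; summing over a first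
   reassembles \<open>x c\<close> by the identity above, and what remains is Z.\<close>
 have "mm m ?P (mm m Z ?Q) i j = (SUM a<d. mm m (dmat (Ad g (x a)) sg) (dmat (Ad g (y a)) sg) i j)" if "i < m" "j < m" for i j
 unfolding Z mm_sum by (rule sum.cong) (simp_all add: dmat_Ad_mm[OF s g] xy that)
 also have "... i j = (SUM a<d. SUM k<m. SUM c<d. (bf n rho (Ad g (y a)) (x c) * Ad g (x a) (sg i k)) * y c (sg k j))"
 if "i < m" "j < m" for i j using that xy Adg by (simp add: mm_def dmat_def Y[of "Ad g (y _)"] sdl mult_ac)
 also have "... i j = (SUM k<m. SUM c<d. (SUM a<d. bf n rho (Ad g (y a)) (x c) * Ad g (x a) (sg i k)) * y c (sg k j))" for i j
 by (subst sum.swap, rule sum.cong[OF refl], subst sum.swap) (simp add: sdr)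
 also have "... i j = (SUM k<m. SUM c<d. x c (sg i k) * y c (sg k j))" if "i < m" for i j using x that by simp
 also have "... i j = Z i j" for i j unfolding Z mm_def dmat_def by (rule sum.swap)
 finally have PZQ: "mm m ?P (mm m Z ?Q) i j = Z i j" if "i < m" "j < m" for i j using that by blast
 have "mm m Z ?P i j = mm m (mm m ?P (mm m Z ?Q)) ?P i j" by (rule mm_cong) (simp_all add: PZQ ij)
 also have "... = mm m (mm m ?P Z) (mm m ?Q ?P) i j" by (simp add: mm_assoc)
 also have "... = mm m ?P Z i j" by (rule mm_one) (simp_all add: mat_inv[OF s g] ij)
 finally show ?thesis by simp
qed

end

context red_group
begin

text \<open>Cartan's criterion in the form used here: if the replicas of elements of I fall into L,
  elements of I orthogonal to L pass the trace test in the faithful representation, so they form a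
  Lie ideal of locally nilpotent elements and vanish.\<close>

lemma nil_sub_zero: assumes s: "rep m sg" and faith: "!!X. X : gl ==> nilp m (dmat X sg) ==> A <= geg X 0"
 and L: "lie_sub {X : I. ALL Y:L. bf m sg X Y = 0}"
 and rp: "!!X psi X'. X : I ==> (!!x y. psi (x + y) = psi x + psi y) ==> replica X psi X' ==> X' : L"
 and X: "X : I" "!!Y. Y : L ==> bf m sg X Y = 0" and f: "f : A" shows "X f = 0" proof (rule nilpotent_ideal_zero[OF L _ _ f])
 fix X assume X: "X : {X : I. ALL Y:L. bf m sg X Y = 0}"
 hence g: "X : gl" using lie_subD(1)[OF L] by blast
 show "A <= geg X 0" proof (rule faith[OF g nilp_if_traces_vanish[OF g s]])
 fix psi X' assume psi: "!!x y. psi (x + y) = psi x + psi y" and r: "replica X psi X'"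
 have "X' : L" by (rule rp[OF _ psi r]) (use X in blast)
 thus "tr m (mm m (dmat X sg) (dmat X' sg)) = 0" using X by (simp add: bf_def)
 qed
qed (use X in blast)

text \<open>Let k be the kernel of rho and l that of the extension. Elements of k act nilpotently in
  the extension, so their replicas lie in l, and the part of k orthogonal to l for a faithful trace
  form vanishes. Hence X agrees on A with its projection to l, which kills b.\<close>

lemma cocycle_killed: assumes c: "cocycle n rho b" and X: "X : gl" "!!i j. i < n ==> j < n ==> X (rho i j) = 0" and j: "j < n" shows "X (b j) = 0"
proof -
 note r = cocycleD(1)[OF c] and re = rep_ext[OF c]
 let ?k = "{X : gl. ALL i<n. ALL j<n. X (rho i j) = 0}"
 let ?l = "{X : gl. ALL i<Suc n. ALL j<Suc n. X (ext n rho b i j) = 0}"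
 obtain m sg where s: "rep m sg" and faith: "!!X. X : gl ==> nilp m (dmat X sg) ==> A <= geg X 0" by (rule faithful_rep) blast
 have lk: "?l <= ?k" proof
 fix X assume X: "X : ?l"
 have "X (rho i j) = 0" if "i < n" "j < n" for i j using X that ext_simps(4)[of n rho b i j] by (metis (mono_tags, lifting) Suc_mono mCe)
 thus "X : ?k" using X by blast
 qed
 have perp: "lie_sub {X : ?k. ALL Y:?l. bf m sg X Y = 0}" by (rule lie_sub_perp[OF s lie_sub_ker(1)[OF r]])
 (use lie_sub_ker(2)[OF re] lie_subD(4)[OF lie_sub_ker(1)[OF re]] in auto)
 have zero: "X f = 0" if X: "X : ?k" "!!Y. Y : ?l ==> bf m sg X Y = 0" and f: "f : A" for X f proof (rule nil_sub_zero[OF s faith perp _ X f])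
 fix X psi X' assume X: "X : ?k" and psi: "!!x y. psi (x + y) = psi x + (psi y :: 'a)" and rp: "replica X psi X'"
 \<comment> \<open>With rho and the constants killed, only the first row survives, and without its
   diagonal entry; such a matrix has square zero.\<close>
 have "nilp (Suc n) (dmat X (ext n rho b))" unfolding nilp_def proof
 fix w :: "nat => 'a" assume "w : Kn (Suc n)"
 let ?M = "mv (Suc n) (dmat X (ext n rho b))"
 have c0: "X (cst (cr G) 1) = 0" "X 0 = 0" using X gl_const gl_zero by blast+
 have z: "?M v i = 0" if "i > 0" for v i
 using that X c0 by (cases i) (auto simp: mv_def dmat_def ext_simps sum.lessThan_Suc_shift simp del: sum.lessThan_Suc)
 have z0: "?M u 0 = 0" if "!!k. u (Suc k) = 0" for u
 using that c0 by (simp add: mv_def dmat_def ext_simps sum.lessThan_Suc_shift del: sum.lessThan_Suc)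
 have "?M (?M w) i = 0" for i by (cases i) (simp_all add: z z0)
 hence "(?M ^^ 2) w = 0" by (auto simp: numeral_2_eq_2 fei fun_at)
 thus "EX N. (?M ^^ N) w = 0" by blast
 qed
 thus "X' : ?l" using replica_of_nilp[OF _ re _ psi rp] X rp unfolding replica_def by blast
 qed blast
 have lg: "?l <= gl" by blast
 have nd: "ALL X:?l. (ALL Y:?l. bf m sg X Y = 0) --> (ALL i<m. ALL j<m. X (sg i j) = 0)" proof (intro ballI impI allI)
 fix X i j assume X: "X : ?l" "ALL Y:?l. bf m sg X Y = 0" and ij: "i < m" "j < m"
 show "X (sg i j) = 0" by (rule zero[OF subsetD[OF lk X(1)] _ repD(1)[OF s ij]]) (use X in blast)
 qed
 obtain d x y where xy: "ALL a<d. x a : ?l & y a : ?l & bf m sg (x a) (y a) = 1"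
 and ex: "ALL X:?l. ALL i<m. ALL j<m. X (sg i j) = lc d (%a. bf m sg X (y a)) x (sg i j) &
 X (sg i j) = lc d (%a. bf m sg X (x a)) y (sg i j)" using dual_bases[OF lie_subD(2)[OF lie_sub_ker(1)[OF re]] lg nd] by (elim exE conjE) (rule that)
 \<comment> \<open>The orthogonal projection of X onto the kernel of the extension;
   \<open>zero\<close> applies to X - Y.\<close>
 define Y where "Y = lc d (%a. bf m sg X (y a)) x"
 have Yl: "Y : ?l" unfolding Y_def using xy by (intro lc_in[OF lie_subD(2)[OF lie_sub_ker(1)[OF re]]]) blast
 have "(X - Y) (b j) = 0" proof (rule zero[of "X - Y"])
 show "X - Y : ?k" using X Yl lk fs.subspace_diff[OF lie_subD(2)[OF lie_sub_ker(1)[OF r]], of X Y] by blast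
 fix Z assume Z: "Z : ?l"
 have "bf m sg X Z = bf m sg (lc d (%a. bf m sg Z (x a)) y) X" unfolding bf_sym[of m sg X Z] by (rule bf_cong) (use ex Z in blast)
 also have "... = bf m sg Y Z" unfolding bf_lc Y_def by (rule sum.cong) (simp_all add: bf_sym[of m sg _ X] bf_sym[of m sg _ Z] mcm)
 finally show "bf m sg (X - Y) Z = 0" by (simp add: bf_linear)
 qed (rule cocycleD(2)[OF c j])
 moreover have "Y (b j) = 0" using Yl j ext_simps(2)[of n rho b j] by (metis (mono_tags, lifting) Suc_mono mCe zero_less_Suc)
 ultimately show ?thesis by (simp add: fun_at)
qed

text \<open>The replicas of elements of \<open>gl\<close> are again in \<open>gl\<close>, so the
  radical of the trace form passes the trace test for nilpotency, and a Lie ideal that is nilpotent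
  in an irreducible representation acts by zero.\<close>

lemma irred_radical: assumes ir: "irred n rho" and X: "X : gl" "!!Y. Y : gl ==> bf n rho X Y = 0" and ij: "i < n" "j < n" shows "X (rho i j) = 0"
proof -
 let ?L = "{X : gl. ALL Y:gl. bf n rho X Y = 0}"
 note r = irredD(1)[OF ir]
 have L: "lie_sub ?L" by (rule lie_sub_perp[OF r lie_sub_gl]) (simp_all add: brf_gl Ad_gl)
 show ?thesis proof (rule nilpotent_ideal_acts_trivially[OF L ir _ _ ij])
 fix X assume X: "X : ?L"
 thus "nilp n (dmat X rho)" by (intro nilp_if_traces_vanish[OF _ r]) (auto simp: replica_def bf_def[symmetric])
 qed (use X in blast)
qed

text \<open>If the trace form of \<open>\<rho>\<close> is nonzero, its Casimir element splits the extension.\<close>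

lemma casimir_splits: assumes ir: "irred n rho" and c: "cocycle n rho b" and X0: "X0 : gl" "i0 < n" "j0 < n" "X0 (rho i0 j0) ~= 0"
 shows "EX w. ALL g:cr G. ALL j<n. b j g = (SUM i<n. w i * rho i j g) - w j" proof -
 note r = irredD(1)[OF ir] and re = rep_ext[OF c]
 obtain d x y where xy: "ALL a<d. x a : gl & y a : gl & bf n rho (x a) (y a) = 1"
 and ex: "ALL X:gl. ALL i<n. ALL j<n. X (rho i j) = lc d (%a. bf n rho X (y a)) x (rho i j) &
 X (rho i j) = lc d (%a. bf n rho X (x a)) y (rho i j)" using dual_bases[OF subspace_gl order_refl, of n rho] irred_radical[OF ir] by blast
 have "X0 (rho i0 j0) = lc d (%a. bf n rho X0 (y a)) x (rho i0 j0)" using ex X0 by blast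
 hence d: "d ~= 0" using X0(4) by (cases d) (simp_all add: lc_at)
 \<comment> \<open>An identity between point derivations on the entries of rho carries over to the
   entries of the extension, because the difference of the two sides also kills the cocycle.\<close>
 have ext: "X (ext n rho b i j) = lc d u z (ext n rho b i j)"
 if X: "X : gl" and z: "!!a. a < d ==> z a : gl" and eq: "ALL i<n. ALL j<n. X (rho i j) = lc d u z (rho i j)"
 and ij: "i < Suc n" "j < Suc n" for X u z i j proof -
 define Y where "Y = X - lc d u z"
 have Y: "Y : gl" unfolding Y_def by (intro fs.subspace_diff[OF subspace_gl X] lc_in[OF subspace_gl z])
 have Yr: "Y (rho i j) = 0" if "i < n" "j < n" for i j using eq that by (simp add: Y_def fun_at)
 have "Y (ext n rho b i j) = 0" using ij by (cases i; cases j) (simp_all add: ext_simps cocycle_killed[OF c Y Yr] Yr gl_const[OF Y] gl_zero[OF Y])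
 thus ?thesis by (simp add: Y_def fun_at)
 qed
 have xg: "x a : gl" "y a : gl" if "a < d" for a using xy that by blast+
 have exx: "X (ext n rho b i j) = (SUM a<d. bf n rho X (y a) * x a (ext n rho b i j))" if "X : gl" "i < Suc n" "j < Suc n" for X i j
 using ext[where z = x, OF that(1) xg(1) _ that(2,3), where u = "%a. bf n rho X (y a)"] ex that(1) unfolding lc_at by blast
 have exy: "X (ext n rho b i j) = (SUM a<d. bf n rho X (x a) * y a (ext n rho b i j))" if "X : gl" "i < Suc n" "j < Suc n" for X i j
 using ext[where z = y, OF that(1) xg(2) _ that(2,3), where u = "%a. bf n rho X (x a)"] ex that(1) unfolding lc_at by blast
 define Z where "Z = (%i j. SUM a<d. mm (Suc n) (dmat (x a) (ext n rho b)) (dmat (y a) (ext n rho b)) i j)"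
 define Zr where "Zr = (%i j. SUM a<d. mm n (dmat (x a) rho) (dmat (y a) rho) i j)"
 have comm: "mm (Suc n) (mat (ext n rho b) g) Z i j = mm (Suc n) Z (mat (ext n rho b) g) i j"
 if "g : cr G" "i < Suc n" "j < Suc n" for g i j by (rule casimir_commutes[OF r re that(1) xg exx exy Z_def that(2,3)])
 have commr: "mm n (mat rho g) Zr i j = mm n Zr (mat rho g) i j"
 if "g : cr G" "i < n" "j < n" for g i j
 by (rule casimir_commutes[OF r r that(1) xg _ _ Zr_def that(2,3)]) (use ex in \<open>unfold lc_at, blast+\<close>)
 obtain l where l: "ALL i<n. ALL j<n. Zr i j = (if i = j then l else 0)" using schur[OF ir commr] by blast
 have y0: "y a (cst (cr G) 1) = 0" "y a 0 = 0" "x a 0 = 0" if "a < d" for a using gl_const gl_zero xg[OF that] by blast+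
 have Z: "Z 0 0 = 0" "Z (Suc i) 0 = 0" "Z (Suc i) (Suc j) = Zr i j" for i j
 by (simp_all add: Z_def Zr_def mm_def dmat_def sum.lessThan_Suc_shift ext_simps y0 del: sum.lessThan_Suc)
 \<comment> \<open>The trace of the Casimir matrix is the number d of basis elements. It is positive
   because \<open>X0\<close> does not act by zero, so the scalar l is nonzero in characteristic
   zero.\<close>
 have "l * of_nat n = (SUM i<n. Zr i i)" using l by simp
 also have "... = (SUM a<d. bf n rho (x a) (y a))" unfolding Zr_def bf_def tr_def by (rule sum.swap)
 also have "... = of_nat d" using xy by simp
 finally have l0: "l ~= 0" using d by auto
 \<comment> \<open>Z has zero first column and lower block l times the identity, so comparing first
   rows in its commutation with the extension solves for b.\<close>
 define w where "w j = Z 0 (Suc j) / l" for j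
 have "b j g = (SUM i<n. w i * rho i j g) - w j" if g: "g : cr G" and j: "j < n" for g j proof -
 have "mm (Suc n) (mat (ext n rho b) g) Z 0 (Suc j) = Z 0 (Suc j) + (SUM i<n. b i g * Zr i j)"
 using g by (simp add: mm_def mat_def sum.lessThan_Suc_shift ext_simps Z cst_at del: sum.lessThan_Suc)
 also have "(SUM i<n. b i g * Zr i j) = (SUM i<n. b i g * l * (if i = j then 1 else 0))" by (rule sum.cong) (simp_all add: l j)
 also have "... = b j g * l" by (rule sum_mult_delta[OF j])
 also have "mm (Suc n) (mat (ext n rho b) g) Z 0 (Suc j) = (SUM i<n. Z 0 (Suc i) * rho i j g)" unfolding comm[OF g zero_less_Suc Suc_mono[OF j]]
 by (simp add: mm_def mat_def sum.lessThan_Suc_shift ext_simps Z del: sum.lessThan_Suc)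
 finally have "b j g * l = (SUM i<n. Z 0 (Suc i) * rho i j g) - Z 0 (Suc j)" by simp
 hence "b j g = ((SUM i<n. Z 0 (Suc i) * rho i j g) - Z 0 (Suc j)) / l" using l0 by (simp add: eq_divide_eq)
 thus ?thesis by (simp add: w_def diff_divide_distrib sum_divide_distrib)
 qed
 thus ?thesis by blast
qed

end

section \<open>Powers of the maximal ideal at the identity\<close>

context aff_group
begin

primrec mpow :: "nat => ('g => 'a) set" where
 "mpow 0 = A"
| "mpow (Suc n) = fs.span {x * h |x h. x : A & x \<one> = 0 & h : mpow n}"

lemma mpow_ideal: "fideal (mpow n)" proof (induction n)
 case 0
 thus ?case by (simp add: fideal_def zero_in add_in mult_in)
next
 case (Suc n)
 let ?S = "{x * h |x h. x : A & x \<one> = 0 & h : mpow n}"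
 note I = idealD[OF Suc]
 have "?S <= A" using I(1) mult_in by blast
 hence "mpow (Suc n) <= A" using fs.span_minimal[OF _ subspace] by simp
 moreover have "a * f : fs.span ?S" if a: "a : A" and f: "f : fs.span ?S" for a f proof -
 have "fs.span ?S <= {f. a * f : fs.span ?S}" proof (rule fs.span_minimal)
 show "?S <= {f. a * f : fs.span ?S}" proof clarify
 fix x h assume xh: "x : A" "x \<one> = 0" "h : mpow n"
 have "x * (a * h) : ?S" using xh I(4)[OF a] by blast
 thus "a * (x * h) : fs.span ?S" by (metis (no_types, lifting) fs.span_base mult.left_commute)
 qed
 have sc: "a * fsc c f = fsc c (a * f)" for c f by (rule ext) (simp add: fun_at)
 show "fsub {f. a * f : fs.span ?S}" by (simp add: fs_def distrib_left sc fs.span_zero fs.span_add fs.span_scale)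
 qed
 thus ?thesis using f by blast
 qed
 ultimately show ?case by (simp add: fideal_def fs.span_zero fs.span_add)
qed

lemma mpow_prod: "x : A ==> x \<one> = 0 ==> h : mpow n ==> x * h : mpow (Suc n)" by (auto intro: fs.span_base)

lemma ideal_subspace: "fideal I ==> fsub I" using cst_mult cst_in by (auto simp: fideal_def fs_def) (metis subsetD)

lemma mpow_subspace: "fsub (mpow n)" by (rule ideal_subspace[OF mpow_ideal])

lemma mpow_Suc_induct: assumes "f : mpow (Suc n)" "fsub {f. P f}" "!!x h. x : A ==> x \<one> = 0 ==> h : mpow n ==> P (x * h)" shows "P f" proof -
 have "fs.span {x * h |x h. x : A & x \<one> = 0 & h : mpow n} <= {f. P f}" by (rule fs.span_minimal[OF _ assms(2)]) (use assms(3) in blast)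
 thus ?thesis using assms(1) by auto
qed

lemma mpow_in: "f : mpow n ==> f : A" using idealD(1)[OF mpow_ideal] by blast

lemma mpow_one: "f : mpow (Suc n) ==> f \<one> = 0" by (erule mpow_Suc_induct) (auto simp: fs_def fun_at)

lemma mpow_1: "f : A ==> f \<one> = 0 ==> f : mpow 1" using mpow_prod[of f "cst (cr G) 1" 0] one_mult[of f] cst_in by (simp add: mcm)

lemma mpow_mult: "f : mpow m ==> h : mpow n ==> f * h : mpow (m + n)" proof (induction m arbitrary: f)
 case 0
 thus ?case using idealD(4)[OF mpow_ideal] by simp
next
 case (Suc m)
 from Suc.prems(1) show ?case proof (rule mpow_Suc_induct)
 have sc: "fsc c f * h = fsc c (f * h)" for c f by (rule ext) (simp add: fun_at)
 show "fsub {f. f * h : mpow (Suc m + n)}" using mpow_subspace[of "Suc m + n"] by (simp add: fs_def distrib_right sc)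
 show "x * k * h : mpow (Suc m + n)" if "x : A" "x \<one> = 0" "k : mpow m" for x k
 using mpow_prod[OF that(1,2) Suc.IH[OF that(3) Suc.prems(2)]] by (simp add: mult.assoc)
 qed
qed

text \<open>The ideal sum of I and the n-th power of the maximal ideal at the identity.\<close>

definition mpi :: "('g => 'a) set => nat => ('g => 'a) set" where
 "mpi I n = {f. EX i:I. f - i : mpow n}"

lemma mpi_ideal: assumes I: "fideal I" shows "fideal (mpi I n)" "mpow n <= mpi I n" "I <= mpi I n" proof -
 show "mpow n <= mpi I n" "I <= mpi I n" using idealD(2)[OF I] idealD(2)[OF mpow_ideal] by (auto simp: mpi_def intro: bexI[of _ 0]) (metis diff_self)
 show "fideal (mpi I n)" unfolding fideal_def proof (intro conjI ballI)
 show "mpi I n <= A" proof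
 fix f assume "f : mpi I n"
 then obtain i where "i : I" "f - i : mpow n" by (auto simp: mpi_def)
 thus "f : A" using add_in[of "f - i" i] idealD(1)[OF I] mpow_in by auto
 qed
 show "0 : mpi I n" using \<open>I <= mpi I n\<close> idealD(2)[OF I] by blast
 fix f h assume "f : mpi I n" "h : mpi I n"
 then obtain i j where ij: "i : I" "f - i : mpow n" "j : I" "h - j : mpow n" by (auto simp: mpi_def)
 have "f + h - (i + j) = (f - i) + (h - j)" by simp
 thus "f + h : mpi I n" unfolding mpi_def using idealD(3)[OF I ij(1,3)] idealD(3)[OF mpow_ideal ij(2,4)] by (metis (mono_tags) mCe)
 next
 fix a f assume a: "a : A" and "f : mpi I n"
 then obtain i where i: "i : I" "f - i : mpow n" by (auto simp: mpi_def)
 have "a * f - a * i = a * (f - i)" by (simp add: right_diff_distrib)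
 thus "a * f : mpi I n" unfolding mpi_def using idealD(4)[OF I a i(1)] idealD(4)[OF mpow_ideal a i(2)] by (metis (mono_tags) mCe)
 qed
qed

definition val0 :: "('g => 'a) => 'g => 'a" where
 "val0 f = f - cst (cr G) (f \<one>)"

lemma val0: "f : A ==> val0 f : A" "val0 f \<one> = 0" "x : cr G ==> val0 f x = f x - f \<one>" "f \<one> = 0 ==> val0 f = f"
 by (auto simp: val0_def cst_in diff_in cst_at fun_at fei)

lemma val0_linear: "val0 (f + h) = val0 f + val0 h" "val0 (fsc c f) = fsc c (val0 f)" by (rule ext, simp add: val0_def cst_at fun_at als)+

lemma val0_mult: assumes "f : A" "h : A" shows "val0 (f * h) = val0 f * h + fsc (f \<one>) (val0 h)"
 "val0 (f * h) = fsc (f \<one>) (val0 h) + fsc (h \<one>) (val0 f) + val0 f * val0 h"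
 by (auto simp: val0_def cst_at fun_at fei als out[OF assms(1)] out[OF assms(2)])

text \<open>The family e represents a basis of the cotangent space at the identity of the scheme cut
  out by I. Its coordinate functionals annihilate I and the products of two functions vanishing at
  the identity, which makes them point derivations.\<close>

lemma exists_euler: assumes I: "fideal I" "!!f. f : I ==> f \<one> = 0"
 obtains r e dl where "!!i. i < r ==> e i : A" "!!i. i < (r::nat) ==> e i \<one> = 0" "!!i. i < r ==> dl i : gl"
 "!!i f. i < r ==> f : I ==> dl i f = 0"
 "!!f. f : A ==> val0 f - lc r (%i. dl i f) e : mpi I 2" proof -
 note mi = mpi_ideal(1)[OF I(1), of 2] and m2 = mpi_ideal(2)[OF I(1), of 2]
 note ms = ideal_subspace[OF mi]
 obtain S where S: "finite S" "A = falg (cr G) S" using fin_gen by blast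
 define T where "T = fs.span (val0 ` S)"
 have SA: "S <= A" using S(2) falg.gen by blast
 have "finite (val0 ` S)" using S(1) by simp
 hence T: "fsub T" "fd T" by (auto simp: T_def fd_def)
 have TA: "T <= A" unfolding T_def by (rule fs.span_minimal[OF _ subspace]) (use SA val0(1) in blast)
 have T1: "f \<one> = 0" if "f : T" for f proof -
 have "T <= {f. f \<one> = 0}" unfolding T_def by (rule fs.span_minimal) (auto simp: fs_def fun_at val0(2))
 thus ?thesis using that by blast
 qed
 have z: "EX t:T. f - t : mpi I 2" if "f : T" for f using that idealD(2)[OF mi] by (intro bexI[of _ f]) simp_all
 \<comment> \<open>Modulo I and the square of the maximal ideal, \<open>val0\<close> is a
   derivation, so the span of the shifted generators already represents every class.\<close>
 have dec0: "EX t:T. val0 f - t : mpi I 2" if "f : falg (cr G) S" for f using that proof (induction rule: falg.induct)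
 case (const c)
 have "val0 (cst (cr G) c) = 0" by (rule ext) (simp add: val0_def cst_at fun_at)
 thus ?case using z[OF fs_0[OF T(1)]] by simp
 next
 case (gen f)
 hence "val0 f : T" unfolding T_def by (intro fs.span_base) blast
 thus ?case by (rule z)
 next
 case (add f g)
 then obtain t u where tu: "t : T" "u : T" "val0 f - t : mpi I 2" "val0 g - u : mpi I 2" by blast
 have "val0 (f + g) - (t + u) = (val0 f - t) + (val0 g - u)" by (simp add: val0_linear)
 thus ?case using tu fs_ad[OF T(1)] idealD(3)[OF mi] by metis
 next
 case (mult f g)
 then obtain t u where tu: "t : T" "u : T" "val0 f - t : mpi I 2" "val0 g - u : mpi I 2" by blast
 have fg: "f : A" "g : A" using mult S(2) by blast+
 have "val0 f * val0 g : mpi I 2" using mpow_mult[OF mpow_1[OF val0(1,2)] mpow_1[OF val0(1,2)], OF fg] m2 by (simp add: numeral_2_eq_2 subset_iff)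
 moreover have "fsc (f \<one>) (val0 g - u) + fsc (g \<one>) (val0 f - t) : mpi I 2" by (intro fs_ad[OF ms] fs_sc[OF ms] tu)
 ultimately have "fsc (f \<one>) (val0 g - u) + fsc (g \<one>) (val0 f - t) + val0 f * val0 g : mpi I 2" by (rule idealD(3)[OF mi, rotated])
 moreover have "fsc (f \<one>) (val0 g - u) + fsc (g \<one>) (val0 f - t) + val0 f * val0 g =
 val0 (f * g) - (fsc (f \<one>) u + fsc (g \<one>) t)" unfolding val0_mult(2)[OF fg] by (simp add: fs_rd als)
 moreover have "fsc (f \<one>) u + fsc (g \<one>) t : T" by (intro fs_ad[OF T(1)] fs_sc[OF T(1)] tu)
 ultimately show ?case by metis
 qed
 have dec: "EX t:T. val0 f - t : mpi I 2" if "f : A" for f using dec0 that S(2) by simp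
 have sub: "fsub (T Int mpi I 2)" by (rule fs.subspace_inter[OF T(1) ms])
 obtain r e where e: "bmod (T Int mpi I 2) T r e" by (rule exists_bmod[OF sub T(1,2)]) auto
 have eT: "e i : T" if "i < r" for i by (rule bmD(1)[OF e that])
 define cf where "cf f = (SOME c. val0 f - lc r c e : mpi I 2)" for f
 have cf: "val0 f - lc r (cf f) e : mpi I 2" if f: "f : A" for f proof -
 obtain t where t: "t : T" "val0 f - t : mpi I 2" using dec[OF f] by blast
 obtain c where c: "t - lc r c e : mpi I 2" using bmD(3)[OF e t(1)] by blast
 have "val0 f - lc r c e : mpi I 2" using idealD(3)[OF mi t(2) c] by simp
 thus ?thesis unfolding cf_def by (rule someI[of "%c. val0 f - lc r c e : mpi I 2"])
 qed
 have uniq: "cf f i = d i" if f: "f : A" and d: "val0 f - lc r d e : mpi I 2" and i: "i < r" for f d i proof -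
 have "lc r d e - lc r (cf f) e : mpi I 2" using ideal_diff[OF mi cf[OF f] d] by simp
 moreover have "lc r d e - lc r (cf f) e : T" by (intro fs.subspace_diff[OF T(1)] lc_in[OF T(1) eT])
 ultimately have "lc r (%i. d i - cf f i) e : T Int mpi I 2" by (simp add: lc_diff)
 thus ?thesis using bmD(2)[OF e _ i] by fastforce
 qed
 have "(%f. cf f i) : gl" if i: "i < r" for i unfolding gl_def proof (intro CollectI conjI ballI allI)
 fix f g assume f: "f : A" and g: "g : A"
 show "cf (f + g) i = cf f i + cf g i" proof (rule uniq[OF add_in[OF f g] _ i])
 show "val0 (f + g) - lc r (%i. cf f i + cf g i) e : mpi I 2"
 using idealD(3)[OF mi cf[OF f] cf[OF g]] by (simp add: val0_linear lc_add[symmetric] als)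
 qed
 have "val0 f * val0 g : mpi I 2" using mpow_mult[OF mpow_1[OF val0(1,2)] mpow_1[OF val0(1,2)], OF f g] m2 by (simp add: numeral_2_eq_2 subset_iff)
 moreover have "fsc (f \<one>) (val0 g - lc r (cf g) e) + fsc (g \<one>) (val0 f - lc r (cf f) e) : mpi I 2"
 by (intro fs_ad[OF ms] fs_sc[OF ms] cf f g)
 ultimately have "fsc (f \<one>) (val0 g - lc r (cf g) e) + fsc (g \<one>) (val0 f - lc r (cf f) e) + val0 f * val0 g : mpi I 2"
 by (rule idealD(3)[OF mi, rotated])
 hence "val0 (f * g) - lc r (%i. f \<one> * cf g i + g \<one> * cf f i) e : mpi I 2"
 unfolding val0_mult(2)[OF f g] lc_add[symmetric] lc_scale[symmetric] by (simp add: fs_rd als)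
 from uniq[OF mult_in[OF f g] this i] show "cf (f * g) i = f \<one> * cf g i + cf f i * g \<one>" by simp
 next
 fix c f assume f: "f : A"
 show "cf (fsc c f) i = c * cf f i" proof (rule uniq[OF scale_in[OF f] _ i])
 show "val0 (fsc c f) - lc r (%i. c * cf f i) e : mpi I 2" using fs_sc[OF ms cf[OF f], of c] by (simp add: val0_linear lc_scale[symmetric] fs_rd)
 qed
 qed
 moreover have "cf f i = 0" if "i < r" "f : I" for i f proof (rule uniq[OF _ _ that(1)])
 show "f : A" using that(2) idealD(1)[OF I(1)] by blast
 have "lc r (%_. 0) e = 0" by (simp add: lc_def fs0 fei fun_at sum_fun_at)
 moreover have "val0 f = f" by (rule val0(4)) (rule I(2)[OF that(2)])
 ultimately show "val0 f - lc r (%_. 0) e : mpi I 2" using mpi_ideal(3)[OF I(1)] that(2) by auto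
 qed
 ultimately show ?thesis using that[of r e "%i f. cf f i"] cf TA T1 eT by blast
qed

text \<open>The Euler operator T, the sum of \<open>e i\<close> times the i-th vector field, acts on
  the n-th power of the maximal ideal as multiplication by n, modulo I and the next power. On J it
  raises the exponent directly, since J is stable under the fields; comparing both and dividing by n
  pushes J one power further. The division is where characteristic zero enters.\<close>

lemma derivation_stable_in_mpi: assumes I: "fideal I" "!!f. f : I ==> f \<one> = 0"
 and DI: "!!X f. X : gl ==> (!!i. i : I ==> X i = 0) ==> f : I ==> dop X f : I" and J: "J <= A" "!!f. f : J ==> f \<one> = 0"
 "!!X f. X : gl ==> (!!i. i : I ==> X i = 0) ==> f : J ==> dop X f : J" shows "J <= mpi I n" proof -
 obtain r e dl where e: "!!i. i < r ==> e i : A" "!!i. i < r ==> e i \<one> = 0" and dl: "!!i. i < r ==> dl i : gl"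
 and dlI: "!!i f. i < r ==> f : I ==> dl i f = 0" and eu: "!!f. f : A ==> val0 f - lc r (%i. dl i f) e : mpi I 2"
 by (rule exists_euler[of I, OF I(1)], erule I(2)) blast
 note mi = mpi_ideal(1)[OF I(1)] and mp = mpi_ideal(2)[OF I(1), THEN subsetD]
 note ms = ideal_subspace[OF mi]
 define T where "T f = (SUM i<r. e i * dop (dl i) f)" for f
 have dA: "dop (dl i) f : A" if "i < r" "f : A" for i f by (rule dop_in[OF dl[OF that(1)] that(2)])
 have lin: "T (f + h) = T f + T h" "T (fsc c f) = fsc c (T f)" if "f : A" "h : A" for f h c proof -
 have sc: "a * fsc c f = fsc c (a * f)" for a c and f :: "'g => 'a" by (rule ext) (simp add: fun_at)
 show "T (f + h) = T f + T h" "T (fsc c f) = fsc c (T f)"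
 using that by (simp_all add: T_def lin_op.D_add[OF lin_op_dop[OF dl]] lin_op.D_scale[OF lin_op_dop[OF dl]]
 distrib_left sum.distrib sc fs.scale_sum_right)
 qed
 have T1: "T f : mpow 1" if "f : A" for f unfolding T_def proof (rule ideal_sum[OF mpow_ideal])
 fix i assume "i : {..<r}"
 hence "e i * dop (dl i) f : mpow (Suc 0)" using e dA that by (intro mpow_prod) simp_all
 thus "e i * dop (dl i) f : mpow 1" by simp
 qed
 have mpi_mult: "f * h : mpi I (m + n)" if fh: "f : mpi I m" "h : mpow n" for f h m n proof -
 obtain i where i: "i : I" "f - i : mpow m" using fh(1) by (auto simp: mpi_def)
 have "h * i : I" by (rule idealD(4)[OF I(1) mpow_in[OF fh(2)] i(1)])
 moreover have "f * h - h * i = (f - i) * h" by (simp add: als)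
 ultimately show ?thesis using mpow_mult[OF i(2) fh(2)] unfolding mpi_def by (metis (mono_tags) mCe)
 qed
 have mpi_prod: "x * f : mpi I (Suc n)" if "x : A" "x \<one> = 0" "f : mpi I n" for x f n
 using mpi_mult[OF that(3) mpow_1[OF that(1,2)]] by (simp add: mcm)
 have Tx: "T f - f : mpi I 2" if f: "f : A" "f \<one> = 0" for f proof -
 have Tf: "T f = lc r (%i. dl i f) e + (SUM i<r. e i * val0 (dop (dl i) f))" proof (rule fun_ext)
 fix x assume "x : cr G"
 thus "T f x = (lc r (%i. dl i f) e + (SUM i<r. e i * val0 (dop (dl i) f))) x"
 using f(1) by (simp add: T_def fun_at sum_fun_at lc_at val0(3) dop_one sum.distrib[symmetric] als)
 qed (use f e in \<open>auto simp: T_def intro!: sum_in mult_in add_in dA val0(1) lc_in[OF subspace]\<close>)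
 have "(SUM i<r. e i * val0 (dop (dl i) f)) : mpi I 2" proof (rule ideal_sum[OF mi])
 fix i assume "i : {..<r}"
 thus "e i * val0 (dop (dl i) f) : mpi I 2"
 using mp[of _ 2] mpow_prod[OF e mpow_1[OF val0(1,2)], of i "dop (dl i) f"] dA f by (simp add: numeral_2_eq_2)
 qed
 from ideal_diff[OF mi this eu[OF f(1)]]
 have "(SUM i<r. e i * val0 (dop (dl i) f)) - (val0 f - lc r (%i. dl i f) e) : mpi I 2" .
 thus ?thesis unfolding Tf using val0(4)[of f] f(2) by (simp add: als)
 qed
 have Tn: "T b - fsc (of_nat n) b : mpi I (Suc n)" if "b : mpow n" for b n using that proof (induction n arbitrary: b)
 case 0
 thus ?case using mp[of _ 1] T1 by (simp add: fs0)
 next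
 case (Suc n)
 let ?Q = "%b. T b - fsc (of_nat (Suc n)) b : mpi I (Suc (Suc n))"
 have "b : A & ?Q b" using Suc.prems proof (rule mpow_Suc_induct)
 have "T 0 = 0" using lin(2)[OF zero_in zero_in, of 0] by (simp add: fs0)
 moreover have "?Q (f + h)" if "f : A" "h : A" "?Q f" "?Q h" for f h
 using idealD(3)[OF mi that(3,4)] that(1,2) by (simp add: lin fs.scale_right_distrib als)
 moreover have "?Q (fsc c f)" if "f : A" "?Q f" for f c using fs_sc[OF ms that(2), of c] that(1)
 by (simp add: lin[OF _ that(1)] fs_rd mcm del: mpow.simps)
 ultimately show "fsub {b. b : A & ?Q b}" using idealD(2)[OF mi] by (simp add: fs_def zero_in add_in scale_in del: mpow.simps)
 fix x h assume x: "x : A" "x \<one> = 0" and h: "h : mpow n"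
 note hA = mpow_in[OF h]
 have "T (x * h) = x * T h + T x * h" proof -
 have "T (x * h) = (SUM i<r. x * (e i * dop (dl i) h) + e i * dop (dl i) x * h)" unfolding T_def
 by (rule sum.cong) (simp_all add: dop_mult[OF dl x(1) hA] distrib_left mult.assoc mult.left_commute)
 thus ?thesis by (simp add: T_def sum.distrib sdl sdr)
 qed
 hence "T (x * h) - fsc (of_nat (Suc n)) (x * h) = x * (T h - fsc (of_nat n) h) + (T x - x) * h" by (simp add: fei fun_at als)
 moreover have "x * (T h - fsc (of_nat n) h) : mpi I (Suc (Suc n))" by (rule mpi_prod[OF x Suc.IH[OF h]])
 moreover have "(T x - x) * h : mpi I (Suc (Suc n))" using mpi_mult[OF Tx[OF x] h] by simp
 ultimately show "x * h : A & ?Q (x * h)" using idealD(3)[OF mi] mult_in[OF x(1) hA] by metis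
 qed
 thus ?case by blast
 qed
 \<comment> \<open>The field keeps f inside J, and the factor \<open>e i\<close> vanishing at the
   identity contributes one more power.\<close>
 have TJ: "T f : mpi I (Suc n)" if "f : J" "J <= mpi I n" for f n unfolding T_def proof (rule ideal_sum[OF mi])
 fix i assume "i : {..<r}"
 thus "e i * dop (dl i) f : mpi I (Suc n)" using e J(3)[OF dl dlI] that by (intro mpi_prod) auto
 qed
 have TI: "T f : I" if "f : I" for f unfolding T_def by (rule ideal_sum[OF I(1)]) (use idealD(4)[OF I(1) e(1)] DI[OF dl dlI] that in auto)
 show ?thesis proof (induction n)
 case 0
 have "J <= mpow 0" using J(1) by simp
 thus ?case using mp by blast
 next
 case IH: (Suc n)
 show ?case proof
 fix f assume f: "f : J"
 show "f : mpi I (Suc n)" proof (cases n)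
 case 0
 have "f : mpow (Suc n)" using mpow_1[of f] f J(1,2) 0 by auto
 thus ?thesis by (rule mp)
 next
 case (Suc m)
 obtain i where i: "i : I" "f - i : mpow n" using IH f by (auto simp: mpi_def)
 have fA: "f : A" and iA: "i : A" using f J(1) i(1) idealD(1)[OF I(1)] by blast+
 have Tfi: "T f = T (f - i) + T i" using lin(1)[OF diff_in[OF fA iA] iA] by simp
 have "T f - (T (f - i) - fsc (of_nat n) (f - i)) - T i + fsc (of_nat n) i : mpi I (Suc n)"
 by (intro fs_ad[OF ms] fs.subspace_diff[OF ms] fs_sc[OF ms] TJ[OF f IH] Tn[OF i(2)]
 subsetD[OF mpi_ideal(3)[OF I(1)]] TI i(1))
 moreover have "T f - (T (f - i) - fsc (of_nat n) (f - i)) - T i + fsc (of_nat n) i = fsc (of_nat n) f" unfolding Tfi by (simp add: fs_rd)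
 ultimately have "fsc (inverse (of_nat n)) (fsc (of_nat n) f) : mpi I (Suc n)" using fs_sc[OF ms] by metis
 moreover have "fsc (inverse (of_nat n)) (fsc (of_nat n) f) = f" unfolding Suc by (simp add: fei fun_at del: of_nat_Suc)
 ultimately show ?thesis by simp
 qed
 qed
 qed
qed

text \<open>The shifted generators generate the shifts of the whole subalgebra as an ideal of A. It
  serves twice: for the maximal ideal of A itself and for the ideal \<open>Iv\<close> of the fibre
  of an orbit map.\<close>

lemma falg_val0: assumes S: "finite S" "S <= A" and f: "f : falg (cr G) S" shows "EX a. (ALL s:S. a s : A) & val0 f = (SUM s:S. val0 s * a s)" using f
 proof (induction rule: falg.induct)
 case (const c)
 have "val0 (cst (cr G) c) = (SUM s:S. val0 s * 0)" by (rule ext) (simp add: val0_def cst_at fun_at)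
 thus ?case using zero_in by (intro exI[of _ "%_. 0"]) simp
 next
 case (gen f)
 have "val0 f = (SUM s:S. val0 s * (if s = f then cst (cr G) 1 else 0))" proof -
 have "(SUM s:S. val0 s * (if s = f then cst (cr G) 1 else 0)) = (SUM s:S. if s = f then val0 s * cst (cr G) 1 else 0)" by (rule sum.cong) auto
 thus ?thesis using gen S(1) one_mult[OF val0(1)] S(2) by (auto simp: mcm)
 qed
 thus ?case using zero_in cst_in by (intro exI[of _ "%s. if s = f then cst (cr G) 1 else 0"]) auto
 next
 case (add f g)
 then obtain a c where a: "ALL s:S. a s : A" "val0 f = (SUM s:S. val0 s * a s)" and c: "ALL s:S. c s : A" "val0 g = (SUM s:S. val0 s * c s)" by blast
 thus ?case by (intro exI[of _ "%s. a s + c s"]) (simp add: val0_linear add_in distrib_left sum.distrib)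
 next
 case (mult f g)
 then obtain a c where a: "ALL s:S. a s : A" "val0 f = (SUM s:S. val0 s * a s)" and c: "ALL s:S. c s : A" "val0 g = (SUM s:S. val0 s * c s)" by blast
 have fg: "f : A" "g : A" using mult falg_least[OF fun_alg_axioms S(2)] by blast+
 have sc: "h * fsc e f = fsc e (h * f)" for h e and f :: "'g => 'a" by (rule ext) (simp add: fun_at)
 show ?case by (intro exI[of _ "%s. a s * g + fsc (f \<one>) (c s)"])
 (use a c fg in \<open>simp add: val0_mult(1) add_in mult_in scale_in distrib_left sum.distrib sc
 sdr fs.scale_sum_right mult.assoc\<close>)
 qed

text \<open>Krull's intersection theorem at the identity, via the Rees algebra of the maximal ideal.\<close>

lemma krull: assumes I: "fideal I" and b: "!!n. b : mpi I n" shows "EX u:A. u \<one> = 0 & b - u * b : I" proof -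
 have "EX c. c : mpow n & b - c : I" for n proof -
 obtain i where "i : I" "b - i : mpow n" using b[of n] by (auto simp: mpi_def)
 thus ?thesis by (intro exI[of _ "b - i"]) simp
 qed
 then obtain bs where bs: "!!n. bs n : mpow n" "!!n. b - bs n : I" by metis
 have bA: "b : A" using b[of 0] idealD(1)[OF mpi_ideal(1)[OF I]] by blast
 let ?G = "cr G"
 obtain S where S: "finite S" "A = falg ?G S" using fin_gen by blast
 have SA: "S <= A" using S(2) falg.gen by blast
 note mgen0 = falg_val0[OF S(1) SA]
 have mgen: "EX a. (ALL s:S. a s : A) & x = (SUM s:S. val0 s * a s)" if "x : A" "x \<one> = 0" for x using mgen0[of x] that S(2) val0(4) by metis
 \<comment> \<open>The function a times the n-th power of a new variable t, on the product of G with
   the affine line. The generators chosen below give the Rees algebra R, which is finitely generated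
   and hence Noetherian.\<close>
 define pw :: "nat => ('g => 'a) => 'g \<times> 'a => 'a" where "pw n a = (%(g, t). t ^ n * a g)" for n a
 let ?Y = "?G \<times> (UNIV :: 'a set)"
 let ?S = "pw 0 ` S Un (%s. pw 1 (val0 s)) ` S"
 have out': "val0 s x = 0" if "s : S" "x ~: ?G" for s x using out[OF val0(1)] that SA by blast
 have supp: "supp_in ?Y ?S" unfolding supp_in_def using SA out out' by (auto simp: pw_def)
 define R where "R = falg ?Y ?S"
 interpret R: fun_alg ?Y R unfolding R_def by (rule fun_alg_falg[OF supp])
 have noeth: "R.noeth" unfolding R_def by (rule noeth_falg[OF _ supp]) (use S(1) in simp)
 have pw_lin: "pw n (f + h) = pw n f + pw n h" "pw n (fsc c f) = fsc c (pw n f)" "pw n 0 = 0"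
 "pw m f * pw n h = pw (m + n) (f * h)" for m n f h c by (auto simp: pw_def fun_at fei als power_add)
 have pw0: "pw 0 a : R" if "a : A" for a proof -
 have "pw 0 a : R" if "a : falg ?G S" for a using that proof (induction rule: falg.induct)
 case (const c)
 have "pw 0 (cst ?G c) = cst ?Y c" by (rule ext) (auto simp: pw_def cst_at split: if_splits)
 thus ?case using R.cst_in by simp
 next
 case (gen f)
 thus ?case unfolding R_def by (intro falg.gen) blast
 next
 case (add f g)
 thus ?case unfolding pw_lin(1) by (intro R.add_in)
 next
 case (mult f g)
 hence "pw 0 f * pw 0 g : R" by (intro R.mult_in)
 thus ?case unfolding pw_lin(4) by simp
 qed
 thus ?thesis using that S(2) by blast
 qed
 have pw_in: "pw n a : R" if "a : mpow n" for n a using that proof (induction n arbitrary: a)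
 case (Suc n)
 from Suc.prems show ?case proof (rule mpow_Suc_induct)
 show "fsub {a. pw (Suc n) a : R}" by (simp add: fs_def pw_lin R.zero_in R.add_in R.scale_in)
 fix x h assume x: "x : A" "x \<one> = 0" and h: "h : mpow n"
 obtain a where a: "ALL s:S. a s : A" "x = (SUM s:S. val0 s * a s)" using mgen[OF x] by blast
 have "pw (Suc n) (x * h) = (SUM s:S. pw 1 (val0 s) * (pw 0 (a s) * pw n h))"
 unfolding a(2) by (rule ext) (auto simp: pw_def fun_at sum_fun_at sdr sdl mult_ac)
 moreover have "pw 1 (val0 s) : R" if "s : S" for s unfolding R_def by (rule falg.gen) (use that in blast)
 ultimately show "pw (Suc n) (x * h) : R" using a(1) pw0 Suc.IH[OF h] by (auto intro!: R.sum_in R.mult_in)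
 qed
 qed (use pw0 in simp)
 have ev: "fhom (%a. a g)" if "g : ?G" for g by (rule eval_hom[OF that])
 have evm: "evp (%a. a g) t (monom a n) = a g * t ^ n" for g t a n by (simp add: evp_def map_poly_monom poly_monom zero_fun_apply)
 have z: "0 : mpow k" for k by (rule idealD(2)[OF mpow_ideal])
 \<comment> \<open>Conversely, the coefficient at the k-th power of t of any element of R lies in
   the k-th power of the maximal ideal.\<close>
 have struct: "EX p. (ALL k. coeff p k : mpow k) & (ALL g:?G. ALL t. F (g, t) = evp (%a. a g) t p)" if "F : R" for F proof -
 have pol: "p : polys" if "ALL k. coeff p k : mpow k" for p using that mpow_in by (auto simp: polys_def)
 have mon: "ALL k. coeff (monom a n) k : mpow k" if "a : mpow n" for a n using that idealD(2)[OF mpow_ideal] by (simp add: coeff_monom)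
 have "EX p. (ALL k. coeff p k : mpow k) & (ALL g:?G. ALL t. F (g, t) = evp (%a. a g) t p)" if "F : falg ?Y ?S" for F using that
 proof (induction rule: falg.induct)
 case (const c)
 show ?case by (rule exI[of _ "monom (cst ?G c) 0"]) (use mon[of "cst ?G c" 0] cst_in in \<open>simp add: evm cst_at\<close>)
 next
 case (gen f)
 then consider s where "s : S" "f = pw 0 s" | s where "s : S" "f = pw 1 (val0 s)" by blast
 thus ?case proof cases
 case 1
 show ?thesis by (rule exI[of _ "monom s 0"]) (use mon[of s 0] SA 1 in \<open>auto simp: evm pw_def z\<close>)
 next
 case 2
 hence "val0 s : mpow 1" using SA by (intro mpow_1 val0) auto
 thus ?thesis by (intro exI[of _ "monom (val0 s) 1"]) (use mon[of "val0 s" 1] 2 in \<open>auto simp: evm pw_def z mcm\<close>)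
 qed
 next
 case (add F H)
 then obtain p q where pq: "ALL k. coeff p k : mpow k" "ALL k. coeff q k : mpow k"
 "ALL g:?G. ALL t. F (g, t) = evp (%a. a g) t p" "ALL g:?G. ALL t. H (g, t) = evp (%a. a g) t q" by blast
 show ?case by (rule exI[of _ "p + q"], rule conjI)
 (use pq in \<open>simp add: idealD(3)[OF mpow_ideal], simp add: evp_hom(1)[OF ev pol pol] fun_at\<close>)
 next
 case (mult F H)
 then obtain p q where pq: "ALL k. coeff p k : mpow k" "ALL k. coeff q k : mpow k"
 "ALL g:?G. ALL t. F (g, t) = evp (%a. a g) t p" "ALL g:?G. ALL t. H (g, t) = evp (%a. a g) t q" by blast
 have cpq: "coeff (p * q) k : mpow k" for k unfolding coeff_mult proof (rule ideal_sum[OF mpow_ideal])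
 fix i assume "i : {..k}"
 thus "coeff p i * coeff q (k - i) : mpow k" using mpow_mult[of "coeff p i" i "coeff q (k - i)" "k - i"] pq by simp
 qed
 show ?case by (rule exI[of _ "p * q"], rule conjI) (use pq cpq in \<open>blast, simp add: evp_hom(3)[OF ev pol pol] fun_at\<close>)
 qed
 thus ?thesis using that unfolding R_def by blast
 qed
 \<comment> \<open>The ideals generated by the elements \<open>pw k (bs k)\<close> for k up to n.
   They become stationary, so the element of index n + 1 is a combination of the earlier ones, and
   comparing coefficients of t yields u.\<close>
 define II where "II n = {F. EX q. (ALL k<=n. q k : R) & F = (SUM k<=n. q k * pw k (bs k))}" for n
 have pb: "pw k (bs k) : R" for k by (rule pw_in[OF bs(1)])
 have II: "R.fideal (II n)" for n unfolding R.fideal_def proof (intro conjI ballI)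
 show "II n <= R" using pb by (auto simp: II_def intro!: R.sum_in R.mult_in)
 show "0 : II n" unfolding II_def by (intro CollectI exI[of _ "%_. 0"]) (simp add: R.zero_in)
 fix F H assume "F : II n" "H : II n"
 then obtain q q' where q: "ALL k<=n. q k : R" "F = (SUM k<=n. q k * pw k (bs k))" "ALL k<=n. q' k : R" "H = (SUM k<=n. q' k * pw k (bs k))"
 unfolding II_def by blast
 thus "F + H : II n" unfolding II_def by (intro CollectI exI[of _ "%k. q k + q' k"]) (simp add: R.add_in distrib_right sum.distrib)
 next
 fix r F assume r: "r : R" and "F : II n"
 then obtain q where q: "ALL k<=n. q k : R" "F = (SUM k<=n. q k * pw k (bs k))" unfolding II_def by blast
 thus "r * F : II n" unfolding II_def by (intro CollectI exI[of _ "%k. r * q k"]) (simp add: r R.mult_in sdl mult.assoc)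
 qed
 have step: "II n <= II (Suc n)" for n proof
 fix F assume "F : II n"
 then obtain q where q: "ALL k<=n. q k : R" "F = (SUM k<=n. q k * pw k (bs k))" unfolding II_def by blast
 thus "F : II (Suc n)" unfolding II_def by (intro CollectI exI[of _ "%k. if k <= n then q k else 0"]) (simp add: R.zero_in)
 qed
 have mono: "II m <= II n" if "m <= n" for m n using step that by (rule lift_Suc_mono_le)
 define J where "J = (\<Union>n. II n)"
 have J: "R.fideal J" unfolding R.fideal_def proof (intro conjI ballI)
 show "J <= R" "0 : J" using R.idealD(1,2)[OF II] by (auto simp: J_def)
 fix F H assume "F : J" "H : J"
 then obtain m n where mn: "F : II m" "H : II n" by (auto simp: J_def)
 have "F + H : II (max m n)" by (rule R.idealD(3)[OF II]) (use mn mono[of m "max m n"] mono[of n "max m n"] in auto)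
 thus "F + H : J" by (auto simp: J_def)
 next
 show "r * F : J" if "r : R" "F : J" for r F using that R.idealD(4)[OF II] by (auto simp: J_def)
 qed
 obtain S' where S': "S' <= J" "finite S'" "!!K. R.fideal K ==> S' <= K ==> J <= K" using noeth[unfolded R.noeth_def, rule_format, OF J] by blast
 have "EX n. S' <= II n" using S'(2,1) proof (induction rule: finite_induct)
 case (insert F S')
 then obtain n m where nm: "S' <= II n" "F : II m" by (auto simp: J_def)
 have "insert F S' <= II (max m n)" using nm mono[of m "max m n"] mono[of n "max m n"] by auto
 thus ?case by blast
 qed simp
 then obtain n where n: "S' <= II n" by blast
 have "pw (Suc n) (bs (Suc n)) : II (Suc n)" proof -
 have "(SUM k<=Suc n. (if k = Suc n then cst ?Y 1 else 0) * pw k (bs k)) = cst ?Y 1 * pw (Suc n) (bs (Suc n))" by simp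
 thus ?thesis unfolding II_def using R.one_mult[OF pb, of "Suc n"] R.cst_in R.zero_in
 by (intro CollectI exI[of _ "%k. if k = Suc n then cst ?Y 1 else 0"]) auto
 qed
 hence "pw (Suc n) (bs (Suc n)) : J" by (auto simp: J_def)
 hence "pw (Suc n) (bs (Suc n)) : II n" using S'(3)[OF II n] by blast
 then obtain q where q: "ALL k<=n. q k : R" "pw (Suc n) (bs (Suc n)) = (SUM k<=n. q k * pw k (bs k))" unfolding II_def by blast
 have "ALL k. EX p. k <= n --> (ALL k. coeff p k : mpow k) & (ALL g:?G. ALL t. q k (g, t) = evp (%a. a g) t p)" using struct q(1) by blast
 then obtain P where P: "!!k j. k <= n ==> coeff (P k) j : mpow j"
 "!!k g t. k <= n ==> g : ?G ==> q k (g, t) = evp (%a. a g) t (P k)" by metis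
 \<comment> \<open>The index \<open>Suc n - k\<close> is positive, so each summand lies in a
   positive power of the maximal ideal and vanishes at the identity.\<close>
 define u where "u = (SUM k<=n. coeff (P k) (Suc n - k))"
 have u1: "coeff (P k) (Suc n - k) \<one> = 0" if "k <= n" for k
 using mpow_one[of _ "n - k"] P(1)[OF that, of "Suc n - k"] that by (simp add: Suc_diff_le del: mpow.simps)
 have uA: "u : A" unfolding u_def by (rule sum_in) (use P(1) mpow_in in auto)
 have "bs (Suc n) = (SUM k<=n. coeff (P k) (Suc n - k) * bs k)" proof (rule fun_ext[OF mpow_in[OF bs(1)]])
 show "(SUM k<=n. coeff (P k) (Suc n - k) * bs k) : A" by (rule sum_in) (auto intro!: mult_in mpow_in[OF P(1)] mpow_in[OF bs(1)])
 fix g assume g: "g : ?G"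
 have "monom (bs (Suc n) g) (Suc n) = (SUM k<=n. monom (bs k g) k * map_poly (%a. a g) (P k))" proof (rule poly_eq_on_nats)
 fix m :: nat
 have "poly (monom (bs (Suc n) g) (Suc n)) (of_nat m) = pw (Suc n) (bs (Suc n)) (g, of_nat m)" by (simp add: pw_def poly_monom mcm)
 also have "... = (SUM k<=n. q k (g, of_nat m) * pw k (bs k) (g, of_nat m))" unfolding q(2) by (simp add: fun_at sum_fun_at)
 also have "... = (SUM k<=n. poly (monom (bs k g) k * map_poly (%a. a g) (P k)) (of_nat m))"
 by (rule sum.cong) (simp_all add: P(2) g pw_def evp_def poly_monom mult_ac)
 finally show "poly (monom (bs (Suc n) g) (Suc n)) (of_nat m) =
 poly (SUM k<=n. monom (bs k g) k * map_poly (%a. a g) (P k)) (of_nat m)" by (simp add: poly_sum)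
 qed
 hence "bs (Suc n) g = coeff (SUM k<=n. monom (bs k g) k * map_poly (%a. a g) (P k)) (Suc n)" by (metis coeff_monom)
 also have "... = (SUM k<=n. bs k g * coeff (P k) (Suc n - k) g)"
 unfolding coeff_sum by (rule sum.cong) (auto simp: coeff_monom_mult coeff_map_poly zero_fun_apply)
 finally show "bs (Suc n) g = (SUM k<=n. coeff (P k) (Suc n - k) * bs k) g" by (simp add: fun_at sum_fun_at mcm)
 qed
 hence "b - u * b = (b - bs (Suc n)) - (SUM k<=n. coeff (P k) (Suc n - k) * (b - bs k))" by (simp add: u_def right_diff_distrib sum_subtractf sdr)
 moreover have "(SUM k<=n. coeff (P k) (Suc n - k) * (b - bs k)) : I"
 by (rule ideal_sum[OF I]) (use P(1) mpow_in bs(2) in \<open>auto intro!: idealD(4)[OF I]\<close>)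
 ultimately have "b - u * b : I" using ideal_diff[OF I bs(2)] by metis
 thus ?thesis using uA u1 by (intro bexI[of _ u]) (simp_all add: u_def sum_fun_at)
qed

text \<open>At each y the translate of f minus its value lies in all powers of the maximal ideal, so
  Krull's theorem makes f constant where a function nonzero at y does not vanish. Quasi-compactness
  is expressed by the ideal J of those functions on whose nonvanishing locus f takes finitely many
  values: it has no common zero, so it contains the unit.\<close>

lemma locally_constant_finite: assumes f: "f : A" and k: "!!X. X : gl ==> dop X f = 0" shows "finite (f ` cr G)" proof -
 define J where "J = {h : A. EX F. finite F & (ALL z:cr G. h z ~= 0 --> f z : F)}"
 have J: "fideal J" unfolding fideal_def proof (intro conjI ballI)
 show "J <= A" "0 : J" by (auto simp: J_def zero_in fun_at)
 fix h h' assume "h : J" "h' : J"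
 then obtain F F' where F: "h : A" "finite F" "ALL z:cr G. h z ~= 0 --> f z : F"
 "h' : A" "finite F'" "ALL z:cr G. h' z ~= 0 --> f z : F'" unfolding J_def by blast
 have "ALL z:cr G. (h + h') z ~= 0 --> f z : F Un F'" using F by (auto simp: fun_at)
 moreover have "finite (F Un F')" using F by blast
 ultimately show "h + h' : J" using F add_in unfolding J_def by blast
 next
 show "a * h : J" if "a : A" "h : J" for a h using that by (auto simp: J_def mult_in fun_at)
 qed
 have "cst (cr G) 1 : J" proof (rule unit_ideal[OF J])
 fix y assume y: "y : cr G"
 have d: "dop X (lt y f) = 0" if X: "X : gl" for X proof (rule fun_ext[OF dop_in[OF X lt_in[OF f y]] zero_in])
 fix z assume z: "z : cr G"
 have "lt z (lt y f) = lt (y \<otimes> z) f" by (rule fun_ext) (use f y z in \<open>simp_all add: lt_in lt_at m_assoc\<close>)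
 thus "dop X (lt y f) z = 0 z" using dop_at[of "y \<otimes> z" X f] k[OF X] y z by (simp add: dop_at fun_at)
 qed
 let ?J = "{f : A. f \<one> = 0 & (ALL X:gl. dop X f = 0)}"
 have I0: "fideal {0}" by (simp add: fideal_def zero_in)
 have D0: "dop X 0 = 0" if "X : gl" for X using lin_op.D_scale[OF lin_op_dop[OF that] zero_in, of 0] by (simp add: fs0)
 have "dop X (val0 (lt y f)) = 0" if X: "X : gl" for X proof -
 have "dop X (cst (cr G) c) = 0" for c by (rule ext) (simp add: dop_def zcut_def lt_cst gl_const[OF X] fun_at)
 hence "dop X (val0 (lt y f) + cst (cr G) (lt y f \<one>)) = dop X (val0 (lt y f))"
 using lin_op.D_add[OF lin_op_dop[OF X] val0(1)[OF lt_in[OF f y]] cst_in] by simp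
 thus ?thesis using d[OF X] by (simp add: val0_def)
 qed
 hence vJ: "val0 (lt y f) : ?J" using val0(1)[OF lt_in[OF f y]] val0(2)[of "lt y f"] by blast
 have "?J <= mpi {0} n" for n by (rule derivation_stable_in_mpi[OF I0]) (auto simp: fun_at D0 zero_in)
 hence "EX u:A. u \<one> = 0 & val0 (lt y f) - u * val0 (lt y f) : {0}" using vJ by (intro krull[OF I0]) blast
 then obtain u where u: "u : A" "u \<one> = 0" "val0 (lt y f) = u * val0 (lt y f)" by auto
 \<comment> \<open>The factor 1 - u, moved from the identity to y; wherever it is nonzero, f takes
   the value f y.\<close>
 let ?h = "lt (inv y) (cst (cr G) 1 - u)"
 have "f z = f y" if z: "z : cr G" "?h z ~= 0" for z proof -
 have "val0 (lt y f) (inv y \<otimes> z) = u (inv y \<otimes> z) * val0 (lt y f) (inv y \<otimes> z)" using fun_cong[OF u(3), of "inv y \<otimes> z"] by (simp only: times_fun_apply)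
 moreover have "u (inv y \<otimes> z) ~= 1" using z y by (simp add: lt_at fun_at cst_at)
 ultimately have "val0 (lt y f) (inv y \<otimes> z) = 0" by simp
 thus ?thesis using y z f by (simp add: val0(3) lt_in lt_at m_assoc[symmetric])
 qed
 hence "?h : J" unfolding J_def using y by (auto intro!: exI[of _ "{f y}"] lt_in diff_in cst_in u(1))
 moreover have "?h y ~= 0" using y u(2) by (simp add: lt_at fun_at cst_at)
 ultimately show "EX h:J. h y ~= 0" by blast
 qed
 then obtain F where "finite F" and F: "ALL z:cr G. cst (cr G) (1::'a) z ~= 0 --> f z : F" unfolding J_def by blast
 show ?thesis by (rule finite_subset[OF _ \<open>finite F\<close>]) (use F in \<open>auto simp: cst_at\<close>)
qed

text \<open>The affine maps \<open>tau h\<close> permute the finite set B of value vectors, so the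
  barycentre m of B is fixed by all of them. Solving this fixed point equation for b gives a
  coboundary with w = - m.\<close>

lemma finite_cocycle_splits: assumes c: "cocycle n rho b" and fin: "!!j. j < n ==> finite (b j ` cr G)"
 shows "EX w. ALL g:cr G. ALL j<n. b j g = (SUM i<n. w i * rho i j g) - w j" proof -
 define B where "B = (%g. \<lambda>i\<in>{..<n}. b i g) ` cr G"
 have "finite B" by (rule finite_subset[OF _ finite_PiE[of "{..<n}" "%i. b i ` cr G"]]) (auto simp: B_def fin PiE_def extensional_def)
 have B0: "card B ~= 0" using \<open>finite B\<close> by (auto simp: B_def)
 define tau where "tau h bt = (\<lambda>j\<in>{..<n}. b j h + (SUM i<n. bt i * rho i j h))" for h and bt :: "nat => 'a"
 have tau: "tau h (\<lambda>i\<in>{..<n}. b i g) = (\<lambda>i\<in>{..<n}. b i (g \<otimes> h))" if "g : cr G" "h : cr G" for g h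
 by (rule ext) (simp add: tau_def cocycleD(3)[OF c _ that])
 have inj: "inj_on (tau h) B" "tau h ` B = B" if h: "h : cr G" for h proof -
 have "tau h ` B <= B" using tau[OF _ h] h by (auto simp: B_def)
 moreover have "B <= tau h ` B" proof
 fix bt assume "bt : B"
 then obtain g where g: "g : cr G" "bt = (\<lambda>i\<in>{..<n}. b i g)" by (auto simp: B_def)
 have "bt = tau h (\<lambda>i\<in>{..<n}. b i (g \<otimes> inv h))" using tau[of "g \<otimes> inv h" h] g h by (simp add: m_assoc)
 thus "bt : tau h ` B" using g h by (auto simp: B_def)
 qed
 ultimately show eq: "tau h ` B = B" by blast
 show "inj_on (tau h) B" by (rule eq_card_imp_inj_on[OF \<open>finite B\<close>]) (simp add: eq)
 qed
 define m where "m j = (SUM bt:B. bt j) / of_nat (card B)" for j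
 have "b j h = (SUM i<n. - m i * rho i j h) - - m j" if h: "h : cr G" and j: "j < n" for h j proof -
 have "(SUM bt:B. bt j) = (SUM bt:B. tau h bt j)" using sum.reindex[OF inj(1)[OF h], of "%bt. bt j"] inj(2)[OF h] by simp
 also have "... = of_nat (card B) * b j h + (SUM bt:B. SUM i<n. bt i * rho i j h)" using j by (simp add: tau_def sum.distrib)
 also have "(SUM bt:B. SUM i<n. bt i * rho i j h) = (SUM i<n. (SUM bt:B. bt i) * rho i j h)" by (subst sum.swap) (simp add: sdr)
 finally have "(SUM bt:B. bt j) / of_nat (card B) = b j h + (SUM i<n. (SUM bt:B. bt i) * rho i j h) / of_nat (card B)"
 using B0 by (simp add: add_divide_distrib)
 moreover have "(SUM i<n. (SUM bt:B. bt i) * rho i j h) / of_nat (card B) = (SUM i<n. m i * rho i j h)"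
 unfolding m_def sum_divide_distrib[of _ "{..<n}"] by simp
 ultimately have "m j = b j h + (SUM i<n. m i * rho i j h)" by (simp add: m_def)
 thus ?thesis by (simp add: sum_negf)
 qed
 thus ?thesis by (intro exI[of _ "%i. - m i"]) blast
qed

end

text \<open>If some point derivation acts nontrivially in rho, the Casimir element splits the
  cocycle. Otherwise all of them kill rho and hence b, so b is locally constant and its values are
  finite in number.\<close>

theorem (in red_group) cocycle_splits: assumes ir: "irred n rho" and c: "cocycle n rho b"
 shows "EX w. ALL g:cr G. ALL j<n. b j g = (SUM i<n. w i * rho i j g) - w j" proof (cases "EX X:gl. EX i<n. EX j<n. X (rho i j) ~= 0")
 case True
 thus ?thesis using casimir_splits[OF ir c] by blast
next
 case False
 have z: "X (rho i j) = 0" if "X : gl" "i < n" "j < n" for X i j using False that by blast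
 note r = irredD(1)[OF ir]
 show ?thesis proof (rule finite_cocycle_splits[OF c locally_constant_finite[OF cocycleD(2)[OF c]]])
 fix j X assume j: "j < n" and X: "X : gl"
 show "dop X (b j) = 0" proof (rule fun_ext[OF dop_in[OF X cocycleD(2)[OF c j]] zero_in])
 fix x assume x: "x : cr G"
 have rhoA: "lc n (%i. b i x) (%i. rho i j) : A" by (rule lc_in[OF subspace repD(1)[OF r _ j]])
 have "lt x (b j) = b j + lc n (%i. b i x) (%i. rho i j)" by (rule fun_ext[OF lt_in[OF cocycleD(2)[OF c j] x] add_in[OF cocycleD(2)[OF c j] rhoA]])
 (simp add: lt_at fun_at lc_at cocycleD(3)[OF c j x])
 hence "X (lt x (b j)) = 0" using glD(1)[OF X cocycleD(2)[OF c j] rhoA] cocycle_killed[OF c X z[OF X] j]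
 gl_lc[OF X, of n "%i. rho i j"] repD(1)[OF r _ j] z[OF X _ j] by simp
 thus "dop X (b j) x = 0 x" by (simp add: dop_at x fun_at)
 qed
 qed
qed

section \<open>Invariant means on finite-dimensional spaces of functions\<close>

context red_group
begin

text \<open>With \<open>M1\<close> the sum of M and the constants, an irreducible quotient of T' by
  \<open>M1\<close> is extended by the trivial module \<open>M1\<close> / M. Splitting that
  extension yields a stable space strictly above M that still omits the constants.\<close>

lemma invariant_complement_step: assumes M: "rstable M" "cst (cr G) 1 ~: M" "M <= T" and T: "rstable T" "fd T" "cst (cr G) 1 : T"
 and ne: "EX t:T. ALL c. t - fsc c (cst (cr G) 1) ~: M" shows "EX N. rstable N & M < N & N <= T & cst (cr G) 1 ~: N" proof -
 let ?o = "cst (cr G) (1::'a)"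
 note Ms = rsD(2)[OF M(1)] and Ts = rsD(2)[OF T(1)]
 define M1 where "M1 = {f. EX c. f - fsc c ?o : M}"
 have rto: "rt g ?o = ?o" if "g : cr G" for g by (rule fun_ext) (use that in \<open>simp_all add: rt_in cst_in rt_at cst_at\<close>)
 have M1T: "M1 <= T" proof
 fix f assume "f : M1"
 then obtain c where "f - fsc c ?o : T" using M(3) by (auto simp: M1_def)
 thus "f : T" using fs_ad[OF Ts _ fs_sc[OF Ts T(3)], of "f - fsc c ?o" c] by simp
 qed
 have M1: "rstable M1" unfolding rstable_def proof (intro conjI ballI)
 show "M1 <= A" using M1T rsD(1)[OF T(1)] by blast
 show "fsub M1" unfolding fs_def proof (intro conjI ballI allI)
 show "0 : M1" using fs_0[OF Ms] by (auto simp: M1_def fs0 intro!: exI[of _ 0])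
 fix f h c assume f: "f : M1" and "h : M1"
 then obtain a b where "f - fsc a ?o : M" "h - fsc b ?o : M" by (auto simp: M1_def)
 from fs_ad[OF Ms this] have "f + h - fsc (a + b) ?o : M" by (simp add: fs.scale_left_distrib als)
 thus "f + h : M1" by (auto simp: M1_def)
 next
 fix f c assume "f : M1"
 then obtain a where "f - fsc a ?o : M" by (auto simp: M1_def)
 from fs_sc[OF Ms this, of c] have "fsc c f - fsc (c * a) ?o : M" by (simp add: fs_rd)
 thus "fsc c f : M1" by (auto simp: M1_def)
 qed
 fix g f assume g: "g : cr G" and "f : M1"
 then obtain a where "f - fsc a ?o : M" by (auto simp: M1_def)
 from rsD(3)[OF M(1) g this] have "rt g f - fsc a ?o : M" by (simp add: rt_linear rto[OF g])
 thus "rt g f : M1" by (auto simp: M1_def)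
 qed
 have MM1: "M <= M1" by (auto simp: M1_def fs0 intro!: exI[of _ 0])
 have "M1 < T" using M1T ne by (auto simp: M1_def)
 then obtain T' n e rho where T': "rstable T'" "M1 < T'" "T' <= T" and e: "bmod M1 T' n e" and ir: "irred n rho"
 and rel: "!!g j. g : cr G ==> j < n ==> rt g (e j) - lc n (%i. rho i j g) e : M1" using exists_irreducible_quotient[OF M1 T(1,2)] by metis
 note T's = rsD(2)[OF T'(1)]
 \<comment> \<open>The constant function comes first, so that the matrix of T' / M has the block
   form whose first row is a cocycle.\<close>
 define e' where "e' j = (case j of 0 => ?o | Suc k => e k)" for j
 have lce: "lc (Suc n) c e' = fsc (c 0) ?o + lc n (%i. c (Suc i)) e" for c
 by (rule ext) (simp add: lc_at sum.lessThan_Suc_shift e'_def fun_at del: sum.lessThan_Suc)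
 have oM1: "fsc c ?o : M1" for c using fs_0[OF Ms] unfolding M1_def by (intro CollectI exI[of _ c]) simp
 have M1D: "f : M1 ==> EX c. f - fsc c ?o : M" for f by (simp add: M1_def)
 have e': "bmod M T' (Suc n) e'" unfolding bmod_def proof (intro conjI allI impI ballI)
 have "?o : T'" using oM1[of 1] T'(2) by (simp add: fs.scale_one psubset_eq subset_iff)
 thus "e' i : T'" if "i < Suc n" for i using that bmD(1)[OF e] by (cases i) (auto simp: e'_def)
 fix c i assume c: "lc (Suc n) c e' : M" and i: "i < Suc n"
 have "lc n (%i. c (Suc i)) e : M1" using fs.subspace_diff[OF rsD(2)[OF M1] subsetD[OF MM1 c] oM1[of "c 0"]] by (simp add: lce)
 hence cz: "c (Suc i) = 0" if "i < n" for i using bmD(2)[OF e, of "%i. c (Suc i)"] that by blast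
 hence "lc n (%i. c (Suc i)) e = 0" by (simp add: lc_def fs0 fei fun_at sum_fun_at)
 hence "fsc (c 0) ?o : M" using c by (simp add: lce)
 hence "c 0 = 0" using fs_sc[OF Ms, of "fsc (c 0) ?o" "inverse (c 0)"] M(2) by (cases "c 0 = 0") (simp_all add: fs.scale_one)
 thus "c i = 0" using cz i by (cases i) auto
 next
 fix t assume "t : T'"
 then obtain c where "t - lc n c e : M1" using bmD(3)[OF e] by blast
 then obtain a where "t - lc n c e - fsc a ?o : M" using M1D by blast
 hence "t - lc (Suc n) (%i. case i of 0 => a | Suc k => c k) e' : M" by (simp add: lce als)
 thus "EX c. t - lc (Suc n) c e' : M" by blast
 qed
 obtain rho' where r': "rep (Suc n) rho'" and rel': "!!g j. g : cr G ==> j < Suc n ==> rt g (e' j) - lc (Suc n) (%i. rho' i j g) e' : M"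
 by (rule basis_mod_rep[OF M(1) T'(1) fd_subset[OF T(2) T'(3)] _ e']) (use MM1 T'(2) in blast)+
 have c0: "rho' i 0 g = (if i = 0 then 1 else 0)" if g: "g : cr G" and i: "i < Suc n" for i g proof (rule basis_mod_unique[OF e' Ms _ _ i])
 show "?o - lc (Suc n) (%i. rho' i 0 g) e' : M" using rel'[OF g, of 0] by (simp add: e'_def rto[OF g])
 show "?o - lc (Suc n) (%i. if i = 0 then 1 else 0) e' : M" using lc_delta[of 0 "Suc n" e'] fs_0[OF Ms] by (simp add: e'_def)
 qed
 have rho: "rho' (Suc i) (Suc j) g = rho i j g" if g: "g : cr G" and ij: "i < n" "j < n" for i j g
 proof (rule basis_mod_unique[OF e rsD(2)[OF M1] _ rel[OF g ij(2)] ij(1)])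
 have "rt g (e j) - lc (Suc n) (%i. rho' i (Suc j) g) e' : M1" using rel'[OF g, of "Suc j"] ij MM1 by (auto simp: e'_def)
 from fs_ad[OF rsD(2)[OF M1] this oM1[of "rho' 0 (Suc j) g"]]
 show "rt g (e j) - lc n (%i. rho' (Suc i) (Suc j) g) e : M1" by (simp add: lce als)
 qed
 have "cocycle n rho (%j. rho' 0 (Suc j))" unfolding cocycle_def proof (intro conjI allI impI ballI)
 fix j g h assume j: "j < n" and gh: "g : cr G" "h : cr G"
 show "rho' 0 (Suc j) (g \<otimes> h) = rho' 0 (Suc j) h + (SUM i<n. rho' 0 (Suc i) g * rho i j h)" using repD(3)[OF r' _ _ gh, of 0 "Suc j"] j gh
 by (simp add: sum.lessThan_Suc_shift c0 rho del: sum.lessThan_Suc)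
 qed (use repD(1)[OF r'] irredD(1)[OF ir] in auto)
 from cocycle_splits[OF ir this] obtain w where
 w: "ALL g:cr G. ALL j<n. rho' 0 (Suc j) g = (SUM i<n. w i * rho i j g) - w j" by blast
 \<comment> \<open>The splitting vector corrects each representative by a constant, which cancels
   the first row of the matrix.\<close>
 define f where "f j = e j + fsc (w j) ?o" for j
 have lcf: "lc n c f = lc n c e + fsc (SUM i<n. c i * w i) ?o" for c by (rule ext) (simp add: lc_at f_def fun_at als sum.distrib sdl)
 have ff: "rt g (f j) - lc n (%i. rho i j g) f : M" if g: "g : cr G" and j: "j < n" for g j proof -
 have "lc n (%i. rho' (Suc i) (Suc j) g) e = lc n (%i. rho i j g) e" by (rule lc_cong) (simp add: rho g j)
 moreover have "rho' 0 (Suc j) g + w j = (SUM i<n. rho i j g * w i)" using w g j by (simp add: mcm)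
 hence "fsc (SUM i<n. rho i j g * w i) ?o = fsc (rho' 0 (Suc j) g) ?o + fsc (w j) ?o" by (metis fs.scale_left_distrib)
 ultimately have "rt g (f j) - lc n (%i. rho i j g) f = rt g (e' (Suc j)) - lc (Suc n) (%i. rho' i (Suc j) g) e'"
 by (simp add: lcf lce f_def e'_def rt_linear rto[OF g])
 thus ?thesis using rel'[OF g, of "Suc j"] j by simp
 qed
 define N where "N = {h. EX c. h - lc n c f : M}"
 have MN: "M <= N" unfolding N_def by (auto intro!: exI[of _ "%_. 0"] simp: lc_def fs0)
 have fT: "f j : T'" if "j < n" for j unfolding f_def using bmD(1)[OF e that] oM1[of "w j"] T'(2) by (intro fs_ad[OF T's]) auto
 have NT: "N <= T'" proof
 fix h assume "h : N"
 then obtain c where c: "h - lc n c f : T'" using MM1 T'(2) by (auto simp: N_def)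
 have "h - lc n c f + lc n c f : T'" by (intro fs_ad[OF T's c] lc_in[OF T's fT])
 thus "h : T'" by simp
 qed
 have "rstable N" unfolding rstable_def proof (intro conjI ballI)
 show "N <= A" using NT rsD(1)[OF T'(1)] by blast
 show sN: "fsub N" unfolding fs_def proof (intro conjI ballI allI)
 show "0 : N" using MN fs_0[OF Ms] by blast
 fix x y c assume "x : N" "y : N"
 then obtain a b where "x - lc n a f : M" "y - lc n b f : M" by (auto simp: N_def)
 from fs_ad[OF Ms this] have "x + y - lc n (%i. a i + b i) f : M" by (simp add: lc_add[symmetric] als)
 thus "x + y : N" by (auto simp: N_def)
 next
 fix x c assume "x : N"
 then obtain a where "x - lc n a f : M" by (auto simp: N_def)
 from fs_sc[OF Ms this, of c] have "fsc c x - lc n (%i. c * a i) f : M" by (simp add: lc_scale[symmetric] fs_rd)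
 thus "fsc c x : N" by (auto simp: N_def)
 qed
 fix g x assume g: "g : cr G" and "x : N"
 then obtain a where a: "x - lc n a f : M" by (auto simp: N_def)
 have fN: "rt g (f j) : N" if "j < n" for j using ff[OF g that] by (auto simp: N_def)
 have "rt g (x - lc n a f) + lc n a (%j. rt g (f j)) : N" by (intro fs_ad[OF sN] subsetD[OF MN] rsD(3)[OF M(1) g a] lc_in[OF sN fN])
 thus "rt g x : N" by (simp add: rt_linear rt_lc)
 qed
 moreover have "?o ~: N" proof
 assume "?o : N"
 then obtain c where c: "?o - lc n c f : M" by (auto simp: N_def)
 hence "lc n c e : M1" using fs.subspace_diff[OF rsD(2)[OF M1] oM1 subsetD[OF MM1 c], of "1 - (SUM i<n. c i * w i)"]
 by (simp add: lcf fs.scale_left_diff_distrib fs.scale_one)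
 hence "c i = 0" if "i < n" for i using bmD(2)[OF e] that by blast
 hence "lc n c f = 0" by (simp add: lc_def fs0 fei fun_at sum_fun_at)
 thus False using c M(2) by simp
 qed
 moreover have "M ~= N" proof
 assume MN': "M = N"
 note n = irredD(2)[OF ir]
 have "f 0 : N" unfolding N_def using lc_delta[OF n, of f] fs_0[OF Ms] by (intro CollectI exI[of _ "%i. if i = 0 then 1 else 0"]) simp
 hence "e 0 : M1" using fs.subspace_diff[OF rsD(2)[OF M1] _ oM1[of "w 0"], of "f 0"] MM1 MN' by (auto simp: f_def)
 hence "lc n (%i. if i = 0 then 1 else 0) e : M1" using lc_delta[OF n, of e] by simp
 from bmD(2)[OF e this n] show False by simp
 qed
 ultimately show ?thesis using MN NT T'(3) by blast
qed

text \<open>A stable subspace M of T of largest size among those omitting the constants is a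
  complement of the constants, and the mean is the projection along it. The mean is needed only on a
  finite-dimensional stable T.\<close>

theorem haar: assumes T: "rstable T" "fd T" "cst (cr G) 1 : T"
 shows "EX I. (ALL f:T. ALL h:T. I (f + h) = I f + I h) & (ALL c. ALL f:T. I (fsc c f) = c * I f) &
 I (cst (cr G) 1) = (1::'a) & (ALL g:cr G. ALL f:T. I (rt g f) = I f)" proof -
 let ?o = "cst (cr G) (1::'a)"
 define P where "P M \<longleftrightarrow> rstable M & M <= T & ?o ~: M" for M
 have "?o \<one> ~= (0 :: 'g => 'a) \<one>" by (simp add: cst_at fun_at)
 hence "?o ~= 0" by metis
 hence P0: "P {0}" using fs_0[OF rsD(2)[OF T(1)]] rstable_zero by (simp add: P_def)
 have "ALL M. P M --> sz M < sz T" using sz_strict_mono[OF _ rsD(2)[OF T(1)] T(2)] T(3) rsD(2) unfolding P_def by blast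
 from ex_has_greatest_nat[of P, OF P0 this] obtain M where M: "P M" "ALL N. P N --> sz N <= sz M" by blast
 have MD: "rstable M" "M <= T" "?o ~: M" using M(1) by (auto simp: P_def)
 note Ms = rsD(2)[OF MD(1)]
 have ex: "EX c. t - fsc c ?o : M" if t: "t : T" for t proof (rule ccontr)
 assume "\<nexists>c. t - fsc c ?o : M"
 then obtain N where N: "rstable N" "M < N" "N <= T" "?o ~: N" using invariant_complement_step[OF MD(1,3,2) T] t by blast
 have "sz M < sz N" by (rule sz_strict_mono[OF Ms rsD(2)[OF N(1)] fd_subset[OF T(2) N(3)] N(2)])
 thus False using M(2) N by (auto simp: P_def)
 qed
 define I where "I t = (SOME c. t - fsc c ?o : M)" for t
 have I: "t - fsc (I t) ?o : M" if "t : T" for t unfolding I_def using ex[OF that] by (rule someI_ex)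
 have uniq: "I t = c" if t: "t : T" and c: "t - fsc c ?o : M" for t c proof (rule ccontr)
 assume ne: "I t ~= c"
 have "fsc (inverse (I t - c)) ((t - fsc c ?o) - (t - fsc (I t) ?o)) : M" by (intro fs_sc[OF Ms] fs.subspace_diff[OF Ms] c I t)
 moreover have "(t - fsc c ?o) - (t - fsc (I t) ?o) = fsc (I t - c) ?o" by (simp add: fs.scale_left_diff_distrib)
 ultimately show False using MD(3) ne by (simp add: fs.scale_one)
 qed
 have rto: "rt g ?o = ?o" if "g : cr G" for g by (rule fun_ext) (use that in \<open>simp_all add: rt_in cst_in rt_at cst_at\<close>)
 note Ts = rsD(2)[OF T(1)]
 show ?thesis proof (intro exI[of _ I] conjI ballI allI)
 fix f h assume fh: "f : T" "h : T"
 show "I (f + h) = I f + I h" by (rule uniq[OF fs_ad[OF Ts fh]])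
 (use fs_ad[OF Ms I[OF fh(1)] I[OF fh(2)]] in \<open>simp add: fs.scale_left_distrib als\<close>)
 next
 fix c f assume f: "f : T"
 show "I (fsc c f) = c * I f" by (rule uniq[OF fs_sc[OF Ts f]]) (use fs_sc[OF Ms I[OF f], of c] in \<open>simp add: fs_rd\<close>)
 next
 show "I ?o = 1" by (rule uniq[OF T(3)]) (simp add: fs.scale_one fs_0[OF Ms])
 fix g f assume g: "g : cr G" and f: "f : T"
 show "I (rt g f) = I f" by (rule uniq[OF rsD(3)[OF T(1) g f]]) (use rsD(3)[OF MD(1) g I[OF f]] in \<open>simp add: rt_linear rto[OF g]\<close>)
 qed
qed

end

section \<open>Functions on an orbit\<close>

context aff_group
begin

lemma dop_cst: "X : gl ==> dop X (cst (cr G) c) = 0" by (rule ext) (simp add: dop_def zcut_def lt_cst gl_const fun_at)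

lemma dop_power: assumes X: "X : gl" and f: "f : A" shows "dop X (f ^ Suc n) = fsc (of_nat (Suc n)) (f ^ n * dop X f)" proof (induction n)
 case (Suc n)
 have "dop X (f * f ^ Suc n) = f * dop X (f ^ Suc n) + dop X f * f ^ Suc n" by (rule dop_mult[OF X f power_in[OF f]])
 hence eq: "dop X (f ^ Suc (Suc n)) = f * dop X (f ^ Suc n) + dop X f * f ^ Suc n" by simp
 show ?case unfolding eq Suc by (simp add: fei fun_at als)
qed (simp add: fs.scale_one)

text \<open>Write y for the derivative of f. Differentiating a product of powers of f and y that
  lies in I, and multiplying by y, trades one power of f for further powers of y; the integer
  coefficient is cancelled in characteristic zero.\<close>

lemma derivation_radical: assumes X: "X : gl" and I: "fideal I" and DI: "!!f. f : I ==> dop X f : I" and f: "f : A" "f ^ Suc n : I"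
 shows "EX b. dop X f ^ b * dop X f : I" proof -
 let ?y = "dop X f"
 have y: "?y : A" "dop X ?y : A" using dop_in[OF X] f(1) by blast+
 note Is = ideal_subspace[OF I]
 have un: "h : I" if "fsc c h : I" "c ~= 0" for c h using fs_sc[OF Is that(1), of "inverse c"] that(2) by (simp add: fs.scale_one)
 have "EX b. f ^ (n - k) * (?y ^ b * ?y) : I" if "k <= n" for k using that proof (induction k)
 case 0
 have "f ^ n * ?y : I" using DI[OF f(2)] dop_power[OF X f(1)] un[of "of_nat (Suc n)"] by (simp del: of_nat_Suc)
 thus ?case by (intro exI[of _ 0]) simp
 next
 case (Suc k)
 then obtain b where b: "f ^ (n - k) * (?y ^ b * ?y) : I" by auto
 define a where "a = n - Suc k"
 have a: "n - k = Suc a" using Suc.prems by (simp add: a_def)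
 have yb: "?y ^ Suc b : A" by (rule power_in[OF y(1)])
 have "dop X (f ^ Suc a * ?y ^ Suc b) = f ^ Suc a * dop X (?y ^ Suc b) + dop X (f ^ Suc a) * ?y ^ Suc b" by (rule dop_mult[OF X power_in[OF f(1)] yb])
 hence "dop X (f ^ Suc a * ?y ^ Suc b) * ?y =
 fsc (of_nat (Suc b)) (dop X ?y * (f ^ Suc a * (?y ^ b * ?y))) + fsc (of_nat (Suc a)) (f ^ a * (?y ^ Suc (Suc b) * ?y))"
 unfolding dop_power[OF X f(1)] dop_power[OF X y(1)] by (simp add: fei fun_at als)
 moreover have "dop X (f ^ Suc a * ?y ^ Suc b) * ?y : I" using idealD(4)[OF I y(1) DI[OF b[unfolded a]]] by (simp add: mult_ac)
 moreover have "fsc (of_nat (Suc b)) (dop X ?y * (f ^ Suc a * (?y ^ b * ?y))) : I" by (intro fs_sc[OF Is] idealD(4)[OF I y(2)] b[unfolded a])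
 ultimately have "fsc (of_nat (Suc a)) (f ^ a * (?y ^ Suc (Suc b) * ?y)) : I" using ideal_diff[OF I] by (metis add_diff_cancel_left')
 hence "f ^ a * (?y ^ Suc (Suc b) * ?y) : I" by (rule un) (simp del: of_nat_Suc)
 thus ?case unfolding a_def by blast
 qed
 from this[of n] show ?thesis by simp
qed

end

text \<open>C stands for the functions on G pulled back along an orbit map. Closedness of the orbit
  appears as \<open>points_C\<close>: each homomorphism of C to the ground field is evaluation at a
  group element.\<close>

locale orbit_alg = aff_group G A
 for G :: "('g, 'm) monoid_scheme" (structure) and A :: "('g => 'a::{alg_closed_field, field_char_0}) set" +
 fixes S and C assumes S: "finite S" "S <= A" and C: "C = falg (cr G) S" and lt_C: "x : cr G ==> c : C ==> lt x c : C"
 and points_C: "fun_alg.fhom (cr G) C phi ==> EX x:cr G. ALL c:C. phi c = c x"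
begin

lemma supp_S: "supp_in (cr G) S" using S(2) out by (auto simp: supp_in_def)

sublocale C: fun_alg "cr G" C unfolding C by (rule fun_alg_falg[OF supp_S])

lemma CA: "C <= A" unfolding C by (rule falg_least[OF fun_alg_axioms S(2)])

lemma SC: "S <= C" unfolding C using falg.gen by blast

definition H :: "'g set" where
 "H = {h : cr G. ALL c:C. c h = c \<one>}"

text \<open>The ideal in A of the scheme-theoretic fibre of the orbit map through the
  identity.\<close>

definition Iv :: "('g => 'a) set" where
 "Iv = {f. EX a. (ALL s:S. a s : A) & f = (SUM s:S. val0 s * a s)}"

lemma H_D: "h : H ==> h : cr G" "h : H ==> c : C ==> c h = c \<one>" by (auto simp: H_def)

lemma H_mult: "x : cr G ==> h : H ==> c : C ==> c (x \<otimes> h) = c x" using H_D(2)[OF _ lt_C, of h x c] H_D(1) by (simp add: lt_at)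

lemma H_closed: "h : H ==> k : H ==> h \<otimes> k : H" "h : H ==> inv h : H" proof -
 show "h \<otimes> k : H" if hk: "h : H" "k : H" proof -
 have "c (h \<otimes> k) = c \<one>" if "c : C" for c using H_mult[OF H_D(1)[OF hk(1)] hk(2) that] H_D(2)[OF hk(1) that] by simp
 thus ?thesis using H_D(1)[OF hk(1)] H_D(1)[OF hk(2)] by (simp add: H_def)
 qed
 assume h: "h : H"
 have "c (inv h) = c \<one>" if "c : C" for c using H_mult[of "inv h" h c] that h H_D(1)[OF h] by simp
 thus "inv h : H" using H_D(1)[OF h] by (simp add: H_def)
qed

lemma val0_A: "s : S ==> val0 s : A" using S(2) val0(1) by blast

lemma ideal_Iv: "fideal Iv" unfolding fideal_def proof (intro conjI ballI)
 show "Iv <= A" using val0_A by (auto simp: Iv_def intro!: sum_in mult_in)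
 show "0 : Iv" unfolding Iv_def by (intro CollectI exI[of _ "%_. 0"]) (simp add: zero_in)
 fix f h assume "f : Iv" "h : Iv"
 then obtain a b where "ALL s:S. a s : A" "f = (SUM s:S. val0 s * a s)" "ALL s:S. b s : A" "h = (SUM s:S. val0 s * b s)" unfolding Iv_def by blast
 thus "f + h : Iv" unfolding Iv_def by (intro CollectI exI[of _ "%s. a s + b s"]) (simp add: add_in distrib_left sum.distrib)
next
 fix r f assume r: "r : A" and "f : Iv"
 then obtain a where "ALL s:S. a s : A" "f = (SUM s:S. val0 s * a s)" unfolding Iv_def by blast
 thus "r * f : Iv" unfolding Iv_def by (intro CollectI exI[of _ "%s. r * a s"]) (simp add: r mult_in sdl mult.left_commute)
qed

lemma val0_Iv: "c : C ==> val0 c : Iv" using falg_val0[OF S] unfolding C Iv_def by blast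

text \<open>Cartier: the ideal of the isotropy group generated by \<open>C\<close> is radical.\<close>

lemma cartier: assumes f: "f : A" "!!h. h : H ==> f h = 0" shows "f : Iv" proof -
 let ?J = "{f : A. ALL h:H. f h = 0}"
 have I1: "f h = 0" if "f : Iv" "h : H" for f h
 using that S(2) by (auto simp: Iv_def fun_at sum_fun_at val0(3) H_D(1) H_D(2)[OF _ subsetD[OF SC]] intro!: sum.neutral)
 have oneH: "\<one> : H" by (simp add: H_def)
 note I1' = I1[OF _ oneH]
 \<comment> \<open>The left translates of c, shifted to vanish at the identity, all lie in
   \<open>Iv\<close>, so X kills them at every point.\<close>
 have DC: "dop X c = 0" if X: "X : gl" "!!i. i : Iv ==> X i = 0" and c: "c : C" for X c
 proof (rule fun_ext[OF dop_in[OF X(1) subsetD[OF CA c]] zero_in])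
 fix x assume x: "x : cr G"
 let ?c = "lt x c"
 have "X (val0 ?c + cst (cr G) (?c \<one>)) = X (val0 ?c) + X (cst (cr G) (?c \<one>))"
 by (rule glD(1)[OF X(1) val0(1) cst_in]) (use lt_C[OF x c] CA in blast)
 thus "dop X c x = 0 x" using X(2)[OF val0_Iv[OF lt_C[OF x c]]] gl_const[OF X(1)] x by (simp add: val0_def dop_at fun_at)
 qed
 have DI: "dop X f : Iv" if X: "X : gl" "!!i. i : Iv ==> X i = 0" and f: "f : Iv" for X f proof -
 interpret D: lin_op A "dop X" by (rule lin_op_dop[OF X(1)])
 obtain a where a: "ALL s:S. a s : A" "f = (SUM s:S. val0 s * a s)" using f unfolding Iv_def by blast
 have D0: "dop X 0 = 0" using D.D_scale[OF zero_in, of 0] by (simp add: fs0)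
 have Ds: "dop X (SUM s:S'. F s) = (SUM s:S'. dop X (F s))" if "!!s. s : S' ==> F s : A" for S' and F :: "('g => 'a) => 'g => 'a"
 using that by (induction S' rule: ifi) (simp_all add: D0 D.D_add sum_in)
 have "dop X f = (SUM s:S. dop X (val0 s * a s))" unfolding a(2) by (rule Ds) (use a(1) val0_A mult_in in blast)
 also have "... = (SUM s:S. val0 s * dop X (a s))" proof (rule sum.cong[OF refl])
 fix s assume s: "s : S"
 have "dop X (val0 s + cst (cr G) (s \<one>)) = dop X (val0 s)" using D.D_add[OF val0_A[OF s] cst_in] dop_cst[OF X(1)] by simp
 hence "dop X (val0 s) = 0" using DC[OF X subsetD[OF SC s]] by (simp add: val0_def)
 thus "dop X (val0 s * a s) = val0 s * dop X (a s)" using dop_mult[OF X(1) val0_A[OF s]] a(1) s by simp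
 qed
 finally show ?thesis unfolding Iv_def using a(1) dop_in[OF X(1)] by (intro CollectI exI[of _ "%s. dop X (a s)"]) auto
 qed
 \<comment> \<open>The vanishing ideal of H is preserved by derivations that kill \<open>Iv\<close>:
   a power of f lies in \<open>Iv\<close> by the Nullstellensatz, hence so does a power of the
   derivative of f, which therefore vanishes on H.\<close>
 have J: "?J <= mpi Iv n" for n proof (rule derivation_stable_in_mpi[of Iv, OF ideal_Iv])
 fix X f assume X: "X : gl" "!!i. i : Iv ==> X i = 0" and f: "f : ?J"
 have "EX n. f ^ Suc n : Iv" proof (rule ccontr)
 assume "\<nexists>n. f ^ Suc n : Iv"
 then obtain x where x: "x : cr G" "!!i. i : Iv ==> i x = 0" "f x ~= 0" using ideal_point[OF ideal_Iv, of f] f by blast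
 have "x : H" using x(1) x(2)[OF val0_Iv] CA val0(3)[of x] by (force simp: H_def)
 thus False using f x(3) by blast
 qed
 then obtain b where b: "dop X f ^ b * dop X f : Iv" using derivation_radical[OF X(1) ideal_Iv DI[OF X]] f by blast
 have "dop X f h = 0" if "h : H" for h using I1[OF b that] by (auto simp: fun_at power_fun_at)
 thus "dop X f : ?J" using dop_in[OF X(1)] f by blast
 qed (use oneH I1' DI in auto)
 have kr: "EX u:A. u \<one> = 0 & f - u * f : Iv" if "f : ?J" for f by (rule krull[OF ideal_Iv]) (use J that in blast)
 have ltI: "lt h i : Iv" if h: "h : H" and i: "i : Iv" for h i proof -
 note hG = H_D(1)[OF h]
 obtain a where a: "ALL s:S. a s : A" "i = (SUM s:S. val0 s * a s)" using i unfolding Iv_def by blast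
 have eq: "lt h i = (SUM s:S. val0 (lt h s) * lt h (a s))" proof (rule fun_ext)
 show "(SUM s:S. val0 (lt h s) * lt h (a s)) : A" using a(1) S(2) hG by (auto intro!: sum_in mult_in val0(1) lt_in)
 fix x assume x: "x : cr G"
 show "lt h i x = (SUM s:S. val0 (lt h s) * lt h (a s)) x"
 using x hG S(2) by (auto simp: a(2) lt_at sum_fun_at fun_at val0(3) lt_in H_D(2)[OF h subsetD[OF SC]] intro!: sum.cong)
 qed (use i idealD(1)[OF ideal_Iv] hG lt_in in blast)
 have "val0 (lt h s) * lt h (a s) : Iv" if "s : S" for s
 using idealD(4)[OF ideal_Iv lt_in val0_Iv[OF lt_C[OF hG subsetD[OF SC that]]], of "a s" h] a(1) that hG by (simp add: mcm)
 thus ?thesis unfolding eq by (rule ideal_sum[OF ideal_Iv])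
 qed
 \<comment> \<open>The multipliers taking f into \<open>Iv\<close> have no common zero: off H some
   shifted element of C is nonzero, and at a point of H the factor 1 - u of Krull's theorem is moved
   there.\<close>
 let ?Q = "{a : A. a * f : Iv}"
 have Q: "fideal ?Q" unfolding fideal_def using idealD(2-4)[OF ideal_Iv] by (auto simp: zero_in add_in mult_in distrib_right mult.assoc)
 have "cst (cr G) 1 : ?Q" proof (rule unit_ideal[OF Q])
 fix x assume x: "x : cr G"
 show "EX a:?Q. a x ~= 0" proof (cases "x : H")
 case False
 then obtain c where c: "c : C" "c x ~= c \<one>" using x by (auto simp: H_def)
 hence "val0 c : ?Q" using idealD(4)[OF ideal_Iv f(1) val0_Iv[OF c(1)]] CA val0(1) by (auto simp: mcm)
 moreover have "val0 c x ~= 0" using c CA x val0(3)[of x c] by auto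
 ultimately show ?thesis by blast
 next
 case True
 have "lt x f : ?J" using f True H_closed(1) lt_in[OF f(1) x] H_D(1) by (auto simp: lt_at)
 then obtain u where u: "u : A" "u \<one> = 0" "lt x f - u * lt x f : Iv" using kr by blast
 let ?a = "lt (inv x) (cst (cr G) 1 - u)"
 have aA: "?a : A" using x u(1) by (intro lt_in diff_in cst_in) auto
 have "lt (inv x) (lt x f - u * lt x f) = ?a * f" by (rule fun_ext)
 (use x f(1) u(1) aA in \<open>auto simp: lt_at fun_at cst_at m_assoc[symmetric] als intro!: lt_in diff_in mult_in\<close>)
 hence "?a * f : Iv" using ltI[OF H_closed(2)[OF True] u(3)] by simp
 moreover have "?a x ~= 0" using x u(2) by (simp add: lt_at fun_at cst_at)
 ultimately show ?thesis using aA by blast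
 qed
 qed
 thus ?thesis using one_mult[OF f(1)] by simp
qed

text \<open>Combinations of W with coefficients in C vanishing at x. That f minus its value at x
  lies here for all x, with one finite W, is the uniform algebraic form of f being constant on the
  fibres.\<close>

definition rel :: "('g => 'a) set => 'g => ('g => 'a) set" where
 "rel W x = {f. EX g. (ALL w:W. g w : C & g w x = 0) & f = (SUM w:W. g w * w)}"

lemma rel_subspace: "fsub (rel W x)" unfolding fs_def proof (intro conjI ballI allI)
 show "0 : rel W x" unfolding rel_def by (intro CollectI exI[of _ "%_. 0"]) (simp add: C.zero_in fun_at)
 fix f h c assume "f : rel W x" "h : rel W x"
 then obtain a b where "ALL w:W. a w : C & a w x = 0" "f = (SUM w:W. a w * w)"
 "ALL w:W. b w : C & b w x = 0" "h = (SUM w:W. b w * w)" unfolding rel_def by blast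
 thus "f + h : rel W x" unfolding rel_def by (intro CollectI exI[of _ "%w. a w + b w"]) (simp add: C.add_in plus_fun_apply distrib_right sum.distrib)
next
 fix f c assume "f : rel W x"
 then obtain a where a: "ALL w:W. a w : C & a w x = 0" "f = (SUM w:W. a w * w)" unfolding rel_def by blast
 have sc: "fsc c f * h = fsc c (f * h)" for f h :: "'g => 'a" by (rule ext) (simp add: fun_at)
 show "fsc c f : rel W x"
 unfolding rel_def using a by (intro CollectI exI[of _ "%w. fsc c (a w)"]) (simp add: C.scale_in fscale_at sc fs.scale_sum_right)
qed

lemma rel_gen: assumes "finite W" "w : W" "c : C" "c x = 0" shows "c * w : rel W x" proof -
 have "(SUM v:W. (if v = w then c else 0) * v) = (SUM v:W. if v = w then c * v else 0)" by (rule sum.cong) auto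
 hence "c * w = (SUM v:W. (if v = w then c else 0) * v)" using assms by simp
 thus ?thesis unfolding rel_def using assms C.zero_in by (intro CollectI exI[of _ "%v. if v = w then c else 0"]) (auto simp: fun_at)
qed

lemma rel_mono: assumes "finite W'" "W <= W'" shows "rel W x <= rel W' x" proof
 fix f assume "f : rel W x"
 then obtain g where g: "ALL w:W. g w : C & g w x = 0" "f = (SUM w:W. g w * w)" unfolding rel_def by blast
 show "f : rel W' x" unfolding g(2) by (rule fs.subspace_sum[OF rel_subspace rel_gen[OF assms(1)]]) (use g(1) assms(2) in auto)
qed

definition inv_fun :: "('g => 'a) => bool" where
 "inv_fun f \<longleftrightarrow> f : A & (ALL x:cr G. ALL h:H. f (x \<otimes> h) = f x)"

lemma fd_span_finite: "finite F ==> fd (fs.span F)" by (auto simp: fd_def)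

text \<open>Cartier's theorem puts the shifted translates of f into \<open>Iv\<close>. They span a
  finite-dimensional space, so the coefficients needed for a basis, together with their translates,
  give one finite W for all x.\<close>

lemma exists_relations: assumes f: "inv_fun f" shows "EX W. finite W & W <= A & (ALL x:cr G. f - cst (cr G) (f x) : rel W x)" proof -
 have fA: "f : A" using f by (simp add: inv_fun_def)
 define T where "T = fs.span ((%x. val0 (lt x f)) ` cr G)"
 note Ts = fs.subspace_span[of "(%x. val0 (lt x f)) ` cr G", folded T_def]
 have TI: "T <= Iv" unfolding T_def proof (rule fs.span_minimal[OF _ ideal_subspace[OF ideal_Iv]], clarify)
 fix x assume x: "x : cr G"
 show "val0 (lt x f) : Iv" by (rule cartier) (use x f fA H_D(1) in \<open>simp_all add: val0(1,3) lt_in lt_at inv_fun_def\<close>)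
 qed
 obtain n a b where ab: "!!i. i < (n::nat) ==> a i : A" "!!i. i < n ==> b i : A"
 "!!x y. x : cr G ==> y : cr G ==> f (x \<otimes> y) = (SUM i<n. a i x * b i y)" using tensE[OF comult[OF fA]] by metis
 have "fd T" proof (rule fd_subset[OF fd_span_finite])
 show "T <= fs.span ((%i. val0 (b i)) ` {..<n})" unfolding T_def proof (rule fs.span_minimal[OF _ fs.subspace_span], clarify)
 fix x assume x: "x : cr G"
 have f1: "f x = (SUM i<n. a i x * b i \<one>)" using ab(3)[OF x one_closed] x by simp
 have "val0 (lt x f) = lc n (%i. a i x) (%i. val0 (b i))"
 by (rule fun_ext) (use x fA ab f1 in \<open>auto simp: val0(1,3) lt_in lt_at lc_at right_diff_distrib sum_subtractf
 intro!: lc_in[OF subspace]\<close>)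
 also have "... : fs.span ((%i. val0 (b i)) ` {..<n})" by (rule lc_in[OF fs.subspace_span fs.span_base]) blast
 finally show "val0 (lt x f) : fs.span ((%i. val0 (b i)) ` {..<n})" .
 qed
 qed simp
 obtain r t where t: "bmod {0} T r t" by (rule exists_bmod[OF fs.subspace_single_0 Ts \<open>fd T\<close>]) (use fs_0[OF Ts] in auto)
 have "EX u. (ALL s:S. u s : A) & t j = (SUM s:S. val0 s * u s)" if "j < r" for j using bmD(1)[OF t that] TI unfolding Iv_def by blast
 then obtain u where u: "!!j s. j < r ==> s : S ==> u j s : A" "!!j. j < r ==> t j = (SUM s:S. val0 s * u j s)" by metis
 have "EX m p q. (ALL i<m. q i : A) & (ALL x:cr G. lt x h = lc m (%i. p i x) q)" if h: "h : A" for h proof -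
 obtain n a b where ab: "!!i. i < (n::nat) ==> a i : A" "!!i. i < n ==> b i : A"
 "!!x y. x : cr G ==> y : cr G ==> h (x \<otimes> y) = (SUM i<n. a i x * b i y)" using tensE[OF comult[OF h]] by metis
 have "lt x h = lc n (%i. a i x) b" if "x : cr G" for x
 by (rule fun_ext) (use that h ab in \<open>auto simp: lt_in lt_at lc_at intro!: lc_in[OF subspace]\<close>)
 thus ?thesis using ab(2) by blast
 qed
 hence "ALL h. EX m p q. h : A --> (ALL i<m. q i : A) & (ALL x:cr G. lt x h = lc m (%i. p i x) q)" by metis
 then obtain m p q where pq: "!!h i. h : A ==> i < m h ==> q h i : A"
 "!!h x. h : A ==> x : cr G ==> lt x h = lc (m h) (%i. p h i x) (q h)" by metis
 define W where "W = (\<Union>j<r. \<Union>s\<in>S. q (u j s) ` {..<m (u j s)})"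
 have W: "finite W" "W <= A" using S(1) u(1) pq(1) by (auto simp: W_def)
 have "f - cst (cr G) (f x) : rel W x" if x: "x : cr G" for x proof -
 have "val0 (lt x f) : T" unfolding T_def by (rule fs.span_base) (use x in blast)
 then obtain c where "val0 (lt x f) - lc r c t : {0}" using bmD(3)[OF t] by blast
 hence c: "val0 (lt x f) = lc r c t" by simp
 have "f - cst (cr G) (f x) = lt (inv x) (val0 (lt x f))"
 by (rule fun_ext) (use x fA in \<open>auto simp: val0(1,3) lt_in lt_at fun_at cst_at diff_in cst_in m_assoc[symmetric]\<close>)
 also have "... = (SUM j<r. SUM s:S. SUM i<m (u j s).
 (fsc (c j * p (u j s) i (inv x)) (lt (inv x) (val0 s))) * q (u j s) i)" proof (rule fun_ext)
 fix y assume y: "y : cr G"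
 have "u j s (inv x \<otimes> y) = (SUM i<m (u j s). p (u j s) i (inv x) * q (u j s) i y)" if "j < r" "s : S" for j s
 using pq(2)[OF u(1)[OF that], of "inv x"] x y lt_at[OF y, of "inv x" "u j s"] by (simp add: lc_at)
 thus "lt (inv x) (val0 (lt x f)) y = (SUM j<r. SUM s:S. SUM i<m (u j s).
 (fsc (c j * p (u j s) i (inv x)) (lt (inv x) (val0 s))) * q (u j s) i) y"
 unfolding c using y x by (simp add: lt_at lc_at u(2) fun_at sum_fun_at sdl mult_ac)
 qed (use x fA u(1) pq(1) S(2) in \<open>auto intro!: lt_in val0(1) sum_in mult_in scale_in\<close>)
 also have "... : rel W x" proof (intro fs.subspace_sum[OF rel_subspace] rel_gen[OF W(1)])
 fix j s i assume jsi: "j : {..<r}" "s : S" "i : {..<m (u j s)}"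
 show "q (u j s) i : W" unfolding W_def using jsi by blast
 have "lt (inv x) (val0 s) = lt (inv x) s - cst (cr G) (s \<one>)" using x by (auto simp: val0_def lt_linear lt_cst)
 thus "fsc (c j * p (u j s) i (inv x)) (lt (inv x) (val0 s)) : C" using x SC jsi(2) by (auto intro!: C.scale_in C.diff_in lt_C C.cst_in)
 show "fsc (c j * p (u j s) i (inv x)) (lt (inv x) (val0 s)) x = 0" using x by (simp add: fun_at lt_at val0(2))
 qed
 finally show ?thesis .
 qed
 thus ?thesis using W by blast
qed

text \<open>Generic freeness by hand, in a ring C that may have zero divisors: once s is inverted, B
  is linearly independent over C and generates W. A new w either becomes dependent after enlarging s
  to \<open>d * s\<close>, or joins B.\<close>

lemma exists_generic_basis: assumes W: "finite W" "W <= A" shows "EX B s. finite B & cst (cr G) 1 : B & s : C & s ~= 0 &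
 (ALL c. (ALL b:B. c b : C) --> (SUM b:B. c b * s * b) = 0 --> (ALL b:B. c b * s = 0)) &
 (ALL w:W. EX c. (ALL b:B. c b : C) & s * w = (SUM b:B. c b * b))" using W proof (induction W rule: finite_induct)
 case empty
 let ?o = "cst (cr G) (1::'a)"
 have "?o \<one> ~= (0 :: 'g => 'a) \<one>" by (simp add: cst_at fun_at)
 hence "?o ~= 0" by metis
 moreover have om: "f * ?o = f" if "f : C" for f using C.one_mult[OF that] by (simp add: mcm)
 ultimately show ?case by (intro exI[of _ "{?o}"] exI[of _ ?o]) (simp add: om C.cst_in C.mult_in)
next
 case (insert w W)
 have WA: "W <= A" using insert.prems by blast
 from insert.IH[OF WA] obtain B s where B: "finite B" "cst (cr G) 1 : B" "s : C" "s ~= 0"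
 and ind: "ALL c. (ALL b:B. c b : C) --> (SUM b:B. c b * s * b) = 0 --> (ALL b:B. c b * s = 0)"
 and gen: "ALL w:W. EX c. (ALL b:B. c b : C) & s * w = (SUM b:B. c b * b)" by (elim exE conjE) (rule that)
 show ?case proof (cases "EX d c. d : C & (ALL b:B. c b : C) & d * s ~= 0 & d * s * w = (SUM b:B. c b * s * b)")
 case True
 then obtain d e where d: "d : C" "ALL b:B. e b : C" "d * s ~= 0" "d * s * w = (SUM b:B. e b * s * b)" by blast
 have gen': "ALL v:insert w W. EX c. (ALL b:B. c b : C) & d * s * v = (SUM b:B. c b * b)" proof
 fix v assume v: "v : insert w W"
 show "EX c. (ALL b:B. c b : C) & d * s * v = (SUM b:B. c b * b)" proof (cases "v = w")
 case True
 thus ?thesis using d B(3) by (intro exI[of _ "%b. e b * s"]) (simp add: C.mult_in)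
 next
 case False
 then obtain c where "ALL b:B. c b : C" "s * v = (SUM b:B. c b * b)" using gen v by blast
 thus ?thesis using d(1) by (intro exI[of _ "%b. d * c b"]) (simp add: C.mult_in mult.assoc sdl)
 qed
 qed
 have "ALL b:B. c b * (d * s) = 0" if c: "ALL b:B. c b : C" "(SUM b:B. c b * (d * s) * b) = 0" for c
 using ind[rule_format, of "%b. c b * d"] c d(1) by (simp add: C.mult_in mult.assoc)
 hence ind': "ALL c. (ALL b:B. c b : C) --> (SUM b:B. c b * (d * s) * b) = 0 --> (ALL b:B. c b * (d * s) = 0)" by blast
 show ?thesis by (rule exI[of _ B], rule exI[of _ "d * s"], intro conjI)
 (fact B(1), fact B(2), fact C.mult_in[OF d(1) B(3)], fact d(3), fact ind', fact gen')
 next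
 case False
 hence no: "d * s = 0" if "d : C" "ALL b:B. c b : C" "d * s * w = (SUM b:B. c b * s * b)" for d c using that by blast
 show ?thesis proof (cases "w : B")
 case True
 have "(SUM b:B. (if b = w then cst (cr G) 1 else 0) * s * b) = (SUM b:B. if b = w then cst (cr G) 1 * s * b else 0)" by (rule sum.cong) auto
 hence e1: "cst (cr G) 1 * s * w = (SUM b:B. (if b = w then cst (cr G) 1 else 0) * s * b)" using True B(1) by simp
 have e2: "ALL b:B. (if b = w then cst (cr G) 1 else 0) : C" using C.cst_in C.zero_in by simp
 have "cst (cr G) 1 * s = 0" by (rule no[OF C.cst_in e2 e1])
 thus ?thesis using C.one_mult[OF B(3)] B(4) by simp
 next
 case wB: False
 have "ALL b:insert w B. c b * s = 0"
 if c: "ALL b:insert w B. c b : C" "(SUM b:insert w B. c b * s * b) = 0" for c proof -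
 have eq: "c w * s * w + (SUM b:B. c b * s * b) = 0" using c(2) wB B(1) by simp
 hence "c w * s * w = (SUM b:B. (- c b) * s * b)" by (simp add: sum_negf eq_neg_iff_add_eq_0)
 hence "c w * s = 0" by (rule no[of "c w" "%b. - c b", rotated 2]) (use c(1) C.uminus_in in auto)
 moreover from this have "ALL b:B. c b * s = 0" using ind c(1) eq by simp
 ultimately show ?thesis by blast
 qed
 moreover have "EX c. (ALL b:insert w B. c b : C) & s * v = (SUM b:insert w B. c b * b)" if v: "v : insert w W" for v proof (cases "v = w")
 case True
 have "(SUM b:B. (if b = w then s else 0) * b) = 0" using wB by (intro sum.neutral) auto
 thus ?thesis using True B(1,3) wB C.zero_in by (intro exI[of _ "%b. if b = w then s else 0"]) simp
 next
 case False
 then obtain c where c: "ALL b:B. c b : C" "s * v = (SUM b:B. c b * b)" using gen v by blast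
 have "(SUM b:B. (if b = w then 0 else c b) * b) = (SUM b:B. c b * b)" using wB by (intro sum.cong) auto
 thus ?thesis using c B(1) wB C.zero_in by (intro exI[of _ "%b. if b = w then 0 else c b"]) simp
 qed
 ultimately show ?thesis using B by (intro exI[of _ "insert w B"] exI[of _ s]) simp
 qed
 qed
qed

text \<open>Since f minus its value at x has coefficients vanishing at x, the coordinate of
  \<open>s * f\<close> at the basis element 1 recovers f at every x where s is nonzero. The
  denominator is \<open>s * s\<close>.\<close>

lemma exists_denominator: assumes F: "finite F" "!!f. f : F ==> inv_fun f" shows "EX q:C. q ~= 0 & (ALL f:F. q * f : C)" proof -
 let ?o = "cst (cr G) (1::'a)"
 have "ALL f. EX W. f : F --> finite W & W <= A & (ALL x:cr G. f - cst (cr G) (f x) : rel W x)" proof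
 fix f
 show "EX W. f : F --> finite W & W <= A & (ALL x:cr G. f - cst (cr G) (f x) : rel W x)" proof (cases "f : F")
 case True
 from exists_relations[OF F(2)[OF True]] show ?thesis by (elim exE) (rule exI, rule impI)
 qed simp
 qed
 then obtain Wf where Wf: "!!f. f : F ==> finite (Wf f)" "!!f. f : F ==> Wf f <= A"
 "!!f x. f : F ==> x : cr G ==> f - cst (cr G) (f x) : rel (Wf f) x" by metis
 define W where "W = F Un (\<Union>f\<in>F. Wf f)"
 have W: "finite W" "W <= A" using F Wf by (auto simp: W_def inv_fun_def)
 obtain B s where B: "finite B" "?o : B" "s : C" "s ~= 0"
 and ind: "ALL c. (ALL b:B. c b : C) --> (SUM b:B. c b * s * b) = 0 --> (ALL b:B. c b * s = 0)"
 and gen: "ALL w:W. EX c. (ALL b:B. c b : C) & s * w = (SUM b:B. c b * b)" using exists_generic_basis[OF W] by (elim exE conjE) (rule that)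
 have "EX gmm. ALL w:W. (ALL b:B. gmm w b : C) & s * w = (SUM b:B. gmm w b * b)" by (rule bchoice[OF gen])
 then obtain gmm where gmm0: "ALL w:W. (ALL b:B. gmm w b : C) & s * w = (SUM b:B. gmm w b * b)" by (rule exE)
 have gmm: "!!w b. w : W ==> b : B ==> gmm w b : C" "!!w. w : W ==> s * w = (SUM b:B. gmm w b * b)"
 by (rule bspec[OF conjunct1[OF bspec[OF gmm0]]], assumption+, rule conjunct2[OF bspec[OF gmm0]], assumption)
 have "s * s * f : C" if f: "f : F" for f proof -
 have fW: "f : W" and fA: "f : A" using f W(2) by (auto simp: W_def)
 have "f x * s x * s x = gmm f ?o x * s x" if x: "x : cr G" for x proof -
 have "f - cst (cr G) (f x) : rel W x" using Wf(3)[OF f x] rel_mono[OF W(1), of "Wf f" x] f by (auto simp: W_def)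
 then obtain g where g: "ALL w:W. g w : C & g w x = 0" "f - cst (cr G) (f x) = (SUM w:W. g w * w)" unfolding rel_def by blast
 \<comment> \<open>The coordinates of s times the relation for x. Independence kills the one at the
   constant 1, and evaluating it at x removes all terms with a factor \<open>g w\<close>.\<close>
 define kp where "kp b = gmm f b - (SUM w:W. g w * gmm w b) - (if b = ?o then fsc (f x) s else 0)" for b
 have "s * (f - cst (cr G) (f x)) = (SUM b:B. gmm f b * b) - fsc (f x) s"
 using C.cst_mult[OF B(3), of "f x"] gmm(2)[OF fW] by (simp add: right_diff_distrib mcm)
 moreover have "s * (SUM w:W. g w * w) = (SUM w:W. g w * (s * w))" by (simp add: sdl mult.left_commute)
 moreover have "... = (SUM b:B. (SUM w:W. g w * gmm w b) * b)" by (simp add: gmm(2) sdl sdr mult.assoc) (rule sum.swap)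
 moreover have "(SUM b:B. (if b = ?o then fsc (f x) s else 0) * b) = fsc (f x) s" proof -
 have "(SUM b:B. (if b = ?o then fsc (f x) s else 0) * b) = (SUM b:B. if b = ?o then fsc (f x) s * b else 0)" by (rule sum.cong) auto
 also have "... = fsc (f x) s * ?o" using B(1,2) by simp
 also have "... = fsc (f x) s" by (subst mcm) (rule C.one_mult[OF C.scale_in[OF B(3)]])
 finally show ?thesis .
 qed
 ultimately have "(SUM b:B. kp b * b) = 0" using g(2) by (simp add: kp_def left_diff_distrib sum_subtractf)
 hence "s * (SUM b:B. kp b * b) = 0" by simp
 hence "(SUM b:B. kp b * s * b) = 0" by (simp add: sdl mult_ac)
 moreover have "ALL b:B. kp b : C" using gmm(1) fW g(1) B(3) by (auto simp: kp_def intro!: C.diff_in C.sum_in C.mult_in C.scale_in C.zero_in)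
 ultimately have "kp ?o * s = 0" using ind B(2) by blast
 hence "kp ?o x * s x = 0" by (metis times_fun_apply zero_fun_apply)
 thus ?thesis using g(1) by (auto simp: kp_def fun_at sum_fun_at left_diff_distrib mult_ac)
 qed
 hence "s * s * f = gmm f ?o * s" using fA CA B(2,3) gmm(1)[OF fW B(2)] by (intro fun_ext) (auto simp: fun_at mult_ac intro!: mult_in)
 thus ?thesis using C.mult_in gmm(1)[OF fW B(2)] B(3) by simp
 qed
 moreover have "s * s ~= 0" proof
 assume "s * s = 0"
 hence "s x = 0" for x by (metis times_fun_apply zero_fun_apply mult_eq_0_iff)
 thus False using B(4) by (auto simp: fun_at fei)
 qed
 ultimately show ?thesis using C.mult_in[OF B(3,3)] by blast
qed

text \<open>The denominators that serve all translates of f at once form an ideal of C stable under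
  translation. If it were proper, the Nullstellensatz and \<open>points_C\<close> would give a
  common zero on the orbit, but a translation moves that zero to a point where q does not
  vanish.\<close>

theorem inv_fun_in: assumes f: "inv_fun f" shows "f : C" proof -
 have fA: "f : A" using f by (simp add: inv_fun_def)
 obtain n a b where ab: "!!i. i < (n::nat) ==> a i : A" "!!i. i < n ==> b i : A"
 "!!x y. x : cr G ==> y : cr G ==> f (x \<otimes> y) = (SUM i<n. a i x * b i y)" using tensE[OF comult[OF fA]] by metis
 define T where "T = fs.span ((%x. lt x f) ` cr G)"
 note Ts = fs.subspace_span[of "(%x. lt x f) ` cr G", folded T_def]
 have "fd T" proof (rule fd_subset[OF fd_span_finite])
 show "T <= fs.span (b ` {..<n})" unfolding T_def proof (rule fs.span_minimal[OF _ fs.subspace_span], clarify)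
 fix x assume x: "x : cr G"
 have "lt x f = lc n (%i. a i x) b" by (rule fun_ext) (use x fA ab in \<open>auto simp: lt_in lt_at lc_at intro!: lc_in[OF subspace]\<close>)
 also have "... : fs.span (b ` {..<n})" by (rule lc_in[OF fs.subspace_span fs.span_base]) blast
 finally show "lt x f : fs.span (b ` {..<n})" .
 qed
 qed simp
 have Tinv: "T <= {f. inv_fun f}" unfolding T_def proof (rule fs.span_minimal)
 show "(%x. lt x f) ` cr G <= {f. inv_fun f}" using f H_D(1) by (auto simp: inv_fun_def lt_in lt_at m_assoc[symmetric])
 show "fsub {f. inv_fun f}" by (auto simp: fs_def inv_fun_def zero_in add_in scale_in fun_at)
 qed
 obtain r t where t: "bmod {0} T r t" by (rule exists_bmod[OF fs.subspace_single_0 Ts \<open>fd T\<close>]) (use fs_0[OF Ts] in auto)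
 have "inv_fun h" if "h : t ` {..<r}" for h using that bmD(1)[OF t] Tinv by blast
 then obtain q where q: "q : C" "q ~= 0" "ALL h:t ` {..<r}. q * h : C" using exists_denominator[of "t ` {..<r}"] by blast
 have qf: "q * lt x f : C" if x: "x : cr G" for x proof -
 have "lt x f : T" unfolding T_def by (rule fs.span_base) (use x in blast)
 then obtain c where "lt x f - lc r c t : {0}" using bmD(3)[OF t] by blast
 hence "q * lt x f = lc r c (%i. q * t i)" by (simp add: fei lc_at fun_at sdl mult_ac)
 also have "... : C" by (rule lc_in[OF C.subspace]) (use q(3) in blast)
 finally show ?thesis .
 qed
 let ?Q = "{q : C. ALL x:cr G. q * lt x f : C}"
 have Q: "C.fideal ?Q" unfolding C.fideal_def by (auto simp: C.zero_in C.add_in C.mult_in distrib_right mult.assoc)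
 have ltQ: "lt z q : ?Q" if z: "z : cr G" for z proof -
 have "lt z q * lt x f : C" if x: "x : cr G" for x proof -
 have "lt z q * lt x f = lt z (q * lt (x \<otimes> inv z) f)"
 by (rule fun_ext) (use x z fA q(1) CA in \<open>auto simp: lt_at fun_at m_assoc intro!: mult_in lt_in\<close>, simp add: m_assoc[symmetric])
 also have "... : C" by (rule lt_C[OF z qf]) (use x z in simp)
 finally show ?thesis .
 qed
 thus ?thesis using lt_C[OF z q(1)] by blast
 qed
 obtain y where y: "q y ~= 0" using q(2) by (auto simp: fei fun_at)
 have yG: "y : cr G" using y C.out[OF q(1)] by blast
 have "cst (cr G) 1 : ?Q" proof (rule ccontr)
 assume no: "cst (cr G) 1 ~: ?Q"
 have pow: "cst (cr G) (1::'a) ^ Suc n = cst (cr G) 1" for n by (rule ext) (simp add: power_fun_at cst_at fun_at)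
 have np: "cst (cr G) 1 ^ Suc n ~: ?Q" for n unfolding pow by (rule no)
 obtain phi where phi: "C.fhom phi" "!!f. f : ?Q ==> phi f = 0"
 by (rule nullstellensatz[OF S(1) supp_S, folded C, OF Q C.cst_in np]) (rule that; assumption)
 obtain g where g: "g : cr G" "ALL c:C. phi c = c g" using points_C[OF phi(1)] by blast
 have "lt (y \<otimes> inv g) q : ?Q" using ltQ yG g(1) by simp
 hence "lt (y \<otimes> inv g) q g = 0" using phi(2) g(2) by force
 thus False using y yG g(1) by (simp add: lt_at m_assoc)
 qed
 hence "cst (cr G) 1 * lt \<one> f : C" by blast
 thus ?thesis using lt_one[OF fA] one_mult[OF fA] by simp
qed

end

section \<open>Equivariant polynomial maps\<close>

definition polyf :: "('a::field => 'v::ab_group_add => 'v) => ('v => 'a) set" where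
 "polyf s = falg UNIV {l. vlin s (*) l}"

lemma fun_alg_polyf: "fun_alg UNIV (polyf s)" unfolding polyf_def by (rule fun_alg_falg) (simp add: supp_in_def)

lemma tens_ex: assumes "tens X Y A B F" shows "EX n a b. (ALL i<(n::nat). a i : A & b i : B) & (ALL x:X. ALL y:Y. F x y = (SUM i<n. a i x * b i y))"
proof -
 obtain n a b where "!!i. i < (n::nat) ==> a i : A" "!!i. i < n ==> b i : B"
 "!!x y. x : X ==> y : Y ==> F x y = (SUM i<n. a i x * b i y)" using tensE[OF assms] by metis
 thus ?thesis by (intro exI[of _ n] exI[of _ a] exI[of _ b]) simp
qed

lemma linear_polyf: "vlin s (*) l ==> l : polyf s" unfolding polyf_def by (rule falg.gen) simp

definition pmap :: "('a::field => 'v::ab_group_add => 'v) => ('a => 'w::ab_group_add => 'w) => ('v => 'w) => bool" where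
 "pmap s s' th \<longleftrightarrow> (ALL l. vlin s' (*) l --> (%x. l (th x)) : polyf s)"

lemma pmap_comp: assumes "pmap s s' th" "f : polyf s'" shows "(%x. f (th x)) : polyf s" using assms(2) unfolding polyf_def
proof (induction rule: falg.induct)
 case (const c)
 have "(%x. cst UNIV c (th x)) = cst UNIV c" by (rule ext) (simp add: cst_at)
 thus ?case by (simp add: falg.const)
next
 case (gen l)
 thus ?case using assms(1) by (simp add: pmap_def polyf_def)
next
 case (add f g)
 have "(%x. (f + g) (th x)) = (%x. f (th x)) + (%x. g (th x))" by (rule ext) (simp add: fun_at)
 thus ?case using falg.add[OF add.IH] by simp
next
 case (mult f g)
 have "(%x. (f * g) (th x)) = (%x. f (th x)) * (%x. g (th x))" by (rule ext) (simp add: fun_at)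
 thus ?case using falg.mult[OF mult.IH] by simp
qed

lemma pmap_pmap: "pmap s s' th ==> pmap s' s'' eta ==> pmap s s'' (%x. eta (th x))" using pmap_comp unfolding pmap_def by fastforce

lemma linear_pmap: "vlin s s' T ==> pmap s s' T"
 unfolding pmap_def using linear_polyf Vector_Spaces.linear_compose[of s s' T "(*)"] by (auto simp: o_def)

lemma generated_algebra_polyf:
 "generated_algebra Z {l. vlin s (*) l} = (%f. restrict f Z) ` polyf s" proof
 show "generated_algebra Z {l. vlin s (*) l} <= (%f. restrict f Z) ` polyf s" proof
 fix F assume "F : generated_algebra Z {l. vlin s (*) l}"
 thus "F : (%f. restrict f Z) ` polyf s" proof (induction rule: generated_algebra.induct)
 case (const c)
 have "(\<lambda>x\<in>Z. c) = restrict (cst UNIV c) Z" by (auto simp: cst_at)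
 thus ?case unfolding polyf_def using falg.const by blast
 next
 case (generator f)
 thus ?case using linear_polyf by blast
 next
 case (add f g)
 then obtain f' g' where "f' : polyf s" "g' : polyf s" "f = restrict f' Z" "g = restrict g' Z" by blast
 moreover from this have "(\<lambda>x\<in>Z. f x + g x) = restrict (f' + g') Z" by (auto simp: fun_at)
 ultimately show ?case using fun_alg.add_in[OF fun_alg_polyf] by blast
 next
 case (mult f g)
 then obtain f' g' where "f' : polyf s" "g' : polyf s" "f = restrict f' Z" "g = restrict g' Z" by blast
 moreover from this have "(\<lambda>x\<in>Z. f x * g x) = restrict (f' * g') Z" by (auto simp: fun_at)
 ultimately show ?case using fun_alg.mult_in[OF fun_alg_polyf] by blast
 qed
 qed
 show "(%f. restrict f Z) ` polyf s <= generated_algebra Z {l. vlin s (*) l}" proof clarify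
 fix f assume "f : polyf s"
 thus "restrict f Z : generated_algebra Z {l. vlin s (*) l}" unfolding polyf_def proof (induction rule: falg.induct)
 case (const c)
 have eq: "restrict (cst UNIV c) Z = (\<lambda>x\<in>Z. c)" by (auto simp: cst_at)
 show ?case unfolding eq by (rule ga_const)
 next
 case (gen f)
 thus ?case by (rule generated_algebra.generator)
 next
 case (add f g)
 have eq: "restrict (f + g) Z = (\<lambda>x\<in>Z. restrict f Z x + restrict g Z x)" by (auto simp: fun_at)
 show ?case unfolding eq by (rule generated_algebra.add[OF add.IH])
 next
 case (mult f g)
 have eq: "restrict (f * g) Z = (\<lambda>x\<in>Z. restrict f Z x * restrict g Z x)" by (auto simp: fun_at)
 show ?case unfolding eq by (rule generated_algebra.mult[OF mult.IH])
 qed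
 qed
qed

text \<open>Relates the topology of a subspace to polynomials on the whole module, the form in which
  closed sets are handled from here on.\<close>

lemma closedin_lr:
 "closedin (zariski Z (linear_ring s Z)) Y \<longleftrightarrow> (EX T<=polyf s. Y = {x : Z. ALL f:T. f x = 0})" proof -
 have "closedin (zariski Z (linear_ring s Z)) Y \<longleftrightarrow>
 (EX T'<=(%f. restrict f Z) ` polyf s. Y = {x : Z. ALL f:T'. f x = 0})" using closedin_zariski[of Z "{l. vlin s (*) l}" Y]
 unfolding linear_ring_def generated_algebra_polyf .
 also have "... \<longleftrightarrow> (EX T<=polyf s. Y = {x : Z. ALL f:T. f x = 0})" proof
 assume "EX T'<=(%f. restrict f Z) ` polyf s. Y = {x : Z. ALL f:T'. f x = 0}"
 then obtain T' where T': "T' <= (%f. restrict f Z) ` polyf s" "Y = {x : Z. ALL f:T'. f x = 0}" by blast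
 obtain T where T: "T <= polyf s" "T' = (%f. restrict f Z) ` T" using T'(1) by (rule subset_imageE)
 have "Y = {x : Z. ALL f:T. f x = 0}" unfolding T'(2) T(2) by auto
 thus "EX T<=polyf s. Y = {x : Z. ALL f:T. f x = 0}" using T(1) by blast
 next
 assume "EX T<=polyf s. Y = {x : Z. ALL f:T. f x = 0}"
 then obtain T where T: "T <= polyf s" "Y = {x : Z. ALL f:T. f x = 0}" by blast
 have "Y = {x : Z. ALL f:(%f. restrict f Z) ` T. f x = 0}" unfolding T(2) by auto
 thus "EX T'<=(%f. restrict f Z) ` polyf s. Y = {x : Z. ALL f:T'. f x = 0}"  by (intro exI[of _ "(%f. restrict f Z) ` T"] conjI image_mono T(1))
 qed
 finally show ?thesis .
qed

lemma (in finite_dimensional_vector_space) crd: shows "vlin scale (*) (%v. representation Basis v b)"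
 "(SUM b:Basis. scale (representation Basis v b) b) = v"
 "vlin scale (*) l ==> l v = (SUM b:Basis. representation Basis v b * l b)" proof -
 have "vector_space scale" by unfold_locales
 moreover have "vector_space ((*) :: 'a => 'a => 'a)" by unfold_locales (simp_all add: als)
 ultimately show "vlin scale (*) (%v. representation Basis v b)" unfolding vli
 by (simp add: representation_add representation_scale independent_Basis span_Basis)
 show *: "(SUM b:Basis. scale (representation Basis v b) b) = v"
 by (rule sum_representation_eq) (auto simp: independent_Basis span_Basis finite_Basis)
 assume "vlin scale (*) l"
 then interpret l: Vector_Spaces.linear scale "(*)" l .
 have "l v = l (SUM b:Basis. scale (representation Basis v b) b)" by (simp only: *)
 thus "l v = (SUM b:Basis. representation Basis v b * l b)" by (simp add: l.sum l.scale)
qed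

locale red_module = red_group G A + vs: finite_dimensional_vector_space s B
 for G :: "('g, 'm) monoid_scheme" (structure) and A :: "('g => 'a::{alg_closed_field, field_char_0}) set"
 and s :: "'a => 'v::ab_group_add => 'v" and B +
 fixes rho :: "'g => 'v => 'v" assumes act: "group_action G UNIV rho" and lin: "g : cr G ==> vlin s s (rho g)"
 and rat: "vlin s (*) l ==> zcut (cr G) (%g. l (rho g v)) : A"
begin

lemma act_mult: "g : cr G ==> h : cr G ==> rho (g \<otimes> h) v = rho g (rho h v)" using group_action.composition_rule[OF act] by auto

lemma act_one: "rho \<one> v = v" using group_action.id_eq_one[OF act] by (metis restrict_apply UNIV_I)

lemma act_inv: "g : cr G ==> rho (inv g) (rho g v) = v" "g : cr G ==> rho g (rho (inv g) v) = v"
 using act_mult[of "inv g" g v] act_mult[of g "inv g" v] act_one by simp_all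

definition crd :: "'v => 'v => 'a" where
 "crd b v = vs.representation B v b"

lemma crd: "vlin s (*) (crd b)" "(SUM b:B. s (crd b v) b) = v"
 "vlin s (*) l ==> l v = (SUM b:B. crd b v * l b)" using vs.crd unfolding crd_def by blast+

lemma finB: "finite B" by (rule vs.finite_Basis)

lemma crd_ext: "(!!b. b : B ==> crd b v = crd b w) ==> v = w" using crd(2)[of v] crd(2)[of w] by (metis (mono_tags, lifting) sum.cong)

lemma crd_act: "g : cr G ==> crd b (rho g v) = (SUM b':B. crd b' v * crd b (rho g b'))"
 using crd(3)[of "%v. crd b (rho g v)" v] Vector_Spaces.linear_compose[OF lin crd(1), of g b] by (simp add: o_def)

lemma crd_sum: "b : B ==> crd b (SUM b:B. s (a b) b) = a b" proof -
 assume b: "b : B"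
 interpret l: Vector_Spaces.linear s "(*)" "crd b" by (rule crd(1))
 have "crd b b' = (if b' = b then 1 else 0)" if "b' : B" for b' using vs.representation_basis[OF vs.independent_Basis that] by (simp add: crd_def)
 hence "(SUM b':B. a b' * crd b b') = (SUM b':B. if b' = b then a b' else 0)" by (intro sum.cong) simp_all
 hence "crd b (SUM b:B. s (a b) b) = (SUM b':B. if b' = b then a b' else 0)" by (simp add: l.sum l.scale)
 thus ?thesis using b finB by simp
qed

definition orb :: "'v => ('v => 'a) => 'g => 'a" where
 "orb v f = zcut (cr G) (%g. f (rho g v))"

lemma orb_at: "g : cr G ==> orb v f g = f (rho g v)" by (simp add: orb_def zcut_def)

lemma orb_hom: "orb v (f + h) = orb v f + orb v h" "orb v (f * h) = orb v f * orb v h" "orb v (cst UNIV c) = cst (cr G) c"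
 by (rule ext, simp add: orb_def zcut_def cst_at fun_at)+

lemma orb_linear: assumes l: "vlin s (*) l" shows "orb v l = (SUM b:B. fsc (l b) (orb v (crd b)))" proof (rule ext)
 fix g
 have "l (rho g v) = (SUM b:B. crd b (rho g v) * l b)" by (rule crd(3)[OF l])
 thus "orb v l g = (SUM b:B. fsc (l b) (orb v (crd b))) g" by (simp add: orb_def zcut_def fun_at sum_fun_at mcm)
qed

lemma orb_alg: "orb v ` polyf s = falg (cr G) (orb v ` crd ` B)" proof
 have sup: "supp_in (cr G) (orb v ` crd ` B)" by (auto simp: supp_in_def orb_def zcut_def)
 interpret C: fun_alg "cr G" "falg (cr G) (orb v ` crd ` B)" by (rule fun_alg_falg[OF sup])
 show "orb v ` polyf s <= falg (cr G) (orb v ` crd ` B)" proof clarify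
 fix f assume "f : polyf s"
 thus "orb v f : falg (cr G) (orb v ` crd ` B)" unfolding polyf_def proof (induction rule: falg.induct)
 case (gen l)
 hence "orb v l = (SUM b:B. fsc (l b) (orb v (crd b)))" by (intro orb_linear) simp
 moreover have "orb v (crd b) : falg (cr G) (orb v ` crd ` B)" if "b : B" for b by (rule falg.gen) (use that in blast)
 ultimately show ?case by (auto intro!: C.sum_in C.scale_in)
 qed (simp_all add: orb_hom C.cst_in C.add_in C.mult_in)
 qed
 have "orb v ` crd ` B <= orb v ` polyf s" using linear_polyf[OF crd(1)] by blast
 moreover have "fun_alg (cr G) (orb v ` polyf s)" proof
 show "f x = 0" if "f : orb v ` polyf s" "x ~: cr G" for f x using that by (auto simp: orb_def zcut_def)
 show "cst (cr G) c : orb v ` polyf s" for c using orb_hom(3)[of v c] fun_alg.cst_in[OF fun_alg_polyf[of s]] by (metis image_eqI)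
 show "f + g : orb v ` polyf s" if "f : orb v ` polyf s" "g : orb v ` polyf s" for f g
 using that by (auto simp: orb_hom(1)[symmetric] intro!: imageI fun_alg.add_in[OF fun_alg_polyf])
 show "f * g : orb v ` polyf s" if "f : orb v ` polyf s" "g : orb v ` polyf s" for f g
 using that by (auto simp: orb_hom(2)[symmetric] intro!: imageI fun_alg.mult_in[OF fun_alg_polyf])
 qed
 ultimately show "falg (cr G) (orb v ` crd ` B) <= orb v ` polyf s" by (rule falg_least[rotated])
qed

text \<open>A homomorphism of the pulled-back algebra assigns values to the coordinates and so
  defines a vector x. The equations T of the closed orbit pull back to zero, hence x lies on the
  orbit, which is what \<open>points_C\<close> demands.\<close>

lemma orbit_alg: assumes T: "T <= polyf s" "{rho g v |g. g : cr G} = {x. ALL f:T. f x = 0}" shows "orbit_alg G A (orb v ` crd ` B) (orb v ` polyf s)"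
proof
 show "finite (orb v ` crd ` B)" using finB by blast
 show "orb v ` crd ` B <= A" using rat[OF crd(1)] by (auto simp: orb_def)
 show "orb v ` polyf s = falg (cr G) (orb v ` crd ` B)" by (rule orb_alg)
 fix x c assume x: "x : cr G" and "c : orb v ` polyf s"
 then obtain f where f: "f : polyf s" "c = orb v f" by blast
 have "lt x c = orb v (%y. f (rho x y))" using x by (auto simp: f(2) lt_def orb_def zcut_def act_mult fei)
 thus "lt x c : orb v ` polyf s" using pmap_comp[OF linear_pmap[OF lin[OF x]] f(1)] by blast
next
 fix phi assume phi: "fun_alg.fhom (cr G) (orb v ` polyf s) phi"
 have sup: "supp_in (cr G) (orb v ` crd ` B)" by (auto simp: supp_in_def orb_def zcut_def)
 interpret C: fun_alg "cr G" "orb v ` polyf s" unfolding orb_alg by (rule fun_alg_falg[OF sup])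
 define x where "x = (SUM b:B. s (phi (orb v (crd b))) b)"
 have x: "phi (orb v f) = f x" if "f : polyf s" for f using that unfolding polyf_def proof (induction rule: falg.induct)
 case (const c)
 show ?case unfolding orb_hom C.homD(1)[OF phi] by (simp add: cst_at)
 next
 case (gen l)
 hence l: "vlin s (*) l" by simp
 interpret l: Vector_Spaces.linear s "(*)" l by (rule l)
 note orb_linear[OF l, of v]
 moreover have "orb v (crd b) : orb v ` polyf s" for b using linear_polyf[OF crd(1)] by blast
 ultimately show ?case by (simp add: x_def C.hom_sum[OF phi] C.hom_scale[OF phi] C.scale_in l.sum l.scale mcm)
 next
 case (add f g)
 note fg = add.hyps[folded polyf_def] and IH = add.IH[folded polyf_def]
 show ?case unfolding orb_hom C.homD(2)[OF phi imageI[OF fg(1)] imageI[OF fg(2)]] IH by (simp add: fun_at)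
 next
 case (mult f g)
 note fg = mult.hyps[folded polyf_def] and IH = mult.IH[folded polyf_def]
 show ?case unfolding orb_hom C.homD(3)[OF phi imageI[OF fg(1)] imageI[OF fg(2)]] IH by (simp add: fun_at)
 qed
 have "f x = 0" if f: "f : T" for f proof -
 have "orb v f = 0" proof (rule ext)
 fix g
 have "f (rho g v) = 0" if "g : cr G" using T(2) f that by blast
 thus "orb v f g = 0 g" by (simp add: orb_def zcut_def fun_at)
 qed
 thus ?thesis using x[of f] f T(1) C.hom_zero[OF phi] by auto
 qed
 then obtain g where g: "g : cr G" "x = rho g v" using T(2) by blast
 show "EX x:cr G. ALL c:orb v ` polyf s. phi c = c x" using x g by (intro bexI[of _ g]) (auto simp: orb_at)
qed

definition eqv :: "('v => 'v) => bool" where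
 "eqv th \<longleftrightarrow> pmap s s th & (ALL g:cr G. ALL x. th (rho g x) = rho g (th x))"

lemma tens_polyf: assumes "f : polyf s" shows "tens (cr G) UNIV A (polyf s) (%g x. f (rho g x))" using assms unfolding polyf_def[of s]
proof (induction rule: falg.induct)
 case (const c)
 show ?case by (rule tens_simple[of "cst (cr G) c" _ "cst UNIV 1"]) (simp_all add: cst_in falg.const cst_at)
next
 case (gen l)
 hence l: "vlin s (*) l" by simp
 have sum: "tens (cr G) UNIV A (falg UNIV {l. vlin s (*) l}) (%g x. SUM b:B'. l (rho g b) * crd b x)"
 if "finite B'" for B' using that proof (induction B' rule: finite_induct)
 case empty
 show ?case by (rule tens_simple[of 0 _ "cst UNIV 1"]) (simp_all add: zero_in falg.const fun_at)
 next
 case (insert b B')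
 have "tens (cr G) UNIV A (falg UNIV {l. vlin s (*) l}) (%g x. l (rho g b) * crd b x)"
 by (rule tens_simple[OF rat[OF l, of b], of "crd b"]) (simp_all add: falg.gen crd(1) zcut_def)
 from tens_add[OF this insert.IH] show ?case using insert.hyps by simp
 qed
 have "l (rho g x) = (SUM b:B. l (rho g b) * crd b x)" if "g : cr G" for g x
 using crd(3)[of "%v. l (rho g v)" x] Vector_Spaces.linear_compose[OF lin[OF that] l] by (simp add: o_def mcm)
 thus ?case using sum[OF finB] unfolding tens_def by simp
next
 case (add f g)
 thus ?case using tens_add[OF add.IH] by (simp add: fun_at)
next
 case (mult f g)
 thus ?case using tens_mult[OF mult.IH mult_in falg.mult] by (simp add: fun_at)
qed

text \<open>The covariant \<open>g v \<mapsto> g e\<close> extends to a polynomial map, which is then averaged over the group.\<close>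

theorem exists_equivariant: assumes T: "T <= polyf s" "{rho g v |g. g : cr G} = {x. ALL f:T. f x = 0}"
 and e: "!!h. h : cr G ==> rho h v = v ==> rho h e = e" shows "EX th. eqv th & th v = e" proof -
 interpret O: orbit_alg G A "orb v ` crd ` B" "orb v ` polyf s" by (rule orbit_alg[OF T])
 interpret P: fun_alg UNIV "polyf s" by (rule fun_alg_polyf)
 have Hv: "rho h v = v" if "h : O.H" for h proof (rule crd_ext)
 fix b
 have "orb v (crd b) h = orb v (crd b) \<one>" using O.H_D(2)[OF that] linear_polyf[OF crd(1)] by blast
 thus "crd b (rho h v) = crd b v" using O.H_D(1)[OF that] by (simp add: orb_at act_one)
 qed
 have "EX F:polyf s. orb e (crd b) = orb v F" for b proof -
 have "O.inv_fun (orb e (crd b))" unfolding O.inv_fun_def using rat[OF crd(1)] e Hv O.H_D(1) by (auto simp: orb_at act_mult) (simp add: orb_def)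
 from O.inv_fun_in[OF this] show ?thesis by blast
 qed
 then obtain F where F: "!!b. F b : polyf s" "!!b. orb e (crd b) = orb v (F b)" by metis
 have Fv: "crd b (rho g e) = F b (rho g v)" if "g : cr G" for g b using fun_cong[OF F(2), of b g] that by (simp add: orb_at)
 \<comment> \<open>The b-th coordinate of the inverse of g applied to F at g x; averaging this over
   g makes F equivariant.\<close>
 define Phi where "Phi b g x = (SUM b':B. crd b (rho (inv g) b') * F b' (rho g x))" for b g x
 have m: "zcut (cr G) (%g. crd b (rho (inv g) b')) : A" for b b' proof -
 have "zcut (cr G) (%g. orb b' (crd b) (inv g)) : A" by (rule antipode) (use rat[OF crd(1)] in \<open>simp add: orb_def\<close>)
 moreover have "zcut (cr G) (%g. orb b' (crd b) (inv g)) = zcut (cr G) (%g. crd b (rho (inv g) b'))" by (rule ext) (simp add: zcut_def orb_at)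
 ultimately show ?thesis by simp
 qed
 have "tens (cr G) UNIV A (polyf s) (%g x. SUM b':B'. crd b (rho (inv g) b') * F b' (rho g x))" if "finite B'" for b B' using that
 proof (induction B' rule: finite_induct)
 case empty
 show ?case by (rule tens_simple[of 0 _ 0]) (simp_all add: zero_in P.zero_in fun_at)
 next
 case (insert c B')
 have "tens (cr G) UNIV A (polyf s) (%g x. crd b (rho (inv g) c))"
 by (rule tens_simple[OF m[of b c], of "cst UNIV 1"]) (simp_all add: P.cst_in cst_at zcut_def)
 from tens_add[OF tens_mult[OF this tens_polyf[OF F(1), of c] mult_in P.mult_in] insert.IH]
 show ?case using insert.hyps by simp
 qed
 from this[OF finB] have "tens (cr G) UNIV A (polyf s) (Phi b)" for b unfolding Phi_def .
 hence "EX n a f. (ALL i<(n::nat). a i : A & f i : polyf s) &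
 (ALL g:cr G. ALL x. Phi b g x = (SUM i<n. a i g * f i x))" for b using tens_ex[of "cr G" UNIV A "polyf s" "Phi b"] by simp
 hence "ALL b. EX n a f. (ALL i<(n::nat). a i : A & f i : polyf s) &
 (ALL g:cr G. ALL x. Phi b g x = (SUM i<n. a i g * f i x))" by (rule allI)
 then obtain n a f where "ALL b. (ALL i<(n b::nat). a b i : A & f b i : polyf s) &
 (ALL g:cr G. ALL x. Phi b g x = (SUM i<n b. a b i g * f b i x))" by (elim choice[THEN exE]) (rule that)
 hence af: "!!b i. i < (n b::nat) ==> a b i : A" "!!b i. i < n b ==> f b i : polyf s"
 "!!b g x. g : cr G ==> Phi b g x = (SUM i<n b. a b i g * f b i x)" by blast+
 \<comment> \<open>The mean lives on a finite-dimensional stable space, so the finitely many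
   coefficient functions in g are collected first, together with the constant 1.\<close>
 define D where "D = insert (cst (cr G) 1) (\<Union>b\<in>B. a b ` {..<n b})"
 have D: "finite D" "D <= A" using finB af(1) cst_in by (auto simp: D_def)
 obtain M where M: "rstable M" "fd M" "D <= M" by (rule locally_finite[OF D])
 have oM: "cst (cr G) 1 : M" using M(3) by (simp add: D_def)
 from haar[OF M(1,2) oM] obtain I where I_: "(ALL f:M. ALL h:M. I (f + h) = I f + I h) & (ALL c. ALL f:M. I (fsc c f) = c * I f) &
 I (cst (cr G) 1) = (1::'a) & (ALL g:cr G. ALL f:M. I (rt g f) = I f)" by (rule exE)
 hence I: "!!f h. f : M ==> h : M ==> I (f + h) = I f + I h" "!!c f. f : M ==> I (fsc c f) = c * I f"
 "I (cst (cr G) 1) = (1::'a)" "!!g f. g : cr G ==> f : M ==> I (rt g f) = I f" by simp_all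
 note Ms = rsD(2)[OF M(1)]
 have I0: "I 0 = 0" using I(2)[OF fs_0[OF Ms], of 0] by (simp add: fs0)
 have Isum: "I (SUM j:J. h j) = (SUM j:J. I (h j))" if "!!j. j : J ==> h j : M" for J :: "'j set" and h
 using that by (induction J rule: ifi) (simp_all add: I0 I(1) fs.subspace_sum[OF Ms])
 have Isum': "I (SUM j:J. h j) = (SUM j:J. I (h j))" if "!!j. j : J ==> h j : M" for J :: "'v set" and h
 using that by (induction J rule: ifi) (simp_all add: I0 I(1) fs.subspace_sum[OF Ms])
 have aM: "a b i : M" if "b : B" "i < n b" for b i using M(3) that by (auto simp: D_def)
 define phi where "phi b x = lc (n b) (%i. f b i x) (a b)" for b x
 have phiM: "phi b x : M" if "b : B" for b x unfolding phi_def by (rule lc_in[OF Ms aM[OF that]])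
 have phi: "phi b x g = Phi b g x" if "g : cr G" for b x g using af(3)[OF that] by (simp add: phi_def lc_at mcm)
 have Iphi: "I (phi b x) = (SUM i<n b. I (a b i) * f b i x)" if b: "b : B" for b x proof -
 have "phi b x = (SUM i<n b. fsc (f b i x) (a b i))" by (simp add: phi_def lc_def)
 moreover have "I (SUM i:J. fsc (f b i x) (a b i)) = (SUM i:J. f b i x * I (a b i))" if "J <= {..<n b}" for J
 using that aM[OF b] by (induction J rule: ifi) (simp_all add: I0 I(1,2) fs.subspace_sum[OF Ms] fs_sc[OF Ms] subset_iff)
 ultimately show ?thesis by (simp add: mcm)
 qed
 define th where "th x = (SUM b:B. s (I (phi b x)) b)" for x
 have cth: "crd b (th x) = I (phi b x)" if "b : B" for b x unfolding th_def by (rule crd_sum[OF that])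
 have "pmap s s th" unfolding pmap_def proof (intro allI impI)
 fix l assume l: "vlin s (*) l"
 then interpret l: Vector_Spaces.linear s "(*)" l .
 have "l (th x) = (SUM b:B. I (phi b x) * l b)" for x by (simp add: th_def l.sum l.scale)
 also have "... x = (SUM b:B. (SUM i<n b. I (a b i) * f b i x) * l b)" for x by (rule sum.cong) (simp_all add: Iphi)
 finally have lth: "l (th x) = (SUM b:B. (SUM i<n b. I (a b i) * f b i x) * l b)" for x .
 have "(%x. l (th x)) = (SUM b:B. SUM i<n b. fsc (I (a b i) * l b) (f b i))" by (rule ext) (simp only: lth sum_fun_at fscale_at sdl mult_ac)
 also have "... : polyf s" by (intro P.sum_in P.scale_in af(2)) simp
 finally show "(%x. l (th x)) : polyf s" .
 qed
 moreover have "th (rho h x) = rho h (th x)" if h: "h : cr G" for h x proof (rule crd_ext)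
 fix b assume b: "b : B"
 \<comment> \<open>Substituting g h for g: the integrand at h x is a right translate of the
   integrand at x, transformed by h; the invariant mean ignores the translation.\<close>
 have "phi b (rho h x) = (SUM b':B. fsc (crd b (rho h b')) (rt h (phi b' x)))" proof (rule fun_ext)
 show "phi b (rho h x) : A" using phiM[OF b] rsD(1)[OF M(1)] by blast
 show "(SUM b':B. fsc (crd b (rho h b')) (rt h (phi b' x))) : A" using phiM rsD(1)[OF M(1)] h by (auto intro!: sum_in scale_in rt_in)
 fix g assume g: "g : cr G"
 have "(SUM b':B. crd b (rho h b') * Phi b' (g \<otimes> h) x) =
 (SUM c:B. (SUM b':B. crd b (rho h b') * crd b' (rho (inv (g \<otimes> h)) c)) * F c (rho (g \<otimes> h) x))"
 unfolding Phi_def sdl sdr by (subst sum.swap) (simp add: mult.assoc)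
 also have "... = (SUM c:B. crd b (rho (inv g) c) * F c (rho (g \<otimes> h) x))" proof (rule sum.cong[OF refl])
 fix c
 have "(SUM b':B. crd b (rho h b') * crd b' (rho (inv (g \<otimes> h)) c)) = crd b (rho h (rho (inv (g \<otimes> h)) c))"
 by (simp add: crd_act[OF h, of b "rho _ c"] mcm)
 also have "... = crd b (rho (inv g) c)" using g h act_mult[of h "inv (g \<otimes> h)" c] by (simp add: inv_mult_group m_assoc[symmetric])
 finally show "(SUM b':B. crd b (rho h b') * crd b' (rho (inv (g \<otimes> h)) c)) * F c (rho (g \<otimes> h) x) =
 crd b (rho (inv g) c) * F c (rho (g \<otimes> h) x)" by simp
 qed
 finally show "phi b (rho h x) g = (SUM b':B. fsc (crd b (rho h b')) (rt h (phi b' x))) g"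
 using g h by (simp add: phi fun_at sum_fun_at rt_at) (simp add: Phi_def act_mult)
 qed
 hence "I (phi b (rho h x)) = (SUM b':B. crd b (rho h b') * I (phi b' x))"
 using Isum'[of B "%b'. fsc (crd b (rho h b')) (rt h (phi b' x))"] phiM rsD(3)[OF M(1) h] by (simp add: I(2,4) h fs_sc[OF Ms])
 also have "... = crd b (rho h (th x))" by (simp add: crd_act[OF h, of b "th x"] cth mcm)
 finally show "crd b (th (rho h x)) = crd b (rho h (th x))" by (simp add: cth[OF b])
 qed
 moreover have "th v = e" proof (rule crd_ext)
 fix b assume b: "b : B"
 \<comment> \<open>At v the integrand does not depend on g, because F at g v is g e; so averaging
   leaves the value e unchanged.\<close>
 have "phi b v = fsc (crd b e) (cst (cr G) 1)" proof (rule fun_ext)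
 show "phi b v : A" using phiM[OF b] rsD(1)[OF M(1)] by blast
 fix g assume g: "g : cr G"
 have "phi b v g = (SUM b':B. crd b' (rho g e) * crd b (rho (inv g) b'))" by (simp add: phi[OF g] Phi_def Fv[OF g, symmetric] mcm)
 also have "... = crd b (rho (inv g) (rho g e))" using crd_act[of "inv g" b "rho g e"] g by simp
 finally show "phi b v g = fsc (crd b e) (cst (cr G) 1) g" using g by (simp add: act_inv fun_at cst_at)
 qed (simp add: scale_in cst_in)
 thus "crd b (th v) = crd b e" using M(3) by (simp add: cth[OF b] I(2,3) D_def)
 qed
 ultimately show ?thesis unfolding eqv_def by blast
qed

end

section \<open>Fixed vectors of the isotropy group of a closed orbit\<close>

lemma det_nonzero_inj:
 fixes M :: "nat => nat => 'a::field" assumes "det (Matrix.mat n n (%(i, j). M i j)) ~= 0"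
 shows "ALL c. (ALL i<n. (SUM j<n. M i j * c j) = 0) --> (ALL j<n. c j = 0)" proof (intro allI impI, rule ccontr)
 let ?A = "Matrix.mat n n (%(i, j). M i j)"
 fix c j assume c: "ALL i<n. (SUM j<n. M i j * c j) = 0" and j: "j < n" "c j ~= 0"
 have "?A *\<^sub>v Matrix.vec n c = 0\<^sub>v n" by (rule eq_vecI) (use c in \<open>simp_all add: scalar_prod_def atLeast0LessThan\<close>)
 moreover have "Matrix.vec n c ~= 0\<^sub>v n" using j by (metis index_vec index_zero_vec(1))
 moreover have "?A : carrier_mat n n" by simp
 ultimately show False using assms det_0_iff_vec_prod_zero[of ?A n] by (metis vec_carrier)
qed

lemma square_solve:
 fixes M :: "nat => nat => 'a::field" assumes "ALL c. (ALL i<n. (SUM j<n. M i j * c j) = 0) --> (ALL j<n. c j = 0)"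
 shows "EX k. ALL i<n. (SUM j<n. M i j * k j) = y i" proof -
 obtain N where N: "ALL i<n. ALL k<n. (SUM j<n. M i j * N j k) = (if i = k then 1 else 0)" using square_inverse[OF assms] by blast
 have "(SUM j<n. M i j * (SUM l<n. N j l * y l)) = y i" if i: "i < n" for i proof -
 have "(SUM j<n. M i j * (SUM l<n. N j l * y l)) = (SUM l<n. (SUM j<n. M i j * N j l) * y l)" by (simp add: sdl sdr mult.assoc) (rule sum.swap)
 also have "... = (SUM l<n. y l * (if l = i then 1 else 0))" by (rule sum.cong) (use N i in auto)
 also have "... = y i" by (rule sum_mult_delta[OF i])
 finally show ?thesis .
 qed
 thus ?thesis by (intro exI[of _ "%j. SUM l<n. N j l * y l"]) simp
qed

lemma polyf_line:
 fixes f :: "'v::ab_group_add => 'a::field" assumes "f : polyf s" shows "EX p. ALL t. poly p t = f (x + s t w)" using assms unfolding polyf_def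
proof (induction rule: falg.induct)
 case (const c)
 show ?case by (rule exI[of _ "[:c:]"]) (simp add: cst_at)
next
 case (gen l)
 then interpret l: Vector_Spaces.linear s "(*)" l by simp
 show ?case by (rule exI[of _ "[:l x, l w:]"]) (simp add: l.add l.scale)
next
 case (add f g)
 then obtain p q where "ALL t. poly p t = f (x + s t w)" "ALL t. poly q t = g (x + s t w)" by blast
 thus ?case by (intro exI[of _ "p + q"]) (simp add: fun_at)
next
 case (mult f g)
 then obtain p q where "ALL t. poly p t = f (x + s t w)" "ALL t. poly q t = g (x + s t w)" by blast
 thus ?case by (intro exI[of _ "p * q"]) (simp add: fun_at)
qed

locale closed_orbit = red_module G A s B rho
 for G :: "('g, 'm) monoid_scheme" (structure) and A :: "('g => 'a::{alg_closed_field, field_char_0}) set"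
 and s :: "'a => 'v::ab_group_add => 'v" and B and rho :: "'g => 'v => 'v" +
 fixes v T assumes T: "T <= polyf s" "{rho g v |g. g : cr G} = {x. ALL f:T. f x = 0}"
begin

sublocale P: fun_alg UNIV "polyf s" by (rule fun_alg_polyf)

definition Hs :: "'g set" where "Hs = {h : cr G. rho h v = v}"

definition E :: "'v set" where "E = {x. ALL h:Hs. rho h x = x}"

lemma ED: "x : E ==> h : Hs ==> rho h x = x" by (simp add: E_def)

lemma Hs_G: "h : Hs ==> h : cr G" by (simp add: Hs_def)

lemma v_E: "v : E" by (simp add: E_def Hs_def)

lemma exists_eqv: "e : E ==> EX th. eqv th & th v = e" by (rule exists_equivariant[OF T]) (simp add: E_def Hs_def)

lemma eqv_act: "eqv th ==> g : cr G ==> th (rho g x) = rho g (th x)" by (simp add: eqv_def)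

lemma eqv_E: "eqv th ==> x : E ==> th x : E" by (auto simp: E_def Hs_G eqv_act[symmetric])

lemma eqv_id: "eqv (%x. x)" by (simp add: eqv_def pmap_def linear_polyf)

lemma eqv_comp: "eqv th ==> eqv eta ==> eqv (%x. eta (th x))" using pmap_pmap by (auto simp: eqv_def)

lemma eqv_sum: assumes "!!i. i < (n::nat) ==> eqv (th i)" shows "eqv (%x. SUM i<n. s (a i) (th i x))" unfolding eqv_def proof (intro conjI ballI allI)
 show "pmap s s (%x. SUM i<n. s (a i) (th i x))" unfolding pmap_def proof (intro allI impI)
 fix l assume l: "vlin s (*) l"
 then interpret l: Vector_Spaces.linear s "(*)" l .
 have "(%x. l (SUM i<n. s (a i) (th i x))) = (SUM i<n. fsc (a i) (%x. l (th i x)))" by (rule ext) (simp add: l.sum l.scale sum_fun_at fscale_at)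
 also have "... : polyf s" using assms l by (auto simp: eqv_def pmap_def intro!: P.sum_in P.scale_in)
 finally show "(%x. l (SUM i<n. s (a i) (th i x))) : polyf s" .
 qed
 fix g x assume g: "g : cr G"
 interpret r: Vector_Spaces.linear s s "rho g" by (rule lin[OF g])
 show "(SUM i<n. s (a i) (th i (rho g x))) = rho g (SUM i<n. s (a i) (th i x))" using assms by (simp add: r.sum r.scale eqv_act g)
qed

lemma subspace_E: "vs.subspace E" unfolding vs.subspace_def proof (intro conjI ballI allI)
 have r: "vlin s s (rho h)" if "h : Hs" for h using lin Hs_G that by blast
 show "0 : E" using r unfolding E_def vli by (auto, metis vs.scale_zero_left)
 show "x + y : E" if "x : E" "y : E" for x y using that r unfolding E_def vli by auto
 show "s c x : E" if "x : E" for x c using that r unfolding E_def vli by auto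
qed

text \<open>The coordinate functionals are taken from a basis of the whole module extending one of
  E, so they are linear forms on V and may be composed with polynomial maps of V.\<close>

lemma E_basis:
 obtains n e c where "!!i. i < (n::nat) ==> e i : E" "!!i. vlin s (*) (c i)"
 "!!i j. i < n ==> j < n ==> c i (e j) = (if i = j then 1 else 0)" "!!x. x : E ==> (SUM i<n. s (c i x) (e i)) = x" proof -
 obtain BE where BE: "BE <= E" "vs.independent BE" "E <= vs.span BE" by (rule vs.maximal_independent_subset)
 have fin: "finite BE" using vs.finiteI_independent[OF BE(2)] .
 let ?B = "vs.extend_basis BE"
 have B: "vs.independent ?B" "BE <= ?B" "vs.span ?B = UNIV"
 using vs.independent_extend_basis[OF BE(2)] vs.extend_basis_superset[OF BE(2)] vs.span_extend_basis[OF BE(2)] by auto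
 obtain e where e: "bij_betw e {0..<card BE} BE" using ex_bij_betw_nat_finite[OF fin] by blast
 have eB: "e i : BE" if "i < card BE" for i using bij_betwE[OF e] that by simp
 have ein: "e i = e j \<longleftrightarrow> i = j" if "i < card BE" "j < card BE" for i j
 using bij_betw_imp_inj_on[OF e] that by (auto simp: inj_on_def)
 show ?thesis proof (rule that[of "card BE" e "%i x. vs.representation ?B x (e i)"])
 show "e i : E" if "i < card BE" for i using eB[OF that] BE(1) by blast
 have "vector_space ((*) :: 'a => 'a => 'a)" by unfold_locales (simp_all add: als)
 thus "vlin s (*) (%x. vs.representation ?B x (e i))" for i unfolding vli using vs.vector_space_axioms B
 by (simp add: vs.representation_add vs.representation_scale)
 show "vs.representation ?B (e j) (e i) = (if i = j then 1 else 0)" if "i < card BE" "j < card BE" for i j proof -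
 have "e j : ?B" using eB[OF that(2)] B(2) by blast
 thus ?thesis using vs.representation_basis[OF B(1)] ein[OF that] by simp
 qed
 fix x assume "x : E"
 hence x: "x : vs.span BE" using BE(3) by blast
 have "(SUM i<card BE. s (vs.representation ?B x (e i)) (e i)) = (SUM b:BE. s (vs.representation ?B x b) b)"
 using sum.reindex_bij_betw[OF e, of "%b. s (vs.representation ?B x b) b"] by (simp add: atLeast0LessThan)
 also have "... = x" unfolding vs.representation_extend[OF B(1) x B(2)] by (rule vs.sum_representation_eq[OF BE(2) x fin]) simp
 finally show "(SUM i<card BE. s (vs.representation ?B x (e i)) (e i)) = x" .
 qed
qed

text \<open>An equivariant map can only enlarge stabilizers, so the stabilizer of a good point is
  contained in \<open>Hs\<close>; the same map also pulls back the equations of the closed orbit of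
  v.\<close>

definition good :: "'v => bool" where "good z \<longleftrightarrow> (EX th. eqv th & th z = v)"

lemma good_v: "good v" using eqv_id by (auto simp: good_def)

lemma good_stab: "good z ==> g : cr G ==> rho g z = z ==> g : Hs" using eqv_act unfolding good_def Hs_def by (metis (mono_tags) mCe)

text \<open>That g z is fixed by \<open>Hs\<close> puts the conjugates by the inverse of g into the
  stabilizer of the good point z, hence into \<open>Hs\<close>. The opposite inclusion comes from
  dimension: g maps E into itself, so onto itself, and the preimage of v is again fixed.\<close>

lemma conj_in_Hs: assumes z: "z : E" "good z" and g: "g : cr G" "rho g z : E"
 shows "h : Hs ==> inv g \<otimes> h \<otimes> g : Hs" "rho (inv g) v : E" "h : Hs ==> g \<otimes> h \<otimes> inv g : Hs"
 "good (rho g z)" "x : E ==> rho g x : E" proof -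
 show c: "inv g \<otimes> h \<otimes> g : Hs" if h: "h : Hs" for h proof (rule good_stab[OF z(2)])
 have "rho (inv g \<otimes> h \<otimes> g) z = rho (inv g) (rho h (rho g z))" using g(1) Hs_G[OF h] by (simp add: act_mult)
 thus "rho (inv g \<otimes> h \<otimes> g) z = z" using ED[OF g(2) h] g(1) by (simp add: act_inv)
 qed (use g(1) Hs_G[OF h] in simp)
 show gE: "rho g x : E" if x: "x : E" for x unfolding E_def proof (intro CollectI ballI)
 fix h assume h: "h : Hs"
 have "rho h (rho g x) = rho g (rho (inv g \<otimes> h \<otimes> g) x)" using g(1) Hs_G[OF h] by (simp add: act_mult act_inv)
 thus "rho h (rho g x) = rho g x" using ED[OF x c[OF h]] by simp
 qed
 obtain n e c where e: "!!i. i < (n::nat) ==> e i : E" "!!i. vlin s (*) (c i)"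
 "!!i j. i < n ==> j < n ==> c i (e j) = (if i = j then 1 else 0)" "!!x. x : E ==> (SUM i<n. s (c i x) (e i)) = x"
 by (rule E_basis) (rule that; assumption)
 interpret r: Vector_Spaces.linear s s "rho g" by (rule lin[OF g(1)])
 have cs: "c i (rho g (SUM j<n. s (k j) (e j))) = (SUM j<n. c i (rho g (e j)) * k j)" for i k proof -
 interpret l: Vector_Spaces.linear s "(*)" "c i" by (rule e(2))
 show ?thesis by (simp add: r.sum r.scale l.sum l.scale mcm)
 qed
 have inE: "(SUM j<n. s (k j) (e j)) : E" for k by (rule vs.subspace_sum[OF subspace_E], rule vs.subspace_scale[OF subspace_E], rule e(1)) simp
 \<comment> \<open>The map given by g on E is injective, hence its square matrix can be solved for
   the coordinates of v.\<close>
 have "EX k. ALL i<n. (SUM j<n. c i (rho g (e j)) * k j) = c i v" proof (rule square_solve, intro allI impI)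
 fix k j assume k: "ALL i<n. (SUM j<n. c i (rho g (e j)) * k j) = 0" and j: "j < n"
 let ?x = "SUM j<n. s (k j) (e j)"
 have "rho g ?x = (SUM i<n. s (c i (rho g ?x)) (e i))" using e(4)[OF gE[OF inE]] by simp
 also have "... = 0" using k by (simp add: cs)
 finally have "?x = rho (inv g) 0" using act_inv(1)[OF g(1), of ?x] by simp
 hence x0: "?x = 0" using lin[of "inv g"] g(1) unfolding vli by (metis inv_closed vs.scale_zero_left)
 interpret l: Vector_Spaces.linear s "(*)" "c j" by (rule e(2))
 have "c j ?x = (SUM i<n. k i * (if i = j then 1 else 0))" by (simp only: l.sum l.scale) (rule sum.cong, use e(3) j in auto)
 thus "k j = 0" unfolding sum_mult_delta[OF j] x0 by (simp add: l.zero)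
 qed
 then obtain k where k: "ALL i<n. (SUM j<n. c i (rho g (e j)) * k j) = c i v" by blast
 let ?x = "SUM j<n. s (k j) (e j)"
 have "rho g ?x = (SUM i<n. s (c i (rho g ?x)) (e i))" using e(4)[OF gE[OF inE]] by simp
 also have "... = v" using k e(4)[OF v_E] by (simp add: cs)
 finally show vE: "rho (inv g) v : E" using act_inv(1)[OF g(1), of ?x] inE[of k] by simp
 show "g \<otimes> h \<otimes> inv g : Hs" if h: "h : Hs" for h using ED[OF vE h] g(1) Hs_G[OF h] by (simp add: Hs_def act_mult act_inv)
 obtain mu where mu: "eqv mu" "mu v = rho (inv g) v" using exists_eqv[OF vE] by blast
 obtain psi where psi: "eqv psi" "psi z = v" using z(2) good_def by blast
 show "good (rho g z)" unfolding good_def by (rule exI[of _ "%x. mu (psi x)"], rule conjI, rule eqv_comp[OF psi(1) mu(1)])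
 (simp add: eqv_act[OF psi(1) g(1)] eqv_act[OF mu(1) g(1)] psi(2) mu(2) act_inv g(1))
qed

lemma polyf_prod: "(!!i. i : I ==> f i : polyf s) ==> (PROD i:I. f i) : polyf s" proof (induction I rule: ifi)
 have "(1 :: 'v => 'a) = cst UNIV 1" by (rule ext) (simp add: cst_at one_fun_apply)
 hence one: "(1 :: 'v => 'a) : polyf s" using P.cst_in by metis
 show "(PROD i:I. f i) : polyf s" if "infinite I" for I :: "'b set" using that one by simp
 show "(PROD i:{}. f i) : polyf s" using one by simp
qed (simp add: P.mult_in)

lemma prod_fun_at: "(PROD i:I. f i) x = (PROD i:I. f i x :: 'a)" by (induction I rule: ifi) (simp_all add: one_fun_apply times_fun_apply)

text \<open>For n equivariant maps, n being the dimension of E, the determinant of the coordinates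
  of their values is nonzero when these values span E; then a combination of the maps sends z to v.
  Conversely, a map sending z to v, followed by maps sending v to the basis vectors, gives the
  identity matrix.\<close>

lemma good_open:
 obtains D where "D <= polyf s" "!!z. z : E ==> good z \<longleftrightarrow> (EX t:D. t z ~= 0)" proof -
 obtain n e c where e: "!!i. i < (n::nat) ==> e i : E" "!!i. vlin s (*) (c i)"
 "!!i j. i < n ==> j < n ==> c i (e j) = (if i = j then 1 else 0)" "!!x. x : E ==> (SUM i<n. s (c i x) (e i)) = x"
 by (rule E_basis) (rule that; assumption)
 define t where "t th z = det (Matrix.mat n n (%(i, j). c i (th j z)))" for th :: "nat => 'v => 'v" and z
 show ?thesis proof (rule that[of "t ` {th. ALL j<n. eqv (th j)}"])
 show "t ` {th. ALL j<n. eqv (th j)} <= polyf s" proof clarify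
 fix th assume th: "ALL j<n. eqv (th j)"
 have "t th = (SUM p:{p. p permutes {0..<n}}. fsc (signof p) (PROD i:{0..<n}. (%z. c i (th (p i) z))))" proof (rule ext)
 fix z
 have "t th z = (SUM p:{p. p permutes {0..<n}}. signof p * (PROD i:{0..<n}. c i (th (p i) z)))"
 unfolding t_def det_def by (auto intro!: sum.cong prod.cong simp: permutes_in_image[of _ "{0..<n}", simplified])
 thus "t th z = (SUM p:{p. p permutes {0..<n}}. fsc (signof p) (PROD i:{0..<n}. (%z. c i (th (p i) z)))) z"
 by (simp add: sum_fun_at fscale_at prod_fun_at)
 qed
 also have "... : polyf s" proof (rule P.sum_in, rule P.scale_in, rule polyf_prod)
 fix p i assume "p : {p. p permutes {0..<n}}" "i : {0..<n}"
 hence "p i < n" using permutes_in_image by fastforce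
 thus "(%z. c i (th (p i) z)) : polyf s" using th e(2) by (auto simp: eqv_def pmap_def)
 qed
 finally show "t th : polyf s" .
 qed
 fix z assume z: "z : E"
 show "good z \<longleftrightarrow> (EX t:t ` {th. ALL j<n. eqv (th j)}. t z ~= 0)" proof
 assume "good z"
 then obtain psi where psi: "eqv psi" "psi z = v" unfolding good_def by blast
 have "ALL j. EX th. j < n --> eqv th & th v = e j" using exists_eqv[OF e(1)] by blast
 then obtain th where th: "!!j. j < n ==> eqv (th j)" "!!j. j < n ==> th j v = e j" by metis
 have "Matrix.mat n n (%(i, j). c i (th j (psi z))) = 1\<^sub>m n" by (rule eq_matI) (simp_all add: psi(2) th(2) e(3))
 hence "t (%j x. th j (psi x)) z ~= 0" by (simp add: t_def)
 thus "EX t:t ` {th. ALL j<n. eqv (th j)}. t z ~= 0" using eqv_comp[OF psi(1) th(1)] by blast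
 next
 assume "EX t:t ` {th. ALL j<n. eqv (th j)}. t z ~= 0"
 then obtain th where th: "ALL j<n. eqv (th j)" "t th z ~= 0" by blast
 obtain k where k: "ALL i<n. (SUM j<n. c i (th j z) * k j) = c i v"
 using square_solve[OF det_nonzero_inj[OF th(2)[unfolded t_def]], of "%i. c i v"] by blast
 define psi where "psi x = (SUM j<n. s (k j) (th j x))" for x
 have psi: "eqv psi" unfolding psi_def by (rule eqv_sum) (use th(1) in blast)
 have "c i (psi z) = c i v" if "i < n" for i proof -
 interpret l: Vector_Spaces.linear s "(*)" "c i" by (rule e(2))
 show ?thesis using k that by (simp add: psi_def l.sum l.scale mcm)
 qed
 hence "(SUM i<n. s (c i (psi z)) (e i)) = (SUM i<n. s (c i v) (e i))" by simp
 hence "psi z = v" using e(4)[OF eqv_E[OF psi z]] e(4)[OF v_E] by simp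
 thus "good z" using psi good_def by blast
 qed
 qed
qed

end

section \<open>Closed sets swept out by lines\<close>

lemma poly_zero_infinite: "infinite {t. poly p t = 0} ==> p = (0 :: 'a::idom poly)" using poly_roots_finite by blast

lemma polyf_shift: assumes "f : polyf s" shows "(%x. f (x + w)) : polyf s" proof (rule pmap_comp[OF _ assms])
 show "pmap s s (%x. x + w)" unfolding pmap_def proof (intro allI impI)
 fix l assume l: "vlin s (*) l"
 then interpret l: Vector_Spaces.linear s "(*)" l .
 have "(%x. l (x + w)) = l + cst UNIV (l w)" by (rule ext) (simp add: l.add cst_at fun_at)
 thus "(%x. l (x + w)) : polyf s" using fun_alg.add_in[OF fun_alg_polyf linear_polyf[OF l] fun_alg.cst_in[OF fun_alg_polyf]] by simp
 qed
qed

text \<open>Points outside A and B are joined by a line inside Z, on which the two separating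
  functions are nonzero polynomials in t and hence simultaneously nonzero somewhere.\<close>

lemma irreducible_linear:
 fixes s :: "'a::{alg_closed_field, field_char_0} => 'v::ab_group_add => 'v"
 assumes s: "vector_space s" and Z: "Z ~= {}" "!!a b t. a : Z ==> b : Z ==> a + s t (b - a) : Z"
 shows "irreducible_closed (zariski Z (linear_ring s Z)) Z" unfolding irreducible_closed_def proof (intro conjI allI impI)
 show "closedin (zariski Z (linear_ring s Z)) Z" unfolding closedin_lr by (rule exI[of _ "{}"]) simp
 fix A B assume AB: "closedin (zariski Z (linear_ring s Z)) A & closedin (zariski Z (linear_ring s Z)) B & Z <= A Un B"
 then obtain TA TB where T: "TA <= polyf s" "A = {x : Z. ALL f:TA. f x = 0}" "TB <= polyf s" "B = {x : Z. ALL f:TB. f x = 0}"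
 unfolding closedin_lr by blast
 show "Z <= A \<or> Z <= B" proof (rule ccontr)
 assume "\<not> (Z <= A \<or> Z <= B)"
 then obtain a b f g where ab: "a : Z" "b : Z" "f : TA" "f a ~= 0" "g : TB" "g b ~= 0" using T by blast
 obtain p q where pq: "ALL t. poly p t = f (a + s t (b - a))" "ALL t. poly q t = g (a + s t (b - a))"
 using polyf_line ab(3,5) T(1,3) by (metis subsetD)
 interpret vector_space s by (rule s)
 have "poly p 0 ~= 0" "poly q 1 ~= 0" using pq ab(4,6) by (simp_all add: scale_one)
 hence "p * q ~= 0" by auto
 then obtain t where "poly (p * q) t ~= 0" using poly_all_0_iff_0 by blast
 hence "f (a + s t (b - a)) ~= 0" "g (a + s t (b - a)) ~= 0" using pq by auto
 thus False using AB Z(2)[OF ab(1,2), of t] ab(3,5) unfolding T(2,4) by blast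
 qed
qed (use Z in simp)

text \<open>The Zariski closure in Z of the union of the lines through points of Y in direction w,
  when these lines lie in Z.\<close>

definition sweep :: "('a::field => 'v::ab_group_add => 'v) => 'v set => 'v set => 'v => 'v set" where
 "sweep s Z Y w = {x : Z. ALL f:polyf s. (ALL y:Y. ALL t. f (y + s t w) = 0) --> f x = 0}"

text \<open>For each t, irreducibility of Y puts its translate by t w into A or into B. One of the
  two receives infinitely many t, and then all t, because the equations are polynomial in t.\<close>

lemma irreducible_sweep:
 fixes s :: "'a::{alg_closed_field, field_char_0} => 'v::ab_group_add => 'v"
 assumes Z: "!!a t. a : Z ==> a + s t w : Z" and Y: "irreducible_closed (zariski Z (linear_ring s Z)) Y" "Y <= Z"
 shows "irreducible_closed (zariski Z (linear_ring s Z)) (sweep s Z Y w)" unfolding irreducible_closed_def proof (intro conjI allI impI)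
 have in_sweep: "y + s t w : sweep s Z Y w" if "y : Y" for y t using Z Y(2) that by (auto simp: sweep_def)
 show "closedin (zariski Z (linear_ring s Z)) (sweep s Z Y w)" unfolding closedin_lr
 by (rule exI[of _ "{f : polyf s. ALL y:Y. ALL t. f (y + s t w) = 0}"]) (auto simp: sweep_def)
 show "sweep s Z Y w ~= {}" using in_sweep Y(1) by (auto simp: irreducible_closed_def)
 fix A B assume AB: "closedin (zariski Z (linear_ring s Z)) A & closedin (zariski Z (linear_ring s Z)) B & sweep s Z Y w <= A Un B"
 have shift: "closedin (zariski Z (linear_ring s Z)) {y : Z. y + s t w : C}"
 if C: "closedin (zariski Z (linear_ring s Z)) C" for C t proof -
 obtain T where T: "T <= polyf s" "C = {x : Z. ALL f:T. f x = 0}" using C unfolding closedin_lr by blast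
 have "{y : Z. y + s t w : C} = {x : Z. ALL f:(%f x. f (x + s t w)) ` T. f x = 0}" using Z by (auto simp: T(2))
 moreover have "(%f x. f (x + s t w)) ` T <= polyf s" using T(1) polyf_shift by blast
 ultimately show ?thesis unfolding closedin_lr by blast
 qed
 have all: "sweep s Z Y w <= C"
 if C: "closedin (zariski Z (linear_ring s Z)) C" and inf: "infinite {t. Y <= {y : Z. y + s t w : C}}" for C proof -
 obtain T where T: "T <= polyf s" "C = {x : Z. ALL f:T. f x = 0}" using C unfolding closedin_lr by blast
 have "f (y + s t w) = 0" if f: "f : T" and y: "y : Y" for f y t proof -
 obtain p where p: "ALL t. poly p t = f (y + s t w)" using polyf_line f T(1) by (metis subsetD)
 have "{t. Y <= {y : Z. y + s t w : C}} <= {t. poly p t = 0}" using p f y by (auto simp: T(2))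
 hence "p = 0" using inf by (intro poly_zero_infinite) (rule infinite_super)
 thus ?thesis using p by simp
 qed
 thus ?thesis using T(1) by (auto simp: sweep_def T(2))
 qed
 have "Y <= {y : Z. y + s t w : A} \<or> Y <= {y : Z. y + s t w : B}" for t proof -
 have "Y <= {y : Z. y + s t w : A} Un {y : Z. y + s t w : B}" using in_sweep AB Y(2) by blast
 thus ?thesis using Y(1) shift[of A t] shift[of B t] AB unfolding irreducible_closed_def by blast
 qed
 hence eq: "UNIV = {t. Y <= {y : Z. y + s t w : A}} Un {t. Y <= {y : Z. y + s t w : B}}" by blast
 hence "infinite {t. Y <= {y : Z. y + s t w : A}} \<or> infinite {t. Y <= {y : Z. y + s t w : B}}"
 using alg_closed_infinite[where 'a = 'a] unfolding eq by simp
 thus "sweep s Z Y w <= A \<or> sweep s Z Y w <= B" using all AB by blast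
qed

lemma codim_ge_2: assumes "!!Y. irreducible_closed T Y ==> Y <= C ==>
 EX Y1 Y2. irreducible_closed T Y1 & irreducible_closed T Y2 & Y < Y1 & Y1 < Y2" shows "codim T C >= 2" unfolding codim_def proof (rule INF_greatest)
 fix Y assume "Y : {Y. irreducible_closed T Y & Y <= C}"
 hence Y: "irreducible_closed T Y" "Y <= C" by auto
 obtain Y1 Y2 where Y12: "irreducible_closed T Y1" "irreducible_closed T Y2" "Y < Y1" "Y1 < Y2" using assms[OF Y] by blast
 have "enat 2 <= codim_irreducible T Y" unfolding codim_irreducible_def
 proof (rule SUP_upper, rule CollectI, rule exI[of _ "%i::nat. if i = 0 then Y else if i = 1 then Y1 else Y2"])
 show "(if (0::nat) = 0 then Y else if (0::nat) = 1 then Y1 else Y2) = Y &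
 (ALL i<=2. irreducible_closed T (if i = 0 then Y else if i = 1 then Y1 else Y2)) &
 (ALL i<2. (if i = 0 then Y else if i = 1 then Y1 else Y2) < (if Suc i = 0 then Y else if Suc i = 1 then Y1 else Y2))"
 using Y(1) Y12 by (auto simp: less_2_cases_iff)
 qed
 thus "2 <= codim_irreducible T Y" by (simp add: numeral_eq_enat)
qed

lemma generated_algebra_mono: assumes "!!f. f : S ==> restrict f X : generated_algebra X S'" shows "generated_algebra X S <= generated_algebra X S'"
proof
 fix f assume "f : generated_algebra X S"
 thus "f : generated_algebra X S'" proof (induction rule: generated_algebra.induct)
 case (const c)
 show ?case by (rule ga_const)
 next
 case (generator f)
 thus ?case by (rule assms)
 next
 case (add f g)
 show ?case by (rule generated_algebra.add[OF add.IH])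
 next
 case (mult f g)
 show ?case by (rule generated_algebra.mult[OF mult.IH])
 qed
qed

lemma generated_algebra_sum: assumes "finite I" "!!i. i : I ==> restrict (f i) X : generated_algebra X S"
 shows "(\<lambda>x\<in>X. SUM i:I. c i * f i x) : generated_algebra X S" using assms proof (induction I rule: finite_induct)
 case empty
 show ?case unfolding sum.empty by (rule ga_const)
next
 case (insert i I)
 have "(\<lambda>x\<in>X. (\<lambda>x\<in>X. (\<lambda>x\<in>X. c i) x * restrict (f i) X x) x + (\<lambda>x\<in>X. SUM i:I. c i * f i x) x) : generated_algebra X S"
 using insert by (intro generated_algebra.add generated_algebra.mult ga_const) auto
 moreover have "(\<lambda>x\<in>X. (\<lambda>x\<in>X. (\<lambda>x\<in>X. c i) x * restrict (f i) X x) x + (\<lambda>x\<in>X. SUM i:I. c i * f i x) x) =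
 (\<lambda>x\<in>X. SUM i:insert i I. c i * f i x)" using insert.hyps by (auto simp: restrict_def)
 ultimately show ?case by (simp only:)
qed

section \<open>Tuples of fixed vectors\<close>

lemma ps_at: "vec_nth (power_scale s c x) i = s c (vec_nth x i)" by (simp add: power_scale_def)

lemma pa_at: "vec_nth (power_action rho g x) i = rho g (vec_nth x i)" by (simp add: power_action_def)

context closed_orbit
begin

lemma vector_space_power: "vector_space (power_scale s :: 'a => 'v ^ 'n::finite => 'v ^ 'n)"
 by unfold_locales (simp_all add: vei ps_at vs.scale_right_distrib vs.scale_left_distrib)

lemma linear_proj: "vlin (power_scale s :: 'a => 'v ^ 'n::finite => 'v ^ 'n) s (%z. vec_nth z i)"
 unfolding vli using vector_space_power vs.vector_space_axioms by (simp add: ps_at)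

lemma polyf_proj: "f : polyf s ==> (%z. f (vec_nth z i)) : polyf (power_scale s :: 'a => 'v ^ 'n::finite => 'v ^ 'n)"
 by (rule pmap_comp[OF linear_pmap[OF linear_proj]])

definition tuples :: "('v ^ 'n::finite) set" where
 "tuples = {z. ALL i. vec_nth z i : E}"

lemma fixed_tuples: "fixed_vectors (power_action rho) Hs = (tuples :: ('v ^ 'n::finite) set)"
 by (auto simp: fixed_vectors_def tuples_def E_def vei pa_at)

lemma tuplesD: "z : tuples ==> vec_nth z i : E" by (simp add: tuples_def)

text \<open>The orbit is a graph over the closed orbit of v: if psi takes component i to v and
  \<open>mu j\<close> takes v to component j, then x lies on the orbit of z precisely when psi of
  its i-th component is on the orbit of v and the maps \<open>mu j\<close> return all components of
  x.\<close>

lemma closed_tuple_orbit: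
 fixes z :: "'v ^ 'n::finite" assumes z: "z : tuples" "good (vec_nth z i)"
 shows "EX TT<=polyf (power_scale s). orbit G (power_action rho) z = {x. ALL f:TT. f x = 0}"
 "stabilizer G (power_action rho) z = Hs" proof -
 let ?P = "polyf (power_scale s :: 'a => 'v ^ 'n => 'v ^ 'n)"
 obtain psi where psi: "eqv psi" "psi (vec_nth z i) = v" using z(2) good_def by blast
 have "ALL j. EX mu. eqv mu & mu v = vec_nth z j" using exists_eqv[OF tuplesD[OF z(1)]] by blast
 then obtain mu where mu: "!!j. eqv (mu j)" "!!j. mu j v = vec_nth z j" by metis
 define TT where "TT = (%f x. f (psi (vec_nth x i))) ` T Un
 {(%x. crd b (mu j (psi (vec_nth x i)))) - (%x. crd b (vec_nth x j)) |b j. b : B}"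
 have "TT <= ?P" proof -
 have pm: "(%x. f (th (vec_nth x i))) : ?P" if "f : polyf s" "eqv th" for f th using polyf_proj[OF pmap_comp[of s s th f]] that by (simp add: eqv_def)
 thus ?thesis unfolding TT_def using pm[OF subsetD[OF T(1)] psi(1)] pm[OF linear_polyf[OF crd(1)] eqv_comp[OF psi(1) mu(1)]]
 polyf_proj[OF linear_polyf[OF crd(1)]] by (auto intro!: fun_alg.diff_in[OF fun_alg_polyf])
 qed
 moreover have "orbit G (power_action rho) z = {x. ALL f:TT. f x = 0}" proof (intro equalityI subsetI CollectI ballI)
 fix x f assume "x : orbit G (power_action rho) z" and f: "f : TT"
 then obtain g where g: "g : cr G" "x = power_action rho g z" unfolding orbit_def by blast
 have "psi (vec_nth x i) = rho g v" by (simp add: g(2) pa_at eqv_act[OF psi(1) g(1)] psi(2))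
 moreover have "ALL f:T. f (rho g v) = 0" using T(2) g(1) by blast
 ultimately show "f x = 0" using f by (auto simp: TT_def fun_at eqv_act[OF mu(1) g(1)] mu(2) g(2) pa_at)
 next
 fix x assume "x : {x. ALL f:TT. f x = 0}"
 hence x: "!!f. f : TT ==> f x = 0" by blast
 have "psi (vec_nth x i) : {x. ALL f:T. f x = 0}" using x[of "%x. _ (psi (vec_nth x i))"] by (auto simp: TT_def)
 then obtain g where g: "g : cr G" "psi (vec_nth x i) = rho g v" using T(2) by blast
 have "vec_nth x j = rho g (vec_nth z j)" for j proof (rule crd_ext)
 fix b assume "b : B"
 hence "((%x. crd b (mu j (psi (vec_nth x i)))) - (%x. crd b (vec_nth x j))) x = 0" by (intro x) (auto simp: TT_def)
 thus "crd b (vec_nth x j) = crd b (rho g (vec_nth z j))" by (simp add: fun_at g(2) eqv_act[OF mu(1) g(1)] mu(2))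
 qed
 hence "x = power_action rho g z" by (simp add: vei pa_at)
 thus "x : orbit G (power_action rho) z" using g(1) unfolding orbit_def by blast
 qed
 ultimately show "EX TT<=?P. orbit G (power_action rho) z = {x. ALL f:TT. f x = 0}" by blast
 show "stabilizer G (power_action rho) z = Hs"
 unfolding stabilizer_def using good_stab[OF z(2)] Hs_G ED[OF tuplesD[OF z(1)]] by (auto simp: vei pa_at)
qed

text \<open>Coordinates are indexed by pairs of a basis vector of E and a component; the bijection h
  renumbers them by natural numbers. The image is the whole affine space, hence closed.\<close>

lemma affine_tuples:
 "affine_variety (tuples :: ('v ^ 'n::finite) set) (linear_ring (power_scale s) tuples)" proof -
 let ?Z = "tuples :: ('v ^ 'n) set" and ?L = "{l. vlin (power_scale s :: 'a => 'v ^ 'n => 'v ^ 'n) (*) l}"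
 obtain n e c where e: "!!i. i < (n::nat) ==> e i : E" "!!i. vlin s (*) (c i)"
 "!!i j. i < n ==> j < n ==> c i (e j) = (if i = j then 1 else 0)" "!!x. x : E ==> (SUM i<n. s (c i x) (e i)) = x"
 by (rule E_basis) (rule that; assumption)
 define D where "D = {..<n} \<times> (UNIV :: 'n set)"
 have D: "finite D" by (simp add: D_def)
 obtain h where h: "bij_betw h {0..<card D} D" using ex_bij_betw_nat_finite[OF D] by blast
 have h': "bij_betw h {..<card D} D" using h by (simp add: atLeast0LessThan)
 define c' where "c' k z = c (fst (h k)) (vec_nth z (snd (h k)))" for k and z :: "'v ^ 'n"
 define w where "w d = (vec_lambda (%i. if i = snd d then e (fst d) else 0) :: 'v ^ 'n)" for d
 have E0: "0 : E" by (rule vs.subspace_0[OF subspace_E])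
 interpret ps: vector_space "power_scale s :: 'a => 'v ^ 'n => 'v ^ 'n" by (rule vector_space_power)
 have lam: "vec_nth (SUM d:D. power_scale s (p d) (w d)) i = (SUM j<n. s (p (j, i)) (e j))" for p i proof -
 have "vec_nth (SUM d:D. power_scale s (p d) (w d)) i = (SUM d:D. s (p d) (vec_nth (w d) i))" by (simp add: ps_at)
 also have "... = (SUM j<n. SUM i':UNIV. s (p (j, i')) (vec_nth (w (j, i')) i))" unfolding D_def by (simp add: sum.cartesian_product)
 also have "... = (SUM j<n. s (p (j, i)) (e j))" proof (rule sum.cong[OF refl])
 fix j
 have "(SUM i':UNIV. s (p (j, i')) (vec_nth (w (j, i')) i)) = (SUM i':UNIV. if i' = i then s (p (j, i')) (e j) else 0)"
 by (rule sum.cong) (auto simp: w_def)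
 thus "(SUM i':UNIV. s (p (j, i')) (vec_nth (w (j, i')) i)) = s (p (j, i)) (e j)" by simp
 qed
 finally show ?thesis .
 qed
 have expand: "z = (SUM d:D. power_scale s (c (fst d) (vec_nth z (snd d))) (w d))" if "z : ?Z" for z
 unfolding vei lam using e(4)[OF tuplesD[OF that]] by simp
 have lin_c': "vlin (power_scale s) (*) (c' k)" for k using Vector_Spaces.linear_compose[OF linear_proj e(2)] by (simp add: c'_def[abs_def] o_def)
 have R: "linear_ring (power_scale s) ?Z = generated_algebra ?Z (c' ` {..<card D})" unfolding linear_ring_def proof
 show "generated_algebra ?Z (c' ` {..<card D}) <= generated_algebra ?Z ?L"
 by (rule generated_algebra_mono) (auto intro!: generated_algebra.generator lin_c')
 show "generated_algebra ?Z ?L <= generated_algebra ?Z (c' ` {..<card D})" proof (rule generated_algebra_mono)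
 fix l assume "l : ?L"
 then interpret l: Vector_Spaces.linear "power_scale s" "(*)" l by simp
 have "l z = (SUM k:{..<card D}. l (w (h k)) * c' k z)" if z: "z : ?Z" for z proof -
 have "l z = l (SUM d:D. power_scale s (c (fst d) (vec_nth z (snd d))) (w d))" using expand[OF z] by simp
 also have "... = (SUM d:D. l (w d) * c (fst d) (vec_nth z (snd d)))" by (simp add: l.sum l.scale mcm)
 also have "... = (SUM k:{..<card D}. l (w (h k)) * c' k z)" unfolding c'_def by (rule sum.reindex_bij_betw[OF h', symmetric])
 finally show ?thesis .
 qed
 hence "restrict l ?Z = (\<lambda>z\<in>?Z. SUM k:{..<card D}. l (w (h k)) * c' k z)" by (auto simp: restrict_def)
 moreover have "(\<lambda>z\<in>?Z. SUM k:{..<card D}. l (w (h k)) * c' k z) : generated_algebra ?Z (c' ` {..<card D})"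
 by (rule generated_algebra_sum) (auto intro!: generated_algebra.generator)
 ultimately show "restrict l ?Z : generated_algebra ?Z (c' ` {..<card D})" by (simp only:)
 qed
 qed
 have inj: "inj_on (%x. \<lambda>i\<in>{..<card D}. c' i x) ?Z" proof (rule inj_onI)
 fix x y assume x: "x : ?Z" and y: "y : ?Z" and eq: "(\<lambda>i\<in>{..<card D}. c' i x) = (\<lambda>i\<in>{..<card D}. c' i y)"
 have "c (fst d) (vec_nth x (snd d)) = c (fst d) (vec_nth y (snd d))" if "d : D" for d proof -
 have "d : h ` {..<card D}" using h' that by (simp add: bij_betw_def)
 then obtain k where k: "k < card D" "d = h k" by auto
 thus ?thesis using fun_cong[OF eq, of k] by (simp add: c'_def)
 qed
 hence "(SUM d:D. power_scale s (c (fst d) (vec_nth x (snd d))) (w d)) =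
 (SUM d:D. power_scale s (c (fst d) (vec_nth y (snd d))) (w d))" by simp
 thus "x = y" using expand[OF x] expand[OF y] by simp
 qed
 have "(%x. \<lambda>i\<in>{..<card D}. c' i x) ` ?Z = affine_space (card D)" proof (intro equalityI subsetI)
 fix p :: "nat => 'a" assume p: "p : affine_space (card D)"
 define k where "k = inv_into {..<card D} h"
 have k: "k (h i) = i" if "i < card D" for i unfolding k_def using h' that by (simp add: bij_betw_inv_into_left)
 let ?z = "SUM d:D. power_scale s (p (k d)) (w d)"
 have "vec_nth ?z i : E" for i unfolding lam by (rule vs.subspace_sum[OF subspace_E], rule vs.subspace_scale[OF subspace_E], rule e(1)) simp
 hence "?z : ?Z" by (simp only: tuples_def mCe) simp
 moreover have "c' i ?z = p i" if i: "i < card D" for i proof -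
 obtain a b where ab: "h i = (a, b)" by (cases "h i")
 hence a: "a < n" using bij_betwE[OF h'] i by (force simp: D_def)
 interpret l: Vector_Spaces.linear s "(*)" "c a" by (rule e(2))
 have "c' i ?z = (SUM j<n. p (k (j, b)) * c a (e j))" unfolding c'_def ab fst_conv snd_conv lam by (simp add: l.sum l.scale)
 also have "... = (SUM j<n. p (k (j, b)) * (if j = a then 1 else 0))" by (rule sum.cong) (use e(3) a in auto)
 also have "... = p (k (a, b))" by (rule sum_mult_delta[OF a])
 finally show ?thesis using k[OF i] ab by simp
 qed
 hence "p = (\<lambda>i\<in>{..<card D}. c' i ?z)" using p by (auto simp: affine_space_def PiE_def extensional_def fei)
 ultimately show "p : (%x. \<lambda>i\<in>{..<card D}. c' i x) ` ?Z" by blast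
 qed (auto simp: affine_space_def split: if_splits)
 moreover have "closedin (zariski (affine_space (card D)) (affine_space_ring (card D))) (affine_space (card D) :: (nat => 'a) set)"
 unfolding affine_space_ring_def by (metis closedin_topspace topspace_zariski)
 ultimately show ?thesis unfolding affine_variety_def using R inj by metis
qed

section \<open>The normalizer quotient and its action on fixed tuples\<close>

lemma subgroup_Hs: "subgroup Hs G" proof (rule subgroupI)
 show "Hs ~= {}" using act_one by (auto simp: Hs_def)
 show "inv a : Hs" if "a : Hs" for a using act_inv(1)[of a v] that by (simp add: Hs_def)
qed (auto simp: Hs_def act_mult)

abbreviation N :: "'g set" where "N \<equiv> normalizer G Hs"

lemma N_iff: "n : N \<longleftrightarrow> n : cr G & (ALL h:Hs. n \<otimes> h \<otimes> inv n : Hs) & (ALL h:Hs. inv n \<otimes> h \<otimes> n : Hs)"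
proof -
 have sub: "Hs <= cr G" using Hs_G by blast
 have "n : N \<longleftrightarrow> n : cr G & n <# Hs #> inv n = Hs" unfolding normalizer_def stabilizer_def using sub by simp
 also have "n <# Hs #> inv n = (%h. n \<otimes> h \<otimes> inv n) ` Hs" by (auto simp: l_coset_def r_coset_def)
 also have "n : cr G & (%h. n \<otimes> h \<otimes> inv n) ` Hs = Hs \<longleftrightarrow>
 n : cr G & (ALL h:Hs. n \<otimes> h \<otimes> inv n : Hs) & (ALL h:Hs. inv n \<otimes> h \<otimes> n : Hs)" proof (intro conj_cong refl iffI)
 assume n: "n : cr G" and eq: "(%h. n \<otimes> h \<otimes> inv n) ` Hs = Hs"
 have "inv n \<otimes> h \<otimes> n : Hs" if h: "h : Hs" for h proof -
 obtain k where k: "k : Hs" "h = n \<otimes> k \<otimes> inv n" using eq h by blast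
 hence "inv n \<otimes> h \<otimes> n = k" using n Hs_G[OF k(1)] by (simp add: m_assoc) (simp add: m_assoc[symmetric])
 thus ?thesis using k(1) by simp
 qed
 thus "(ALL h:Hs. n \<otimes> h \<otimes> inv n : Hs) & (ALL h:Hs. inv n \<otimes> h \<otimes> n : Hs)" using eq by blast
 next
 assume n: "n : cr G" and c: "(ALL h:Hs. n \<otimes> h \<otimes> inv n : Hs) & (ALL h:Hs. inv n \<otimes> h \<otimes> n : Hs)"
 have "h : (%h. n \<otimes> h \<otimes> inv n) ` Hs" if h: "h : Hs" for h proof (rule image_eqI)
 show "h = n \<otimes> (inv n \<otimes> h \<otimes> n) \<otimes> inv n" using n Hs_G[OF h] by (simp add: m_assoc) (simp add: m_assoc[symmetric])
 qed (use c h in blast)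
 thus "(%h. n \<otimes> h \<otimes> inv n) ` Hs = Hs" using c by blast
 qed
 finally show ?thesis .
qed

lemma N_G: "n : N ==> n : cr G" by (simp add: N_iff)

lemma subgroup_N: "subgroup N G" by (rule normalizer_imp_subgroup) (use Hs_G in blast)

lemma N_tuples: "n : N ==> z : tuples ==> power_action rho n z : tuples" proof -
 assume n: "n : N" and z: "z : tuples"
 have "rho h (rho n x) = rho n x" if x: "x : E" and h: "h : Hs" for x h proof -
 have "rho h (rho n x) = rho n (rho (inv n \<otimes> h \<otimes> n) x)" using N_G[OF n] Hs_G[OF h] by (simp add: act_mult act_inv)
 thus ?thesis using n h ED[OF x] unfolding N_iff by simp
 qed
 thus ?thesis using z by (simp add: tuples_def pa_at E_def)
qed

lemma N_goal: "z : tuples ==> good (vec_nth z i) ==> g : cr G ==> power_action rho g z : tuples ==> g : N"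
 using conj_in_Hs(1,3)[OF tuplesD, of z i g] tuplesD[of "power_action rho g z" i] by (simp add: N_iff pa_at)

lemma pa_mult: "g : cr G ==> h : cr G ==> power_action rho (g \<otimes> h) z = power_action rho g (power_action rho h z)"
 by (simp add: vei pa_at act_mult)

lemma pa_one: "power_action rho \<one> z = z" by (simp add: vei pa_at act_one)

text \<open>The image of z under n is again fixed by \<open>Hs\<close>, so every element of the
  coset sends z to the same point.\<close>

lemma nqa: assumes n: "n : N" and z: "z : tuples" shows "normalizer_quotient_action (power_action rho) Hs (Hs #> n) z = power_action rho n z" proof -
 have "power_action rho (h \<otimes> n) z = power_action rho n z" if h: "h : Hs" for h
 using ED[OF tuplesD[OF N_tuples[OF n z]] h] N_G[OF n] Hs_G[OF h] by (simp add: vei pa_at act_mult)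
 moreover have "(%g. power_action rho g z) ` (Hs #> n) = (%h. power_action rho (h \<otimes> n) z) ` Hs" by (auto simp: r_coset_def)
 ultimately have "(%g. power_action rho g z) ` (Hs #> n) = {power_action rho n z}" using subgroup.one_closed[OF subgroup_Hs] by auto
 thus ?thesis using z by (simp add: normalizer_quotient_action_def fixed_tuples)
qed

lemma nq_carrier: "carrier (normalizer_quotient G Hs) = (%n. Hs #> n) ` N"
 by (auto simp: normalizer_quotient_def FactGroup_def RCOSETS_def r_coset_def)

lemma nq_normal: "Hs \<lhd> (G\<lparr>carrier := N\<rparr>)" by (rule subgroup_in_normalizer[OF subgroup_Hs])

lemma nq_mult: "n : N ==> m : N ==> (Hs #> n) \<otimes>\<^bsub>normalizer_quotient G Hs\<^esub> (Hs #> m) = Hs #> (n \<otimes> m)"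
 using normal.rcos_sum[OF nq_normal, of n m] by (simp add: normalizer_quotient_def FactGroup_def set_mult_def r_coset_def)

lemma nq_one: "\<one>\<^bsub>normalizer_quotient G Hs\<^esub> = Hs" by (simp add: normalizer_quotient_def FactGroup_def)

lemma nq_action:
 "group_action (normalizer_quotient G Hs) (tuples :: ('v ^ 'n::finite) set) (normalizer_quotient_action (power_action rho) Hs)" proof -
 let ?F = "normalizer_quotient G Hs" and ?phi = "normalizer_quotient_action (power_action rho) Hs" and ?Z = "tuples :: ('v ^ 'n) set"
 have ext: "?phi C : extensional ?Z" for C by (simp add: normalizer_quotient_action_def fixed_tuples)
 have inv: "inv n : N" if "n : N" for n by (rule subgroup.m_inv_closed[OF subgroup_N that])
 have bij: "?phi (Hs #> n) : Bij ?Z" if n: "n : N" for n unfolding Bij_def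
 proof (intro IntI CollectI ext bij_betw_byWitness[where f' = "?phi (Hs #> inv n)"])
 note nG = N_G[OF n]
 show "ALL a:?Z. ?phi (Hs #> inv n) (?phi (Hs #> n) a) = a"
 using nG by (simp add: nqa[OF n] nqa[OF inv[OF n]] N_tuples[OF n] pa_mult[symmetric] pa_one)
 show "ALL a:?Z. ?phi (Hs #> n) (?phi (Hs #> inv n) a) = a"
 using nG by (simp add: nqa[OF n] nqa[OF inv[OF n]] N_tuples[OF inv[OF n]] pa_mult[symmetric] pa_one)
 show "?phi (Hs #> n) ` ?Z <= ?Z" "?phi (Hs #> inv n) ` ?Z <= ?Z"
 using N_tuples[OF n] N_tuples[OF inv[OF n]] by (auto simp: nqa[OF n] nqa[OF inv[OF n]])
 qed
 have "?phi : hom ?F (BijGroup ?Z)" unfolding hom_def proof (intro CollectI conjI ballI funcsetI)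
 show "?phi C : carrier (BijGroup ?Z)" if "C : carrier ?F" for C using that bij by (auto simp: nq_carrier BijGroup_def)
 fix C D assume "C : carrier ?F" "D : carrier ?F"
 then obtain n m where nm: "n : N" "m : N" "C = Hs #> n" "D = Hs #> m" by (auto simp: nq_carrier)
 have nmN: "n \<otimes> m : N" by (rule subgroup.m_closed[OF subgroup_N nm(1,2)])
 have "?phi (Hs #> (n \<otimes> m)) = compose ?Z (?phi C) (?phi D)" proof (rule extensionalityI[OF ext compose_extensional])
 fix z assume z: "z : ?Z"
 thus "?phi (Hs #> (n \<otimes> m)) z = compose ?Z (?phi C) (?phi D) z" using nm by (simp add: compose_eq nqa nmN N_tuples pa_mult N_G)
 qed
 thus "?phi (C \<otimes>\<^bsub>?F\<^esub> D) = ?phi C \<otimes>\<^bsub>BijGroup ?Z\<^esub> ?phi D" using bij nm by (simp add: nq_mult BijGroup_def)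
 qed
 moreover have "group ?F" unfolding normalizer_quotient_def by (rule normal.factorgroup_is_group[OF nq_normal])
 ultimately show ?thesis unfolding group_action_def group_hom_def group_hom_axioms_def using group_BijGroup by blast
qed

text \<open>The open set consists of the fixed tuples with at least one good component. The diagonal
  tuple of v belongs to it and also witnesses that \<open>Hs\<close> is an isotropy group of a
  closed orbit.\<close>

theorem admissible_tuples:
 "closed_orbit_isotropy_group G (power_scale s :: 'a => 'v ^ 'n::finite => 'v ^ 'n) (power_action rho) Hs"
 "CARD('n) >= 2 ==> admissible G (power_scale s :: 'a => 'v ^ 'n::finite => 'v ^ 'n) (power_action rho) Hs" proof -
 let ?s = "power_scale s :: 'a => 'v ^ 'n => 'v ^ 'n" and ?p = "power_action rho :: 'g => 'v ^ 'n => 'v ^ 'n" and ?Z = "tuples :: ('v ^ 'n) set"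
 let ?F = "normalizer_quotient G Hs" and ?phi = "normalizer_quotient_action ?p Hs"
 let ?top = "zariski ?Z (linear_ring ?s ?Z)"
 define d where "d = (vec_lambda (%i. v) :: 'v ^ 'n)"
 have d: "d : ?Z" "good (vec_nth d i)" for i using v_E good_v by (simp_all add: d_def tuples_def)
 show co: "closed_orbit_isotropy_group G ?s ?p Hs" unfolding closed_orbit_isotropy_group_def closedin_lr
 using closed_tuple_orbit[OF d] by (intro exI[of _ d]) simp
 assume "CARD('n) >= 2"
 then obtain i0 i1 :: 'n where i01: "i0 ~= i1"
 by (metis UNIV_I card_2_iff' card_le_Suc0_iff_eq finite_class.finite_UNIV not_less_eq_eq numeral_2_eq_2)
 obtain D where D: "D <= polyf s" "!!z. z : E ==> good z \<longleftrightarrow> (EX t:D. t z ~= 0)" by (rule good_open) (rule that; assumption)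
 define U where "U = {z : ?Z. EX i. good (vec_nth z i)}"
 have dU: "d : U" using d by (auto simp: U_def)
 interpret ps: vector_space ?s by (rule vector_space_power)
 have Zsub: "a + ?s t b : ?Z" if "a : ?Z" "b : ?Z" for a b t
 using that vs.subspace_add[OF subspace_E] vs.subspace_scale[OF subspace_E] by (simp add: tuples_def ps_at)
 have Zdiff: "b - a : ?Z" if "a : ?Z" "b : ?Z" for a b using that vs.subspace_diff[OF subspace_E] by (simp add: tuples_def)
 have topsp: "topspace ?top = ?Z" unfolding linear_ring_def by (rule topspace_zariski)
 have compl: "?Z - U = {z : ?Z. ALL f:(\<Union>i. (%t z. t (vec_nth z i)) ` D). f z = 0}" using D(2)[OF tuplesD] by (auto simp: U_def)
 have clU: "closedin ?top (?Z - U)" unfolding closedin_lr using D(1) polyf_proj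
 by (intro exI[of _ "\<Union>i. (%t z. t (vec_nth z i)) ` D"] conjI compl) blast
 have UZ: "U <= ?Z" by (auto simp: U_def)
 have opU: "openin ?top U" using clU UZ by (simp add: openin_closedin_eq topsp)
 have irrZ: "irreducible_closed ?top ?Z" by (rule irreducible_linear[OF vector_space_power]) (use d(1) Zsub Zdiff in auto)
 have dense: "?top closure_of U = ?Z" proof -
 have "?Z <= ?top closure_of U Un (?Z - U)" using closure_of_subset[of U ?top] UZ topsp by auto
 hence "?Z <= ?top closure_of U \<or> ?Z <= ?Z - U" using irrZ clU closedin_closure_of[of ?top U] unfolding irreducible_closed_def by blast
 thus ?thesis using dU UZ closure_of_subset_topspace[of ?top U] topsp by auto
 qed
 have codim: "codim ?top (?Z - U) >= 2" proof (rule codim_ge_2)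
 fix Y assume Y: "irreducible_closed ?top Y" "Y <= ?Z - U"
 then obtain y where y: "y : Y" by (auto simp: irreducible_closed_def)
 have yZ: "y : ?Z" using y Y(2) by blast
 \<comment> \<open>The direction that moves component \<open>i0\<close> of y to v at parameter 1, so
   that the swept set reaches into U and is strictly larger than Y.\<close>
 define w where "w = (vec_lambda (%i. if i = i0 then v - vec_nth y i0 else 0) :: 'v ^ 'n)"
 have w: "w : ?Z" using tuplesD[OF yZ, of i0] v_E vs.subspace_diff[OF subspace_E] vs.subspace_0[OF subspace_E] by (simp add: w_def tuples_def)
 let ?Y1 = "sweep ?s ?Z Y w"
 have irr: "irreducible_closed ?top ?Y1" by (rule irreducible_sweep[OF _ Y(1)]) (use Zsub w Y(2) in auto)
 have in1: "a + ?s t w : ?Y1" if "a : Y" for a t using that Y(2) Zsub w by (auto simp: sweep_def)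
 have "Y <= ?Y1" using in1[of _ 0] by auto
 have "y + ?s 1 w : ?Y1" "y + ?s 1 w ~: Y" proof -
 have "good (vec_nth (y + ?s 1 w) i0)" using good_v by (simp add: ps_at w_def)
 hence "y + ?s 1 w : U" using Zsub[OF yZ w] unfolding U_def by blast
 thus "y + ?s 1 w ~: Y" using Y(2) by blast
 qed (rule in1[OF y])
 hence Y1: "Y < ?Y1" using \<open>Y <= ?Y1\<close> by blast
 have Y2: "?Y1 < ?Z" proof -
 \<comment> \<open>Component \<open>i1\<close> is untouched by w and stays bad along all lines, so t
   applied to it vanishes on the swept set but not at d; hence the swept set is not all of
   \<open>?Z\<close>.\<close>
 obtain t where t: "t : D" "t v ~= 0" using D(2)[OF v_E] good_v by blast
 have "t (vec_nth (a + ?s c w) i1) = 0" if a: "a : Y" for a c proof -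
 have "vec_nth (a + ?s c w) i1 = vec_nth a i1" using i01 by (simp add: ps_at w_def)
 moreover have "\<not> good (vec_nth a i1)" "vec_nth a i1 : E" using a Y(2) tuplesD by (auto simp: U_def)
 ultimately show ?thesis using D(2) t(1) by metis
 qed
 moreover have "ALL f:polyf ?s. (ALL y:Y. ALL c. f (y + ?s c w) = 0) --> f d = 0" if "d : ?Y1" using that by (simp add: sweep_def)
 from bspec[OF this polyf_proj[OF subsetD[OF D(1) t(1)], of i1]]
 have "(ALL y:Y. ALL c. t (vec_nth (y + ?s c w) i1) = 0) --> t (vec_nth d i1) = 0" if "d : ?Y1" using that by simp
 ultimately have "d ~: ?Y1" using t(2) by (auto simp: d_def)
 thus ?thesis using d(1) by (auto simp: sweep_def)
 qed
 show "EX Y1 Y2. irreducible_closed ?top Y1 & irreducible_closed ?top Y2 & Y < Y1 & Y1 < Y2"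
 by (rule exI[of _ ?Y1], rule exI[of _ ?Z], intro conjI irr irrZ Y1 Y2)
 qed
 have inv: "?phi C ` U <= U" if C: "C : carrier ?F" for C proof
 fix x assume "x : ?phi C ` U"
 then obtain z where z: "z : U" "x = ?phi C z" by blast
 obtain n where n: "n : N" "C = Hs #> n" using C by (auto simp: nq_carrier)
 have zn: "z : U" "n : N" "x = ?p n z" using z n nqa[OF n(1) subsetD[OF UZ z(1)]] by simp_all
 then obtain i where i: "good (vec_nth z i)" by (auto simp: U_def)
 have zZ: "z : ?Z" using zn(1) UZ by blast
 have "good (rho n (vec_nth z i))" by (rule conj_in_Hs(4)[OF tuplesD[OF zZ] i N_G[OF zn(2)]])
 (use tuplesD[OF N_tuples[OF zn(2) zZ], of i] in \<open>simp add: pa_at\<close>)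
 hence "good (vec_nth x i)" by (simp add: zn(3) pa_at)
 thus "x : U" using N_tuples[OF zn(2) zZ] unfolding U_def zn(3) by blast
 qed
 have free: "stabilizer ?F ?phi z = {\<one>\<^bsub>?F\<^esub>}" and closed: "closedin ?top (orbit ?F ?phi z)" if z: "z : U" for z proof -
 obtain i where zZ: "z : ?Z" and i: "good (vec_nth z i)" using z by (auto simp: U_def)
 note co = closed_tuple_orbit[OF zZ i]
 show "stabilizer ?F ?phi z = {\<one>\<^bsub>?F\<^esub>}" proof (intro equalityI subsetI)
 fix C assume "C : stabilizer ?F ?phi z"
 then obtain n where n: "n : N" "C = Hs #> n" "?phi C z = z" by (auto simp: stabilizer_def nq_carrier)
 hence "?p n z = z" using nqa[OF n(1) zZ] by simp
 hence "n : Hs" using co(2) N_G[OF n(1)] by (auto simp: stabilizer_def)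
 thus "C : {\<one>\<^bsub>?F\<^esub>}" unfolding n(2) nq_one by (simp add: coset_join2[OF Hs_G subgroup_Hs])
 next
 fix C assume "C : {\<one>\<^bsub>?F\<^esub>}"
 moreover have "Hs #> \<one> = Hs" by (rule coset_mult_one) (use Hs_G in blast)
 ultimately have C: "C = Hs #> \<one>" by (simp add: nq_one)
 have "\<one> : N" by (rule subgroup.one_closed[OF subgroup_N])
 thus "C : stabilizer ?F ?phi z" using nqa[OF _ zZ, of \<one>] by (simp add: stabilizer_def nq_carrier C pa_one)
 qed
 \<comment> \<open>A group element that keeps the tuple z among the fixed tuples normalizes
   \<open>Hs\<close>, so closedness is inherited from the orbit of the whole group.\<close>
 have "orbit ?F ?phi z = orbit G ?p z Int ?Z" proof (intro equalityI subsetI)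
 fix x assume "x : orbit ?F ?phi z"
 then obtain n where "n : N" "x = ?p n z" using nqa[OF _ zZ] by (auto simp: orbit_def nq_carrier)
 thus "x : orbit G ?p z Int ?Z" using N_tuples zZ N_G unfolding orbit_def by blast
 next
 fix x assume "x : orbit G ?p z Int ?Z"
 then obtain g where g: "g : cr G" "x = ?p g z" "x : ?Z" by (auto simp: orbit_def)
 hence "g : N" using N_goal[OF zZ i] by blast
 thus "x : orbit ?F ?phi z" using nqa[OF _ zZ] g(2) unfolding orbit_def nq_carrier by force
 qed
 moreover obtain TT where "TT <= polyf ?s" "orbit G ?p z = {x. ALL f:TT. f x = 0}" using co(1) by blast
 ultimately show "closedin ?top (orbit ?F ?phi z)" unfolding closedin_lr by (intro exI[of _ TT]) auto
 qed
 show "admissible G ?s ?p Hs" unfolding admissible_def strongly_stable_def fixed_tuples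
 by (intro conjI co nq_action affine_tuples exI[of _ U] opU dense codim ballI inv free closed)
qed

end

theorem proposition1:
  fixes G :: "('g, 'm) monoid_scheme"
    and R :: "('g \<Rightarrow> 'a::{alg_closed_field, field_char_0}) set"
    and s :: "'a \<Rightarrow> 'v::ab_group_add \<Rightarrow> 'v"
    and \<rho> :: "'g \<Rightarrow> 'v \<Rightarrow> 'v"
    and H :: "'g set"
  assumes "reductive_group G R"
    and "rational_module G R s \<rho>"
    and "closed_orbit_isotropy_group G s \<rho> H"
  shows "closed_orbit_isotropy_group G
           (power_scale s :: 'a \<Rightarrow> 'v ^ 'n::finite \<Rightarrow> 'v ^ 'n) (power_action \<rho>) H \<and>
         (CARD('n) \<ge> 2 \<longrightarrow>
            admissible G (power_scale s :: 'a \<Rightarrow> 'v ^ 'n \<Rightarrow> 'v ^ 'n) (power_action \<rho>) H)"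
proof -
 obtain B where B: "finite_dimensional_vector_space s B" and act: "group_action G UNIV \<rho>" and lin: "!!g. g : cr G ==> vlin s s (\<rho> g)"
 and rat: "!!l v. vlin s (*) l ==> (\<lambda>g\<in>cr G. l (\<rho> g v)) : R" using assms(2) unfolding rational_module_def by blast
 obtain v where v: "H = stabilizer G \<rho> v" "closedin (zariski UNIV (linear_ring s UNIV)) (orbit G \<rho> v)"
 using assms(3) unfolding closed_orbit_isotropy_group_def by blast
 obtain T where T: "T <= polyf s" "orbit G \<rho> v = {x : UNIV. ALL f:T. f x = 0}" using v(2) unfolding closedin_lr by blast
 have "zcut (cr G) (%g. l (\<rho> g v)) : zext (cr G) R" if "vlin s (*) l" for l v proof -
 have "restrict (zcut (cr G) (%g. l (\<rho> g v))) (cr G) = (\<lambda>g\<in>cr G. l (\<rho> g v))" by (auto simp: zcut_def)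
 then show ?thesis using rat[OF that, of v] by (simp add: zext_def zcut_def)
 qed
 then have "red_module G (zext (cr G) R) s B \<rho>"
 unfolding red_module_def red_module_axioms_def using red_group_zext[OF assms(1)] B act lin by blast
 then interpret closed_orbit G "zext (cr G) R" s B \<rho> v T unfolding closed_orbit_def closed_orbit_axioms_def using T by (simp add: orbit_def)
 have "H = Hs" by (simp add: v(1) stabilizer_def Hs_def)
 then show ?thesis using admissible_tuples by blast
qed

end
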